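(* Let $V$ be a finite-dimensional unitary representation of a compact Lie group $C$ with moment map $\mu\colon V\to\mathfrak c^*$, and let $\tilde Y=(T^*V)/\!\!/\!\!/C=\mu_{hk}^{-1}(0)/C$ be the hyperkähler quotient with respect to the hyperkähler moment map extending $\mu$. Assume that $\tilde Y$ is smooth. Suppose that the Kähler quotient $N=V/\!\!/C=\mu^{-1}(0)/C$ is smooth and compact. Let $\psi$ be a moment map for the $U(1)$-action on $\tilde Y$ (with respect to the Kähler form $\omega_I$). Then $-\psi$ is a proper strictly plurisubharmonic function on the complex manifold $\tilde Y_J$.
   Context: $V$ carries a $C$-invariant Hermitian form with real part $g$ and complex structure $I$; $\mathfrak c$ is the Lie algebra of $C$. A moment map on $V$ has the form $\langle\mu(v),\xi\rangle=\tfrac12g(I\xi v,v)+\langle\theta,\xi\rangle$, $\theta\in\mathfrak c^*$ being $Ad^*$-invariant. $X:=T^*V=V_{\mathbb R}\oplus V_{\mathbb R}$ as a real vector space, with the direct sum metric, $I(x,y)=(Ix,-Iy)$, $J(x,y)=(-y,x)$, $K=IJ$, $\omega_L(u,w)=g(Lu,w)$. The hyperkähler moment map extending $\mu$ is $\mu_{hk}=(\mu_I,\mu_J,\mu_K)$ with $\langle\mu_I(x,y),\xi\rangle=\tfrac12g(I\xi x,x)-\tfrac12g(I\xi y,y)+\langle\theta,\xi\rangle$, $\langle\mu_J(x,y),\xi\rangle=g(\xi x,y)$, $\langle\mu_K(x,y),\xi\rangle=-g(I\xi x,y)$. When $\tilde Y=\mu_{hk}^{-1}(0)/C$ is smooth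 it is a hyperkähler manifold with the quotient structure (still denoted $I,J,K$, $\omega_I,\omega_J,\omega_K$), and $\tilde Y_J$ denotes $\tilde Y$ with the complex structure $J$. The $U(1)$-action on $\tilde Y$ is the one induced by the action on $T^*V$ by fiberwise multiplication (rotation) on the cotangent fibres, which preserves $\mu_{hk}^{-1}(0)$ and commutes with $C$; it preserves $\omega_I$, and a moment map for it is a $U(1)$-invariant function $\psi\colon\tilde Y\to\mathbb R$ with $d\psi=\phi\lrcorner\,\omega_I$, $\phi$ being the vector field tangent to the action. A real $C^2$-function $\rho$ on a complex manifold is strictly plurisubharmonic if $dd^c\rho$ is a strictly positive $(1,1)$-form. *)

theory Defs
  imports "HOL-Analysis.Analysis" "HOL-Algebra.Group_Action"
begin

section \<open>Differentiable functions on subsets of Euclidean space\<close>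

text \<open>\<open>Ck k F W\<close> is meant for open \<open>W\<close> in a finite-dimensional space, where it says that all
  iterated directional derivatives up to order \<open>k\<close> exist and are continuous.  On an arbitrary set a
  function is \<open>C\<^sup>k\<close> (smooth) if locally it extends to a \<open>C\<^sup>k\<close> (smooth) function on an open set.\<close>

primrec Ck :: "nat \<Rightarrow> ('a::real_normed_vector \<Rightarrow> 'b::real_normed_vector) \<Rightarrow> 'a set \<Rightarrow> bool" where
  "Ck 0 F W \<longleftrightarrow> continuous_on W F"
| "Ck (Suc k) F W \<longleftrightarrow>
     (\<forall>x\<in>W. F differentiable (at x)) \<and> (\<forall>v. Ck k (\<lambda>x. frechet_derivative F (at x) v) W)"

definition Ck_on :: "nat \<Rightarrow> ('a::real_normed_vector \<Rightarrow> 'b::real_normed_vector) \<Rightarrow> 'a set \<Rightarrow> bool" where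
  "Ck_on k f S \<longleftrightarrow>
     (\<forall>x\<in>S. \<exists>W F. open W \<and> x \<in> W \<and> Ck k F W \<and> (\<forall>y\<in>S \<inter> W. F y = f y))"

definition smooth_on :: "('a::real_normed_vector \<Rightarrow> 'b::real_normed_vector) \<Rightarrow> 'a set \<Rightarrow> bool" where
  "smooth_on f S \<longleftrightarrow>
     (\<forall>x\<in>S. \<exists>W F. open W \<and> x \<in> W \<and> (\<forall>k. Ck k F W) \<and> (\<forall>y\<in>S \<inter> W. F y = f y))"

definition embedded_submanifold :: "'x::euclidean_space set \<Rightarrow> bool" where
  "embedded_submanifold S \<longleftrightarrow>
     (\<forall>z\<in>S. \<exists>W (W'::'x set) F F' E. open W \<and> z \<in> W \<and> open W' \<and> homeomorphism W W' F F' \<and>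
        smooth_on F W \<and> smooth_on F' W' \<and> subspace E \<and> F ` (S \<inter> W) = W' \<inter> E)"

text \<open>Velocities of curves; for an embedded submanifold this is the usual tangent space.\<close>

definition tangent_space :: "'x::real_normed_vector set \<Rightarrow> 'x \<Rightarrow> 'x set" where
  "tangent_space S z =
     {u. \<exists>\<gamma>::real \<Rightarrow> 'x. range \<gamma> \<subseteq> S \<and> \<gamma> 0 = z \<and> (\<gamma> has_vector_derivative u) (at 0)}"


section \<open>Manifolds\<close>

text \<open>Charts take values in open subsets of a linear subspace \<open>cmodel c\<close> of a Euclidean space \<open>'e\<close>;
  in this way the dimension is not tied to a type and may be \<open>0\<close>.  A tangent vector at a point of
  \<open>cdom c\<close> is represented by its coordinate vector in \<open>cmodel c\<close>, and tensors are given by their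
  coordinate expressions in charts.  Derivatives of functions \<open>f\<close> on \<open>cimg c\<close> are written
  \<open>frechet_derivative f (at q within cimg c)\<close>; this is determined on \<open>cmodel c\<close> only.\<close>

record ('q, 'e) chart =
  cdom :: "'q set"
  cmodel :: "'e set"
  cmap :: "'q \<Rightarrow> 'e"

definition cimg :: "('q, 'e) chart \<Rightarrow> 'e set" where
  "cimg c = cmap c ` cdom c"

definition cinv :: "('q, 'e) chart \<Rightarrow> 'e \<Rightarrow> 'q" where
  "cinv c = inv_into (cdom c) (cmap c)"

definition is_chart :: "'q topology \<Rightarrow> ('q, 'e::euclidean_space) chart \<Rightarrow> bool" where
  "is_chart T c \<longleftrightarrow> openin T (cdom c) \<and> subspace (cmodel c) \<and>
     openin (top_of_set (cmodel c)) (cimg c) \<and>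
     homeomorphic_map (subtopology T (cdom c)) (top_of_set (cimg c)) (cmap c)"

definition smooth_manifold :: "'q topology \<Rightarrow> ('q, 'e::euclidean_space) chart set \<Rightarrow> bool" where
  "smooth_manifold T A \<longleftrightarrow> Hausdorff_space T \<and> second_countable T \<and>
     (\<forall>c\<in>A. is_chart T c) \<and> (\<Union>c\<in>A. cdom c) = topspace T \<and>
     (\<forall>c\<in>A. \<forall>d\<in>A. smooth_on (\<lambda>x. cmap d (cinv c x)) (cmap c ` (cdom c \<inter> cdom d)))"


section \<open>Strictly plurisubharmonic functions\<close>

text \<open>The complex manifold is given by a smooth atlas and the coordinate expression
  \<open>J c q\<close> of its complex structure at the point with coordinate \<open>q\<close> in the chart \<open>c\<close>.  Here
  \<open>d\<^sup>c\<rho> = - d\<rho> \<circ> J\<close>, so that \<open>dd\<^sup>c\<rho> = 2i\<partial>\<partial>\<close>-bar \<open>\<rho>\<close>; on the complex numbers \<open>|z|\<^sup>2\<close> is strictly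
  plurisubharmonic.\<close>

type_synonym ('q, 'e) endo_field = "('q, 'e) chart \<Rightarrow> 'e \<Rightarrow> 'e \<Rightarrow> 'e"

definition dc ::
    "('q, 'e::euclidean_space) endo_field \<Rightarrow> ('q \<Rightarrow> real) \<Rightarrow> ('q, 'e) chart \<Rightarrow> 'e \<Rightarrow> 'e \<Rightarrow> real" where
  "dc J \<rho> c q w = - frechet_derivative (\<lambda>x. \<rho> (cinv c x)) (at q within cimg c) (J c q w)"

definition ext_deriv ::
    "('q, 'e::euclidean_space) chart \<Rightarrow> ('e \<Rightarrow> 'e \<Rightarrow> real) \<Rightarrow> 'e \<Rightarrow> 'e \<Rightarrow> 'e \<Rightarrow> real" where
  "ext_deriv c \<beta> q u w =
     frechet_derivative (\<lambda>x. \<beta> x w) (at q within cimg c) u -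
     frechet_derivative (\<lambda>x. \<beta> x u) (at q within cimg c) w"

definition ddc ::
    "('q, 'e::euclidean_space) endo_field \<Rightarrow> ('q \<Rightarrow> real) \<Rightarrow> ('q, 'e) chart \<Rightarrow> 'e \<Rightarrow> 'e \<Rightarrow> 'e \<Rightarrow> real" where
  "ddc J \<rho> c = ext_deriv c (dc J \<rho> c)"

definition strictly_plurisubharmonic ::
    "('q, 'e::euclidean_space) chart set \<Rightarrow> ('q, 'e) endo_field \<Rightarrow> ('q \<Rightarrow> real) \<Rightarrow> bool" where
  "strictly_plurisubharmonic A J \<rho> \<longleftrightarrow>
     (\<forall>c\<in>A. Ck_on 2 (\<lambda>x. \<rho> (cinv c x)) (cimg c) \<and>
       (\<forall>q\<in>cimg c.
         (\<forall>u\<in>cmodel c. \<forall>w\<in>cmodel c. ddc J \<rho> c q (J c q u) (J c q w) = ddc J \<rho> c q u w) \<and>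
         (\<forall>u\<in>cmodel c. u \<noteq> 0 \<longrightarrow> ddc J \<rho> c q u (J c q u) > 0)))"


section \<open>Compact Lie groups and unitary representations\<close>

definition lie_group :: "'c monoid \<Rightarrow> 'c topology \<Rightarrow> ('c, 'l::euclidean_space) chart set \<Rightarrow> bool" where
  "lie_group G T A \<longleftrightarrow> group G \<and> topspace T = carrier G \<and> smooth_manifold T A \<and>
     continuous_map (prod_topology T T) T (\<lambda>(g, h). g \<otimes>\<^bsub>G\<^esub> h) \<and>
     continuous_map T T (\<lambda>g. inv\<^bsub>G\<^esub> g) \<and>
     (\<forall>c\<in>A. \<forall>c'\<in>A. \<forall>d\<in>A.
        smooth_on (\<lambda>(x, y). cmap d (cinv c x \<otimes>\<^bsub>G\<^esub> cinv c' y))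
          {(x, y). x \<in> cimg c \<and> y \<in> cimg c' \<and> cinv c x \<otimes>\<^bsub>G\<^esub> cinv c' y \<in> cdom d}) \<and>
     (\<forall>c\<in>A. \<forall>d\<in>A.
        smooth_on (\<lambda>x. cmap d (inv\<^bsub>G\<^esub> (cinv c x)))
          {x. x \<in> cimg c \<and> inv\<^bsub>G\<^esub> (cinv c x) \<in> cdom d})"

definition compact_lie_group ::
    "'c monoid \<Rightarrow> 'c topology \<Rightarrow> ('c, 'l::euclidean_space) chart set \<Rightarrow> bool" where
  "compact_lie_group G T A \<longleftrightarrow> lie_group G T A \<and> compact_space T"

text \<open>A Hermitian vector space is a Euclidean space (the inner product being the real part \<open>g\<close> of the
  Hermitian form) with an orthogonal complex structure.\<close>

definition hermitian_structure :: "('v::euclidean_space \<Rightarrow> 'v) \<Rightarrow> bool" where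
  "hermitian_structure I \<longleftrightarrow>
     linear I \<and> (\<forall>v. I (I v) = - v) \<and> (\<forall>u v. I u \<bullet> I v = u \<bullet> v)"

definition unitary_rep ::
    "'c monoid \<Rightarrow> ('c, 'l::euclidean_space) chart set \<Rightarrow> ('v::euclidean_space \<Rightarrow> 'v) \<Rightarrow>
      ('c \<Rightarrow> 'v \<Rightarrow> 'v) \<Rightarrow> bool" where
  "unitary_rep G A I r \<longleftrightarrow>
     (\<forall>g\<in>carrier G. linear (r g) \<and> (\<forall>v. r g (I v) = I (r g v)) \<and>
        (\<forall>u v. r g u \<bullet> r g v = u \<bullet> v)) \<and>
     (\<forall>g\<in>carrier G. \<forall>h\<in>carrier G. \<forall>v. r (g \<otimes>\<^bsub>G\<^esub> h) v = r g (r h v)) \<and>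
     (\<forall>v. r \<one>\<^bsub>G\<^esub> v = v) \<and>
     (\<forall>c\<in>A. \<forall>v. smooth_on (\<lambda>x. r (cinv c x) v) (cimg c))"

text \<open>The Lie algebra is the tangent space at the identity, written in a chart \<open>e\<close> around the
  identity: its elements are the vectors \<open>\<xi> \<in> cmodel e\<close>.\<close>

definition Ad :: "'c monoid \<Rightarrow> ('c, 'l::euclidean_space) chart \<Rightarrow> 'c \<Rightarrow> 'l \<Rightarrow> 'l" where
  "Ad G e g = frechet_derivative (\<lambda>x. cmap e (g \<otimes>\<^bsub>G\<^esub> cinv e x \<otimes>\<^bsub>G\<^esub> inv\<^bsub>G\<^esub> g))
     (at (cmap e \<one>\<^bsub>G\<^esub>) within cimg e)"

definition lie_act ::
    "'c monoid \<Rightarrow> ('c, 'l::euclidean_space) chart \<Rightarrow> ('c \<Rightarrow> 'v::euclidean_space \<Rightarrow> 'v) \<Rightarrow>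
      'l \<Rightarrow> 'v \<Rightarrow> 'v" where
  "lie_act G e r \<xi> v =
     frechet_derivative (\<lambda>x. r (cinv e x) v) (at (cmap e \<one>\<^bsub>G\<^esub>) within cimg e) \<xi>"

text \<open>An element of the dual of the Lie algebra is represented by a linear functional on the
  surrounding Euclidean space; only its values on \<open>cmodel e\<close> are ever used.\<close>

definition Ad_invariant :: "'c monoid \<Rightarrow> ('c, 'l::euclidean_space) chart \<Rightarrow> ('l \<Rightarrow> real) \<Rightarrow> bool" where
  "Ad_invariant G e \<theta> \<longleftrightarrow> linear \<theta> \<and> (\<forall>g\<in>carrier G. \<forall>\<xi>\<in>cmodel e. \<theta> (Ad G e g \<xi>) = \<theta> \<xi>)"


section \<open>Quotients\<close>

definition quotient_top :: "'x::topological_space set \<Rightarrow> ('x \<Rightarrow> 'q) \<Rightarrow> 'q topology" where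
  "quotient_top Z \<pi> = topology (\<lambda>U. U \<subseteq> \<pi> ` Z \<and> openin (top_of_set Z) {z \<in> Z. \<pi> z \<in> U})"

lemma openin_quotient_top:
  "openin (quotient_top Z \<pi>) U \<longleftrightarrow> U \<subseteq> \<pi> ` Z \<and> openin (top_of_set Z) {z \<in> Z. \<pi> z \<in> U}"
proof -
  have "istopology (\<lambda>U. U \<subseteq> \<pi> ` Z \<and> openin (top_of_set Z) {z \<in> Z. \<pi> z \<in> U})"
    unfolding istopology_def
  proof (intro conjI allI impI)
    fix S T
    assume S: "S \<subseteq> \<pi> ` Z \<and> openin (top_of_set Z) {z \<in> Z. \<pi> z \<in> S}"
      and T: "T \<subseteq> \<pi> ` Z \<and> openin (top_of_set Z) {z \<in> Z. \<pi> z \<in> T}"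
    then show "S \<inter> T \<subseteq> \<pi> ` Z" by blast
    have "{z \<in> Z. \<pi> z \<in> S \<inter> T} = {z \<in> Z. \<pi> z \<in> S} \<inter> {z \<in> Z. \<pi> z \<in> T}" by blast
    then show "openin (top_of_set Z) {z \<in> Z. \<pi> z \<in> S \<inter> T}"
      using S T by (simp add: openin_Int)
  next
    fix K
    assume K: "\<forall>U\<in>K. U \<subseteq> \<pi> ` Z \<and> openin (top_of_set Z) {z \<in> Z. \<pi> z \<in> U}"
    then show "\<Union>K \<subseteq> \<pi> ` Z" by blast
    have "{z \<in> Z. \<pi> z \<in> \<Union>K} = \<Union>((\<lambda>U. {z \<in> Z. \<pi> z \<in> U}) ` K)" by blast
    moreover have "openin (top_of_set Z) (\<Union>((\<lambda>U. {z \<in> Z. \<pi> z \<in> U}) ` K))"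
      using K by (intro openin_Union) blast
    ultimately show "openin (top_of_set Z) {z \<in> Z. \<pi> z \<in> \<Union>K}" by (simp only:)
  qed
  then show ?thesis
    by (simp add: quotient_top_def)
qed

text \<open>The quotient of \<open>Z\<close> by the fibres of \<open>\<pi>\<close> is smooth, with smooth structure \<open>A\<close>: \<open>Z\<close> is a
  submanifold and \<open>\<pi>\<close> a smooth submersion.  For the orbit map of a group action this covers free
  actions, but also actions whose isotropy groups are nontrivial and of constant type.\<close>

definition smooth_quotient ::
    "'x::euclidean_space set \<Rightarrow> ('x \<Rightarrow> 'q) \<Rightarrow> ('q, 'e::euclidean_space) chart set \<Rightarrow> bool" where
  "smooth_quotient Z \<pi> A \<longleftrightarrow>
     embedded_submanifold Z \<and> smooth_manifold (quotient_top Z \<pi>) A \<and>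
     (\<forall>c\<in>A. smooth_on (\<lambda>z. cmap c (\<pi> z)) {z \<in> Z. \<pi> z \<in> cdom c} \<and>
        (\<forall>z\<in>Z. \<pi> z \<in> cdom c \<longrightarrow>
           frechet_derivative (\<lambda>z. cmap c (\<pi> z)) (at z within Z) ` tangent_space Z z = cmodel c))"

definition horizontal :: "'x::euclidean_space set \<Rightarrow> ('x \<Rightarrow> 'q) \<Rightarrow> 'x \<Rightarrow> 'x set" where
  "horizontal Z \<pi> z =
     {h \<in> tangent_space Z z. \<forall>u\<in>tangent_space {z' \<in> Z. \<pi> z' = \<pi> z} z. h \<bullet> u = 0}"

text \<open>\<open>h\<close> is the horizontal lift to \<open>z\<close> of the tangent vector with coordinates \<open>w\<close> at \<open>\<pi> z\<close>.\<close>

definition hlift ::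
    "'x::euclidean_space set \<Rightarrow> ('x \<Rightarrow> 'q) \<Rightarrow> ('q, 'e::euclidean_space) chart \<Rightarrow>
      'x \<Rightarrow> 'e \<Rightarrow> 'x \<Rightarrow> bool" where
  "hlift Z \<pi> c z w h \<longleftrightarrow>
     h \<in> horizontal Z \<pi> z \<and> frechet_derivative (\<lambda>z. cmap c (\<pi> z)) (at z within Z) h = w"

text \<open>The quotient structure: the metric and the endomorphism fields for which \<open>d\<pi>\<close> is, on
  horizontal spaces, isometric and \<open>L\<close>-linear (\<open>L\<close> being \<open>I\<close>, \<open>J\<close> or \<open>K\<close>).  They are given by their
  coordinate expressions at the point with coordinate \<open>q\<close> in the chart \<open>c\<close>; the choice of
  \<open>z\<close> in the fibre is immaterial.\<close>

definition quotient_metric ::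
    "'x::euclidean_space set \<Rightarrow> ('x \<Rightarrow> 'q) \<Rightarrow> ('q, 'e::euclidean_space) chart \<Rightarrow>
      'e \<Rightarrow> 'e \<Rightarrow> 'e \<Rightarrow> real" where
  "quotient_metric Z \<pi> c q u w =
     (THE a. \<exists>z\<in>Z. \<exists>h k. \<pi> z = cinv c q \<and> hlift Z \<pi> c z u h \<and> hlift Z \<pi> c z w k \<and> a = h \<bullet> k)"

definition quotient_endo ::
    "'x::euclidean_space set \<Rightarrow> ('x \<Rightarrow> 'q) \<Rightarrow> ('x \<Rightarrow> 'x) \<Rightarrow> ('q, 'e::euclidean_space) endo_field" where
  "quotient_endo Z \<pi> L c q u =
     (THE w. \<exists>z\<in>Z. \<exists>h. \<pi> z = cinv c q \<and> hlift Z \<pi> c z u h \<and>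
        w = frechet_derivative (\<lambda>z. cmap c (\<pi> z)) (at z within Z) (L h))"

definition quotient_form ::
    "'x::euclidean_space set \<Rightarrow> ('x \<Rightarrow> 'q) \<Rightarrow> ('x \<Rightarrow> 'x) \<Rightarrow> ('q, 'e::euclidean_space) chart \<Rightarrow>
      'e \<Rightarrow> 'e \<Rightarrow> 'e \<Rightarrow> real" where
  "quotient_form Z \<pi> L c q u w = quotient_metric Z \<pi> c q (quotient_endo Z \<pi> L c q u) w"


section \<open>Kaehler and hyperkaehler quotients of a unitary representation\<close>

definition mu ::
    "'c monoid \<Rightarrow> ('c, 'l::euclidean_space) chart \<Rightarrow> ('v::euclidean_space \<Rightarrow> 'v) \<Rightarrow>
      ('c \<Rightarrow> 'v \<Rightarrow> 'v) \<Rightarrow> ('l \<Rightarrow> real) \<Rightarrow> 'v \<Rightarrow> 'l \<Rightarrow> real" where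
  "mu G e I r \<theta> v \<xi> = 1/2 * (I (lie_act G e r \<xi> v) \<bullet> v) + \<theta> \<xi>"

definition mu_zero ::
    "'c monoid \<Rightarrow> ('c, 'l::euclidean_space) chart \<Rightarrow> ('v::euclidean_space \<Rightarrow> 'v) \<Rightarrow>
      ('c \<Rightarrow> 'v \<Rightarrow> 'v) \<Rightarrow> ('l \<Rightarrow> real) \<Rightarrow> 'v set" where
  "mu_zero G e I r \<theta> = {v. \<forall>\<xi>\<in>cmodel e. mu G e I r \<theta> v \<xi> = 0}"

text \<open>The cotangent bundle of \<open>V\<close> is \<open>'v \<times> 'v\<close> with its product inner product.\<close>

definition cot_I :: "('v::euclidean_space \<Rightarrow> 'v) \<Rightarrow> 'v \<times> 'v \<Rightarrow> 'v \<times> 'v" where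
  "cot_I I z = (I (fst z), - I (snd z))"

definition cot_J :: "'v::euclidean_space \<times> 'v \<Rightarrow> 'v \<times> 'v" where
  "cot_J z = (- snd z, fst z)"

definition cot_rep :: "('c \<Rightarrow> 'v \<Rightarrow> 'v) \<Rightarrow> 'c \<Rightarrow> 'v \<times> 'v \<Rightarrow> 'v \<times> 'v" where
  "cot_rep r g z = (r g (fst z), r g (snd z))"

definition mu_I ::
    "'c monoid \<Rightarrow> ('c, 'l::euclidean_space) chart \<Rightarrow> ('v::euclidean_space \<Rightarrow> 'v) \<Rightarrow>
      ('c \<Rightarrow> 'v \<Rightarrow> 'v) \<Rightarrow> ('l \<Rightarrow> real) \<Rightarrow> 'v \<times> 'v \<Rightarrow> 'l \<Rightarrow> real" where
  "mu_I G e I r \<theta> z \<xi> =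
     1/2 * (I (lie_act G e r \<xi> (fst z)) \<bullet> fst z) - 1/2 * (I (lie_act G e r \<xi> (snd z)) \<bullet> snd z) + \<theta> \<xi>"

definition mu_J ::
    "'c monoid \<Rightarrow> ('c, 'l::euclidean_space) chart \<Rightarrow> ('c \<Rightarrow> 'v::euclidean_space \<Rightarrow> 'v) \<Rightarrow>
      'v \<times> 'v \<Rightarrow> 'l \<Rightarrow> real" where
  "mu_J G e r z \<xi> = lie_act G e r \<xi> (fst z) \<bullet> snd z"

definition mu_K ::
    "'c monoid \<Rightarrow> ('c, 'l::euclidean_space) chart \<Rightarrow> ('v::euclidean_space \<Rightarrow> 'v) \<Rightarrow>
      ('c \<Rightarrow> 'v \<Rightarrow> 'v) \<Rightarrow> 'v \<times> 'v \<Rightarrow> 'l \<Rightarrow> real" where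
  "mu_K G e I r z \<xi> = - (I (lie_act G e r \<xi> (fst z)) \<bullet> snd z)"

definition mu_hk_zero ::
    "'c monoid \<Rightarrow> ('c, 'l::euclidean_space) chart \<Rightarrow> ('v::euclidean_space \<Rightarrow> 'v) \<Rightarrow>
      ('c \<Rightarrow> 'v \<Rightarrow> 'v) \<Rightarrow> ('l \<Rightarrow> real) \<Rightarrow> ('v \<times> 'v) set" where
  "mu_hk_zero G e I r \<theta> =
     {z. \<forall>\<xi>\<in>cmodel e. mu_I G e I r \<theta> z \<xi> = 0 \<and> mu_J G e r z \<xi> = 0 \<and> mu_K G e I r z \<xi> = 0}"

text \<open>Multiplication by \<open>exp(it)\<close> on the fibres.  The complex structure of the fibres is the
  restriction of \<open>cot_I I\<close>, that is, \<open>-I\<close>; the action is holomorphic for it.\<close>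

definition rot :: "('v::euclidean_space \<Rightarrow> 'v) \<Rightarrow> real \<Rightarrow> 'v \<times> 'v \<Rightarrow> 'v \<times> 'v" where
  "rot I t z = (fst z, cos t *\<^sub>R snd z - sin t *\<^sub>R I (snd z))"

text \<open>\<open>rot_field I c q\<close> is the coordinate expression of the vector field on the quotient (whose
  points are orbits, i.e. sets of points) tangent to the induced \<open>U(1)\<close>-action.\<close>

definition rot_field ::
    "('v::euclidean_space \<Rightarrow> 'v) \<Rightarrow> (('v \<times> 'v) set, 'e::euclidean_space) chart \<Rightarrow> 'e \<Rightarrow> 'e" where
  "rot_field I c q = vector_derivative (\<lambda>t. cmap c (rot I t ` cinv c q)) (at 0)"

definition rot_moment_map ::
    "('v::euclidean_space \<Rightarrow> 'v) \<Rightarrow> ('v \<times> 'v) set \<Rightarrow> ('v \<times> 'v \<Rightarrow> ('v \<times> 'v) set) \<Rightarrow>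
      (('v \<times> 'v) set, 'e::euclidean_space) chart set \<Rightarrow> (('v \<times> 'v) set \<Rightarrow> real) \<Rightarrow> bool" where
  "rot_moment_map I Z \<pi> A \<psi> \<longleftrightarrow>
     (\<forall>p\<in>\<pi> ` Z. \<forall>t. \<psi> (rot I t ` p) = \<psi> p) \<and>
     (\<forall>c\<in>A. \<forall>q\<in>cimg c. \<exists>D. ((\<lambda>x. \<psi> (cinv c x)) has_derivative D) (at q within cimg c) \<and>
        (\<forall>w\<in>cmodel c. D w = quotient_form Z \<pi> (cot_I I) c q (rot_field I c q) w))"

end

theory Submission
  imports Defs
begin

text \<open>
  The vector field of the circle action gives \<open>d\<psi> = -d(|y|\<^sup>2/2)\<close>, so \<open>-\<psi>\<close> is \<open>|y|\<^sup>2/2\<close> up to a locally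
  constant function, and \<open>dd\<^sup>c(-\<psi>) = \<omega>\<^sub>J\<close>.  The quotient structure \<open>J\<close> exists because the horizontal
  space at a zero \<open>z\<close> of the moment map is quaternionic: smoothness of the quotient forces the
  horizontal vectors to be fixed infinitesimally by the stabiliser of \<open>z\<close>, and a Brouwer fixed point
  argument shows that all solutions of the linearised equations fixed by the stabiliser are tangent
  to the zero set.

  For properness, compactness of \<open>N\<close> excludes nonzero zeros of the homogeneous moment map on \<open>V\<close>,
  which bounds \<open>|x|\<close> by \<open>|y|\<close> on the zero set.  The minimum of \<open>|y|\<^sup>2\<close> on a level set of the locally
  constant function is attained at a point whose orbit is fixed by the circle; there an element \<open>A\<close>
  of the Lie algebra with \<open>A x = 0\<close> and \<open>A y = - I y\<close> exists, and conjugation of \<open>A\<close> into the commutant of a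
  regular element shows that \<open>|y|\<^sup>2\<close> takes only finitely many values at such points.  Hence the locally constant
  function is bounded.
\<close>

text \<open>Smoothness of the quotient does not make 0 a regular value of the hyperkaehler moment
  map: isotropy may be nontrivial, and then the kernel of the differential of the moment map can be
  larger than the tangent space of \<open>Z\<close>. That the horizontal space is closed under
  \<open>cI\<close> and \<open>cot_J\<close> therefore needs a substitute for regularity: the
  equations are restricted to vectors annihilated by the stabiliser algebra, where those not implied
  by invariance form a nondegenerate system. The group enters through the compact operator group
  \<open>K\<close> and the operator Lie algebra \<open>\<g>\<close>. First-variation arguments take
  a curve in \<open>K\<close> with a given velocity at \<open>oid\<close>, typically at a maximum of
  a linear function on \<open>K\<close>. Properness needs more than the growth of |y|^2: \<psi> is
  determined only up to a locally constant function, and \<open>Z\<close> might a priori have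
  infinitely many components, so a bound uniform over all of them is required. Finiteness of the
  critical values gives it by placing a point of each level in one compact set.\<close>

text \<open>Operators are vectors indexed by the basis, so that they form a Euclidean space.\<close>

typedef (overloaded) ('v::euclidean_space) bidx = "Basis :: 'v set"
  using nonempty_Basis by blast

instance bidx :: (euclidean_space) finite
proof
  have "(UNIV :: 'a bidx set) = Abs_bidx ` Basis"
    by (metis Abs_bidx_cases UNIV_eq_I image_eqI)
  then show "finite (UNIV :: 'a bidx set)"
    by (metis finite_Basis finite_imageI)
qed

section \<open>Operators on a Euclidean space with the Hilbert-Schmidt inner product\<close>

type_synonym 'v opr = "'v ^ 'v bidx"

definition app :: "'v::euclidean_space opr \<Rightarrow> 'v \<Rightarrow> 'v" where
  "app A v = (\<Sum>i\<in>UNIV. (v \<bullet> Rep_bidx i) *\<^sub>R (A $ i))"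

definition opr_of :: "('v::euclidean_space \<Rightarrow> 'v) \<Rightarrow> 'v opr" where
  "opr_of f = (\<chi> i. f (Rep_bidx i))"

lemma sum_bidx: "(\<Sum>i\<in>UNIV. f (Rep_bidx i :: 'v::euclidean_space)) = (\<Sum>b\<in>Basis. f b)"
proof (rule sum.reindex_bij_betw)
  show "bij_betw (Rep_bidx :: 'v bidx \<Rightarrow> 'v) UNIV Basis"
    by (simp add: bij_betw_def inj_on_def Rep_bidx_inject type_definition.Rep_range[OF type_definition_bidx])
qed

lemma app_Basis: "app A (Rep_bidx i) = A $ i"
proof -
  have "app A (Rep_bidx i) = (\<Sum>j\<in>UNIV. (if j = i then A $ i else 0))"
    unfolding app_def
    by (rule sum.cong) (auto simp: inner_Basis[OF Rep_bidx Rep_bidx] Rep_bidx_inject)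
  then show ?thesis by simp
qed

lemma bounded_bilinear_app: "bounded_bilinear app"
proof
  fix a a' :: "'a opr" and b b' :: 'a and r :: real
  show "app (a + a') b = app a b + app a' b"
    by (simp add: app_def algebra_simps sum.distrib)
  show "app a (b + b') = app a b + app a b'"
    by (simp add: app_def algebra_simps sum.distrib)
  show "app (r *\<^sub>R a) b = r *\<^sub>R app a b"
    by (simp add: app_def scaleR_sum_right algebra_simps)
  show "app a (r *\<^sub>R b) = r *\<^sub>R app a b"
    by (simp add: app_def scaleR_sum_right)
  show "\<exists>K. \<forall>a b. norm (app a b :: 'a) \<le> norm a * norm b * K"
  proof (intro exI allI)
    fix a :: "'a opr" and b :: 'a
    have "norm (app a b) \<le> (\<Sum>i\<in>UNIV. norm ((b \<bullet> Rep_bidx i) *\<^sub>R (a $ i)))"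
      unfolding app_def by (rule norm_sum)
    also have "\<dots> \<le> (\<Sum>i\<in>(UNIV :: 'a bidx set). norm a * norm b)"
    proof (rule sum_mono)
      fix i :: "'a bidx"
      have "\<bar>b \<bullet> Rep_bidx i\<bar> \<le> norm b"
        using Cauchy_Schwarz_ineq2[of b "Rep_bidx i"] Rep_bidx[of i] by simp
      then show "norm ((b \<bullet> Rep_bidx i) *\<^sub>R (a $ i)) \<le> norm a * norm b"
        using Finite_Cartesian_Product.norm_nth_le[of a i] by (simp add: mult.commute[of "norm a"] mult_mono)
    qed
    finally show "norm (app a b) \<le> norm a * norm b * real CARD('a bidx)"
      by (simp add: mult.commute)
  qed
qed

interpretation app: bounded_bilinear app
  by (rule bounded_bilinear_app)

lemma linear_app [simp]: "linear (app A)"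
  by (rule bounded_linear.linear[OF app.bounded_linear_right])

lemma app_opr_of:
  assumes "linear f" shows "app (opr_of f) v = f v"
proof -
  have "app (opr_of f) v = (\<Sum>b\<in>Basis. (v \<bullet> b) *\<^sub>R f b)"
    unfolding app_def opr_of_def using sum_bidx[of "\<lambda>b. (v \<bullet> b) *\<^sub>R f b"] by simp
  also have "\<dots> = f (\<Sum>b\<in>Basis. (v \<bullet> b) *\<^sub>R b)"
    by (simp add: linear_sum[OF assms] linear_cmul[OF assms])
  finally show ?thesis by (simp add: euclidean_representation)
qed

lemma opr_of_app [simp]: "opr_of (app A) = A"
  by (simp add: opr_of_def vec_eq_iff app_Basis)

lemma opr_eqI: "(\<And>v. app A v = app B v) \<Longrightarrow> A = B"
  by (metis opr_of_app ext)

definition omul :: "'v::euclidean_space opr \<Rightarrow> 'v opr \<Rightarrow> 'v opr" where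
  "omul A B = opr_of (\<lambda>v. app A (app B v))"

lemma app_omul [simp]: "app (omul A B) v = app A (app B v)"
  unfolding omul_def
  using linear_compose[OF linear_app[of B] linear_app[of A]] by (simp add: app_opr_of o_def)

definition oid :: "'v::euclidean_space opr" where "oid = opr_of (\<lambda>v. v)"

lemma app_oid [simp]: "app oid v = v"
  by (simp add: oid_def app_opr_of linear_id[unfolded id_def])

definition oadj :: "'v::euclidean_space opr \<Rightarrow> 'v opr" where
  "oadj A = opr_of (adjoint (app A))"

lemma app_oadj: "app (oadj A) v \<bullet> w = v \<bullet> app A w"
  by (simp add: oadj_def app_opr_of adjoint_linear adjoint_clauses(2))

lemma app_oadj': "w \<bullet> app (oadj A) v = app A w \<bullet> v"
  by (metis app_oadj inner_commute)

lemma oadj_unique: "(\<And>v w. app B v \<bullet> w = v \<bullet> app A w) \<Longrightarrow> oadj A = B"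
  by (rule opr_eqI, rule vector_eq_ldot[THEN iffD1]) (metis app_oadj inner_commute)

lemma oadj_oadj [simp]: "oadj (oadj A) = A"
  by (rule oadj_unique) (simp add: app_oadj')

lemma oadj_omul: "oadj (omul A B) = omul (oadj B) (oadj A)"
  by (rule oadj_unique) (simp add: app_oadj)

lemma omul_assoc: "omul (omul A B) C = omul A (omul B C)"
  by (rule opr_eqI) simp

lemma omul_oid [simp]: "omul oid A = A" "omul A oid = A"
  by (rule opr_eqI, simp)+

lemma bounded_bilinear_omul: "bounded_bilinear omul"
  unfolding bilinear_conv_bounded_bilinear[symmetric] bilinear_def
  by (intro conjI allI linearI; rule opr_eqI)
     (simp_all add: app.add_left app.add_right app.scaleR_left app.scaleR_right)

interpretation omul: bounded_bilinear omul
  by (rule bounded_bilinear_omul)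

text \<open>This is the Hilbert-Schmidt product. It is the right one here because commutation with a
  skew operator is skew for it, which drives the arguments with centralisers and maximal
  tori.\<close>

lemma inner_opr: "A \<bullet> B = (\<Sum>b\<in>Basis. app A b \<bullet> app B b)"
  unfolding inner_vec_def
  using sum_bidx[of "\<lambda>b. app A b \<bullet> app B b"] by (simp add: app_Basis)

lemma inner_omul_left: "omul A B \<bullet> C = B \<bullet> omul (oadj A) C"
  by (simp add: inner_opr app_oadj')

text \<open>Both sides are the sum of products of corresponding matrix entries, taken by columns on
  one side and by rows on the other.\<close>

lemma inner_oadj: "oadj A \<bullet> oadj B = A \<bullet> B"
proof -
  have "app (oadj A) b \<bullet> app (oadj B) b = (\<Sum>c\<in>Basis. (b \<bullet> app A c) * (b \<bullet> app B c))" for b :: 'a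
    by (subst euclidean_inner) (simp add: app_oadj)
  then have "oadj A \<bullet> oadj B = (\<Sum>b\<in>Basis. \<Sum>c\<in>Basis. (b \<bullet> app A c) * (b \<bullet> app B c))"
    by (simp add: inner_opr)
  also have "\<dots> = (\<Sum>c\<in>Basis. \<Sum>b\<in>Basis. (b \<bullet> app A c) * (b \<bullet> app B c))"
    by (rule sum.swap)
  also have "\<dots> = (\<Sum>c\<in>Basis. app A c \<bullet> app B c)"
    by (rule sum.cong[OF refl], subst euclidean_inner) (simp add: inner_commute)
  finally show ?thesis by (simp add: inner_opr)
qed

lemma inner_omul_right: "omul A B \<bullet> C = A \<bullet> omul C (oadj B)"
proof -
  have "omul A B \<bullet> C = omul (oadj B) (oadj A) \<bullet> oadj C"
    by (metis inner_oadj oadj_omul)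
  also have "\<dots> = oadj A \<bullet> omul B (oadj C)"
    by (simp add: inner_omul_left)
  also have "\<dots> = A \<bullet> omul C (oadj B)"
    by (metis inner_oadj oadj_omul oadj_oadj)
  finally show ?thesis .
qed

text \<open>The operator norm is at most the Hilbert-Schmidt norm, by Cauchy-Schwarz in the
  coordinates of \<open>v\<close>. The constant 1 matters later, where projections at distance less
  than 1 are compared.\<close>

lemma norm_app_le: "norm (app A v) \<le> norm A * norm v"
proof -
  have "norm (app A v) \<le> norm v * norm A"
  proof -
    have "norm (app A v) ^ 2 \<le> (norm v * norm A) ^ 2"
    proof -
      have "app A v = (\<Sum>i\<in>UNIV. (v \<bullet> Rep_bidx i) *\<^sub>R (A $ i))" by (simp add: app_def)
      then have "norm (app A v) \<le> (\<Sum>i\<in>UNIV. \<bar>v \<bullet> Rep_bidx i\<bar> * norm (A $ i))"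
        using norm_sum[of "\<lambda>i. (v \<bullet> Rep_bidx i) *\<^sub>R (A $ i)" UNIV] by simp
      also have "\<dots> \<le> L2_set (\<lambda>i. v \<bullet> Rep_bidx i) UNIV * L2_set (\<lambda>i. norm (A $ i)) UNIV"
        using L2_set_mult_ineq[where A = UNIV and f = "\<lambda>i. v \<bullet> Rep_bidx i" and g = "\<lambda>i. norm (A $ i)"] by simp
      also have "L2_set (\<lambda>i. v \<bullet> Rep_bidx i) UNIV = norm v"
        unfolding L2_set_def using sum_bidx[of "\<lambda>b. (v \<bullet> b)\<^sup>2"]
        by (simp add: norm_eq_sqrt_inner euclidean_inner[of v v] power2_eq_square)
      also have "L2_set (\<lambda>i. norm (A $ i)) UNIV = norm A"
        by (simp add: norm_vec_def)
      finally show ?thesis by (simp add: power_mono)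
    qed
    then show ?thesis by (rule power2_le_imp_le) simp
  qed
  then show ?thesis by (simp add: mult.commute)
qed

section \<open>Maps of class \<open>C\<^sup>k\<close>\<close>

lemma frechet_derivative_cong_open:
  assumes "open W" "x \<in> W" "\<And>y. y \<in> W \<Longrightarrow> f y = g y"
  shows "frechet_derivative f (at x) = frechet_derivative g (at x)"
proof -
  have "(f has_derivative D) (at x) \<longleftrightarrow> (g has_derivative D) (at x)" for D
    using assms has_derivative_transform_within_open by (metis (no_types, lifting))
  then show ?thesis by (simp add: frechet_derivative_def)
qed

lemma differentiable_cong_open:
  assumes "open W" "x \<in> W" "\<And>y. y \<in> W \<Longrightarrow> f y = g y"
  shows "f differentiable (at x) \<longleftrightarrow> g differentiable (at x)"
  using assms has_derivative_transform_within_open unfolding differentiable_def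
  by (metis (no_types, lifting))

lemma Ck_cong:
  assumes "open W" "\<And>y. y \<in> W \<Longrightarrow> f y = g y"
  shows "Ck k f W \<longleftrightarrow> Ck k g W"
  using assms(2)
proof (induction k arbitrary: f g)
  case 0
  then show ?case by (simp cong: continuous_on_cong)
next
  case (Suc k)
  then show ?case
    using frechet_derivative_cong_open[OF assms(1), of _ f g]
      differentiable_cong_open[OF assms(1), of _ f g] by (metis (no_types, lifting) Ck.simps(2))
qed

lemma Ck_subset: "Ck k f W \<Longrightarrow> V \<subseteq> W \<Longrightarrow> Ck k f V"
  by (induction k arbitrary: f) (auto intro: continuous_on_subset)

lemma Ck_Suc_imp: "Ck (Suc k) f W \<Longrightarrow> Ck k f W"
proof (induction k arbitrary: f)
  case 0
  then show ?case
    by (auto intro!: continuous_at_imp_continuous_on differentiable_imp_continuous_within)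
next
  case (Suc k)
  then show ?case by (metis Ck.simps(2))
qed

lemma Ck_has_derivative:
  "Ck (Suc k) f W \<Longrightarrow> x \<in> W \<Longrightarrow> (f has_derivative frechet_derivative f (at x)) (at x)"
  by (simp add: frechet_derivative_works)

lemma Ck_continuous: "Ck k f W \<Longrightarrow> continuous_on W f"
  by (induction k) (use Ck_Suc_imp in auto)

text \<open>Lets regularity be checked on an explicit formula for the derivative, although
  \<open>Ck\<close> itself speaks of \<open>frechet_derivative\<close>.\<close>

lemma Ck_SucI:
  assumes "open W" "\<And>x. x \<in> W \<Longrightarrow> (f has_derivative f' x) (at x)" "\<And>v. Ck k (\<lambda>x. f' x v) W"
  shows "Ck (Suc k) f W"
proof -
  have eq: "f' x v = frechet_derivative f (at x) v" if "x \<in> W" for x v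
    using assms(2)[OF that] frechet_derivative_at by metis
  then have "Ck k (\<lambda>x. frechet_derivative f (at x) v) W" for v
    using assms(3) Ck_cong[OF assms(1), of "\<lambda>x. f' x v" "\<lambda>x. frechet_derivative f (at x) v"] by blast
  then show ?thesis using assms(2) by (auto simp: differentiable_def)
qed

lemma Ck_const: "Ck k (\<lambda>x. c) W"
proof (induction k arbitrary: c)
  case (Suc k)
  have "frechet_derivative (\<lambda>x. c) (at x) v = 0" for x v
    by (simp add: frechet_derivative_const)
  with Suc[of 0] show ?case by simp
qed simp

lemma Ck_linear_compose:
  assumes "open W" "bounded_linear L" "Ck k f W"
  shows "Ck k (\<lambda>x. L (f x)) W"
  using assms(3)
proof (induction k arbitrary: f)
  case 0
  then show ?case using assms(2) by (simp add: bounded_linear.continuous_on)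
next
  case (Suc k)
  show ?case
    by (rule Ck_SucI[OF assms(1), where f' = "\<lambda>x v. L (frechet_derivative f (at x) v)"])
       (use Suc assms(2) in \<open>auto intro: bounded_linear.has_derivative Ck_has_derivative[OF Suc.prems]\<close>)
qed

lemma Ck_id: "open W \<Longrightarrow> Ck k (\<lambda>x. x) W"
  by (cases k) (auto intro!: Ck_SucI[where f' = "\<lambda>x v. v"] Ck_const)

lemma Ck_linear: "open W \<Longrightarrow> bounded_linear L \<Longrightarrow> Ck k L W"
  using Ck_linear_compose[OF _ _ Ck_id] .

lemma Ck_add:
  assumes "open W" "Ck k f W" "Ck k g W"
  shows "Ck k (\<lambda>x. f x + g x) W"
  using assms(2,3)
proof (induction k arbitrary: f g)
  case 0
  then show ?case by (simp add: continuous_on_add)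
next
  case (Suc k)
  show ?case
    by (rule Ck_SucI[OF assms(1),
          where f' = "\<lambda>x v. frechet_derivative f (at x) v + frechet_derivative g (at x) v"])
       (use Suc in \<open>auto intro!: has_derivative_add Ck_has_derivative[OF Suc.prems(1)]
          Ck_has_derivative[OF Suc.prems(2)]\<close>)
qed

lemma Ck_sum:
  assumes "open W" "\<And>i. i \<in> S \<Longrightarrow> Ck k (f i) W"
  shows "Ck k (\<lambda>x. \<Sum>i\<in>S. f i x) W"
  using assms(2)
  by (induction S rule: infinite_finite_induct) (auto intro: Ck_const Ck_add[OF assms(1)])

lemma Ck_bilinear:
  assumes W: "open W" and p: "bounded_bilinear p" and "Ck k f W" "Ck k g W"
  shows "Ck k (\<lambda>x. p (f x) (g x)) W"
  using assms(3,4)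
proof (induction k arbitrary: f g)
  case 0
  then show ?case by (simp add: bounded_bilinear.continuous_on[OF p])
next
  case (Suc k)
  have "Ck k f W" "Ck k g W" using Suc.prems Ck_Suc_imp by blast+
  then show ?case
    by (intro Ck_SucI[OF W, where
          f' = "\<lambda>x v. p (f x) (frechet_derivative g (at x) v) + p (frechet_derivative f (at x) v) (g x)"]
          bounded_bilinear.FDERIV[OF p] Ck_has_derivative[OF Suc.prems(1)]
          Ck_has_derivative[OF Suc.prems(2)] Ck_add[OF W] Suc.IH)
       (use Suc.prems in auto)
qed

lemma Ck_pair:
  assumes "open W" "Ck k f W" "Ck k g W"
  shows "Ck k (\<lambda>x. (f x, g x)) W"
proof -
  have "bounded_linear (\<lambda>x :: 'b. (x, 0 :: 'c))" "bounded_linear (\<lambda>x :: 'c. (0 :: 'b, x))"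
    by (intro bounded_linear_Pair bounded_linear_ident bounded_linear_zero)+
  then have "Ck k (\<lambda>x. (f x, 0) + (0, g x)) W"
    using assms by (intro Ck_add Ck_linear_compose[of W "\<lambda>x. (x, 0)"] Ck_linear_compose[of W "\<lambda>x. (0, x)"])
  then show ?thesis by simp
qed

lemma linear_Basis_sum:
  fixes L :: "'a::euclidean_space \<Rightarrow> 'b::real_normed_vector"
  assumes "bounded_linear L" shows "L v = (\<Sum>b\<in>Basis. (v \<bullet> b) *\<^sub>R L b)"
proof -
  have "L v = L (\<Sum>b\<in>Basis. (v \<bullet> b) *\<^sub>R b)" by (simp add: euclidean_representation)
  then show ?thesis
    using assms by (simp add: linear_sum linear_cmul bounded_linear.linear)
qed

text \<open>In the chain rule the direction in which \<open>G\<close> is differentiated varies with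
  the point. Expanding it in a basis leaves only fixed directions \<open>b\<close>, and the
  induction hypothesis applies to the partial derivatives of \<open>G\<close>.\<close>

lemma Ck_compose:
  fixes G :: "'b::euclidean_space \<Rightarrow> 'c::real_normed_vector" and F :: "'a::real_normed_vector \<Rightarrow> 'b"
  assumes W: "open W" and "open V" and FV: "F ` W \<subseteq> V" and "Ck k G V" "Ck k F W"
  shows "Ck k (\<lambda>x. G (F x)) W"
  using assms(4,5)
proof (induction k arbitrary: G)
  case 0
  then show ?case using FV by (auto intro: continuous_on_compose2)
next
  case (Suc k)
  let ?DG = "\<lambda>y. frechet_derivative G (at y)" and ?DF = "\<lambda>x. frechet_derivative F (at x)"
  show ?case
  proof (rule Ck_SucI[OF W, where f' = "\<lambda>x v. \<Sum>b\<in>Basis. (?DF x v \<bullet> b) *\<^sub>R ?DG (F x) b"])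
    fix x assume x: "x \<in> W"
    then have "F x \<in> V" using FV by auto
    then have "(G has_derivative ?DG (F x)) (at (F x))" using Ck_has_derivative[OF Suc.prems(1)] by blast
    moreover have "(F has_derivative ?DF x) (at x)" using Ck_has_derivative[OF Suc.prems(2) x] .
    ultimately have "((\<lambda>x. G (F x)) has_derivative (\<lambda>v. ?DG (F x) (?DF x v))) (at x)"
      by (rule has_derivative_compose[rotated])
    moreover have "(\<lambda>v. ?DG (F x) (?DF x v)) = (\<lambda>v. \<Sum>b\<in>Basis. (?DF x v \<bullet> b) *\<^sub>R ?DG (F x) b)"
      by (intro ext linear_Basis_sum has_derivative_bounded_linear)
         (rule \<open>(G has_derivative ?DG (F x)) (at (F x))\<close>)
    ultimately show "((\<lambda>x. G (F x)) has_derivative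
        (\<lambda>v. \<Sum>b\<in>Basis. (?DF x v \<bullet> b) *\<^sub>R ?DG (F x) b)) (at x)"
      by (simp only:)
  next
    fix v
    have "Ck k (\<lambda>x. ?DG (F x) b) W" for b
      using Suc.IH[of "\<lambda>y. ?DG y b"] Suc.prems Ck_Suc_imp[OF Suc.prems(2)] by simp
    moreover have "Ck k (\<lambda>x. ?DF x v \<bullet> b) W" for b
      using Ck_linear_compose[OF W bounded_linear_inner_left, of k "\<lambda>x. ?DF x v"] Suc.prems by simp
    ultimately show "Ck k (\<lambda>x. \<Sum>b\<in>Basis. (?DF x v \<bullet> b) *\<^sub>R ?DG (F x) b) W"
      by (intro Ck_sum[OF W] Ck_bilinear[OF W bounded_bilinear_scaleR])
  qed
qed

text \<open>\<open>Ck\<close> controls the derivative for each fixed direction; linearity in the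
  direction turns this into joint regularity in point and direction.\<close>

lemma Ck_frechet_pair:
  fixes f :: "'a::euclidean_space \<Rightarrow> 'b::real_normed_vector"
  assumes U: "open U" and f: "Ck (Suc k) f U"
  shows "Ck k (\<lambda>p. frechet_derivative f (at (fst p)) (snd p)) (U \<times> UNIV)"
proof -
  have o: "open (U \<times> (UNIV :: 'a set))" using U by (simp add: open_Times)
  have "Ck k (\<lambda>p. \<Sum>b\<in>Basis. (snd p \<bullet> b) *\<^sub>R frechet_derivative f (at (fst p)) b) (U \<times> (UNIV :: 'a set))"
  proof (intro Ck_sum[OF o] Ck_bilinear[OF o bounded_bilinear_scaleR])
    fix b :: 'a assume "b \<in> Basis"
    show "Ck k (\<lambda>p :: 'a \<times> 'a. snd p \<bullet> b) (U \<times> UNIV)"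
      by (intro Ck_linear_compose[OF o bounded_linear_inner_left] Ck_linear[OF o] bounded_linear_snd)
    show "Ck k (\<lambda>p. frechet_derivative f (at (fst p)) b) (U \<times> (UNIV :: 'a set))"
      by (rule Ck_compose[OF o U, where G = "\<lambda>x. frechet_derivative f (at x) b"])
         (use f Ck_linear[OF o] bounded_linear_fst in auto)
  qed
  then show ?thesis
  proof (rule Ck_cong[OF o, THEN iffD1, rotated])
    fix y :: "'a \<times> 'a" assume "y \<in> U \<times> UNIV"
    then have "fst y \<in> U" by auto
    from linear_Basis_sum[OF has_derivative_bounded_linear[OF Ck_has_derivative[OF f this]]]
    show "(\<Sum>b\<in>Basis. (snd y \<bullet> b) *\<^sub>R frechet_derivative f (at (fst y)) b)
        = frechet_derivative f (at (fst y)) (snd y)" ..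
  qed
qed

lemma Ck_frechet_apply:
  fixes f :: "'a::euclidean_space \<Rightarrow> 'b::real_normed_vector"
  assumes "open U" "Ck (Suc k) f U" "open V" "Ck k g V" "g ` V \<subseteq> U" "Ck k w V"
  shows "Ck k (\<lambda>y. frechet_derivative f (at (g y)) (w y)) V"
  using Ck_compose[OF \<open>open V\<close> _ _ Ck_frechet_pair[OF assms(1,2)] Ck_pair[OF \<open>open V\<close> assms(4,6)]] assms
  by (auto simp: open_Times)

section \<open>The inverse function theorem with a twice continuously differentiable inverse\<close>

lemma has_derivative_blinfun_vanishing:
  fixes h :: "'a::real_normed_vector \<Rightarrow> 'b::real_normed_vector"
    and B :: "'a \<Rightarrow> 'b \<Rightarrow>\<^sub>L 'c::real_normed_vector"
  assumes h: "(h has_derivative h') (at y)" and h0: "h y = 0" and B: "isCont B y"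
  shows "((\<lambda>z. B z (h z)) has_derivative (\<lambda>a. B y (h' a))) (at y)"
proof -
  have 1: "((\<lambda>z. B y (h z)) has_derivative (\<lambda>a. B y (h' a))) (at y)"
    using h by (rule bounded_linear.has_derivative[OF blinfun.bounded_linear_right])
  \<comment> \<open>\<open>B\<close> is merely continuous. But \<open>h\<close> vanishes at
    \<open>y\<close>, so \<open>h z\<close> is at most a constant times \<open>norm (z - y)\<close>,
    and the factor \<open>B z - B y\<close> tends to 0: this part of the product is of smaller
    order.\<close>
  have 2: "((\<lambda>z. (B z - B y) (h z)) has_derivative (\<lambda>a. 0)) (at y)"
    unfolding has_derivative_within_alt
  proof (intro conjI allI impI)
    show "bounded_linear (\<lambda>a :: 'a. 0 :: 'c)" by (rule bounded_linear_zero)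
    fix e :: real assume "e > 0"
    obtain C where C: "C > 0" "\<And>a. norm (h' a) \<le> norm a * C"
      using bounded_linear.pos_bounded[OF has_derivative_bounded_linear[OF h]] by blast
    obtain d1 where d1: "d1 > 0" "\<And>z. norm (z - y) < d1 \<Longrightarrow> norm (h z - h y - h' (z - y)) \<le> 1 * norm (z - y)"
      using h[unfolded has_derivative_within_alt, THEN conjunct2, rule_format, of 1] by auto
    have "e / (C + 1) > 0" using \<open>e > 0\<close> C(1) by simp
    then obtain d2 where d2: "d2 > 0" "\<And>z. dist z y < d2 \<Longrightarrow> dist (B z) (B y) < e / (C + 1)"
      using B[unfolded continuous_at_eps_delta] by blast
    have "norm ((B z - B y) (h z) - (B y - B y) (h y) - 0) \<le> e * norm (z - y)"
      if "norm (z - y) < min d1 d2" for z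
    proof -
      have "norm (h z) \<le> norm (h z - h' (z - y)) + norm (h' (z - y))"
        using norm_triangle_ineq[of "h z - h' (z - y)" "h' (z - y)"] by simp
      also have "\<dots> \<le> norm (z - y) * (C + 1)"
        using d1(2)[of z] C(2)[of "z - y"] that h0 by (simp add: algebra_simps)
      finally have hz: "norm (h z) \<le> norm (z - y) * (C + 1)" .
      have "norm ((B z - B y) (h z)) \<le> norm (B z - B y) * norm (h z)"
        by (rule norm_blinfun)
      also have "\<dots> \<le> e / (C + 1) * (norm (z - y) * (C + 1))"
        using d2(2)[of z] that hz \<open>e > 0\<close> C(1)
        by (intro mult_mono) (auto simp: dist_norm)
      also have "\<dots> = e * norm (z - y)" using C(1) by simp
      finally show ?thesis by simp
    qed
    then show "\<exists>d>0. \<forall>z\<in>UNIV. norm (z - y) < d \<longrightarrow>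
        norm ((B z - B y) (h z) - (B y - B y) (h y) - 0) \<le> e * norm (z - y)"
      using d1(1) d2(1) by (metis min_less_iff_conj)
  qed
  show ?thesis
    using has_derivative_add[OF 1 2] by (simp add: blinfun.diff_left)
qed

text \<open>The derivative of the inverse at \<open>y\<close> is the inverse of
  \<open>f' (g y)\<close>. Its continuity comes from the resolvent identity. For its
  differentiability at \<open>y\<close> put \<open>w = g' y v\<close>: then \<open>g' z v\<close>
  equals \<open>G z\<close> applied to \<open>v - f' (g z) w\<close>, plus \<open>w\<close>, and the
  argument of \<open>G z\<close> vanishes at \<open>z = y\<close>, so continuity of \<open>G\<close>
  is enough. Order 2 is what \<open>strictly_plurisubharmonic\<close> asks for.\<close>

lemma inverse_function_Ck2:
  fixes f :: "'a::euclidean_space \<Rightarrow> 'a"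
  assumes U: "open U" and f: "Ck 2 f U" and x0: "x0 \<in> U"
    and inj: "\<And>v. frechet_derivative f (at x0) v = 0 \<Longrightarrow> v = 0"
  obtains U' V g where "open U'" "U' \<subseteq> U" "x0 \<in> U'" "open V" "f x0 \<in> V"
    "homeomorphism U' V f g" "Ck 2 g V"
proof -
  define f' where "f' x = Blinfun (frechet_derivative f (at x))" for x
  have fS: "Ck (Suc (Suc 0)) f U" using f by (simp add: numeral_2_eq_2)
  have der: "(f has_derivative frechet_derivative f (at x)) (at x)" if "x \<in> U" for x
    using Ck_has_derivative[OF fS that] .
  have app: "blinfun_apply (f' x) = frechet_derivative f (at x)" if "x \<in> U" for x
    unfolding f'_def by (rule bounded_linear_Blinfun_apply[OF has_derivative_bounded_linear[OF der[OF that]]])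
  have contf': "continuous_on U f'"
  proof (rule continuous_on_blinfun_componentwise)
    fix i :: 'a
    have "continuous_on U (\<lambda>x. frechet_derivative f (at x) i)"
      using fS by (intro Ck_continuous[of "Suc 0"]) simp
    then show "continuous_on U (\<lambda>x. blinfun_apply (f' x) i)"
      by (simp cong: continuous_on_cong add: app)
  qed
  have "linear (f' x0)" by (rule bounded_linear.linear[OF blinfun.bounded_linear_right])
  moreover have "inj (f' x0)"
    unfolding linear_injective_0[OF \<open>linear (f' x0)\<close>] using inj app[OF x0] by simp
  ultimately obtain h where h: "linear h" "h \<circ> f' x0 = id"
    using linear_injective_left_inverse by blast
  have "h (f' x0 v) = v" for v using fun_cong[OF h(2), of v] by simp
  then have "Blinfun h o\<^sub>L f' x0 = id_blinfun"
    using h(1) by (intro blinfun_eqI) (simp add: bounded_linear_Blinfun_apply linear_conv_bounded_linear)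
  from inverse_function_theorem[OF U _ contf' x0 this] obtain U' V g g'
    where U': "open U'" "U' \<subseteq> U" "x0 \<in> U'" and V: "open V" "f x0 \<in> V"
      and hom: "homeomorphism U' V f g"
      and g: "\<And>y. y \<in> V \<Longrightarrow> (g has_derivative (g' y)) (at y)"
      and g': "\<And>y. y \<in> V \<Longrightarrow> g' y = inv_into UNIV (blinfun_apply (f' (g y)))"
      and bij: "\<And>y. y \<in> V \<Longrightarrow> bij (blinfun_apply (f' (g y)))"
    using der app by (metis (no_types, lifting))
  have gU: "g y \<in> U" if "y \<in> V" for y
    using hom U'(2) that by (metis homeomorphism_def imageI subsetD)
  define G where "G y = Blinfun (g' y)" for y
  have G: "blinfun_apply (G y) = g' y" if "y \<in> V" for y
    unfolding G_def by (rule bounded_linear_Blinfun_apply[OF has_derivative_bounded_linear[OF g[OF that]]])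
  have GL: "G y (f' (g y) v) = v" and GR: "f' (g y) (G y v) = v" if "y \<in> V" for y v
    using bij[OF that] by (simp_all add: G[OF that] g'[OF that] bij_is_inj bij_is_surj surj_f_inv_f)
  have contg: "continuous_on V g"
    using hom by (simp add: homeomorphism_def)
  have contfg: "continuous_on V (\<lambda>y. f' (g y))"
    using contf' contg gU by (auto intro: continuous_on_compose2)
  have resolvent: "G z - G y = G z o\<^sub>L (f' (g y) - f' (g z)) o\<^sub>L G y" if "y \<in> V" "z \<in> V" for y z
    by (rule blinfun_eqI) (simp add: blinfun.diff_left blinfun.diff_right GL GR that)
  have Gcont: "isCont G y" if y: "y \<in> V" for y
  proof -
    have fc: "((\<lambda>z. f' (g z)) \<longlongrightarrow> f' (g y)) (at y)"
      using contfg y V(1) by (metis continuous_on_eq_continuous_at isCont_def)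
    define b where "b = norm (G y)"
    have "((\<lambda>z. norm (f' (g y) - f' (g z)) * b) \<longlongrightarrow> 0) (at y)"
      using tendsto_mult[OF tendsto_norm[OF tendsto_diff[OF tendsto_const fc]] tendsto_const, of "f' (g y)" b]
      by simp
    \<comment> \<open>The bound 1/2 lets the term with \<open>norm (G z)\<close> be absorbed on the
      left, giving \<open>norm (G z) \<le> 2 * b\<close> near \<open>y\<close>.\<close>
    then have ev: "eventually (\<lambda>z. norm (f' (g y) - f' (g z)) * b < 1/2) (at y)"
      by (rule order_tendstoD) simp
    have evV: "eventually (\<lambda>z. z \<in> V) (at y)"
      using V(1) y by (metis eventually_at_in_open')
    have "eventually (\<lambda>z. norm (G z - G y) \<le> 2 * b * (norm (f' (g y) - f' (g z)) * b)) (at y)"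
      using ev evV
    proof eventually_elim
      case (elim z)
      define d where "d = norm (f' (g y) - f' (g z)) * b"
      have "norm (G z - G y) \<le> norm (G z) * norm (f' (g y) - f' (g z)) * b"
        unfolding resolvent[OF y elim(2)] b_def
        by (meson mult_right_mono norm_blinfun_compose norm_ge_zero order_trans)
      then have *: "norm (G z - G y) \<le> norm (G z) * d" by (simp add: d_def mult.assoc)
      have "norm (G z) \<le> norm (G z - G y) + b"
        unfolding b_def by (metis diff_add_cancel norm_triangle_ineq)
      also have "\<dots> \<le> norm (G z) * (1/2) + b"
        using * elim(1) mult_left_mono[of d "1/2" "norm (G z)"] by (simp add: d_def)
      finally have "norm (G z) \<le> 2 * b" by simp
      moreover have "0 \<le> d" by (simp add: d_def b_def)
      ultimately show ?case using * mult_right_mono[of "norm (G z)" "2 * b" d] by (simp add: d_def)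
    qed
    moreover have "((\<lambda>z. 2 * b * (norm (f' (g y) - f' (g z)) * b)) \<longlongrightarrow> 2 * b * 0) (at y)"
      by (intro tendsto_intros) fact
    ultimately have "((\<lambda>z. G z - G y) \<longlongrightarrow> 0) (at y)"
      by (auto intro: Lim_null_comparison)
    then show ?thesis by (simp add: isCont_def LIM_zero_iff)
  qed
  have g1: "Ck 1 g V"
  proof -
    have "continuous_on V (\<lambda>y. g' y v)" for v
    proof -
      have "continuous_on V (\<lambda>y. G y v)"
        using Gcont by (intro continuous_at_imp_continuous_on ballI continuous_intros) auto
      then show ?thesis by (simp cong: continuous_on_cong add: G)
    qed
    then show ?thesis
      using Ck_SucI[OF V(1) g, of 0] by simp
  qed
  have Dg: "g' y = frechet_derivative g (at y)" if "y \<in> V" for y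
    using frechet_derivative_at[OF g[OF that]] .
  have "Ck 1 (\<lambda>y. g' y v) V" for v
  proof -
    define F2 where "F2 p = frechet_derivative f (at (fst p)) (snd p)" for p
    have F2: "Ck (Suc 0) F2 (U \<times> UNIV)"
      unfolding F2_def using Ck_frechet_pair[OF U fS] .
    have oU: "open (U \<times> (UNIV :: 'a set))" using U by (simp add: open_Times)
    \<comment> \<open>The usual formula for the derivative of an inverse: minus the inverse, times
      the derivative of the operator, times the inverse.\<close>
    define W where "W y a = - g' y (frechet_derivative F2 (at (g y, g' y v)) (g' y a, 0))" for y a
    have "Ck (Suc 0) (\<lambda>y. g' y v) V"
    proof (rule Ck_SucI[OF V(1), where f' = W])
      fix y assume y: "y \<in> V"
      define w where "w = g' y v"
      have "(g y, w) \<in> U \<times> UNIV" using gU[OF y] by simp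
      from Ck_has_derivative[OF F2 this]
      have D: "(F2 has_derivative frechet_derivative F2 (at (g y, w))) (at (g y, w))" .
      have "((\<lambda>z. (g z, w)) has_derivative (\<lambda>a. (g' y a, 0))) (at y)"
        by (intro has_derivative_Pair g[OF y] has_derivative_const)
      from has_derivative_compose[OF this D]
      have "((\<lambda>z. F2 (g z, w)) has_derivative (\<lambda>a. frechet_derivative F2 (at (g y, w)) (g' y a, 0))) (at y)" .
      from has_derivative_diff[OF has_derivative_const this]
      have h: "((\<lambda>z. v - F2 (g z, w)) has_derivative
          (\<lambda>a. - frechet_derivative F2 (at (g y, w)) (g' y a, 0))) (at y)" by simp
      have F2f: "F2 (g z, u) = f' (g z) u" if "z \<in> V" for z u
        by (simp add: F2_def app[OF gU[OF that]])
      have "v - F2 (g y, w) = 0"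
        using GR[OF y] by (simp add: F2f[OF y] w_def G[OF y, symmetric])
      from has_derivative_blinfun_vanishing[OF h this Gcont[OF y]]
      have "((\<lambda>z. G z (v - F2 (g z, w))) has_derivative (\<lambda>a. W y a)) (at y)"
        by (simp add: W_def G[OF y] w_def blinfun.minus_right flip: G[OF y])
      from has_derivative_add[OF this has_derivative_const[of w]]
      have "((\<lambda>z. G z (v - F2 (g z, w)) + w) has_derivative W y) (at y)" by simp
      moreover have "G z (v - F2 (g z, w)) + w = g' z v" if "z \<in> V" for z
        unfolding G[OF that, symmetric] by (simp add: F2f[OF that] blinfun.diff_right GL[OF that])
      ultimately show "((\<lambda>z. g' z v) has_derivative W y) (at y)"
        by (rule has_derivative_transform_within_open[OF _ V(1) y])
    next
      fix a
      have cg: "continuous_on V (\<lambda>y. g' y u)" for u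
        using g1 by (simp add: Dg cong: continuous_on_cong)
      have "continuous_on V (\<lambda>y. frechet_derivative F2 (at (g y, g' y v)) (g' y a, 0))"
        by (rule Ck_continuous[OF Ck_frechet_apply[OF oU F2 V(1)]])
           (use gU in \<open>auto intro!: continuous_on_Pair contg cg continuous_on_const\<close>)
      moreover have "continuous_on V G"
        using Gcont by (simp add: continuous_at_imp_continuous_on)
      ultimately have "continuous_on V (\<lambda>y. - G y (frechet_derivative F2 (at (g y, g' y v)) (g' y a, 0)))"
        by (intro continuous_intros)
      then have "continuous_on V (\<lambda>y. W y a)"
        by (simp add: W_def G cong: continuous_on_cong)
      then show "Ck 0 (\<lambda>y. W y a) V" by simp
    qed
    then show ?thesis by simp
  qed
  with g have "Ck (Suc 1) g V" by (rule Ck_SucI[OF V(1)])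
  then have "Ck 2 g V" by (simp add: numeral_2_eq_2)
  then show ?thesis using that U' V hom by blast
qed

section \<open>Symmetry of second derivatives\<close>

lemma mixed_second_difference:
  fixes f :: "'a::real_normed_vector \<Rightarrow> real"
  assumes W: "open W" and f: "Ck 2 f W" and h: "h > 0"
    and sub: "\<And>s t. 0 \<le> s \<Longrightarrow> s \<le> h \<Longrightarrow> 0 \<le> t \<Longrightarrow> t \<le> h \<Longrightarrow> x + s *\<^sub>R u + t *\<^sub>R w \<in> W"
  obtains s t where "0 < s" "s < h" "0 < t" "t < h"
    "f (x + h *\<^sub>R u + h *\<^sub>R w) - f (x + h *\<^sub>R u) - f (x + h *\<^sub>R w) + f x =
      h * h * frechet_derivative (\<lambda>y. frechet_derivative f (at y) u) (at (x + s *\<^sub>R u + t *\<^sub>R w)) w"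
proof -
  have fS: "Ck (Suc (Suc 0)) f W" using f by (simp add: numeral_2_eq_2)
  let ?D = "\<lambda>y. frechet_derivative f (at y)"
  let ?p = "\<lambda>s. f (x + s *\<^sub>R u + h *\<^sub>R w) - f (x + s *\<^sub>R u)"
  have d1: "((\<lambda>s. f (x + s *\<^sub>R u + t *\<^sub>R w)) has_real_derivative ?D (x + s *\<^sub>R u + t *\<^sub>R w) u) (at s)"
    if "0 \<le> s" "s \<le> h" "0 \<le> t" "t \<le> h" for s t
  proof -
    have i: "((\<lambda>s. x + s *\<^sub>R u + t *\<^sub>R w) has_derivative (\<lambda>a. a *\<^sub>R u)) (at s)"
      by (auto intro!: derivative_eq_intros)
    have D: "(f has_derivative ?D (x + s *\<^sub>R u + t *\<^sub>R w)) (at (x + s *\<^sub>R u + t *\<^sub>R w))"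
      using Ck_has_derivative[OF fS sub[OF that]] .
    have "?D (x + s *\<^sub>R u + t *\<^sub>R w) (a *\<^sub>R u) = ?D (x + s *\<^sub>R u + t *\<^sub>R w) u * a" for a
      using linear_cmul[OF has_derivative_linear[OF D]] by simp
    with has_derivative_compose[OF i D] show ?thesis
      by (simp add: has_field_derivative_def)
  qed
  \<comment> \<open>The mean value theorem is applied to the difference \<open>?p\<close> in the
    direction \<open>u\<close>, and below to its derivative in the direction
    \<open>w\<close>.\<close>
  have "\<exists>s. 0 < s \<and> s < h \<and> ?p h - ?p 0 = (h - 0) * (?D (x + s *\<^sub>R u + h *\<^sub>R w) u - ?D (x + s *\<^sub>R u) u)"
    by (rule MVT2[OF h]) (use d1[of _ h] d1[of _ 0] h in \<open>auto intro!: DERIV_diff\<close>)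
  then obtain s where s: "0 < s" "s < h"
      "?p h - ?p 0 = h * (?D (x + s *\<^sub>R u + h *\<^sub>R w) u - ?D (x + s *\<^sub>R u) u)" by auto
  let ?DD = "\<lambda>y. frechet_derivative (\<lambda>y. ?D y u) (at y)"
  have d2: "((\<lambda>t. ?D (x + s *\<^sub>R u + t *\<^sub>R w) u) has_real_derivative ?DD (x + s *\<^sub>R u + t *\<^sub>R w) w) (at t)"
    if "0 \<le> t" "t \<le> h" for t
  proof -
    have i: "((\<lambda>t. x + s *\<^sub>R u + t *\<^sub>R w) has_derivative (\<lambda>a. a *\<^sub>R w)) (at t)"
      by (auto intro!: derivative_eq_intros)
    have "Ck (Suc 0) (\<lambda>y. ?D y u) W" using fS by simp
    from Ck_has_derivative[OF this sub, of s t] that s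
    have D: "((\<lambda>y. ?D y u) has_derivative ?DD (x + s *\<^sub>R u + t *\<^sub>R w)) (at (x + s *\<^sub>R u + t *\<^sub>R w))"
      by simp
    have "?DD (x + s *\<^sub>R u + t *\<^sub>R w) (a *\<^sub>R w) = ?DD (x + s *\<^sub>R u + t *\<^sub>R w) w * a" for a
      using linear_cmul[OF has_derivative_linear[OF D]] by simp
    with has_derivative_compose[OF i D] show ?thesis
      by (simp add: has_field_derivative_def)
  qed
  have "\<exists>t. 0 < t \<and> t < h \<and> ?D (x + s *\<^sub>R u + h *\<^sub>R w) u - ?D (x + s *\<^sub>R u + 0 *\<^sub>R w) u =
      (h - 0) * ?DD (x + s *\<^sub>R u + t *\<^sub>R w) w"
    by (rule MVT2[OF h]) (use d2 in auto)
  then show ?thesis using s that by auto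
qed

text \<open>The second difference over a parallelogram is symmetric in its two sides. Divided by
  \<open>h * h\<close> it equals either mixed derivative at some nearby point, and continuity
  transfers the equality to \<open>x\<close>.\<close>

lemma second_derivative_symmetric_real:
  fixes f :: "'a::real_normed_vector \<Rightarrow> real"
  assumes W: "open W" and f: "Ck 2 f W" and x: "x \<in> W"
  shows "frechet_derivative (\<lambda>y. frechet_derivative f (at y) u) (at x) w =
    frechet_derivative (\<lambda>y. frechet_derivative f (at y) w) (at x) u"
proof -
  let ?DD = "\<lambda>u w y. frechet_derivative (\<lambda>y. frechet_derivative f (at y) u) (at y) w"
  have fS: "Ck (Suc (Suc 0)) f W" using f by (simp add: numeral_2_eq_2)
  have cont: "isCont (?DD u w) x" for u w
    using fS x W by (simp add: continuous_on_eq_continuous_at)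
  obtain r where r: "r > 0" "ball x r \<subseteq> W" using W x openE by blast
  define m where "m = norm u + norm w + 1"
  have m: "m > 0" by (simp add: m_def add_nonneg_pos)
  have nm: "norm (s *\<^sub>R u + t *\<^sub>R w) < h * m" if "0 \<le> s" "s \<le> h" "0 \<le> t" "t \<le> h" "h > 0" for s t h
  proof -
    have "norm (s *\<^sub>R u + t *\<^sub>R w) \<le> s * norm u + t * norm w"
      using norm_triangle_ineq[of "s *\<^sub>R u" "t *\<^sub>R w"] that by simp
    also have "\<dots> \<le> h * norm u + h * norm w" using that by (intro add_mono mult_right_mono) auto
    also have "\<dots> < h * m" using that by (simp add: m_def algebra_simps)
    finally show ?thesis .
  qed
  have "\<bar>?DD u w x - ?DD w u x\<bar> < e" if e: "e > 0" for e
  proof -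
    obtain d1 where d1: "d1 > 0" "\<And>y. dist y x < d1 \<Longrightarrow> dist (?DD u w y) (?DD u w x) < e/2"
      using cont[of u w] e unfolding continuous_at_eps_delta by (meson half_gt_zero)
    obtain d2 where d2: "d2 > 0" "\<And>y. dist y x < d2 \<Longrightarrow> dist (?DD w u y) (?DD w u x) < e/2"
      using cont[of w u] e unfolding continuous_at_eps_delta by (meson half_gt_zero)
    define h where "h = min r (min d1 d2) / m"
    have h: "h > 0" using r(1) d1(1) d2(1) m by (simp add: h_def)
    have hm: "h * m = min r (min d1 d2)" using m by (simp add: h_def)
    have near: "dist (x + s *\<^sub>R u + t *\<^sub>R w) x < min r (min d1 d2)"
      if "0 \<le> s" "s \<le> h" "0 \<le> t" "t \<le> h" for s t
      using nm[OF that h] by (simp add: dist_norm hm add.assoc)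
    then have sub: "x + s *\<^sub>R u + t *\<^sub>R w \<in> W" if "0 \<le> s" "s \<le> h" "0 \<le> t" "t \<le> h" for s t
      using r(2) that by (metis dist_commute mem_ball min_less_iff_conj subsetD)
    obtain s t where st: "0 < s" "s < h" "0 < t" "t < h"
      "f (x + h *\<^sub>R u + h *\<^sub>R w) - f (x + h *\<^sub>R u) - f (x + h *\<^sub>R w) + f x = h * h * ?DD u w (x + s *\<^sub>R u + t *\<^sub>R w)"
      by (rule mixed_second_difference[OF W f h sub])
    have sub': "x + t *\<^sub>R w + s *\<^sub>R u \<in> W" if "0 \<le> t" "t \<le> h" "0 \<le> s" "s \<le> h" for s t
      using sub[of s t] that by (simp add: algebra_simps)
    obtain t' s' where st': "0 < s'" "s' < h" "0 < t'" "t' < h"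
      "f (x + h *\<^sub>R w + h *\<^sub>R u) - f (x + h *\<^sub>R w) - f (x + h *\<^sub>R u) + f x = h * h * ?DD w u (x + t' *\<^sub>R w + s' *\<^sub>R u)"
      by (rule mixed_second_difference[OF W f h sub'])
    have "h * h * ?DD u w (x + s *\<^sub>R u + t *\<^sub>R w) = h * h * ?DD w u (x + s' *\<^sub>R u + t' *\<^sub>R w)"
      using st(5) st'(5) by (simp add: algebra_simps)
    then have "?DD u w (x + s *\<^sub>R u + t *\<^sub>R w) = ?DD w u (x + s' *\<^sub>R u + t' *\<^sub>R w)" using h by simp
    moreover have "dist (?DD u w (x + s *\<^sub>R u + t *\<^sub>R w)) (?DD u w x) < e/2"
      using d1(2) near[of s t] st by simp
    moreover have "dist (?DD w u (x + s' *\<^sub>R u + t' *\<^sub>R w)) (?DD w u x) < e/2"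
      using d2(2) near[of s' t'] st' by simp
    ultimately show ?thesis unfolding dist_real_def by linarith
  qed
  \<comment> \<open>A nonzero difference would be smaller than itself.\<close>
  from this[of "\<bar>?DD u w x - ?DD w u x\<bar>"] show ?thesis by (cases "?DD u w x = ?DD w u x") auto
qed

lemma second_derivative_symmetric:
  fixes f :: "'a::real_normed_vector \<Rightarrow> 'b::euclidean_space"
  assumes W: "open W" and f: "Ck 2 f W" and x: "x \<in> W"
  shows "frechet_derivative (\<lambda>y. frechet_derivative f (at y) u) (at x) w =
    frechet_derivative (\<lambda>y. frechet_derivative f (at y) w) (at x) u"
proof (rule euclidean_eqI)
  fix b :: 'b
  have fS: "Ck (Suc (Suc 0)) f W" using f by (simp add: numeral_2_eq_2)
  have D1: "frechet_derivative (\<lambda>y. f y \<bullet> b) (at y) u = frechet_derivative f (at y) u \<bullet> b" if "y \<in> W" for y u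
    using frechet_derivative_at[OF bounded_linear.has_derivative[OF bounded_linear_inner_left
        Ck_has_derivative[OF fS that]], of b] by metis
  have D2: "frechet_derivative (\<lambda>y. frechet_derivative (\<lambda>y. f y \<bullet> b) (at y) u) (at x) w =
      frechet_derivative (\<lambda>y. frechet_derivative f (at y) u) (at x) w \<bullet> b" for u w
  proof -
    have "frechet_derivative (\<lambda>y. frechet_derivative (\<lambda>y. f y \<bullet> b) (at y) u) (at x) =
      frechet_derivative (\<lambda>y. frechet_derivative f (at y) u \<bullet> b) (at x)"
      by (rule frechet_derivative_cong_open[OF W x]) (rule D1)
    moreover have "Ck (Suc 0) (\<lambda>y. frechet_derivative f (at y) u) W" using fS by simp
    ultimately show ?thesis
      using frechet_derivative_at[OF bounded_linear.has_derivative[OF bounded_linear_inner_left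
        Ck_has_derivative[OF _ x, where f = "\<lambda>y. frechet_derivative f (at y) u"]], of 0 b] by metis
  qed
  have "Ck 2 (\<lambda>y. f y \<bullet> b) W"
    by (rule Ck_linear_compose[OF W bounded_linear_inner_left f])
  from second_derivative_symmetric_real[OF W this x, of u w]
  show "frechet_derivative (\<lambda>y. frechet_derivative f (at y) u) (at x) w \<bullet> b =
    frechet_derivative (\<lambda>y. frechet_derivative f (at y) w) (at x) u \<bullet> b"
    by (simp add: D2)
qed

lemma Ck_local:
  assumes "open W" "\<And>x. x \<in> W \<Longrightarrow> \<exists>V. open V \<and> x \<in> V \<and> Ck k f V"
  shows "Ck k f W"
  using assms(2)
proof (induction k arbitrary: f)
  case 0
  show ?case
  proof (simp, intro continuous_at_imp_continuous_on ballI)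
    fix x assume "x \<in> W"
    with 0 obtain V where "open V" "x \<in> V" "continuous_on V f" by auto
    then show "isCont f x" by (simp add: continuous_on_eq_continuous_at)
  qed
next
  case (Suc k)
  show ?case
  proof (simp, intro conjI ballI allI)
    fix x assume "x \<in> W"
    then show "f differentiable (at x)" using Suc.prems by (metis Ck.simps(2))
  next
    fix v
    show "Ck k (\<lambda>x. frechet_derivative f (at x) v) W"
      using Suc.prems by (intro Suc.IH) (metis Ck.simps(2))
  qed
qed

section \<open>Embedded submanifolds and smooth quotients\<close>

lemma smooth_on_open:
  assumes "open W" "smooth_on f W"
  shows "Ck k f W"
proof (rule Ck_local[OF assms(1)])
  fix x assume x: "x \<in> W"
  with assms(2) obtain V F where V: "open V" "x \<in> V" "Ck k F V" "\<forall>y\<in>W \<inter> V. F y = f y"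
    unfolding smooth_on_def by metis
  have "open (W \<inter> V)" using assms(1) V(1) by (rule open_Int)
  then have "Ck k f (W \<inter> V)"
    using Ck_cong[OF \<open>open (W \<inter> V)\<close>, of F f k] Ck_subset[OF V(3), of "W \<inter> V"] V(4) by auto
  then show "\<exists>V. open V \<and> x \<in> V \<and> Ck k f V"
    using \<open>open (W \<inter> V)\<close> x V(2) by blast
qed

lemma embedded_chart:
  fixes S :: "'x::euclidean_space set"
  assumes "embedded_submanifold S" "z \<in> S"
  obtains W and W' :: "'x set" and F F' E where "open W" "z \<in> W" "open W'" "homeomorphism W W' F F'"
    "\<forall>k. Ck k F W" "\<forall>k. Ck k F' W'" "subspace E" "F ` (S \<inter> W) = W' \<inter> E"
proof -
  obtain W and W' :: "'x set" and F F' E where *: "open W" "z \<in> W" "open W'" "homeomorphism W W' F F'"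
    "smooth_on F W" "smooth_on F' W'" "subspace E" "F ` (S \<inter> W) = W' \<inter> (E :: 'x set)"
    using assms(1)[unfolded embedded_submanifold_def, rule_format, OF assms(2)] by auto
  show ?thesis
    by (rule that[OF *(1-4) _ _ *(7,8)]) (use smooth_on_open[OF *(1,5)] smooth_on_open[OF *(3,6)] in auto)
qed

text \<open>\<open>tangent_space\<close> asks for curves on the whole real line inside
  \<open>S\<close>; a curve known only near 0 is continued by the constant \<open>z\<close>.\<close>

lemma tangent_spaceI:
  assumes "d > 0" "\<And>t. \<bar>t\<bar> < d \<Longrightarrow> \<gamma> t \<in> S" "\<gamma> 0 = z" "(\<gamma> has_vector_derivative u) (at 0)"
  shows "u \<in> tangent_space S z"
proof -
  let ?g = "\<lambda>t. if \<bar>t\<bar> < d then \<gamma> t else z"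
  have "z \<in> S" using assms(1) assms(2)[of 0] assms(3) by simp
  then have "range ?g \<subseteq> S" using assms(2) by auto
  moreover have "(?g has_vector_derivative u) (at 0)"
    by (rule has_vector_derivative_transform_within[OF assms(4) assms(1)])
       (auto simp: dist_real_def)
  ultimately show ?thesis
    using assms(1,3) unfolding tangent_space_def by (intro CollectI exI[of _ ?g]) auto
qed

lemma tangent_spaceE:
  assumes "u \<in> tangent_space S z"
  obtains \<gamma> where "\<And>t. \<gamma> t \<in> S" "\<gamma> 0 = z" "(\<gamma> has_vector_derivative u) (at 0)"
proof -
  from assms obtain \<gamma> where "range \<gamma> \<subseteq> S" "\<gamma> 0 = z" "(\<gamma> has_vector_derivative u) (at 0)"
    unfolding tangent_space_def by auto
  then show ?thesis using that[of \<gamma>] by (simp add: image_subset_iff)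
qed

lemma homeomorphism_derivative_inverse:
  assumes "open W" "open W'" "homeomorphism W W' F F'" "Ck (Suc 0) F W" "Ck (Suc 0) F' W'" "y \<in> W"
  shows "frechet_derivative F' (at (F y)) (frechet_derivative F (at y) v) = v"
    "frechet_derivative F (at y) (frechet_derivative F' (at (F y)) v) = v"
proof -
  have Fy: "F y \<in> W'" "F' (F y) = y" using assms(3,6) by (auto simp: homeomorphism_def)
  have D: "(F has_derivative frechet_derivative F (at y)) (at y)"
    using Ck_has_derivative[OF assms(4,6)] .
  have D': "(F' has_derivative frechet_derivative F' (at (F y))) (at (F y))"
    using Ck_has_derivative[OF assms(5) Fy(1)] .
  have "((\<lambda>x. F' (F x)) has_derivative (\<lambda>v. frechet_derivative F' (at (F y)) (frechet_derivative F (at y) v))) (at y)"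
    by (rule has_derivative_compose[OF D D'])
  then have "((\<lambda>x. x) has_derivative (\<lambda>v. frechet_derivative F' (at (F y)) (frechet_derivative F (at y) v))) (at y)"
    by (rule has_derivative_transform_within_open[OF _ assms(1,6)])
       (use assms(3) in \<open>auto simp: homeomorphism_def\<close>)
  from has_derivative_unique[OF this has_derivative_ident]
  show "frechet_derivative F' (at (F y)) (frechet_derivative F (at y) v) = v" by metis
  have D2: "(F has_derivative frechet_derivative F (at y)) (at (F' (F y)))"
    using D Fy(2) by simp
  have "((\<lambda>x. F (F' x)) has_derivative (\<lambda>v. frechet_derivative F (at y) (frechet_derivative F' (at (F y)) v))) (at (F y))"
    by (rule has_derivative_compose[OF D' D2])
  then have "((\<lambda>x. x) has_derivative (\<lambda>v. frechet_derivative F (at y) (frechet_derivative F' (at (F y)) v))) (at (F y))"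
    by (rule has_derivative_transform_within_open[OF _ assms(2) Fy(1)])
       (use assms(3) in \<open>auto simp: homeomorphism_def\<close>)
  from has_derivative_unique[OF this has_derivative_ident]
  show "frechet_derivative F (at y) (frechet_derivative F' (at (F y)) v) = v" by metis
qed

lemma has_vector_derivative_compose:
  assumes "(\<gamma> has_vector_derivative u) (at t)" "(f has_derivative D) (at (\<gamma> t) within S)"
    "\<And>s. \<gamma> s \<in> S"
  shows "((\<lambda>s. f (\<gamma> s)) has_vector_derivative D u) (at t)"
proof -
  have g: "(\<gamma> has_derivative (\<lambda>s. s *\<^sub>R u)) (at t)"
    using assms(1) by (simp add: has_vector_derivative_def)
  have "(f has_derivative D) (at (\<gamma> t) within \<gamma> ` UNIV)"
    using has_derivative_subset[OF assms(2), of "\<gamma> ` UNIV"] assms(3) by auto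
  from diff_chain_within[OF g this]
  have "(f \<circ> \<gamma> has_derivative D \<circ> (\<lambda>s. s *\<^sub>R u)) (at t)" .
  then show ?thesis
    using linear_cmul[OF has_derivative_linear[OF assms(2)]]
    by (simp add: has_vector_derivative_def o_def)
qed

text \<open>A derivative within \<open>S\<close> need not be unique as a linear map. On the velocity
  of a curve in \<open>S\<close> its value is the derivative of the composed curve, which is
  unique.\<close>

lemma tangent_space_derivative_unique:
  assumes "u \<in> tangent_space S z" "(f has_derivative D) (at z within S)" "(f has_derivative D') (at z within S)"
  shows "D u = D' u"
proof -
  obtain \<gamma> where g: "\<And>t. \<gamma> t \<in> S" "\<gamma> 0 = z" "(\<gamma> has_vector_derivative u) (at 0)"
    by (rule tangent_spaceE[OF assms(1)]) auto
  show ?thesis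
    using has_vector_derivative_compose[OF g(3), of f D S] has_vector_derivative_compose[OF g(3), of f D' S]
      assms(2,3) g(1,2) vector_derivative_unique_at by metis
qed

lemma has_vector_derivative_quotient:
  assumes "(f has_vector_derivative u) (at a)"
  shows "((\<lambda>t. (f t - f a) /\<^sub>R (t - a)) \<longlongrightarrow> u) (at a)"
proof -
  have *: "((\<lambda>t. norm (f t - f a - (t - a) *\<^sub>R u) / norm (t - a)) \<longlongrightarrow> 0) (at a)"
    using assms by (simp add: has_vector_derivative_def has_derivative_iff_norm)
  have "\<forall>\<^sub>F t in at a. norm (f t - f a - (t - a) *\<^sub>R u) / norm (t - a)
      = norm ((f t - f a) /\<^sub>R (t - a) - u)"
  proof (rule eventually_at_filter[THEN iffD2], intro always_eventually allI impI)
    fix t assume "t \<noteq> a"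
    then have "(f t - f a) /\<^sub>R (t - a) - u = (f t - f a - (t - a) *\<^sub>R u) /\<^sub>R (t - a)"
      by (simp add: scaleR_diff_right)
    then show "norm (f t - f a - (t - a) *\<^sub>R u) / norm (t - a) = norm ((f t - f a) /\<^sub>R (t - a) - u)"
      by (simp add: divide_inverse mult.commute)
  qed
  from tendsto_cong[OF this] * have "((\<lambda>t. norm ((f t - f a) /\<^sub>R (t - a) - u)) \<longlongrightarrow> 0) (at a)" by blast
  then show ?thesis using tendsto_norm_zero_iff LIM_zero_iff by blast
qed

lemma limit_in_subspace_derivative:
  assumes g: "(f has_vector_derivative u) (at (0::real))" and E: "subspace E" and f0: "f 0 \<in> E"
    and ev: "d > 0" "\<And>t. \<bar>t\<bar> < d \<Longrightarrow> f t \<in> (E :: 'a::euclidean_space set)"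
  shows "u \<in> E"
proof (rule Lim_in_closed_set[OF closed_subspace[OF E] _ _ has_vector_derivative_quotient[OF g]])
  have "(f t - f 0) /\<^sub>R (t - 0) \<in> E" if "\<bar>t\<bar> < d" for t
    using subspace_scale[OF E subspace_diff[OF E ev(2)[OF that] f0]] .
  then show "\<forall>\<^sub>F t in at 0. (f t - f 0) /\<^sub>R (t - 0) \<in> E"
    unfolding eventually_at using ev(1) by (intro exI[of _ d]) (simp add: dist_real_def)
qed simp

text \<open>\<open>F\<close> carries curves in \<open>S\<close> into \<open>E\<close>, so their
  velocities go to \<open>E\<close>; conversely a straight line in \<open>E\<close> pulls back under
  \<open>F'\<close> to a curve in \<open>S\<close>.\<close>

lemma tangent_space_embedded:
  fixes S W W' E :: "'a::euclidean_space set"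
  assumes W: "open W" "open W'" "homeomorphism W W' F F'" "Ck (Suc 0) F W" "Ck (Suc 0) F' W'"
    and E: "subspace E" "F ` (S \<inter> W) = W' \<inter> E" and y: "y \<in> S" "y \<in> W"
  shows "tangent_space S y = {u. frechet_derivative F (at y) u \<in> E}"
proof (intro Set.set_eqI iffI)
  fix u assume "u \<in> tangent_space S y"
  then obtain \<gamma> where g: "\<And>t. \<gamma> t \<in> S" "\<gamma> 0 = y" "(\<gamma> has_vector_derivative u) (at 0)"
    using tangent_spaceE by metis
  have "isCont \<gamma> 0" using g(3) has_vector_derivative_continuous by blast
  then have "\<forall>\<^sub>F t in at 0. \<gamma> t \<in> W"
    using W(1) y(2) g(2) unfolding isCont_def tendsto_def by blast
  then obtain d where d: "d > 0" "\<And>t. t \<noteq> 0 \<Longrightarrow> dist t 0 < d \<Longrightarrow> \<gamma> t \<in> W"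
    unfolding eventually_at by blast
  have in_E: "F (\<gamma> t) \<in> E" if "\<bar>t\<bar> < d" for t
  proof -
    have "\<gamma> t \<in> S \<inter> W" using d(2)[of t] that g(1,2) y(2) by (cases "t = 0") auto
    then show ?thesis using E(2) by blast
  qed
  have "((\<lambda>t. F (\<gamma> t)) has_vector_derivative frechet_derivative F (at y) u) (at 0)"
    using has_vector_derivative_compose[OF g(3), of F _ UNIV] Ck_has_derivative[OF W(4) y(2)] g(2) by simp
  then have "frechet_derivative F (at y) u \<in> E"
    by (rule limit_in_subspace_derivative[OF _ E(1) _ d(1)]) (use in_E d(1) in auto)
  then show "u \<in> {u. frechet_derivative F (at y) u \<in> E}" by simp
next
  fix u assume "u \<in> {u. frechet_derivative F (at y) u \<in> E}"
  define a where "a = frechet_derivative F (at y) u"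
  have a: "a \<in> E" using \<open>u \<in> _\<close> by (simp add: a_def)
  have Fy: "F y \<in> W'" "F y \<in> E" "F' (F y) = y"
    using E(2) y W(3) by (auto simp: homeomorphism_def)
  have "isCont (\<lambda>t. F y + t *\<^sub>R a) 0" by (intro continuous_intros)
  then have "\<forall>\<^sub>F t in at 0. F y + t *\<^sub>R a \<in> W'"
    using W(2) Fy(1) unfolding isCont_def tendsto_def by auto
  then obtain d where d: "d > 0" "\<And>t. t \<noteq> 0 \<Longrightarrow> dist t 0 < d \<Longrightarrow> F y + t *\<^sub>R a \<in> W'"
    unfolding eventually_at by blast
  have "F' (F y + t *\<^sub>R a) \<in> S" if "\<bar>t\<bar> < d" for t
  proof -
    have "F y + t *\<^sub>R a \<in> W' \<inter> E"
      using d(2)[of t] that Fy E(1) a by (cases "t = 0") (auto simp: subspace_add subspace_scale)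
    then obtain x where "x \<in> S \<inter> W" "F x = F y + t *\<^sub>R a" using E(2) by (metis imageE)
    then show ?thesis using W(3) by (metis IntE homeomorphism_apply1)
  qed
  moreover have "((\<lambda>t. F' (F y + t *\<^sub>R a)) has_vector_derivative frechet_derivative F' (at (F y)) a) (at 0)"
  proof (rule has_vector_derivative_compose[where S = UNIV and f = F' and \<gamma> = "\<lambda>t. F y + t *\<^sub>R a"
        and D = "frechet_derivative F' (at (F y))" and u = a])
    show "((\<lambda>t. F y + t *\<^sub>R a) has_vector_derivative a) (at 0)"
      by (auto intro!: derivative_eq_intros)
    show "(F' has_derivative frechet_derivative F' (at (F y))) (at (F y + 0 *\<^sub>R a))"
      using Ck_has_derivative[OF W(5) Fy(1)] by simp
  qed simp
  moreover have "frechet_derivative F' (at (F y)) a = u"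
    unfolding a_def by (rule homeomorphism_derivative_inverse(1)[OF W y(2)])
  ultimately show "u \<in> tangent_space S y"
    using Fy(3) by (intro tangent_spaceI[OF d(1), of "\<lambda>t. F' (F y + t *\<^sub>R a)"]) auto
qed

lemma subspace_tangent_space:
  fixes S :: "'a::euclidean_space set"
  assumes "embedded_submanifold S" "z \<in> S"
  shows "subspace (tangent_space S z)"
proof -
  obtain W and W' :: "'a set" and F F' E where *: "open W" "z \<in> W" "open W'" "homeomorphism W W' F F'"
    "\<forall>k. Ck k F W" "\<forall>k. Ck k F' W'" "subspace E" "F ` (S \<inter> W) = W' \<inter> E"
    by (rule embedded_chart[OF assms])
  have "linear (frechet_derivative F (at z))"
    using Ck_has_derivative[OF *(5)[rule_format] *(2)] by (rule has_derivative_linear)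
  then have "subspace {u. frechet_derivative F (at z) u \<in> E}"
    using *(7) by (simp add: subspace_def linear_0 linear_add linear_cmul)
  then show ?thesis
    using tangent_space_embedded[OF *(1,3,4) *(5,6)[rule_format] *(7,8) assms(2) *(2)] by simp
qed

text \<open>The tangent bundle is closed over \<open>S\<close>, because locally it is given by the
  closed condition that the derivative of a straightening map lies in \<open>E\<close>.\<close>

lemma tangent_space_limit:
  fixes S :: "'a::euclidean_space set"
  assumes S: "embedded_submanifold S" and z: "z \<in> S" "\<And>n. zs n \<in> S" "zs \<longlonglongrightarrow> z"
    and u: "\<And>n. us n \<in> tangent_space S (zs n)" "us \<longlonglongrightarrow> u"
  shows "u \<in> tangent_space S z"
proof -
  obtain W and W' :: "'a set" and F F' E where *: "open W" "z \<in> W" "open W'" "homeomorphism W W' F F'"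
    "\<forall>k. Ck k F W" "\<forall>k. Ck k F' W'" "subspace E" "F ` (S \<inter> W) = W' \<inter> E"
    by (rule embedded_chart[OF S z(1)])
  note T = tangent_space_embedded[OF *(1,3,4) *(5,6)[rule_format] *(7,8)]
  have "continuous_on (W \<times> UNIV) (\<lambda>p. frechet_derivative F (at (fst p)) (snd p))"
    using Ck_continuous[OF Ck_frechet_pair[OF *(1) *(5)[rule_format]]] .
  then have "isCont (\<lambda>p. frechet_derivative F (at (fst p)) (snd p)) (z, u)"
    using *(1,2) by (simp add: continuous_on_eq_continuous_at open_Times)
  from isCont_tendsto_compose[OF this tendsto_Pair[OF z(3) u(2)]]
  have lim: "(\<lambda>n. frechet_derivative F (at (zs n)) (us n)) \<longlonglongrightarrow> frechet_derivative F (at z) u" by simp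
  have ev: "\<forall>\<^sub>F n in sequentially. frechet_derivative F (at (zs n)) (us n) \<in> E"
    using topological_tendstoD[OF z(3) *(1,2)]
    by eventually_elim (use T[OF z(2)] u(1) in blast)
  have "frechet_derivative F (at z) u \<in> E"
    by (rule Lim_in_closed_set[OF closed_subspace[OF *(7)] ev _ lim]) simp
  then show ?thesis using T[OF z(1) *(2)] by simp
qed

lemma Ck2_imp_Ck1: "Ck 2 f W \<Longrightarrow> Ck (Suc 0) f W"
  by (rule Ck_Suc_imp) (simp add: numeral_2_eq_2 del: Ck.simps)

section \<open>Smooth quotients in charts: local trivialisations and vertical vectors\<close>

abbreviation dquot :: "'x::euclidean_space set \<Rightarrow> ('x \<Rightarrow> 'q) \<Rightarrow> ('q, 'e::euclidean_space) chart \<Rightarrow> 'x \<Rightarrow> 'x \<Rightarrow> 'e"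
  where "dquot Z \<pi> c z \<equiv> frechet_derivative (\<lambda>z. cmap c (\<pi> z)) (at z within Z)"

lemma is_chart_cimg_subset: "is_chart T c \<Longrightarrow> cimg c \<subseteq> cmodel c"
  unfolding is_chart_def by (metis openin_imp_subset)

lemma is_chart_bij: "is_chart T c \<Longrightarrow> bij_betw (cmap c) (cdom c) (cimg c)"
proof -
  assume "is_chart T c"
  then have "homeomorphic_map (subtopology T (cdom c)) (top_of_set (cimg c)) (cmap c)" "cdom c \<subseteq> topspace T"
    by (auto simp: is_chart_def openin_subset)
  then have "bij_betw (cmap c) (topspace (subtopology T (cdom c))) (topspace (top_of_set (cimg c)))"
    by (simp add: homeomorphic_eq_everything_map bij_betw_def)
  with \<open>cdom c \<subseteq> topspace T\<close> show ?thesis by (simp add: topspace_subtopology Int_absorb1)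
qed

lemma cinv_cmap: "is_chart T c \<Longrightarrow> p \<in> cdom c \<Longrightarrow> cinv c (cmap c p) = p"
  using is_chart_bij unfolding cinv_def by (metis bij_betw_inv_into_left)

lemma cmap_cinv: "is_chart T c \<Longrightarrow> q \<in> cimg c \<Longrightarrow> cmap c (cinv c q) = q"
  using is_chart_bij unfolding cinv_def by (metis bij_betw_inv_into_right)

lemma cinv_in_cdom: "is_chart T c \<Longrightarrow> q \<in> cimg c \<Longrightarrow> cinv c q \<in> cdom c"
  unfolding cinv_def cimg_def by (simp add: inv_into_into)

lemma cmap_in_cimg: "p \<in> cdom c \<Longrightarrow> cmap c p \<in> cimg c"
  by (simp add: cimg_def)

lemma smooth_quotient_chart:
  "smooth_quotient Z \<pi> A \<Longrightarrow> c \<in> A \<Longrightarrow> is_chart (quotient_top Z \<pi>) c"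
  by (simp add: smooth_quotient_def smooth_manifold_def)

lemma topspace_quotient_top: "topspace (quotient_top Z \<pi>) = \<pi> ` Z"
proof
  show "topspace (quotient_top Z \<pi>) \<subseteq> \<pi> ` Z"
    unfolding topspace_def by (auto simp: openin_quotient_top)
  have "{z \<in> Z. \<pi> z \<in> \<pi> ` Z} = Z" by auto
  then have "openin (quotient_top Z \<pi>) (\<pi> ` Z)" by (simp add: openin_quotient_top)
  then show "\<pi> ` Z \<subseteq> topspace (quotient_top Z \<pi>)" by (rule openin_subset)
qed

lemma continuous_map_quotient_top: "continuous_map (top_of_set Z) (quotient_top Z \<pi>) \<pi>"
  by (simp add: continuous_map topspace_quotient_top openin_quotient_top)

text \<open>Near \<open>z\<close> the coordinate projection is replaced by a map \<open>G\<close>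
  that is smooth on an open set, so that ordinary derivatives can be used.\<close>

lemma smooth_quotient_extension:
  assumes Q: "smooth_quotient Z \<pi> A" and c: "c \<in> A" and z: "z \<in> Z" "\<pi> z \<in> cdom c"
  obtains N G where "open N" "z \<in> N" "\<forall>k. Ck k G N"
    "\<forall>y\<in>Z \<inter> N. \<pi> y \<in> cdom c \<and> G y = cmap c (\<pi> y)"
proof -
  have "openin (quotient_top Z \<pi>) (cdom c)"
    using smooth_quotient_chart[OF Q c] by (simp add: is_chart_def)
  then have "openin (top_of_set Z) {z \<in> Z. \<pi> z \<in> cdom c}" by (simp add: openin_quotient_top)
  then obtain O1 where O1: "open O1" "{z \<in> Z. \<pi> z \<in> cdom c} = Z \<inter> O1"
    unfolding openin_open by blast
  have "smooth_on (\<lambda>z. cmap c (\<pi> z)) {z \<in> Z. \<pi> z \<in> cdom c}"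
    using Q c by (simp add: smooth_quotient_def)
  then obtain W F where W: "open W" "z \<in> W" "\<forall>k. Ck k F W"
      "\<forall>y\<in>{z \<in> Z. \<pi> z \<in> cdom c} \<inter> W. F y = cmap c (\<pi> y)"
    unfolding smooth_on_def using z by auto
  show ?thesis
  proof (rule that[of "O1 \<inter> W" F])
    show "open (O1 \<inter> W)" using O1(1) W(1) by (rule open_Int)
    show "z \<in> O1 \<inter> W" using O1(2) W(2) z by blast
    show "\<forall>k. Ck k F (O1 \<inter> W)" using W(3) Ck_subset by (metis inf_le2)
    show "\<forall>y\<in>Z \<inter> (O1 \<inter> W). \<pi> y \<in> cdom c \<and> F y = cmap c (\<pi> y)" using O1(2) W(4) by blast
  qed
qed

lemma has_derivative_extension:
  assumes N: "open N" "Ck (Suc 0) G N" "\<And>y. y \<in> Z \<inter> N \<Longrightarrow> G y = f y" and y: "y \<in> Z" "y \<in> N"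
  shows "(f has_derivative frechet_derivative G (at y)) (at y within Z)"
    "(f has_derivative frechet_derivative f (at y within Z)) (at y within Z)"
    "u \<in> tangent_space Z y \<Longrightarrow> frechet_derivative f (at y within Z) u = frechet_derivative G (at y) u"
proof -
  obtain d where d: "d > 0" "ball y d \<subseteq> N" using N(1) y(2) openE by blast
  have "(G has_derivative frechet_derivative G (at y)) (at y within Z)"
    using Ck_has_derivative[OF N(2) y(2)] by (rule has_derivative_at_withinI)
  then show 1: "(f has_derivative frechet_derivative G (at y)) (at y within Z)"
    by (rule has_derivative_transform_within[OF _ d(1) y(1)])
       (use d(2) N(3) in \<open>auto simp: dist_commute subset_iff\<close>)
  then show 2: "(f has_derivative frechet_derivative f (at y within Z)) (at y within Z)"
    using frechet_derivative_works differentiable_def by blast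
  show "frechet_derivative f (at y within Z) u = frechet_derivative G (at y) u" if "u \<in> tangent_space Z y"
    using tangent_space_derivative_unique[OF that 2 1] .
qed

lemma dquot_has_derivative:
  assumes Q: "smooth_quotient Z \<pi> A" and c: "c \<in> A" and z: "z \<in> Z" "\<pi> z \<in> cdom c"
  shows "((\<lambda>z. cmap c (\<pi> z)) has_derivative dquot Z \<pi> c z) (at z within Z)"
proof -
  obtain N G where *: "open N" "z \<in> N" "\<forall>k. Ck k G N"
    "\<forall>y\<in>Z \<inter> N. \<pi> y \<in> cdom c \<and> G y = cmap c (\<pi> y)"
    by (rule smooth_quotient_extension[OF Q c z])
  show ?thesis
    by (rule has_derivative_extension(2)[OF *(1) *(3)[rule_format] _ z(1) *(2)]) (use *(4) in auto)
qed

text \<open>The differential of the projection is jointly continuous on the tangent bundle, since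
  there it agrees with the derivative of a local smooth extension.\<close>

lemma dquot_limit:
  assumes Q: "smooth_quotient Z \<pi> A" and c: "c \<in> A" and z: "z \<in> Z" "\<pi> z \<in> cdom c"
    and zs: "\<And>n. zs n \<in> Z" "zs \<longlonglongrightarrow> z"
    and us: "\<And>n. us n \<in> tangent_space Z (zs n)" "us \<longlonglongrightarrow> u"
  shows "(\<lambda>n. dquot Z \<pi> c (zs n) (us n)) \<longlonglongrightarrow> dquot Z \<pi> c z u"
proof -
  obtain N G where *: "open N" "z \<in> N" "\<forall>k. Ck k G N"
    "\<forall>y\<in>Z \<inter> N. \<pi> y \<in> cdom c \<and> G y = cmap c (\<pi> y)"
    by (rule smooth_quotient_extension[OF Q c z])
  have D: "dquot Z \<pi> c y v = frechet_derivative G (at y) v" if "y \<in> Z" "y \<in> N" "v \<in> tangent_space Z y" for y v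
    by (rule has_derivative_extension(3)[OF *(1) *(3)[rule_format] _ that]) (use *(4) in auto)
  have "embedded_submanifold Z" using Q by (simp add: smooth_quotient_def)
  then have u: "u \<in> tangent_space Z z" by (rule tangent_space_limit[OF _ z(1) zs us])
  have "continuous_on (N \<times> UNIV) (\<lambda>p. frechet_derivative G (at (fst p)) (snd p))"
    using Ck_continuous[OF Ck_frechet_pair[OF *(1) *(3)[rule_format]]] .
  then have "isCont (\<lambda>p. frechet_derivative G (at (fst p)) (snd p)) (z, u)"
    using *(1,2) by (simp add: continuous_on_eq_continuous_at open_Times)
  from isCont_tendsto_compose[OF this tendsto_Pair[OF zs(2) us(2)]]
  have lim: "(\<lambda>n. frechet_derivative G (at (zs n)) (us n)) \<longlonglongrightarrow> dquot Z \<pi> c z u"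
    by (simp add: D[OF z(1) *(2) u])
  have "\<forall>\<^sub>F n in sequentially. frechet_derivative G (at (zs n)) (us n) = dquot Z \<pi> c (zs n) (us n)"
    using topological_tendstoD[OF zs(2) *(1,2)] by eventually_elim (simp add: D zs(1) us(1))
  from tendsto_cong[OF this] lim show ?thesis by blast
qed

lemma dquot_image:
  assumes "smooth_quotient Z \<pi> A" "c \<in> A" "z \<in> Z" "\<pi> z \<in> cdom c"
  shows "dquot Z \<pi> c z ` tangent_space Z z = cmodel c"
  using assms by (simp add: smooth_quotient_def)

text \<open>The implicit function theorem for a submersion between subsets modelled on linear
  subspaces. The projection is read in a straightening chart of \<open>Z\<close> as a map
  \<open>p\<close>, and \<open>p\<close> is completed to a map \<open>\<Xi>\<close> between open
  sets of the whole product space, so that the inverse function theorem applies. Its local inverse,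
  transported back to the ambient space of \<open>Z\<close>, is \<open>s\<close>; the first variable
  moves along the fibres.\<close>

lemma local_trivialization:
  fixes Z :: "'x::euclidean_space set" and c :: "('q, 'e::euclidean_space) chart"
  assumes Q: "smooth_quotient Z \<pi> A" and c: "c \<in> A" and z: "z \<in> Z" "\<pi> z \<in> cdom c"
  obtains N and s :: "'x \<times> 'e \<Rightarrow> 'x" where "open N" "(0, cmap c (\<pi> z)) \<in> N" "Ck 2 s N"
    "s (0, cmap c (\<pi> z)) = z"
    "\<forall>v q. (v, q) \<in> N \<and> v \<in> tangent_space Z z \<and> q \<in> cmodel c \<longrightarrow>
       s (v, q) \<in> Z \<and> \<pi> (s (v, q)) \<in> cdom c \<and> cmap c (\<pi> (s (v, q))) = q"
    "\<forall>v\<in>tangent_space Z z. dquot Z \<pi> c z v = 0 \<longrightarrow>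
       frechet_derivative s (at (0, cmap c (\<pi> z))) (v, 0) = v"
proof -
  define q0 where "q0 = cmap c (\<pi> z)"
  let ?T = "tangent_space Z z" and ?M = "cmodel c" and ?D = "\<lambda>f x. frechet_derivative f (at x)"
  have emb: "embedded_submanifold Z" using Q by (simp add: smooth_quotient_def)
  have chart: "is_chart (quotient_top Z \<pi>) c" by (rule smooth_quotient_chart[OF Q c])
  then have M: "subspace ?M" by (simp add: is_chart_def)
  obtain N0 G where G: "open N0" "z \<in> N0" "\<forall>k. Ck k G N0"
    "\<forall>y\<in>Z \<inter> N0. \<pi> y \<in> cdom c \<and> G y = cmap c (\<pi> y)"
    by (rule smooth_quotient_extension[OF Q c z])
  obtain W and W' :: "'x set" and F F' E where W: "open W" "z \<in> W" "open W'" "homeomorphism W W' F F'"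
    "\<forall>k. Ck k F W" "\<forall>k. Ck k F' W'" "subspace E" "F ` (Z \<inter> W) = W' \<inter> E"
    by (rule embedded_chart[OF emb z(1)])
  have T: "?T = {u. ?D F z u \<in> E}"
    using tangent_space_embedded[OF W(1,3,4) W(5,6)[rule_format] W(7,8) z(1) W(2)] .
  note hinv = homeomorphism_derivative_inverse[OF W(1,3,4) W(5,6)[rule_format] W(2)]
  define a0 where "a0 = F z"
  have a0: "a0 \<in> W'" "a0 \<in> E" "F' a0 = z"
    using W(2,4,8) z(1) by (auto simp: a0_def homeomorphism_def)
  have FDF: "(F has_derivative ?D F z) (at z)" using Ck_has_derivative[OF W(5)[rule_format] W(2)] .
  have F'DF: "(F' has_derivative ?D F' a0) (at a0)" using Ck_has_derivative[OF W(6)[rule_format] a0(1)] .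
  have GDF: "(G has_derivative ?D G z) (at z)" using Ck_has_derivative[OF G(3)[rule_format] G(2)] .
  have dG: "?D G z u = dquot Z \<pi> c z u" if "u \<in> ?T" for u
    by (rule has_derivative_extension(3)[OF G(1) G(3)[rule_format] _ z(1) G(2) that, symmetric]) (use G(4) in auto)
  define B where "B = W' \<inter> F' -` N0"
  have oB: "open B"
    unfolding B_def using W(4) G(1) W(3)
    by (intro continuous_open_preimage) (auto simp: homeomorphism_def)
  have a0B: "a0 \<in> B" using a0 G(2) by (simp add: B_def)
  define p where "p a = G (F' a)" for a
  have pC: "Ck k p B" for k
    unfolding p_def[abs_def]
    by (rule Ck_compose[OF oB G(1) _ G(3)[rule_format] Ck_subset[OF W(6)[rule_format]]]) (auto simp: B_def)
  define dp where "dp v = ?D G z (?D F' a0 v)" for v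
  have pD: "(p has_derivative dp) (at a0)"
    unfolding p_def[abs_def] dp_def[abs_def] using has_derivative_compose[OF F'DF] GDF a0(3) by simp
  have onE: "p a \<in> ?M \<and> F' a \<in> Z \<and> \<pi> (F' a) \<in> cdom c \<and> cmap c (\<pi> (F' a)) = p a"
    if "a \<in> B" "a \<in> E" for a
  proof -
    have "a \<in> W' \<inter> E" using that by (simp add: B_def)
    then obtain y where y: "y \<in> Z \<inter> W" "F y = a" using W(8) by (metis imageE)
    then have "F' a = y" using W(4) by (metis IntE homeomorphism_apply1)
    with y that G(4) have *: "F' a \<in> Z" "\<pi> (F' a) \<in> cdom c" "cmap c (\<pi> (F' a)) = p a"
      by (auto simp: B_def p_def)
    then show ?thesis using is_chart_cimg_subset[OF chart] cmap_in_cimg[OF *(2)] by auto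
  qed
  have dpE: "dp ` E = ?M"
  proof -
    have "?T = ?D F' a0 ` E"
      unfolding T a0_def using hinv by (auto intro!: image_eqI)
    then have "dp ` E = ?D G z ` ?T" by (auto simp: dp_def)
    also have "\<dots> = dquot Z \<pi> c z ` ?T" using dG by (rule image_cong[OF refl])
    finally show ?thesis using dquot_image[OF Q c z] by simp
  qed
  obtain R0 where R0: "linear R0" "range R0 \<subseteq> E" "\<forall>v\<in>dp ` E. dp (R0 v) = v"
    using linear_exists_right_inverse_on[OF has_derivative_linear[OF pD] W(7)] by auto
  \<comment> \<open>A linear projection onto the model space of the chart.\<close>
  obtain P where P: "range P \<subseteq> ?M" "linear P" "\<forall>v\<in>?M. P v = v"
    using linear_exists_left_inverse_on[OF linear_id M] by (auto simp: inj_on_def)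
  define R where "R w = R0 (P w)" for w
  have linR: "linear R" using linear_compose[OF P(2) R0(1)] by (simp add: R_def[abs_def] o_def)
  have PM: "P w \<in> ?M" for w using P(1) by auto
  have RE: "R w \<in> E" and dpR: "dp (R w) = P w" for w
    using R0(2,3) PM by (auto simp: R_def dpE)
  define \<alpha> where "\<alpha> = ?D F z"
  have lin\<alpha>: "linear \<alpha>" unfolding \<alpha>_def using FDF by (rule has_derivative_linear)
  have bl\<alpha>: "bounded_linear \<alpha>" and blR: "bounded_linear R" and blP: "bounded_linear P"
    using lin\<alpha> linR P(2) linear_conv_bounded_linear by blast+
  define L where "L x = \<alpha> (fst x) + R (snd x)" for x :: "'x \<times> 'e"
  have blL: "bounded_linear L"
    unfolding L_def[abs_def] by (intro bounded_linear_add bounded_linear_compose[OF bl\<alpha>] bounded_linear_compose[OF blR]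
      bounded_linear_fst bounded_linear_snd)
  define U where "U = (\<lambda>x. a0 + L x) -` B"
  have oU: "open U"
    unfolding U_def using oB blL
    by (intro open_vimage continuous_intros bounded_linear.continuous_on[OF blL]) auto
  \<comment> \<open>The first component keeps the tangent vector. The summand
    \<open>snd x - P (snd x)\<close> fills the directions transverse to the model space, where
    \<open>p\<close> gives no control. With the right inverse \<open>R\<close> of \<open>dp\<close>,
    the derivative at the origin sends \<open>(v, w)\<close> to
    \<open>(v, dp (\<alpha> v) + w)\<close>, which is injective.\<close>
  define \<Xi> where "\<Xi> x = (fst x, p (a0 + L x) + (snd x - P (snd x)))" for x :: "'x \<times> 'e"
  have affC: "Ck k (\<lambda>x. a0 + L x) U" for k
    by (intro Ck_add[OF oU] Ck_const Ck_linear[OF oU blL])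
  have blQ: "bounded_linear (\<lambda>x :: 'x \<times> 'e. snd x - P (snd x))"
    by (intro bounded_linear_sub bounded_linear_compose[OF blP] bounded_linear_snd)
  have \<Xi>C: "Ck 2 \<Xi> U"
    unfolding \<Xi>_def[abs_def]
    by (intro Ck_pair[OF oU] Ck_add[OF oU] Ck_linear[OF oU] bounded_linear_fst blQ
        Ck_compose[OF oU oB _ pC affC]) (auto simp: U_def)
  have L0: "L 0 = 0" using linear_0[OF bounded_linear.linear[OF blL]] .
  have x0: "(0, 0) \<in> U" using a0B L0 by (simp add: U_def zero_prod_def)
  have "(p has_derivative dp) (at (a0 + L (0, 0)))" using pD L0 by (simp add: zero_prod_def)
  then have "((\<lambda>x. p (a0 + L x)) has_derivative (\<lambda>x. dp (L x))) (at (0, 0))"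
    by (rule has_derivative_compose[rotated])
       (auto intro!: derivative_eq_intros bounded_linear_imp_has_derivative[OF blL])
  then have \<Xi>D: "(\<Xi> has_derivative (\<lambda>x. (fst x, dp (L x) + (snd x - P (snd x))))) (at (0, 0))"
    unfolding \<Xi>_def[abs_def]
    by (intro has_derivative_Pair has_derivative_add bounded_linear_imp_has_derivative[OF bounded_linear_fst]
        bounded_linear_imp_has_derivative[OF blQ])
  have dpL: "dp (L x) = dp (\<alpha> (fst x)) + P (snd x)" for x
    by (simp add: L_def linear_add[OF has_derivative_linear[OF pD]] dpR)
  have \<Xi>D': "?D \<Xi> (0, 0) x = (fst x, dp (\<alpha> (fst x)) + snd x)" for x
    unfolding frechet_derivative_at[OF \<Xi>D, symmetric] by (simp add: dpL)
  have "?D \<Xi> (0, 0) x = 0 \<Longrightarrow> x = 0" for x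
    using linear_0[OF lin\<alpha>] linear_0[OF has_derivative_linear[OF pD]] by (cases x) (auto simp: \<Xi>D' zero_prod_def)
  from inverse_function_Ck2[OF oU \<Xi>C x0 this]
  obtain U' V g where g: "open U'" "U' \<subseteq> U" "(0, 0) \<in> U'" "open V" "\<Xi> (0, 0) \<in> V"
    "homeomorphism U' V \<Xi> g" "Ck 2 g V" by blast
  have pa0: "p a0 = q0" using onE[OF a0B a0(2)] a0(3) by (simp add: q0_def)
  have \<Xi>0: "\<Xi> (0, 0) = (0, q0)"
    using L0 pa0 linear_0[OF P(2)] by (simp add: \<Xi>_def zero_prod_def)
  have g0: "g (0, q0) = (0, 0)" using g(3,6) \<Xi>0 by (metis homeomorphism_apply1)
  have gU: "g y \<in> U'" "\<Xi> (g y) = y" if "y \<in> V" for y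
    using g(6) that by (auto simp: homeomorphism_def)
  have gUB: "a0 + L (g y) \<in> B" if "y \<in> V" for y
    using subsetD[OF g(2) gU(1)[OF that]] by (simp add: U_def)
  define s where "s y = F' (a0 + L (g y))" for y
  have sC: "Ck 2 s V"
    unfolding s_def[abs_def]
    by (rule Ck_compose[OF g(4) W(3) _ W(6)[rule_format] Ck_compose[OF g(4) oU _ affC g(7)]])
       (use gUB gU(1) g(2) in \<open>auto simp: B_def\<close>)
  show ?thesis
  proof (rule that[of V s, folded q0_def])
    show "open V" "Ck 2 s V" "(0, q0) \<in> V" using g \<Xi>0 sC by auto
    show "s (0, q0) = z" using g0 L0 a0(3) by (simp add: s_def zero_prod_def)
    show "\<forall>v q. (v, q) \<in> V \<and> v \<in> ?T \<and> q \<in> ?M \<longrightarrow>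
        s (v, q) \<in> Z \<and> \<pi> (s (v, q)) \<in> cdom c \<and> cmap c (\<pi> (s (v, q))) = q"
    proof (intro allI impI, elim conjE)
      fix v q assume vq: "(v, q) \<in> V" "v \<in> ?T" "q \<in> ?M"
      obtain w where w: "g (v, q) = (v, w)"
        using gU(2)[OF vq(1)] by (cases "g (v, q)") (auto simp: \<Xi>_def)
      define a where "a = a0 + L (v, w)"
      have aB: "a \<in> B" using gUB[OF vq(1)] w by (simp add: a_def)
      have aE: "a \<in> E"
        using vq(2) a0(2) RE W(7) by (auto simp: a_def L_def T \<alpha>_def intro!: subspace_add)
      have eq: "p a + (w - P w) = q"
        using gU(2)[OF vq(1)] w by (simp add: \<Xi>_def a_def)
      then have "w - P w = q - p a" by (simp add: algebra_simps)
      \<comment> \<open>The transverse part lies in the model space as a difference of two of its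
        points. There \<open>P\<close> is the identity, yet \<open>P\<close> also kills this part,
        so it is 0.\<close>
      then have "w - P w \<in> ?M" using vq(3) onE[OF aB aE] M by (simp add: subspace_diff)
      then have "w - P w = P (w - P w)" using P(3) by simp
      also have "\<dots> = 0" using P(3) PM by (simp add: linear_diff[OF P(2)])
      finally have "p a = q" using eq by simp
      then show "s (v, q) \<in> Z \<and> \<pi> (s (v, q)) \<in> cdom c \<and> cmap c (\<pi> (s (v, q))) = q"
        using onE[OF aB aE] by (simp add: s_def w a_def)
    qed
    show "\<forall>v\<in>?T. dquot Z \<pi> c z v = 0 \<longrightarrow> ?D s (0, q0) (v, 0) = v"
    proof (intro ballI impI)
      fix v assume v: "v \<in> ?T" "dquot Z \<pi> c z v = 0"
      have y0: "(0, q0) \<in> V" using g \<Xi>0 by auto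
      have gD: "(g has_derivative ?D g (0, q0)) (at (0, q0))"
        using Ck_has_derivative[OF Ck2_imp_Ck1[OF g(7)] y0] .
      have \<Xi>S: "Ck (Suc 0) \<Xi> U'" "Ck (Suc 0) g V"
        by (rule Ck2_imp_Ck1[OF Ck_subset[OF \<Xi>C g(2)]], rule Ck2_imp_Ck1[OF g(7)])
      note hh = homeomorphism_derivative_inverse(2)[OF g(1,4,6) \<Xi>S g(3), unfolded \<Xi>0]
      have "?D \<Xi> (0, 0) (?D g (0, q0) (v, 0)) = (v, 0)" by (rule hh)
      moreover have "dp (\<alpha> v) = 0"
        unfolding dp_def \<alpha>_def a0_def hinv(1) using dG[OF v(1)] v(2) by simp
      \<comment> \<open>For a vertical \<open>v\<close> the correction
        \<open>dp (\<alpha> v)\<close> vanishes, so the derivative of the inverse fixes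
        \<open>(v, 0)\<close>.\<close>
      ultimately have gv: "?D g (0, q0) (v, 0) = (v, 0)"
        unfolding \<Xi>D' by (metis add_0 prod.collapse prod.inject)
      have "((\<lambda>y. a0 + L (g y)) has_derivative (\<lambda>x. L (?D g (0, q0) x))) (at (0, q0))"
        using has_derivative_compose[OF gD bounded_linear_imp_has_derivative[OF blL]]
        by (auto intro!: derivative_eq_intros)
      moreover have "(F' has_derivative ?D F' a0) (at (a0 + L (g (0, q0))))"
        using F'DF g0 L0 by (simp add: zero_prod_def)
      ultimately have "(s has_derivative (\<lambda>x. ?D F' a0 (L (?D g (0, q0) x)))) (at (0, q0))"
        unfolding s_def[abs_def] by (rule has_derivative_compose)
      from frechet_derivative_at[OF this]
      have "?D s (0, q0) (v, 0) = ?D F' a0 (L (v, 0))" using gv by metis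
      also have "\<dots> = v" using hinv(1) linear_0[OF linR] by (simp add: L_def \<alpha>_def a0_def)
      finally show "?D s (0, q0) (v, 0) = v" .
    qed
  qed
qed

lemma local_section:
  fixes Z :: "'x::euclidean_space set" and c :: "('q, 'e::euclidean_space) chart"
  assumes Q: "smooth_quotient Z \<pi> A" and c: "c \<in> A" and z: "z \<in> Z" "\<pi> z \<in> cdom c"
  obtains N and s :: "'e \<Rightarrow> 'x" where "open N" "cmap c (\<pi> z) \<in> N" "Ck 2 s N" "s (cmap c (\<pi> z)) = z"
    "\<forall>q\<in>N \<inter> cmodel c. s q \<in> Z \<and> \<pi> (s q) \<in> cdom c \<and> cmap c (\<pi> (s q)) = q"
proof -
  have T0: "0 \<in> tangent_space Z z"
    using subspace_tangent_space[OF _ z(1)] Q by (simp add: smooth_quotient_def subspace_0)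
  obtain N and s :: "'x \<times> 'e \<Rightarrow> 'x" where s: "open N" "(0, cmap c (\<pi> z)) \<in> N" "Ck 2 s N"
    "s (0, cmap c (\<pi> z)) = z"
    "\<forall>v q. (v, q) \<in> N \<and> v \<in> tangent_space Z z \<and> q \<in> cmodel c \<longrightarrow>
       s (v, q) \<in> Z \<and> \<pi> (s (v, q)) \<in> cdom c \<and> cmap c (\<pi> (s (v, q))) = q"
    by (rule local_trivialization[OF Q c z])
  have cont: "continuous_on UNIV (\<lambda>q :: 'e. (0 :: 'x, q))" by (intro continuous_intros)
  show ?thesis
  proof (rule that[of "Pair 0 -` N" "\<lambda>q. s (0, q)"])
    show o: "open (Pair 0 -` N)" using open_vimage[OF s(1) cont] by simp
    show "Ck 2 (\<lambda>q. s (0, q)) (Pair 0 -` N)"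
      by (rule Ck_compose[OF o s(1) _ s(3) Ck_pair[OF o Ck_const Ck_id[OF o]]]) auto
  qed (use s T0 in auto)
qed

text \<open>In a local trivialisation the curve \<open>s (t *\<^sub>R v, q0)\<close> stays in the
  fibre of \<open>z\<close>, and for vertical \<open>v\<close> its velocity is
  \<open>v\<close>.\<close>

lemma dquot_kernel:
  fixes Z :: "'x::euclidean_space set" and c :: "('q, 'e::euclidean_space) chart"
  assumes Q: "smooth_quotient Z \<pi> A" and c: "c \<in> A" and z: "z \<in> Z" "\<pi> z \<in> cdom c"
    and v: "v \<in> tangent_space Z z" "dquot Z \<pi> c z v = 0"
  shows "v \<in> tangent_space {z' \<in> Z. \<pi> z' = \<pi> z} z"
proof -
  define q0 where "q0 = cmap c (\<pi> z)"
  have chart: "is_chart (quotient_top Z \<pi>) c" by (rule smooth_quotient_chart[OF Q c])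
  have sub: "subspace (tangent_space Z z)"
    using subspace_tangent_space[OF _ z(1)] Q by (simp add: smooth_quotient_def)
  have q0M: "q0 \<in> cmodel c" using is_chart_cimg_subset[OF chart] cmap_in_cimg[OF z(2)] by (auto simp: q0_def)
  obtain N and s :: "'x \<times> 'e \<Rightarrow> 'x" where s: "open N" "(0, q0) \<in> N" "Ck 2 s N"
    "s (0, q0) = z"
    "\<forall>v q. (v, q) \<in> N \<and> v \<in> tangent_space Z z \<and> q \<in> cmodel c \<longrightarrow>
       s (v, q) \<in> Z \<and> \<pi> (s (v, q)) \<in> cdom c \<and> cmap c (\<pi> (s (v, q))) = q"
    "\<forall>v\<in>tangent_space Z z. dquot Z \<pi> c z v = 0 \<longrightarrow>
       frechet_derivative s (at (0, q0)) (v, 0) = v"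
    by (rule local_trivialization[OF Q c z, folded q0_def])
  have "isCont (\<lambda>t. (t *\<^sub>R v, q0)) 0" by (intro continuous_intros)
  then have "\<forall>\<^sub>F t in at 0. (t *\<^sub>R v, q0) \<in> N"
    using s(1,2) unfolding isCont_def tendsto_def by auto
  then obtain d where d: "d > 0" "\<And>t. t \<noteq> 0 \<Longrightarrow> dist t 0 < d \<Longrightarrow> (t *\<^sub>R v, q0) \<in> N"
    unfolding eventually_at by blast
  show ?thesis
  proof (rule tangent_spaceI[OF d(1), of "\<lambda>t. s (t *\<^sub>R v, q0)"])
    fix t :: real assume "\<bar>t\<bar> < d"
    then have "(t *\<^sub>R v, q0) \<in> N" using d(2)[of t] s(2) by (cases "t = 0") auto
    then have *: "s (t *\<^sub>R v, q0) \<in> Z" "\<pi> (s (t *\<^sub>R v, q0)) \<in> cdom c" "cmap c (\<pi> (s (t *\<^sub>R v, q0))) = q0"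
      using s(5) subspace_scale[OF sub v(1)] q0M by blast+
    have "\<pi> (s (t *\<^sub>R v, q0)) = \<pi> z"
      using cinv_cmap[OF chart *(2)] cinv_cmap[OF chart z(2)] *(3) by (simp add: q0_def)
    then show "s (t *\<^sub>R v, q0) \<in> {z' \<in> Z. \<pi> z' = \<pi> z}" using *(1) by simp
  next
    show "s (0 *\<^sub>R v, q0) = z" using s(4) by simp
    have g: "((\<lambda>t. (t *\<^sub>R v, q0)) has_vector_derivative (v, 0)) (at 0)"
      unfolding has_vector_derivative_def by (auto intro!: derivative_eq_intros)
    from Ck_has_derivative[OF Ck2_imp_Ck1[OF s(3)] s(2)]
    have "(s has_derivative frechet_derivative s (at (0, q0))) (at (0 *\<^sub>R v, q0))" by simp
    from has_vector_derivative_compose[OF g this]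
    have "((\<lambda>t. s (t *\<^sub>R v, q0)) has_vector_derivative frechet_derivative s (at (0, q0)) (v, 0)) (at 0)" by simp
    then show "((\<lambda>t. s (t *\<^sub>R v, q0)) has_vector_derivative v) (at 0)" using s(6) v by simp
  qed
qed

section \<open>Orthogonal representations of compact Lie groups\<close>

lemma smooth_on_has_derivative:
  assumes "smooth_on f S" "x \<in> S"
  obtains D where "(f has_derivative D) (at x within S)"
proof -
  obtain W F where W: "open W" "x \<in> W" "\<forall>k. Ck k F W" "\<forall>y\<in>S \<inter> W. F y = f y"
    using assms unfolding smooth_on_def by auto
  have "(f has_derivative frechet_derivative F (at x)) (at x within S)"
    by (rule has_derivative_extension(1)[OF W(1) W(3)[rule_format] _ assms(2) W(2)]) (use W(4) in auto)
  then show ?thesis by (rule that)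
qed

lemma smooth_on_continuous_on: "smooth_on f S \<Longrightarrow> continuous_on S f"
  by (auto simp: continuous_on_eq_continuous_within elim!: smooth_on_has_derivative intro: has_derivative_continuous)

section \<open>Multiplication of a Lie group in a chart at the identity\<close>

locale compact_lie_chart =
  fixes C :: "'c monoid" and T :: "'c topology" and AC :: "('c, 'l::euclidean_space) chart set"
    and e :: "('c, 'l) chart"
  assumes clg: "compact_lie_group C T AC" and e_in: "e \<in> AC" and one_in: "\<one>\<^bsub>C\<^esub> \<in> cdom e"
begin

definition x0 :: 'l where "x0 = cmap e \<one>\<^bsub>C\<^esub>"

lemma group_C: "group C"
  and topspace_T: "topspace T = carrier C"
  and manifold_T: "smooth_manifold T AC"
  and compact_T: "compact_space T"
  and continuous_mult: "continuous_map (prod_topology T T) T (\<lambda>(g, h). g \<otimes>\<^bsub>C\<^esub> h)"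
  using clg by (auto simp: compact_lie_group_def lie_group_def)

lemma smooth_mult:
  assumes "c \<in> AC" "c' \<in> AC" "d \<in> AC"
  shows "smooth_on (\<lambda>p. cmap d (cinv c (fst p) \<otimes>\<^bsub>C\<^esub> cinv c' (snd p)))
      {p. fst p \<in> cimg c \<and> snd p \<in> cimg c' \<and> cinv c (fst p) \<otimes>\<^bsub>C\<^esub> cinv c' (snd p) \<in> cdom d}"
  using clg assms by (simp add: compact_lie_group_def lie_group_def case_prod_unfold)

lemma chart_in: "c \<in> AC \<Longrightarrow> is_chart T c"
  using manifold_T by (simp add: smooth_manifold_def)

lemma chart_e: "is_chart T e"
  using chart_in e_in by blast

lemma cdom_subset: "c \<in> AC \<Longrightarrow> cdom c \<subseteq> carrier C"
  using chart_in topspace_T openin_subset unfolding is_chart_def by metis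

lemma chart_at:
  assumes "g \<in> carrier C" obtains c where "c \<in> AC" "g \<in> cdom c"
  using manifold_T assms topspace_T unfolding smooth_manifold_def by blast

lemma subspace_e: "subspace (cmodel e)"
  and openin_cimg: "openin (top_of_set (cmodel e)) (cimg e)"
  using chart_e by (auto simp: is_chart_def)

lemma cimg_subset: "cimg e \<subseteq> cmodel e"
  using is_chart_cimg_subset[OF chart_e] .

lemma x0_in: "x0 \<in> cimg e" "x0 \<in> cmodel e"
  using cmap_in_cimg[OF one_in] cimg_subset by (auto simp: x0_def)

lemma cinv_x0: "cinv e x0 = \<one>\<^bsub>C\<^esub>"
  unfolding x0_def by (rule cinv_cmap[OF chart_e one_in])

lemma cinv_carrier: "c \<in> AC \<Longrightarrow> x \<in> cimg c \<Longrightarrow> cinv c x \<in> carrier C"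
  using cinv_in_cdom chart_in cdom_subset by blast

lemma continuous_cinv:
  assumes "c \<in> AC" shows "continuous_map (top_of_set (cimg c)) T (cinv c)"
proof -
  have chart: "is_chart T c" using chart_in assms by blast
  then have "homeomorphic_map (subtopology T (cdom c)) (top_of_set (cimg c)) (cmap c)"
    by (simp add: is_chart_def)
  then obtain g where g: "homeomorphic_maps (subtopology T (cdom c)) (top_of_set (cimg c)) (cmap c) g"
    using homeomorphic_map_maps by blast
  then have cg: "continuous_map (top_of_set (cimg c)) (subtopology T (cdom c)) g"
    and g1: "\<And>y. y \<in> cimg c \<Longrightarrow> cmap c (g y) = y"
    by (auto simp: homeomorphic_maps_def)
  have "g y = cinv c y" if "y \<in> cimg c" for y
  proof -
    have "g y \<in> cdom c"
      using cg that by (auto simp: continuous_map_def Pi_iff topspace_subtopology)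
    then show ?thesis using cinv_cmap[OF chart] g1[OF that] by metis
  qed
  then have "continuous_map (top_of_set (cimg c)) (subtopology T (cdom c)) (cinv c)"
    using continuous_map_eq[OF cg] by simp
  then show ?thesis by (simp add: continuous_map_in_subtopology)
qed

lemma continuous_cmap:
  assumes "c \<in> AC" shows "continuous_map (subtopology T (cdom c)) euclidean (cmap c)"
proof -
  have "homeomorphic_map (subtopology T (cdom c)) (top_of_set (cimg c)) (cmap c)"
    using chart_in[OF assms] by (simp add: is_chart_def)
  then show ?thesis
    using homeomorphic_imp_continuous_map continuous_map_in_subtopology by blast
qed

lemma near_in_cimg:
  obtains \<rho> where "\<rho> > 0" "\<And>x. x \<in> cmodel e \<Longrightarrow> norm (x - x0) \<le> \<rho> \<Longrightarrow> x \<in> cimg e"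
proof -
  obtain U where U: "open U" "cimg e = cmodel e \<inter> U" using openin_cimg openin_open by metis
  then have "x0 \<in> U" using x0_in by auto
  then obtain \<rho> where "\<rho> > 0" "cball x0 \<rho> \<subseteq> U" using U(1) open_contains_cball by blast
  then show ?thesis using U(2) by (intro that[of \<rho>]) (auto simp: dist_norm norm_minus_commute subset_iff)
qed

lemma continuous_chart_mult:
  assumes "c \<in> AC" "c' \<in> AC"
  shows "continuous_map (top_of_set (cimg c \<times> cimg c')) T (\<lambda>p. cinv c (fst p) \<otimes>\<^bsub>C\<^esub> cinv c' (snd p))"
proof -
  have fs: "continuous_on (cimg c \<times> cimg c') fst" "continuous_on (cimg c \<times> cimg c') snd"
    by (intro continuous_intros)+
  have 1: "continuous_map (top_of_set (cimg c \<times> cimg c')) T (\<lambda>p. cinv c (fst p))"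
    using continuous_map_compose[OF _ continuous_cinv[OF assms(1)], of "top_of_set (cimg c \<times> cimg c')" fst] fs
    by (simp add: o_def Pi_def)
  have 2: "continuous_map (top_of_set (cimg c \<times> cimg c')) T (\<lambda>p. cinv c' (snd p))"
    using continuous_map_compose[OF _ continuous_cinv[OF assms(2)], of "top_of_set (cimg c \<times> cimg c')" snd] fs
    by (simp add: o_def Pi_def)
  have "continuous_map (top_of_set (cimg c \<times> cimg c')) (prod_topology T T)
      (\<lambda>p. (cinv c (fst p), cinv c' (snd p)))"
    using 1 2 by (intro continuous_map_pairedI)
  from continuous_map_compose[OF this continuous_mult] show ?thesis by (simp add: o_def)
qed

text \<open>Multiplying by \<open>x0\<close> is exact, and the partial derivative in the second
  factor is the identity at \<open>(x0, x0)\<close>, hence close to it nearby; the mean value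
  inequality in the second variable gives the bound. The error is proportional to
  \<open>norm (y - x0)\<close> alone, so in a long product of small factors the errors add up to
  \<epsilon> times the total length.\<close>

lemma chart_mult_estimate:
  assumes "\<epsilon> > 0"
  obtains \<delta> where "\<delta> > 0"
    "\<And>x y. x \<in> cmodel e \<Longrightarrow> y \<in> cmodel e \<Longrightarrow> norm (x - x0) \<le> \<delta> \<Longrightarrow> norm (y - x0) \<le> \<delta> \<Longrightarrow>
      x \<in> cimg e \<and> y \<in> cimg e \<and> cinv e x \<otimes>\<^bsub>C\<^esub> cinv e y \<in> cdom e \<and>
      norm (cmap e (cinv e x \<otimes>\<^bsub>C\<^esub> cinv e y) - x - y + x0) \<le> \<epsilon> * norm (y - x0)"
proof -
  interpret group C by (rule group_C)
  let ?M = "cmodel e"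
  define D where "D = {p. fst p \<in> cimg e \<and> snd p \<in> cimg e \<and> cinv e (fst p) \<otimes>\<^bsub>C\<^esub> cinv e (snd p) \<in> cdom e}"
  define m where "m p = cmap e (cinv e (fst p) \<otimes>\<^bsub>C\<^esub> cinv e (snd p))" for p
  have "openin (top_of_set (cimg e \<times> cimg e))
      {p \<in> cimg e \<times> cimg e. cinv e (fst p) \<otimes>\<^bsub>C\<^esub> cinv e (snd p) \<in> cdom e}"
    using openin_continuous_map_preimage[OF continuous_chart_mult[OF e_in e_in], of "cdom e"] chart_e
    by (simp add: is_chart_def)
  moreover have "{p \<in> cimg e \<times> cimg e. cinv e (fst p) \<otimes>\<^bsub>C\<^esub> cinv e (snd p) \<in> cdom e} = D"
    by (auto simp: D_def)
  moreover have "openin (top_of_set (?M \<times> ?M)) (cimg e \<times> cimg e)"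
    using openin_cimg by (intro openin_Times)
  ultimately have "openin (top_of_set (?M \<times> ?M)) D" using openin_trans by metis
  then obtain U where U: "open U" "D = (?M \<times> ?M) \<inter> U" unfolding openin_open by blast
  have x0D: "(x0, x0) \<in> D"
    using x0_in one_in by (simp add: D_def cinv_x0)
  have "smooth_on m D"
    using smooth_mult[OF e_in e_in e_in] by (simp add: m_def[abs_def] D_def)
  then obtain W F where W: "open W" "(x0, x0) \<in> W" "\<forall>k. Ck k F W" "\<forall>y\<in>D \<inter> W. F y = m y"
    unfolding smooth_on_def using x0D by auto
  have "open (U \<inter> W)" "(x0, x0) \<in> U \<inter> W" using U W x0D by auto
  then obtain A B where AB: "open A" "open B" "x0 \<in> A" "x0 \<in> B" "A \<times> B \<subseteq> U \<inter> W"
    by (metis mem_Sigma_iff open_prod_elim)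
  then obtain \<delta>1 where \<delta>1: "\<delta>1 > 0" "cball x0 \<delta>1 \<subseteq> A \<inter> B"
    by (metis IntI open_Int open_contains_cball)
  have in_UW: "(x, y) \<in> U \<inter> W" if "norm (x - x0) \<le> \<delta>1" "norm (y - x0) \<le> \<delta>1" for x y
    using that \<delta>1(2) AB(5) by (auto simp: dist_norm norm_minus_commute subset_iff)
  let ?DF = "\<lambda>p. frechet_derivative F (at p)"
  have FD: "(F has_derivative ?DF p) (at p)" if "p \<in> W" for p
    using Ck_has_derivative[OF W(3)[rule_format] that] .
  have linDF: "linear (?DF p)" if "p \<in> W" for p
    using FD[OF that] by (rule has_derivative_linear)
  have inD: "(x, y) \<in> D" if "x \<in> ?M" "y \<in> ?M" "norm (x - x0) \<le> \<delta>1" "norm (y - x0) \<le> \<delta>1" for x y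
    using in_UW[OF that(3,4)] U(2) that(1,2) by auto
  have Fm: "F (x, y) = m (x, y)" if "x \<in> ?M" "y \<in> ?M" "norm (x - x0) \<le> \<delta>1" "norm (y - x0) \<le> \<delta>1" for x y
    using in_UW[OF that(3,4)] inD[OF that] W(4) by auto
  have m1: "m (x, x0) = x" "m (x0, x) = x" if "x \<in> cimg e" for x
    using cinv_carrier[OF e_in that] by (simp_all add: m_def cinv_x0 cmap_cinv[OF chart_e that])
  have D1: "?DF (x0, x0) (0, v) = v" if v: "v \<in> ?M" for v
  proof -
    have g: "((\<lambda>t. (x0, x0 + t *\<^sub>R v)) has_vector_derivative (0, v)) (at 0)"
      unfolding has_vector_derivative_def by (auto intro!: derivative_eq_intros)
    have "((\<lambda>t. F (x0, x0 + t *\<^sub>R v)) has_vector_derivative ?DF (x0, x0) (0, v)) (at 0)"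
      using has_vector_derivative_compose[OF g, of F "?DF (x0, x0)" UNIV] FD[OF W(2)] by simp
    then have *: "((\<lambda>t. F (x0, x0 + t *\<^sub>R v)) has_vector_derivative ?DF (x0, x0) (0, v)) (at 0 within UNIV)"
      by simp
    have **: "F (x0, x0 + t *\<^sub>R v) = x0 + t *\<^sub>R v" if "dist t 0 < \<delta>1 / (norm v + 1)" for t
    proof -
      have "\<bar>t\<bar> * norm v \<le> \<bar>t\<bar> * (norm v + 1)" by (intro mult_left_mono) auto
      also have "\<dots> \<le> \<delta>1"
        using that by (simp add: dist_real_def pos_less_divide_eq add_nonneg_pos)
      finally have "norm (x0 + t *\<^sub>R v - x0) \<le> \<delta>1" by simp
      moreover have M: "x0 + t *\<^sub>R v \<in> ?M" using x0_in v subspace_e by (simp add: subspace_add subspace_scale)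
      ultimately have "F (x0, x0 + t *\<^sub>R v) = m (x0, x0 + t *\<^sub>R v)" "(x0, x0 + t *\<^sub>R v) \<in> D"
        using Fm inD x0_in \<delta>1(1) by auto
      then show ?thesis using m1 by (simp add: D_def)
    qed
    have "\<delta>1 / (norm v + 1) > 0" using \<delta>1(1) by (simp add: add_nonneg_pos)
    from has_vector_derivative_transform_within[OF * this UNIV_I **]
    have "((\<lambda>t. x0 + t *\<^sub>R v) has_vector_derivative ?DF (x0, x0) (0, v)) (at 0)" by simp
    moreover have "((\<lambda>t. x0 + t *\<^sub>R v) has_vector_derivative v) (at 0)"
      by (auto intro!: derivative_eq_intros)
    ultimately show ?thesis by (rule vector_derivative_unique_at)
  qed
  obtain P where P: "range P \<subseteq> ?M" "linear P" "\<forall>v\<in>?M. P v = v"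
    using linear_exists_left_inverse_on[OF linear_id subspace_e] by (auto simp: inj_on_def)
  \<comment> \<open>Deviation of the partial derivative in the second factor from the identity. The
    projection \<open>P\<close> restricts attention to the model space, where the extension
    \<open>F\<close> is tied to the multiplication.\<close>
  define L where "L p v = ?DF p (0, P v) - P v" for p v
  have linL: "linear (L p)" if "p \<in> W" for p
  proof -
    have "linear (\<lambda>v. (0 :: 'l, P v))"
      using linear_add[OF P(2)] linear_cmul[OF P(2)] by (intro linearI) auto
    from linear_compose[OF this linDF[OF that]] show ?thesis
      unfolding L_def[abs_def] o_def by (rule linear_compose_sub[OF _ P(2)])
  qed
  have cL: "isCont (\<lambda>p. \<Sum>b\<in>Basis. norm (L p b)) (x0, x0)"
  proof (intro continuous_intros)
    fix b :: 'l
    have "Ck 1 F W" using W(3) by blast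
    then have "continuous_on W (\<lambda>p. ?DF p (0, P b))" by simp
    then show "isCont (\<lambda>p. L p b) (x0, x0)"
      using W(1,2) by (auto simp: L_def continuous_on_eq_continuous_at intro!: continuous_intros)
  qed
  have L00: "(\<Sum>b\<in>Basis. norm (L (x0, x0) b)) = 0"
    using D1[OF subsetD[OF P(1) rangeI]] by (simp add: L_def)
  obtain \<delta>2 where \<delta>2: "\<delta>2 > 0" "\<And>p. dist p (x0, x0) < \<delta>2 \<Longrightarrow> (\<Sum>b\<in>Basis. norm (L p b)) < \<epsilon>"
    using cL assms unfolding continuous_at_eps_delta L00 dist_real_def by (auto simp: sum_nonneg)
  define \<delta> where "\<delta> = min \<delta>1 (\<delta>2 / 4)"
  have \<delta>: "\<delta> > 0" "\<delta> \<le> \<delta>1" "\<delta> \<le> \<delta>2 / 4" using \<delta>1(1) \<delta>2(1) by (auto simp: \<delta>_def)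
  have Lbound: "norm (L (x, y) v) \<le> \<epsilon> * norm v"
    if "norm (x - x0) \<le> \<delta>" "norm (y - x0) \<le> \<delta>" for x y v
  proof -
    have "(x, y) \<in> W" using in_UW that \<delta>(2) by force
    then have "bounded_linear (L (x, y))" using linL linear_conv_bounded_linear by blast
    from linear_Basis_sum[OF this]
    have "norm (L (x, y) v) = norm (\<Sum>b\<in>Basis. (v \<bullet> b) *\<^sub>R L (x, y) b)" by metis
    also have "\<dots> \<le> (\<Sum>b\<in>Basis. norm ((v \<bullet> b) *\<^sub>R L (x, y) b))" by (rule norm_sum)
    also have "\<dots> \<le> (\<Sum>b\<in>Basis. norm v * norm (L (x, y) b))"
      by (intro sum_mono) (simp add: Basis_le_norm mult_right_mono)
    also have "\<dots> = norm v * (\<Sum>b\<in>Basis. norm (L (x, y) b))" by (simp add: sum_distrib_left)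
    also have "\<dots> \<le> norm v * \<epsilon>"
    proof (rule mult_left_mono)
      have "dist (x, y) (x0, x0) \<le> norm (x - x0) + norm (y - x0)"
        unfolding dist_norm using norm_Pair_le[of "x - x0" "y - x0"] by simp
      also have "\<dots> < \<delta>2" using that \<delta>(3) \<delta>2(1) by linarith
      finally show "(\<Sum>b\<in>Basis. norm (L (x, y) b)) \<le> \<epsilon>" using \<delta>2(2) by force
    qed simp
    finally show ?thesis by (simp add: mult.commute)
  qed
  show ?thesis
  proof (rule that[OF \<delta>(1)])
    fix x y assume xy: "x \<in> ?M" "y \<in> ?M" "norm (x - x0) \<le> \<delta>" "norm (y - x0) \<le> \<delta>"
    have D: "(x, y) \<in> D" using inD[OF xy(1,2)] xy(3,4) \<delta>(2) by auto
    define u where "u = y - x0"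
    have u: "u \<in> ?M" using xy(2) x0_in subspace_e by (simp add: u_def subspace_diff)
    \<comment> \<open>Along the segment from \<open>x0\<close> to \<open>y\<close> the derivative of
      this function is \<open>L\<close> applied to \<open>u\<close>.\<close>
    define f where "f t = F (x, x0 + t *\<^sub>R u) - t *\<^sub>R u" for t
    have seg: "norm (x0 + t *\<^sub>R u - x0) \<le> \<delta>" if "t \<in> {0..1}" for t
      using that xy(4) mult_left_le_one_le[of "norm u" "\<bar>t\<bar>"] by (simp add: u_def)
    have fD: "(f has_derivative (\<lambda>s. s *\<^sub>R L (x, x0 + t *\<^sub>R u) u)) (at t within {0..1})" if t: "t \<in> {0..1}" for t
    proof -
      have W': "(x, x0 + t *\<^sub>R u) \<in> W"
        using in_UW[of x "x0 + t *\<^sub>R u"] xy(3) seg[OF t] \<delta>(2) by auto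
      have g: "((\<lambda>t. (x, x0 + t *\<^sub>R u)) has_vector_derivative (0, u)) (at t)"
        unfolding has_vector_derivative_def by (auto intro!: derivative_eq_intros)
      have "((\<lambda>t. F (x, x0 + t *\<^sub>R u)) has_vector_derivative ?DF (x, x0 + t *\<^sub>R u) (0, u)) (at t)"
        using has_vector_derivative_compose[OF g, of F "?DF (x, x0 + t *\<^sub>R u)" UNIV] FD[OF W'] by simp
      then have "(f has_vector_derivative ?DF (x, x0 + t *\<^sub>R u) (0, u) - u) (at t)"
        unfolding f_def[abs_def] by (auto intro!: derivative_eq_intros)
      then show ?thesis
        using P(3) u by (simp add: L_def has_vector_derivative_def has_derivative_at_withinI)
    qed
    have "norm (f 1 - f 0) \<le> (\<epsilon> * norm u) * norm (1 - 0 :: real)"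
    proof (rule differentiable_bound[OF convex_real_interval(5) fD])
      fix t :: real assume t: "t \<in> {0..1}"
      have "onorm (\<lambda>s. s *\<^sub>R L (x, x0 + t *\<^sub>R u) u) \<le> norm (L (x, x0 + t *\<^sub>R u) u)"
        by (rule onorm_bound) (auto simp: mult.commute)
      also have "\<dots> \<le> \<epsilon> * norm u" by (rule Lbound[OF xy(3) seg[OF t]])
      finally show "onorm (\<lambda>s. s *\<^sub>R L (x, x0 + t *\<^sub>R u) u) \<le> \<epsilon> * norm u" .
    qed auto
    moreover have "f 1 = m (x, y) - y + x0"
      using Fm[OF xy(1,2)] xy(3,4) \<delta>(2) by (simp add: f_def u_def)
    moreover have "f 0 = x"
      using Fm[OF xy(1) x0_in(2)] xy(3) \<delta>(2) \<delta>1(1) m1(1) D by (simp add: f_def D_def)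
    ultimately have "norm (m (x, y) - x - y + x0) \<le> \<epsilon> * norm (y - x0)"
      by (simp add: u_def algebra_simps)
    then show "x \<in> cimg e \<and> y \<in> cimg e \<and> cinv e x \<otimes>\<^bsub>C\<^esub> cinv e y \<in> cdom e \<and>
      norm (cmap e (cinv e x \<otimes>\<^bsub>C\<^esub> cinv e y) - x - y + x0) \<le> \<epsilon> * norm (y - x0)"
      using D by (simp add: D_def m_def)
  qed
qed

end

section \<open>The infinitesimal action and the stabiliser\<close>

locale lie_rep = compact_lie_chart C T AC e
  for C :: "'c monoid" and T :: "'c topology" and AC :: "('c, 'l::euclidean_space) chart set"
    and e :: "('c, 'l) chart" +
  fixes R :: "'c \<Rightarrow> 'x::euclidean_space \<Rightarrow> 'x"
  assumes R_linear: "g \<in> carrier C \<Longrightarrow> linear (R g)"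
    and R_norm: "g \<in> carrier C \<Longrightarrow> norm (R g v) = norm v"
    and R_mult: "g \<in> carrier C \<Longrightarrow> h \<in> carrier C \<Longrightarrow> R (g \<otimes>\<^bsub>C\<^esub> h) v = R g (R h v)"
    and R_one: "R \<one>\<^bsub>C\<^esub> v = v"
    and R_smooth: "c \<in> AC \<Longrightarrow> smooth_on (\<lambda>x. R (cinv c x) v) (cimg c)"
begin

abbreviation dR :: "'l \<Rightarrow> 'x \<Rightarrow> 'x" where "dR \<equiv> lie_act C e R"

lemma R_inv:
  assumes "g \<in> carrier C" shows "R (inv\<^bsub>C\<^esub> g) (R g v) = v" "R g (R (inv\<^bsub>C\<^esub> g) v) = v"
proof -
  interpret group C by (rule group_C)
  show "R (inv\<^bsub>C\<^esub> g) (R g v) = v" "R g (R (inv\<^bsub>C\<^esub> g) v) = v"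
    using assms by (simp_all add: R_one flip: R_mult)
qed

lemma dR_has_derivative: "((\<lambda>x. R (cinv e x) v) has_derivative (\<lambda>\<xi>. dR \<xi> v)) (at x0 within cimg e)"
proof -
  obtain D where "((\<lambda>x. R (cinv e x) v) has_derivative D) (at x0 within cimg e)"
    by (rule smooth_on_has_derivative[OF R_smooth[OF e_in] x0_in(1)])
  then have "(\<lambda>x. R (cinv e x) v) differentiable (at x0 within cimg e)" by (auto simp: differentiable_def)
  then show ?thesis unfolding frechet_derivative_works lie_act_def x0_def .
qed

lemma linear_dR: "linear (\<lambda>\<xi>. dR \<xi> v)"
  using dR_has_derivative by (rule has_derivative_linear)

lemma chart_line:
  assumes "\<xi> \<in> cmodel e"
  obtains d where "d > 0" "\<And>t. \<bar>t\<bar> < d \<Longrightarrow> x0 + t *\<^sub>R \<xi> \<in> cimg e"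
proof -
  obtain \<rho> where \<rho>: "\<rho> > 0" "\<And>x. x \<in> cmodel e \<Longrightarrow> norm (x - x0) \<le> \<rho> \<Longrightarrow> x \<in> cimg e"
    using near_in_cimg by blast
  have pos: "norm \<xi> + 1 > 0" by (simp add: add_nonneg_pos)
  show ?thesis
  proof (rule that[of "\<rho> / (norm \<xi> + 1)"])
    show "\<rho> / (norm \<xi> + 1) > 0" using \<rho>(1) pos by simp
    fix t :: real assume t: "\<bar>t\<bar> < \<rho> / (norm \<xi> + 1)"
    have "\<bar>t\<bar> * norm \<xi> \<le> \<bar>t\<bar> * (norm \<xi> + 1)" by (intro mult_left_mono) auto
    also have "\<dots> \<le> \<rho>" using t pos by (simp add: pos_less_divide_eq)
    finally show "x0 + t *\<^sub>R \<xi> \<in> cimg e"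
      using assms x0_in(2) subspace_e by (intro \<rho>(2)) (auto simp: subspace_add subspace_scale)
  qed
qed

lemma tangent_space_cimg:
  assumes "\<xi> \<in> cmodel e" shows "\<xi> \<in> tangent_space (cimg e) x0"
proof -
  obtain d where d: "d > 0" "\<And>t. \<bar>t\<bar> < d \<Longrightarrow> x0 + t *\<^sub>R \<xi> \<in> cimg e" using chart_line[OF assms] by blast
  show ?thesis
    by (rule tangent_spaceI[OF d(1), of "\<lambda>t. x0 + t *\<^sub>R \<xi>"]) (use d(2) in \<open>auto intro!: derivative_eq_intros\<close>)
qed

lemma dR_eqI:
  assumes "\<xi> \<in> cmodel e" "((\<lambda>x. R (cinv e x) v) has_derivative D) (at x0 within cimg e)"
  shows "dR \<xi> v = D \<xi>"
  using tangent_space_derivative_unique[OF tangent_space_cimg[OF assms(1)] dR_has_derivative assms(2)] .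

text \<open>Restricted to \<open>\<xi>\<close> in the model space: elsewhere the derivative within
  \<open>cimg e\<close> is not determined, and the choices for different vectors need not fit
  together.\<close>

lemma linear_dR_right:
  assumes "\<xi> \<in> cmodel e" shows "linear (dR \<xi>)"
proof (rule linearI)
  fix u v :: 'x and a :: real
  have "((\<lambda>x. R (cinv e x) u + R (cinv e x) v) has_derivative (\<lambda>\<xi>. dR \<xi> u + dR \<xi> v)) (at x0 within cimg e)"
    by (intro has_derivative_add dR_has_derivative)
  then have "((\<lambda>x. R (cinv e x) (u + v)) has_derivative (\<lambda>\<xi>. dR \<xi> u + dR \<xi> v)) (at x0 within cimg e)"
    by (rule has_derivative_transform[OF x0_in(1), rotated])
       (simp add: linear_add[OF R_linear[OF cinv_carrier[OF e_in]]])
  from dR_eqI[OF assms this] show "dR \<xi> (u + v) = dR \<xi> u + dR \<xi> v" .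
  have "((\<lambda>x. a *\<^sub>R R (cinv e x) u) has_derivative (\<lambda>\<xi>. a *\<^sub>R dR \<xi> u)) (at x0 within cimg e)"
    by (intro has_derivative_scaleR_right dR_has_derivative)
  then have "((\<lambda>x. R (cinv e x) (a *\<^sub>R u)) has_derivative (\<lambda>\<xi>. a *\<^sub>R dR \<xi> u)) (at x0 within cimg e)"
    by (rule has_derivative_transform[OF x0_in(1), rotated])
       (simp add: linear_cmul[OF R_linear[OF cinv_carrier[OF e_in]]])
  from dR_eqI[OF assms this] show "dR \<xi> (a *\<^sub>R u) = a *\<^sub>R dR \<xi> u" .
qed

text \<open>A straight line in the chart, continued by the identity. One curve serves all vectors
  \<open>v\<close>, so it can also be differentiated as a curve of operators.\<close>

lemma chart_curve:
  assumes "\<xi> \<in> cmodel e"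
  obtains k where "\<And>t. k t \<in> carrier C" "k 0 = \<one>\<^bsub>C\<^esub>"
    "\<forall>v. ((\<lambda>t. R (k t) v) has_vector_derivative dR \<xi> v) (at 0)"
proof -
  interpret group C by (rule group_C)
  obtain d where d: "d > 0" "\<And>t. \<bar>t\<bar> < d \<Longrightarrow> x0 + t *\<^sub>R \<xi> \<in> cimg e" using chart_line[OF assms] by blast
  define y where "y t = (if \<bar>t\<bar> < d then x0 + t *\<^sub>R \<xi> else x0)" for t
  have y: "y t \<in> cimg e" for t using d(2) x0_in(1) by (simp add: y_def)
  have "((\<lambda>t. x0 + t *\<^sub>R \<xi>) has_vector_derivative \<xi>) (at 0 within UNIV)"
    by (auto intro!: derivative_eq_intros)
  from has_vector_derivative_transform_within[OF this d(1), of y]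
  have yd: "(y has_vector_derivative \<xi>) (at 0)" by (simp add: y_def dist_real_def)
  have y0: "y 0 = x0" using d(1) by (simp add: y_def)
  show ?thesis
  proof (rule that[of "\<lambda>t. cinv e (y t)"])
    show "\<forall>v. ((\<lambda>t. R (cinv e (y t)) v) has_vector_derivative dR \<xi> v) (at 0)"
    proof
      fix v
      show "((\<lambda>t. R (cinv e (y t)) v) has_vector_derivative dR \<xi> v) (at 0)"
        using has_vector_derivative_compose[OF yd, of "\<lambda>x. R (cinv e x) v" "\<lambda>\<xi>. dR \<xi> v" "cimg e"]
          dR_has_derivative y y0 by simp
    qed
  qed (use y y0 cinv_x0 cinv_carrier[OF e_in] in auto)
qed

lemma dR_estimate:
  assumes "\<epsilon> > 0"
  obtains \<delta> where "\<delta> > 0" "\<And>x. x \<in> cmodel e \<Longrightarrow> norm (x - x0) \<le> \<delta> \<Longrightarrow>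
      x \<in> cimg e \<and> norm (R (cinv e x) v - v - dR (x - x0) v) \<le> \<epsilon> * norm (x - x0)"
proof -
  obtain \<rho> where \<rho>: "\<rho> > 0" "\<And>x. x \<in> cmodel e \<Longrightarrow> norm (x - x0) \<le> \<rho> \<Longrightarrow> x \<in> cimg e"
    using near_in_cimg by blast
  obtain d where d: "d > 0" "\<And>x. x \<in> cimg e \<Longrightarrow> norm (x - x0) < d \<Longrightarrow>
      norm (R (cinv e x) v - R (cinv e x0) v - dR (x - x0) v) \<le> \<epsilon> * norm (x - x0)"
    using dR_has_derivative[of v] assms unfolding has_derivative_within_alt by blast
  show ?thesis
    by (rule that[of "min \<rho> (d / 2)"]) (use \<rho> d R_one cinv_x0 in auto)
qed

lemma continuous_R: "continuous_map T euclidean (\<lambda>g. R g v)"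
proof -
  have "continuous_map (subtopology T (cdom c)) euclidean (\<lambda>g. R g v)" if "c \<in> AC" for c
  proof -
    have chart: "is_chart T c" using chart_in that by blast
    have "continuous_map (subtopology T (cdom c)) (top_of_set (cimg c)) (cmap c)"
      using chart homeomorphic_imp_continuous_map by (auto simp: is_chart_def)
    moreover have "continuous_map (top_of_set (cimg c)) euclidean (\<lambda>x. R (cinv c x) v)"
      using smooth_on_continuous_on[OF R_smooth[OF that]] by simp
    ultimately have "continuous_map (subtopology T (cdom c)) euclidean ((\<lambda>x. R (cinv c x) v) \<circ> cmap c)"
      by (rule continuous_map_compose)
    then show ?thesis
      by (rule continuous_map_eq) (simp add: cinv_cmap[OF chart])
  qed
  moreover have "openin T (cdom c)" if "c \<in> AC" for c
    using chart_in[OF that] by (simp add: is_chart_def)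
  ultimately have 1: "openin T {g \<in> cdom c. R g v \<in> V}" if "c \<in> AC" "open V" for c V
    using openin_continuous_map_preimage[of "subtopology T (cdom c)" euclidean "\<lambda>g. R g v" V] that
      cdom_subset[OF that(1)] openin_trans_full[of T "cdom c"]
    by (simp add: topspace_T Int_absorb1)
  have "openin T {g \<in> topspace T. R g v \<in> V}" if "open V" for V
  proof -
    have *: "{g \<in> topspace T. R g v \<in> V} = (\<Union>c\<in>AC. {g \<in> cdom c. R g v \<in> V})"
      using manifold_T unfolding smooth_manifold_def by blast
    show ?thesis unfolding * by (rule openin_Union) (use 1 that in auto)
  qed
  then show ?thesis by (simp add: continuous_map)
qed

lemma orbit_compact:
  assumes "closedin T S" shows "compact ((\<lambda>g. R g v) ` S)"
proof -
  have "compactin T S" using closedin_compact_space[OF compact_T assms] .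
  then have "compactin euclidean ((\<lambda>g. R g v) ` S)"
    by (rule image_compactin[OF _ continuous_R])
  then show ?thesis by simp
qed

text \<open>Elements outside a neighbourhood of the stabiliser of \<open>z\<close> form a closed,
  hence compact set, whose image in the orbit is compact and misses \<open>z\<close>. An element
  that moves \<open>z\<close> little therefore is the product of an element near the identity and
  one that fixes \<open>z\<close>.\<close>

lemma near_orbit:
  assumes "\<delta> > 0"
  obtains \<delta>' where "\<delta>' > 0" "\<And>g. g \<in> carrier C \<Longrightarrow> norm (R g z - z) < \<delta>' \<Longrightarrow>
      \<exists>x\<in>cimg e. norm (x - x0) < \<delta> \<and> R (cinv e x) z = R g z"
proof -
  interpret group C by (rule group_C)
  define U where "U = {g \<in> cdom e. norm (cmap e g - x0) < \<delta>}"
  have oe: "openin T (cdom e)" using chart_e by (simp add: is_chart_def)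
  have "openin (subtopology T (cdom e)) {g \<in> topspace (subtopology T (cdom e)). cmap e g \<in> ball x0 \<delta>}"
    using continuous_cmap[OF e_in] by (rule openin_continuous_map_preimage) simp
  moreover have "{g \<in> topspace (subtopology T (cdom e)). cmap e g \<in> ball x0 \<delta>} = U"
    using cdom_subset[OF e_in] topspace_T by (auto simp: U_def dist_norm norm_minus_commute topspace_subtopology)
  ultimately have U: "openin T U" using openin_trans_full oe by metis
  have Uc: "U \<subseteq> carrier C" using cdom_subset[OF e_in] by (auto simp: U_def)
  have oneU: "\<one>\<^bsub>C\<^esub> \<in> U" using one_in assms by (simp add: U_def x0_def)
  define V where "V h = {g \<in> carrier C. g \<otimes>\<^bsub>C\<^esub> inv\<^bsub>C\<^esub> h \<in> U}" for h
  have oV: "openin T (V h)" if h: "h \<in> carrier C" for h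
  proof -
    have "continuous_map T (prod_topology T T) (\<lambda>g. (g, inv\<^bsub>C\<^esub> h))"
      using h topspace_T by (intro continuous_map_pairedI) auto
    from continuous_map_compose[OF this continuous_mult]
    have "continuous_map T T (\<lambda>g. g \<otimes>\<^bsub>C\<^esub> inv\<^bsub>C\<^esub> h)" by (simp add: o_def)
    from openin_continuous_map_preimage[OF this U] show ?thesis by (simp add: V_def topspace_T)
  qed
  define S where "S = {h \<in> carrier C. R h z = z}"
  define K where "K = carrier C - (\<Union>h\<in>S. V h)"
  have "openin T (\<Union>h\<in>S. V h)" using oV by (intro openin_Union) (auto simp: S_def)
  then have "closedin T K" unfolding K_def topspace_T[symmetric] by blast
  then have comp: "compact ((\<lambda>g. R g z) ` K)" by (rule orbit_compact)
  have "z \<notin> (\<lambda>g. R g z) ` K"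
  proof
    assume "z \<in> (\<lambda>g. R g z) ` K"
    then obtain g where g: "g \<in> K" "R g z = z" by auto
    then have "g \<in> S" "g \<in> carrier C" by (auto simp: K_def S_def)
    then have "g \<in> V g" using oneU by (simp add: V_def)
    then show False using g \<open>g \<in> S\<close> by (auto simp: K_def)
  qed
  then obtain \<delta>' where \<delta>': "\<delta>' > 0" "ball z \<delta>' \<subseteq> - (\<lambda>g. R g z) ` K"
    using comp by (metis Compl_iff compact_imp_closed open_Compl openE)
  show ?thesis
  proof (rule that[OF \<delta>'(1)])
    fix g assume g: "g \<in> carrier C" "norm (R g z - z) < \<delta>'"
    then have "R g z \<in> ball z \<delta>'" by (simp add: dist_norm norm_minus_commute)
    then have "g \<notin> K" using \<delta>'(2) by auto
    then obtain h where h: "h \<in> S" "g \<otimes>\<^bsub>C\<^esub> inv\<^bsub>C\<^esub> h \<in> U" using g(1) by (auto simp: K_def V_def)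
    define u where "u = g \<otimes>\<^bsub>C\<^esub> inv\<^bsub>C\<^esub> h"
    have u: "u \<in> carrier C" "u \<in> cdom e" "norm (cmap e u - x0) < \<delta>"
      using h(2) Uc by (auto simp: U_def u_def)
    have "g = u \<otimes>\<^bsub>C\<^esub> h" using h(1) g(1) by (simp add: u_def S_def m_assoc)
    then have "R u z = R g z" using R_mult[OF u(1), of h z] h(1) by (simp add: S_def)
    then show "\<exists>x\<in>cimg e. norm (x - x0) < \<delta> \<and> R (cinv e x) z = R g z"
      using u cmap_in_cimg[OF u(2)] cinv_cmap[OF chart_e u(2)] by (intro bexI[of _ "cmap e u"]) auto
  qed
qed

text \<open>A vector \<kappa> that annihilates \<open>z\<close> is tangent to the stabiliser of
  \<open>z\<close>. In the role of the exponential of \<open>s *\<^sub>R \<kappa>\<close>, the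
  \<open>n\<close>-th power of the element with coordinate
  \<open>x0 + (s/n) *\<^sub>R \<kappa>\<close> is used. It stays within
  \<open>\<epsilon> * s\<close> of \<open>x0 + s *\<^sub>R \<kappa>\<close> and moves
  \<open>z\<close> arbitrarily little for large \<open>n\<close>. Compactness of this ball then
  yields a point in it that does not move \<open>z\<close> at all.\<close>

lemma stabilizer_direction:
  assumes \<kappa>: "\<kappa> \<in> cmodel e" "dR \<kappa> z = 0" and "\<epsilon> > 0"
  obtains \<delta> where "\<delta> > 0"
    "\<And>s. 0 < s \<Longrightarrow> s \<le> \<delta> \<Longrightarrow> \<exists>y\<in>cimg e. norm (y - x0 - s *\<^sub>R \<kappa>) \<le> \<epsilon> * s \<and> R (cinv e y) z = z"
proof -
  interpret group C by (rule group_C)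
  let ?M = "cmodel e"
  define k where "k = norm \<kappa> + 1"
  have k: "k > 0" "norm \<kappa> \<le> k" by (auto simp: k_def add_nonneg_pos)
  define \<epsilon>' where "\<epsilon>' = \<epsilon> / k"
  have \<epsilon>': "\<epsilon>' > 0" "\<epsilon>' * k = \<epsilon>" using assms(3) k by (auto simp: \<epsilon>'_def)
  obtain \<delta>0 where \<delta>0: "\<delta>0 > 0"
    "\<And>x y. x \<in> ?M \<Longrightarrow> y \<in> ?M \<Longrightarrow> norm (x - x0) \<le> \<delta>0 \<Longrightarrow> norm (y - x0) \<le> \<delta>0 \<Longrightarrow>
      x \<in> cimg e \<and> y \<in> cimg e \<and> cinv e x \<otimes>\<^bsub>C\<^esub> cinv e y \<in> cdom e \<and>
      norm (cmap e (cinv e x \<otimes>\<^bsub>C\<^esub> cinv e y) - x - y + x0) \<le> \<epsilon>' * norm (y - x0)"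
    using chart_mult_estimate[OF \<epsilon>'(1)] by metis
  \<comment> \<open>Chosen so that the ball of radius \<open>\<epsilon> * s\<close> about
    \<open>x0 + s *\<^sub>R \<kappa>\<close> stays within \<open>\<delta>0\<close> of
    \<open>x0\<close>.\<close>
  define \<delta> where "\<delta> = \<delta>0 / (k + \<epsilon>)"
  have \<delta>: "\<delta> > 0" using \<delta>0(1) k assms(3) by (simp add: \<delta>_def)
  show ?thesis
  proof (rule that[OF \<delta>])
    fix s :: real assume s: "0 < s" "s \<le> \<delta>"
    have sk: "s * (k + \<epsilon>) \<le> \<delta>0" using s(2) k assms(3) by (simp add: \<delta>_def pos_le_divide_eq)
    define K where "K = ?M \<inter> cball (x0 + s *\<^sub>R \<kappa>) (\<epsilon> * s)"
    have K_near: "norm (x - x0) \<le> \<delta>0" if "x \<in> K" for x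
    proof -
      have "norm (x - x0) \<le> norm (x - (x0 + s *\<^sub>R \<kappa>)) + norm (s *\<^sub>R \<kappa>)"
        using norm_triangle_ineq[of "x - (x0 + s *\<^sub>R \<kappa>)" "s *\<^sub>R \<kappa>"] by simp
      also have "\<dots> \<le> \<epsilon> * s + s * k"
        using that s(1) k(2) by (intro add_mono) (auto simp: K_def dist_norm norm_minus_commute mult_left_mono)
      also have "\<dots> \<le> \<delta>0" using sk by (simp add: algebra_simps)
      finally show ?thesis .
    qed
    have K_cimg: "K \<subseteq> cimg e" using \<delta>0(2)[of _ x0] x0_in(2) K_near \<delta>0(1) by (auto simp: K_def)
    have "compact K" unfolding K_def using closed_subspace[OF subspace_e] by (simp add: closed_Int_compact)
    moreover have "x0 + s *\<^sub>R \<kappa> \<in> K"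
      using x0_in(2) \<kappa>(1) subspace_e s(1) assms(3) by (auto simp: K_def subspace_add subspace_scale)
    moreover have "continuous_on K (\<lambda>y. norm (R (cinv e y) z - z))"
      using continuous_on_subset[OF smooth_on_continuous_on[OF R_smooth[OF e_in]] K_cimg]
      by (intro continuous_intros)
    ultimately obtain y where y: "y \<in> K" "\<And>y'. y' \<in> K \<Longrightarrow> norm (R (cinv e y) z - z) \<le> norm (R (cinv e y') z - z)"
      using continuous_attains_inf[of K "\<lambda>y. norm (R (cinv e y) z - z)"] by blast
    have small: "norm (R (cinv e y) z - z) \<le> \<eta> * (s * k)" if \<eta>: "\<eta> > 0" for \<eta>
    proof -
      obtain d where d: "d > 0" "\<And>x. x \<in> ?M \<Longrightarrow> norm (x - x0) \<le> d \<Longrightarrow>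
          x \<in> cimg e \<and> norm (R (cinv e x) z - z - dR (x - x0) z) \<le> \<eta> * norm (x - x0)"
        using dR_estimate[OF \<eta>] by metis
      \<comment> \<open>So many factors that a single one is within \<open>d\<close> of
        \<open>x0\<close>, where the \<eta>-estimate holds.\<close>
      obtain n :: nat where n: "n > 0" "s * k / d < n" 
        by (metis reals_Archimedean2 gr_zeroI less_trans of_nat_0_less_iff of_nat_less_0_iff d(1) s(1) k(1)
            divide_pos_pos mult_pos_pos)
      define t where "t = s / n"
      have t: "t > 0" "real n * t = s" using s(1) n(1) by (auto simp: t_def)
      define a where "a = x0 + t *\<^sub>R \<kappa>"
      have aM: "a \<in> ?M" using x0_in(2) \<kappa>(1) subspace_e by (simp add: a_def subspace_add subspace_scale)
      have an: "norm (a - x0) \<le> t * k" using t(1) k(2) by (simp add: a_def mult_left_mono)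
      have ts: "t \<le> s" using t n(1) by (metis mult_le_cancel_right1 of_nat_1 of_nat_le_iff less_one not_le less_le_not_le Suc_leI One_nat_def)
      have ad: "norm (a - x0) \<le> d"
      proof -
        have "t * k \<le> d" using n(1,2) d(1) by (simp add: t_def field_simps)
        then show ?thesis using an by linarith
      qed
      have a\<delta>0: "norm (a - x0) \<le> \<delta>0"
      proof -
        have "t * k \<le> s * (k + \<epsilon>)" using ts t(1) k(1) assms(3) by (intro mult_mono) auto
        then show ?thesis using an sk by linarith
      qed
      have az: "norm (R (cinv e a) z - z) \<le> \<eta> * (t * k)"
      proof -
        have "dR (a - x0) z = 0" using linear_cmul[OF linear_dR, of t \<kappa> z] \<kappa>(2) by (simp add: a_def)
        then have "norm (R (cinv e a) z - z) \<le> \<eta> * norm (a - x0)" using d(2)[OF aM ad] by simp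
        also have "\<dots> \<le> \<eta> * (t * k)" using an \<eta> by simp
        finally show ?thesis .
      qed
      have ac: "cinv e a \<in> carrier C" using \<delta>0(2)[OF aM aM a\<delta>0 a\<delta>0] cinv_carrier[OF e_in] by blast
      \<comment> \<open>Coordinate of the \<open>j\<close>-th power of the element with coordinate
        \<open>a\<close>; the induction shows that the powers up to \<open>n\<close> stay in the
        chart.\<close>
      define b where "b = rec_nat x0 (\<lambda>_ b. cmap e (cinv e b \<otimes>\<^bsub>C\<^esub> cinv e a))"
      have b0: "b 0 = x0" and bS: "b (Suc j) = cmap e (cinv e (b j) \<otimes>\<^bsub>C\<^esub> cinv e a)" for j
        by (simp_all add: b_def)
      have "j \<le> n \<Longrightarrow> b j \<in> cimg e \<and> norm (b j - x0 - (j * t) *\<^sub>R \<kappa>) \<le> j * t * \<epsilon> \<and>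
          norm (R (cinv e (b j)) z - z) \<le> j * (\<eta> * (t * k))" for j
      proof (induction j)
        case 0
        then show ?case using x0_in by (simp add: b0 cinv_x0 R_one)
      next
        case (Suc j)
        then have IH: "b j \<in> cimg e" "norm (b j - x0 - (j * t) *\<^sub>R \<kappa>) \<le> j * t * \<epsilon>"
          "norm (R (cinv e (b j)) z - z) \<le> j * (\<eta> * (t * k))" by auto
        have jt: "j * t \<le> s" using Suc.prems t by (metis mult_right_mono of_nat_mono Suc_leD less_imp_le)
        have bM: "b j \<in> ?M" using IH(1) cimg_subset by blast
        have bn: "norm (b j - x0) \<le> \<delta>0"
        proof -
          have "norm (b j - x0) \<le> norm (b j - x0 - (j * t) *\<^sub>R \<kappa>) + norm ((j * t) *\<^sub>R \<kappa>)"
            using norm_triangle_ineq[of "b j - x0 - (j * t) *\<^sub>R \<kappa>" "(j * t) *\<^sub>R \<kappa>"] by simp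
          also have "\<dots> \<le> j * t * \<epsilon> + j * t * k"
            using IH(2) t(1) k(2) by (intro add_mono) (auto simp: mult_left_mono)
          also have "\<dots> = j * t * (k + \<epsilon>)" by (simp add: algebra_simps)
          also have "\<dots> \<le> s * (k + \<epsilon>)" using jt k(1) assms(3) by (intro mult_right_mono) auto
          finally show ?thesis using sk by linarith
        qed
        note E = \<delta>0(2)[OF bM aM bn a\<delta>0]
        have 1: "b (Suc j) \<in> cimg e" unfolding bS using E by (intro cmap_in_cimg) simp
        have "norm (b (Suc j) - x0 - (Suc j * t) *\<^sub>R \<kappa>) =
            norm ((cmap e (cinv e (b j) \<otimes>\<^bsub>C\<^esub> cinv e a) - b j - a + x0) + (b j - x0 - (j * t) *\<^sub>R \<kappa>))"
          by (simp add: bS a_def algebra_simps)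
        also have "\<dots> \<le> \<epsilon>' * norm (a - x0) + j * t * \<epsilon>"
          using E IH(2) by (intro norm_triangle_mono) auto
        also have "\<dots> \<le> \<epsilon>' * (t * k) + j * t * \<epsilon>" using an \<epsilon>'(1) by simp
        also have "\<dots> = Suc j * t * \<epsilon>" by (simp add: algebra_simps flip: \<epsilon>'(2))
        finally have 2: "norm (b (Suc j) - x0 - (Suc j * t) *\<^sub>R \<kappa>) \<le> Suc j * t * \<epsilon>" .
        have bc: "cinv e (b j) \<in> carrier C" using IH(1) cinv_carrier[OF e_in] by blast
        have "R (cinv e (b (Suc j))) z = R (cinv e (b j)) (R (cinv e a) z)"
          using E cinv_cmap[OF chart_e] R_mult[OF bc ac] by (simp add: bS)
        \<comment> \<open>The group acts by isometries, so the displacements of \<open>z\<close>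
          only add up.\<close>
        then have "R (cinv e (b (Suc j))) z - z =
            R (cinv e (b j)) (R (cinv e a) z - z) + (R (cinv e (b j)) z - z)"
          by (simp add: linear_diff[OF R_linear[OF bc]])
        then have "norm (R (cinv e (b (Suc j))) z - z) \<le> \<eta> * (t * k) + j * (\<eta> * (t * k))"
          using az IH(3) R_norm[OF bc] by (metis norm_triangle_mono)
        then show ?case using 1 2 by (simp add: algebra_simps)
      qed
      from this[of n] have bn: "b n \<in> cimg e" "norm (b n - x0 - s *\<^sub>R \<kappa>) \<le> s * \<epsilon>"
          "norm (R (cinv e (b n)) z - z) \<le> n * (\<eta> * (t * k))" using t(2) by auto
      have "b n \<in> K" using bn cimg_subset
        by (auto simp: K_def dist_norm norm_minus_commute[of "x0 + _"] diff_diff_eq mult.commute)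
      then have "norm (R (cinv e y) z - z) \<le> n * (\<eta> * (t * k))" using y(2) bn(3) by force
      also have "\<dots> = \<eta> * (s * k)" by (simp add: algebra_simps flip: t(2))
      finally show ?thesis .
    qed
    have "norm (R (cinv e y) z - z) \<le> 0"
    proof (rule field_le_epsilon)
      fix x :: real assume "x > 0"
      then show "norm (R (cinv e y) z - z) \<le> 0 + x"
        using small[of "x / (s * k)"] s(1) k(1) by simp
    qed
    then have "R (cinv e y) z = z" by simp
    moreover have "norm (y - x0 - s *\<^sub>R \<kappa>) \<le> \<epsilon> * s"
      using y(1) by (simp add: K_def dist_norm norm_minus_commute diff_diff_eq)
    ultimately show "\<exists>y\<in>cimg e. norm (y - x0 - s *\<^sub>R \<kappa>) \<le> \<epsilon> * s \<and> R (cinv e y) z = z"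
      using y(1) K_cimg by blast
  qed
qed

end

section \<open>Tangent vectors of orbits\<close>

context lie_rep
begin

text \<open>Curves in an orbit lift to curves of minimal parameters of comparable speed, because the stabiliser
  directions could otherwise be used to shorten the parameter.\<close>

definition minimal_param :: "real \<Rightarrow> 'x \<Rightarrow> 'l \<Rightarrow> bool" where
  "minimal_param \<rho> z x \<longleftrightarrow> x \<in> cmodel e \<and> norm (x - x0) \<le> \<rho> \<and>
     (\<forall>x'\<in>cmodel e. norm (x' - x0) \<le> \<rho> \<longrightarrow> R (cinv e x') z = R (cinv e x) z \<longrightarrow>
        norm (x - x0) \<le> norm (x' - x0))"

lemma minimal_param_exists:
  assumes \<rho>: "\<And>x. x \<in> cmodel e \<Longrightarrow> norm (x - x0) \<le> \<rho> \<Longrightarrow> x \<in> cimg e"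
    and x: "x \<in> cmodel e" "norm (x - x0) \<le> \<rho>"
  obtains x' where "minimal_param \<rho> z x'" "R (cinv e x') z = R (cinv e x) z" "norm (x' - x0) \<le> norm (x - x0)"
proof -
  define K where "K = {x' \<in> cmodel e \<inter> cball x0 \<rho>. R (cinv e x') z = R (cinv e x) z}"
  have sub: "cmodel e \<inter> cball x0 \<rho> \<subseteq> cimg e" using \<rho> by (auto simp: dist_norm norm_minus_commute)
  have "compact (cmodel e \<inter> cball x0 \<rho>)" using closed_subspace[OF subspace_e] by (simp add: closed_Int_compact)
  moreover have "closedin (top_of_set (cmodel e \<inter> cball x0 \<rho>)) K"
    unfolding K_def
    using continuous_on_subset[OF smooth_on_continuous_on[OF R_smooth[OF e_in]] sub]
    by (intro continuous_closedin_preimage_constant)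
  ultimately have "compact K" using closedin_compact by blast
  moreover have "x \<in> K" using x by (simp add: K_def dist_norm norm_minus_commute)
  moreover have "continuous_on K (\<lambda>x'. norm (x' - x0))" by (intro continuous_intros)
  ultimately obtain x' where x': "x' \<in> K" "\<And>y. y \<in> K \<Longrightarrow> norm (x' - x0) \<le> norm (y - x0)"
    using continuous_attains_inf[of K "\<lambda>x'. norm (x' - x0)"] by blast
  show ?thesis
  proof (rule that[of x'])
    show "minimal_param \<rho> z x'"
      unfolding minimal_param_def
      using x' by (auto simp: K_def dist_norm norm_minus_commute)
    show "R (cinv e x') z = R (cinv e x) z" using x'(1) by (simp add: K_def)
    show "norm (x' - x0) \<le> norm (x - x0)" using x'(2) \<open>x \<in> K\<close> .
  qed
qed

text \<open>If there were no such bound, minimal parameters would exist whose displacement of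
  \<open>z\<close> is of smaller order than their length. A limit \<kappa> of their directions
  annihilates \<open>z\<close>, so some element of the stabiliser has a coordinate near
  \<open>x0 - s *\<^sub>R \<kappa>\<close>. Multiplying by it on the right leaves the effect on
  \<open>z\<close> unchanged and shortens the parameter, against minimality.\<close>

lemma minimal_param_bound:
  assumes "\<rho> > 0"
  obtains B \<rho>1 where "B > 0" "\<rho>1 > 0"
    "\<And>x. minimal_param \<rho> z x \<Longrightarrow> norm (x - x0) \<le> \<rho>1 \<Longrightarrow> norm (x - x0) \<le> B * norm (R (cinv e x) z - z)"
proof -
  have "\<exists>n :: nat. \<forall>x. minimal_param \<rho> z x \<longrightarrow> norm (x - x0) \<le> 1 / Suc n \<longrightarrow>
      norm (x - x0) \<le> Suc n * norm (R (cinv e x) z - z)"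
  proof (rule ccontr)
    assume "\<not> ?thesis"
    then obtain x where x: "\<And>n. minimal_param \<rho> z (x n)" "\<And>n. norm (x n - x0) \<le> 1 / Suc n"
      "\<And>n. norm (x n - x0) > Suc n * norm (R (cinv e (x n)) z - z)"
      by (metis not_le)
    define s where "s n = norm (x n - x0)" for n
    have s: "s n > 0" "s n \<le> 1 / Suc n" "Suc n * norm (R (cinv e (x n)) z - z) < s n" for n
    proof -
      have "0 \<le> Suc n * norm (R (cinv e (x n)) z - z)" by (intro mult_nonneg_nonneg) simp_all
      then show "s n > 0" using x(3)[of n] unfolding s_def by (rule le_less_trans)
      show "s n \<le> 1 / Suc n" "Suc n * norm (R (cinv e (x n)) z - z) < s n"
        using x(2,3)[of n] by (simp_all add: s_def)
    qed
    have xM: "x n \<in> cmodel e" for n using x(1) by (simp add: minimal_param_def)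
    have s0: "s \<longlonglongrightarrow> 0"
      using LIMSEQ_inverse_real_of_nat s by (intro tendsto_sandwich[of "\<lambda>_. 0" s _ "\<lambda>n. 1 / Suc n"])
        (auto simp: inverse_eq_divide less_imp_le)
    define u where "u n = (x n - x0) /\<^sub>R s n" for n
    have xu: "x n - x0 = s n *\<^sub>R u n" for n using s(1)[of n] by (simp add: u_def)
    have uM: "u n \<in> cmodel e" for n
      unfolding u_def using xM x0_in(2) subspace_e by (intro subspace_scale subspace_diff)
    have "norm (u n) = 1" for n using s(1)[of n] by (simp add: u_def s_def)
    then have "u n \<in> sphere 0 1" for n by simp
    then obtain \<kappa> r where \<kappa>: "strict_mono r" "(u \<circ> r) \<longlonglongrightarrow> \<kappa>"
      using compact_sphere[of "0 :: 'l" 1] unfolding compact_def by metis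
    have \<kappa>M: "\<kappa> \<in> cmodel e"
      by (rule Lim_in_closed_set[OF closed_subspace[OF subspace_e] _ _ \<kappa>(2)]) (use uM in auto)
    have sr: "(\<lambda>n. s (r n)) \<longlonglongrightarrow> 0" using LIMSEQ_subseq_LIMSEQ[OF s0 \<kappa>(1)] by (simp add: o_def)
    have "(\<lambda>n. dR (u (r n)) z) \<longlonglongrightarrow> dR \<kappa> z"
      using bounded_linear.tendsto[OF linear_dR[of z, unfolded linear_conv_bounded_linear] \<kappa>(2)] by (simp add: o_def)
    moreover have "(\<lambda>n. dR (u (r n)) z) \<longlonglongrightarrow> 0"
    proof (rule LIMSEQ_I)
      fix \<epsilon> :: real assume \<epsilon>: "\<epsilon> > 0"
      then have "\<epsilon> / 2 > 0" by simp
      then obtain d where d: "d > 0" "\<And>x. x \<in> cmodel e \<Longrightarrow> norm (x - x0) \<le> d \<Longrightarrow>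
          x \<in> cimg e \<and> norm (R (cinv e x) z - z - dR (x - x0) z) \<le> \<epsilon> / 2 * norm (x - x0)"
        using dR_estimate by metis
      obtain N1 where N1: "\<And>n. n \<ge> N1 \<Longrightarrow> \<bar>s (r n)\<bar> < d"
        using LIMSEQ_D[OF sr d(1)] by auto
      obtain N2 :: nat where N2: "1 / Suc N2 < \<epsilon> / 2" using \<open>\<epsilon> / 2 > 0\<close> nat_approx_posE by metis
      have "norm (dR (u (r n)) z - 0) < \<epsilon>" if n: "n \<ge> max N1 N2" for n
      proof -
        let ?n = "r n"
        have rn: "N2 \<le> ?n" using seq_suble[OF \<kappa>(1), of n] n by linarith
        have "norm (x ?n - x0) \<le> d" using N1[of n] n by (simp add: s_def)
        note * = d(2)[OF xM this]
        have "s ?n * norm (dR (u ?n) z) = norm (dR (x ?n - x0) z)"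
          using s(1)[of ?n] by (simp add: xu linear_cmul[OF linear_dR])
        also have "\<dots> \<le> norm (R (cinv e (x ?n)) z - z) + norm (R (cinv e (x ?n)) z - z - dR (x ?n - x0) z)"
          using norm_triangle_ineq4[of "R (cinv e (x ?n)) z - z" "R (cinv e (x ?n)) z - z - dR (x ?n - x0) z"] by simp
        also have "\<dots> < s ?n / Suc ?n + \<epsilon> / 2 * s ?n"
          using s(3)[of ?n] * by (intro add_less_le_mono) (auto simp: s_def field_simps)
        also have "\<dots> = s ?n * (1 / Suc ?n + \<epsilon> / 2)" by (simp add: algebra_simps)
        finally have "norm (dR (u ?n) z) < 1 / Suc ?n + \<epsilon> / 2" using s(1)[of ?n] by (simp add: mult_less_cancel_left_pos)
        moreover have "1 / Suc ?n \<le> 1 / Suc N2" using rn by (simp add: frac_le)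
        ultimately show ?thesis using N2 by simp
      qed
      then show "\<exists>N. \<forall>n\<ge>N. norm (dR (u (r n)) z - 0) < \<epsilon>" by blast
    qed
    ultimately have "dR \<kappa> z = 0" by (rule LIMSEQ_unique)
    then have "dR (- \<kappa>) z = 0" by (simp add: linear_neg[OF linear_dR])
    moreover have "- \<kappa> \<in> cmodel e" using \<kappa>M subspace_e by (rule subspace_neg[rotated])
    ultimately obtain \<delta> where \<delta>: "\<delta> > 0"
      "\<And>s. 0 < s \<Longrightarrow> s \<le> \<delta> \<Longrightarrow> \<exists>y\<in>cimg e. norm (y - x0 - s *\<^sub>R - \<kappa>) \<le> 1/8 * s \<and> R (cinv e y) z = z"
      using stabilizer_direction[of "- \<kappa>" z "1/8"] by auto
    obtain \<delta>2 where \<delta>2: "\<delta>2 > 0" "\<And>x y. x \<in> cmodel e \<Longrightarrow> y \<in> cmodel e \<Longrightarrow> norm (x - x0) \<le> \<delta>2 \<Longrightarrow> norm (y - x0) \<le> \<delta>2 \<Longrightarrow>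
      x \<in> cimg e \<and> y \<in> cimg e \<and> cinv e x \<otimes>\<^bsub>C\<^esub> cinv e y \<in> cdom e \<and>
      norm (cmap e (cinv e x \<otimes>\<^bsub>C\<^esub> cinv e y) - x - y + x0) \<le> 1/8 * norm (y - x0)"
      using chart_mult_estimate[of "1/8"] by auto
    have "norm \<kappa> = 1"
    proof -
      have "(\<lambda>n. norm ((u \<circ> r) n)) \<longlonglongrightarrow> norm \<kappa>" using \<kappa>(2) by (rule tendsto_norm)
      moreover have "(\<lambda>n. norm ((u \<circ> r) n)) = (\<lambda>n. 1)" using \<open>\<And>n. norm (u n) = 1\<close> by auto
      ultimately show ?thesis using LIMSEQ_unique tendsto_const by metis
    qed
    have ev1: "\<forall>\<^sub>F n in sequentially. s (r n) < min \<delta> (\<delta>2 / 2)"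
      using order_tendstoD(2)[OF sr, of "min \<delta> (\<delta>2 / 2)"] \<delta>(1) \<delta>2(1) by simp
    have ev2: "\<forall>\<^sub>F n in sequentially. dist ((u \<circ> r) n) \<kappa> < 1/8"
      using tendstoD[OF \<kappa>(2), of "1/8"] by simp
    from eventually_happens'[OF _ eventually_conj[OF ev1 ev2]]
    obtain n where n: "s (r n) < min \<delta> (\<delta>2 / 2)" "dist (u (r n)) \<kappa> < 1/8" by auto
    let ?x = "x (r n)" and ?s = "s (r n)"
    have sp: "?s > 0" using s(1) .
    obtain y where y: "y \<in> cimg e" "norm (y - x0 + ?s *\<^sub>R \<kappa>) \<le> 1/8 * ?s" "R (cinv e y) z = z"
      using \<delta>(2)[OF sp] n(1) by auto
    have yM: "y \<in> cmodel e" using y(1) cimg_subset by blast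
    have yn: "norm (y - x0) \<le> 9/8 * ?s"
    proof -
      have "norm (y - x0) \<le> norm (y - x0 + ?s *\<^sub>R \<kappa>) + norm (?s *\<^sub>R \<kappa>)"
        using norm_triangle_ineq4[of "y - x0 + ?s *\<^sub>R \<kappa>" "?s *\<^sub>R \<kappa>"] by simp
      then show ?thesis using y(2) sp \<open>norm \<kappa> = 1\<close> by simp
    qed
    have xn: "norm (?x - x0) \<le> \<delta>2" "norm (y - x0) \<le> \<delta>2"
      using n(1) yn sp by (auto simp: s_def[symmetric])
    note E = \<delta>2(2)[OF xM yM xn]
    define x' where "x' = cmap e (cinv e ?x \<otimes>\<^bsub>C\<^esub> cinv e y)"
    have x'M: "x' \<in> cmodel e" unfolding x'_def
      using E by (intro subsetD[OF cimg_subset] cmap_in_cimg) simp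
    have "norm (x' - x0) = norm ((x' - ?x - y + x0) + ((?x - x0 - ?s *\<^sub>R \<kappa>) + (y - x0 + ?s *\<^sub>R \<kappa>)))"
      by (simp add: algebra_simps)
    also have "\<dots> \<le> 1/8 * norm (y - x0) + (norm (?x - x0 - ?s *\<^sub>R \<kappa>) + norm (y - x0 + ?s *\<^sub>R \<kappa>))"
      using E by (intro norm_triangle_mono norm_triangle_ineq) (auto simp: x'_def)
    also have "norm (?x - x0 - ?s *\<^sub>R \<kappa>) = ?s * norm (u (r n) - \<kappa>)"
      using sp by (simp add: xu flip: scaleR_diff_right)
    finally have "norm (x' - x0) \<le> 1/8 * norm (y - x0) +
        (?s * norm (u (r n) - \<kappa>) + norm (y - x0 + ?s *\<^sub>R \<kappa>))" .
    moreover have "?s * norm (u (r n) - \<kappa>) \<le> ?s * (1/8)"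
      using n(2) sp by (intro mult_left_mono) (auto simp: dist_norm)
    \<comment> \<open>The three tolerances 1/8 add up to 25/64 of the old length.\<close>
    ultimately have "norm (x' - x0) \<le> 1/8 * (9/8 * ?s) + (?s * (1/8) + 1/8 * ?s)"
      using yn y(2) by linarith
    then have "norm (x' - x0) < ?s" using sp by linarith
    then have lt: "norm (x' - x0) < norm (?x - x0)" by (simp add: s_def)
    have "R (cinv e x') z = R (cinv e ?x) z"
      using E y(3) R_mult[OF cinv_carrier[OF e_in] cinv_carrier[OF e_in], of ?x y]
      by (simp add: x'_def cinv_cmap[OF chart_e])
    then have "norm (?x - x0) \<le> norm (x' - x0)"
      using x(1)[of "r n"] x'M lt unfolding minimal_param_def by force
    then show False using lt by simp
  qed
  then obtain n :: nat where n: "\<forall>x. minimal_param \<rho> z x \<longrightarrow> norm (x - x0) \<le> 1 / Suc n \<longrightarrow>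
      norm (x - x0) \<le> Suc n * norm (R (cinv e x) z - z)" ..
  show ?thesis by (rule that[of "Suc n" "1 / Suc n"]) (use n in auto)
qed

text \<open>The parameters lifting a curve in the orbit are bounded by a constant times the
  displacement, so their difference quotients have a convergent subsequence. Its limit is the
  required element of the Lie algebra.\<close>

lemma tangent_space_orbit:
  assumes u: "u \<in> tangent_space (orbit C R z) z"
  shows "\<exists>\<xi>\<in>cmodel e. u = dR \<xi> z"
proof -
  obtain \<gamma> where g: "\<And>t. \<gamma> t \<in> orbit C R z" "\<gamma> 0 = z" "(\<gamma> has_vector_derivative u) (at 0)"
    using tangent_spaceE[OF u] by blast
  obtain \<rho> where \<rho>: "\<rho> > 0" "\<And>x. x \<in> cmodel e \<Longrightarrow> norm (x - x0) \<le> \<rho> \<Longrightarrow> x \<in> cimg e"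
    using near_in_cimg by blast
  obtain B \<rho>1 where B: "B > 0" "\<rho>1 > 0"
    "\<And>x. minimal_param \<rho> z x \<Longrightarrow> norm (x - x0) \<le> \<rho>1 \<Longrightarrow> norm (x - x0) \<le> B * norm (R (cinv e x) z - z)"
    using minimal_param_bound[OF \<rho>(1), of z] by metis
  have "min \<rho> \<rho>1 > 0" using \<rho>(1) B(2) by simp
  then obtain \<delta> where \<delta>: "\<delta> > 0" "\<And>g. g \<in> carrier C \<Longrightarrow> norm (R g z - z) < \<delta> \<Longrightarrow>
      \<exists>x\<in>cimg e. norm (x - x0) < min \<rho> \<rho>1 \<and> R (cinv e x) z = R g z"
    using near_orbit[of "min \<rho> \<rho>1" z] by metis
  have param: "\<exists>x\<in>cmodel e. norm (x - x0) \<le> B * norm (w - z) \<and> x \<in> cimg e \<and> R (cinv e x) z = w"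
    if w: "w \<in> orbit C R z" "norm (w - z) < \<delta>" for w
  proof -
    obtain g where "g \<in> carrier C" "w = R g z" using w(1) by (auto simp: orbit_def)
    then obtain x where x: "x \<in> cimg e" "norm (x - x0) < min \<rho> \<rho>1" "R (cinv e x) z = w"
      using \<delta>(2) w(2) by blast
    have xM: "x \<in> cmodel e" "norm (x - x0) \<le> \<rho>" using x cimg_subset by auto
    obtain x' where x': "minimal_param \<rho> z x'" "R (cinv e x') z = R (cinv e x) z" "norm (x' - x0) \<le> norm (x - x0)"
      by (rule minimal_param_exists[OF \<rho>(2) xM])
    have "norm (x' - x0) \<le> B * norm (R (cinv e x') z - z)"
      using x'(3) x(2) by (intro B(3)[OF x'(1)]) simp
    then show ?thesis
      using x' x(3) \<rho>(2) unfolding minimal_param_def by (intro bexI[of _ x']) auto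
  qed
  have "(\<gamma> \<longlongrightarrow> z) (at 0)"
    using has_vector_derivative_continuous[OF g(3)] g(2) by (simp add: isCont_def)
  then have "\<forall>\<^sub>F t in at 0. dist (\<gamma> t) z < \<delta>" using \<delta>(1) by (rule tendstoD)
  then obtain d where d: "d > 0" "\<And>t. t \<noteq> 0 \<Longrightarrow> \<bar>t\<bar> < d \<Longrightarrow> norm (\<gamma> t - z) < \<delta>"
    unfolding eventually_at by (auto simp: dist_real_def dist_norm)
  define t where "t n = d / 2 / Suc n" for n
  have t: "t n > 0" "\<bar>t n\<bar> < d" for n
  proof -
    show "t n > 0" using d(1) by (simp add: t_def)
    have "t n \<le> d / 2" using d(1) by (simp add: t_def field_simps)
    then show "\<bar>t n\<bar> < d" using \<open>t n > 0\<close> d(1) by linarith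
  qed
  have t0: "t \<longlonglongrightarrow> 0"
    unfolding t_def[abs_def] using LIMSEQ_Suc[OF lim_const_over_n[of "d / 2"]] .
  have "\<forall>n. \<exists>x\<in>cmodel e. norm (x - x0) \<le> B * norm (\<gamma> (t n) - z) \<and> x \<in> cimg e \<and> R (cinv e x) z = \<gamma> (t n)"
    using param[OF g(1) d(2)] t by (metis less_irrefl)
  then obtain x where x: "\<And>n. x n \<in> cmodel e" "\<And>n. norm (x n - x0) \<le> B * norm (\<gamma> (t n) - z)"
    "\<And>n. x n \<in> cimg e" "\<And>n. R (cinv e (x n)) z = \<gamma> (t n)" by metis
  have filt: "filterlim t (at 0) sequentially"
    using t0 t(1) by (auto simp: filterlim_at intro!: always_eventually) (metis less_irrefl)
  have q: "(\<lambda>n. (\<gamma> (t n) - z) /\<^sub>R t n) \<longlonglongrightarrow> u"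
    using filterlim_compose[OF has_vector_derivative_quotient[OF g(3)] filt] by (simp add: g(2))
  define v where "v n = (x n - x0) /\<^sub>R t n" for n
  have vM: "v n \<in> cmodel e" for n
    unfolding v_def using x(1) x0_in(2) subspace_e by (intro subspace_scale subspace_diff)
  have xv: "x n - x0 = t n *\<^sub>R v n" for n using t(1)[of n] by (simp add: v_def)
  have vb: "norm (v n) \<le> B * norm ((\<gamma> (t n) - z) /\<^sub>R t n)" for n
    using x(2)[of n] t(1)[of n] by (simp add: v_def divide_inverse mult.left_commute mult_left_mono)
  obtain Q where Q: "\<And>n. norm ((\<gamma> (t n) - z) /\<^sub>R t n) \<le> Q"
    using convergent_imp_Bseq[OF convergentI[OF q]] unfolding Bseq_def by blast
  have vB: "norm (v n) \<le> B * Q" for n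
    using vb[of n] mult_left_mono[OF Q[of n], of B] B(1) by linarith
  then have "v n \<in> cball 0 (B * Q)" for n by simp
  then obtain \<xi> r where \<xi>: "strict_mono r" "(v \<circ> r) \<longlonglongrightarrow> \<xi>"
    using compact_cball[of "0 :: 'l" "B * Q"] unfolding compact_def by metis
  have \<xi>M: "\<xi> \<in> cmodel e"
    by (rule Lim_in_closed_set[OF closed_subspace[OF subspace_e] _ _ \<xi>(2)]) (use vM in auto)
  have 1: "(\<lambda>n. dR (v (r n)) z) \<longlonglongrightarrow> dR \<xi> z"
    using bounded_linear.tendsto[OF linear_dR[of z, unfolded linear_conv_bounded_linear] \<xi>(2)] by (simp add: o_def)
  have 2: "(\<lambda>n. (\<gamma> (t (r n)) - z) /\<^sub>R t (r n)) \<longlonglongrightarrow> u"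
    using LIMSEQ_subseq_LIMSEQ[OF q \<xi>(1)] by (simp add: o_def)
  have BQ: "B * Q \<ge> 0" using vB[of 0] norm_ge_zero order_trans by blast
  have 3: "(\<lambda>n. (\<gamma> (t (r n)) - z) /\<^sub>R t (r n) - dR (v (r n)) z) \<longlonglongrightarrow> 0"
  proof (rule LIMSEQ_I)
    fix \<epsilon> :: real assume \<epsilon>: "\<epsilon> > 0"
    define \<epsilon>' where "\<epsilon>' = \<epsilon> / (B * Q + 1)"
    have \<epsilon>': "\<epsilon>' > 0" using \<epsilon> BQ by (simp add: \<epsilon>'_def)
    then obtain d where d: "d > 0" "\<And>x. x \<in> cmodel e \<Longrightarrow> norm (x - x0) \<le> d \<Longrightarrow>
        x \<in> cimg e \<and> norm (R (cinv e x) z - z - dR (x - x0) z) \<le> \<epsilon>' * norm (x - x0)"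
      using dR_estimate by metis
    have "(\<lambda>n. t (r n) * (B * Q)) \<longlonglongrightarrow> 0 * (B * Q)"
      using LIMSEQ_subseq_LIMSEQ[OF t0 \<xi>(1)] by (intro tendsto_intros) (simp add: o_def)
    then have "\<forall>\<^sub>F n in sequentially. t (r n) * (B * Q) < d" using d(1) by (intro order_tendstoD(2)) auto
    then obtain N where N: "\<And>n. n \<ge> N \<Longrightarrow> t (r n) * (B * Q) < d" unfolding eventually_sequentially by blast
    have "norm ((\<gamma> (t (r n)) - z) /\<^sub>R t (r n) - dR (v (r n)) z - 0) < \<epsilon>" if "n \<ge> N" for n
    proof -
      let ?n = "r n"
      have tp: "t ?n > 0" using t(1) .
      have nx: "norm (x ?n - x0) \<le> t ?n * (B * Q)"
        using tp vB[of ?n] by (simp add: xv mult_left_mono)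
      then have "norm (\<gamma> (t ?n) - z - dR (x ?n - x0) z) \<le> \<epsilon>' * norm (x ?n - x0)"
        using d(2)[OF x(1)] N[OF that] x(4) by force
      also have "\<dots> \<le> \<epsilon>' * (t ?n * (B * Q))" using nx \<epsilon>' by simp
      finally have "norm (\<gamma> (t ?n) - z - dR (x ?n - x0) z) \<le> t ?n * (\<epsilon>' * (B * Q))" by (simp add: algebra_simps)
      moreover have "\<gamma> (t ?n) - z - dR (x ?n - x0) z = t ?n *\<^sub>R ((\<gamma> (t ?n) - z) /\<^sub>R t ?n - dR (v ?n) z)"
        using tp by (simp add: xv linear_cmul[OF linear_dR] scaleR_diff_right)
      ultimately have "norm ((\<gamma> (t ?n) - z) /\<^sub>R t ?n - dR (v ?n) z) \<le> \<epsilon>' * (B * Q)"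
        using tp by (simp add: mult_le_cancel_left_pos)
      also have "\<dots> < \<epsilon>" using \<epsilon> BQ by (simp add: \<epsilon>'_def pos_divide_less_eq)
      finally show ?thesis by simp
    qed
    then show "\<exists>N. \<forall>n\<ge>N. norm ((\<gamma> (t (r n)) - z) /\<^sub>R t (r n) - dR (v (r n)) z - 0) < \<epsilon>" by blast
  qed
  have "(\<lambda>n. (\<gamma> (t (r n)) - z) /\<^sub>R t (r n)) \<longlonglongrightarrow> 0 + dR \<xi> z"
    using tendsto_add[OF 3 1] by simp
  then have "u = dR \<xi> z" using LIMSEQ_unique[OF 2] by simp
  then show ?thesis using \<xi>M by blast
qed

text \<open>Conjugation is differentiable at the identity as a composite of two multiplications,
  read in charts around \<open>g\<close>, its inverse and the identity. The second claim
  differentiates the representation of a conjugated curve.\<close>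

lemma Ad_dR:
  assumes g: "g \<in> carrier C" and \<xi>: "\<xi> \<in> cmodel e"
  shows "Ad C e g \<xi> \<in> cmodel e" "dR (Ad C e g \<xi>) v = R g (dR \<xi> (R (inv\<^bsub>C\<^esub> g) v))"
proof -
  interpret group C by (rule group_C)
  let ?f = "\<lambda>x. cmap e (g \<otimes>\<^bsub>C\<^esub> cinv e x \<otimes>\<^bsub>C\<^esub> inv\<^bsub>C\<^esub> g)"
  have gi: "inv\<^bsub>C\<^esub> g \<in> carrier C" using g by simp
  obtain c where c: "c \<in> AC" "g \<in> cdom c" by (rule chart_at[OF g])
  obtain c' where c': "c' \<in> AC" "inv\<^bsub>C\<^esub> g \<in> cdom c'" by (rule chart_at[OF gi])
  define a where "a = cmap c g"
  define b where "b = cmap c' (inv\<^bsub>C\<^esub> g)"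
  have a: "a \<in> cimg c" "cinv c a = g" using cmap_in_cimg[OF c(2)] cinv_cmap[OF chart_in[OF c(1)] c(2)] by (simp_all add: a_def)
  have b: "b \<in> cimg c'" "cinv c' b = inv\<^bsub>C\<^esub> g" using cmap_in_cimg[OF c'(2)] cinv_cmap[OF chart_in[OF c'(1)] c'(2)] by (simp_all add: b_def)
  have cc: "cinv e x \<in> carrier C" if "x \<in> cimg e" for x using cinv_carrier[OF e_in that] .
  have cL: "continuous_map (top_of_set (cimg e)) T (\<lambda>x. g \<otimes>\<^bsub>C\<^esub> cinv e x)"
  proof -
    have "continuous_map (top_of_set (cimg e)) (prod_topology T T) (\<lambda>x. (g, cinv e x))"
      using g topspace_T continuous_cinv[OF e_in] by (intro continuous_map_pairedI) auto
    from continuous_map_compose[OF this continuous_mult] show ?thesis by (simp add: o_def)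
  qed
  have cLR: "continuous_map (top_of_set (cimg e)) T (\<lambda>x. g \<otimes>\<^bsub>C\<^esub> cinv e x \<otimes>\<^bsub>C\<^esub> inv\<^bsub>C\<^esub> g)"
  proof -
    have "continuous_map (top_of_set (cimg e)) (prod_topology T T) (\<lambda>x. (g \<otimes>\<^bsub>C\<^esub> cinv e x, inv\<^bsub>C\<^esub> g))"
      using gi topspace_T cL by (intro continuous_map_pairedI) auto
    from continuous_map_compose[OF this continuous_mult] show ?thesis by (simp add: o_def)
  qed
  define s where "s = {x \<in> cimg e. g \<otimes>\<^bsub>C\<^esub> cinv e x \<in> cdom c} \<inter>
      {x \<in> cimg e. g \<otimes>\<^bsub>C\<^esub> cinv e x \<otimes>\<^bsub>C\<^esub> inv\<^bsub>C\<^esub> g \<in> cdom e}"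
  have "openin (top_of_set (cimg e)) s"
    unfolding s_def
    using openin_continuous_map_preimage[OF cL, of "cdom c"] openin_continuous_map_preimage[OF cLR, of "cdom e"]
      chart_in[OF c(1)] chart_e by (intro openin_Int) (auto simp: is_chart_def)
  then obtain V where V: "open V" "s = cimg e \<inter> V" unfolding openin_open by blast
  have x0s: "x0 \<in> s" using x0_in(1) one_in c g by (simp add: s_def cinv_x0)
  define h where "h x = cmap c (g \<otimes>\<^bsub>C\<^esub> cinv e x)" for x
  have hx0: "h x0 = a" using g by (simp add: h_def cinv_x0 a_def)
  obtain D1 where D1: "((\<lambda>p. cmap c (cinv c (fst p) \<otimes>\<^bsub>C\<^esub> cinv e (snd p))) has_derivative D1)
     (at (a, x0) within {p. fst p \<in> cimg c \<and> snd p \<in> cimg e \<and> cinv c (fst p) \<otimes>\<^bsub>C\<^esub> cinv e (snd p) \<in> cdom c})"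
    by (rule smooth_on_has_derivative[OF smooth_mult[OF c(1) e_in c(1)], of "(a, x0)"])
       (use a x0_in(1) cinv_x0 g c in auto)
  have aD: "((\<lambda>x. (a, x)) has_derivative (\<lambda>v. (0, v))) (at x0 within s)"
    by (auto intro!: derivative_eq_intros)
  have as: "(\<lambda>x. (a, x)) ` s \<subseteq> {p. fst p \<in> cimg c \<and> snd p \<in> cimg e \<and> cinv c (fst p) \<otimes>\<^bsub>C\<^esub> cinv e (snd p) \<in> cdom c}"
    using a by (auto simp: s_def)
  have "((\<lambda>x. cmap c (cinv c (fst (a, x)) \<otimes>\<^bsub>C\<^esub> cinv e (snd (a, x)))) has_derivative (\<lambda>v. D1 (0, v))) (at x0 within s)"
    by (rule has_derivative_in_compose[OF aD]) (rule has_derivative_subset[OF D1 as])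
  then have hD: "(h has_derivative (\<lambda>v. D1 (0, v))) (at x0 within s)"
    by (simp add: h_def[abs_def] a(2))
  have h_in: "h x \<in> cimg c" "cinv c (h x) = g \<otimes>\<^bsub>C\<^esub> cinv e x" if "x \<in> s" for x
    using that cmap_in_cimg cinv_cmap[OF chart_in[OF c(1)]] by (auto simp: h_def s_def)
  obtain D2 where D2: "((\<lambda>p. cmap e (cinv c (fst p) \<otimes>\<^bsub>C\<^esub> cinv c' (snd p))) has_derivative D2)
     (at (a, b) within {p. fst p \<in> cimg c \<and> snd p \<in> cimg c' \<and> cinv c (fst p) \<otimes>\<^bsub>C\<^esub> cinv c' (snd p) \<in> cdom e})"
    by (rule smooth_on_has_derivative[OF smooth_mult[OF c(1) c'(1) e_in], of "(a, b)"])
       (use a b one_in g in auto)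
  have hb: "((\<lambda>x. (h x, b)) has_derivative (\<lambda>v. (D1 (0, v), 0))) (at x0 within s)"
    using hD by (auto intro!: derivative_eq_intros)
  have hbs: "(\<lambda>x. (h x, b)) ` s \<subseteq> {p. fst p \<in> cimg c \<and> snd p \<in> cimg c' \<and> cinv c (fst p) \<otimes>\<^bsub>C\<^esub> cinv c' (snd p) \<in> cdom e}"
    using b h_in by (auto simp: s_def)
  have "((\<lambda>x. cmap e (cinv c (fst (h x, b)) \<otimes>\<^bsub>C\<^esub> cinv c' (snd (h x, b)))) has_derivative
      (\<lambda>v. D2 (D1 (0, v), 0))) (at x0 within s)"
    by (rule has_derivative_in_compose[OF hb]) (use has_derivative_subset[OF D2 hbs] hx0 in simp)
  then have "(?f has_derivative (\<lambda>v. D2 (D1 (0, v), 0))) (at x0 within s)"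
    by (rule has_derivative_transform[OF x0s, rotated]) (simp add: h_in b)
  \<comment> \<open>\<open>s\<close> is relatively open in \<open>cimg e\<close>, so the derivative
    within \<open>s\<close> is also the one that occurs in \<open>Ad\<close>.\<close>
  moreover have at_eq: "at x0 within s = at x0 within cimg e"
    using V x0s by (intro at_within_nhd[of _ V]) auto
  ultimately have "?f differentiable (at x0 within cimg e)" unfolding differentiable_def by auto
  then have fD: "(?f has_derivative Ad C e g) (at x0 within cimg e)"
    unfolding frechet_derivative_works Ad_def x0_def .
  have fx0: "?f x0 = x0" using g unfolding cinv_x0 by (simp add: x0_def)
  have "\<xi> \<in> tangent_space s x0"
  proof -
    have "\<xi> \<in> tangent_space (cimg e) x0" by (rule tangent_space_cimg[OF \<xi>])
    then obtain \<gamma> where g: "\<And>t. \<gamma> t \<in> cimg e" "\<gamma> 0 = x0" "(\<gamma> has_vector_derivative \<xi>) (at 0)"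
      using tangent_spaceE by metis
    have "(\<gamma> \<longlongrightarrow> x0) (at 0)" using has_vector_derivative_continuous[OF g(3)] g(2) by (simp add: isCont_def)
    then have "\<forall>\<^sub>F t in at 0. \<gamma> t \<in> V" using V x0s by (intro topological_tendstoD) auto
    then obtain d where d: "d > 0" "\<And>t. t \<noteq> 0 \<Longrightarrow> \<bar>t\<bar> < d \<Longrightarrow> \<gamma> t \<in> V"
      unfolding eventually_at by (auto simp: dist_real_def)
    show ?thesis
    proof (rule tangent_spaceI[OF d(1) _ g(2,3)])
      fix t :: real assume "\<bar>t\<bar> < d"
      then show "\<gamma> t \<in> s" using d(2)[of t] g(1,2) V(2) x0s by (cases "t = 0") auto
    qed
  qed
  then obtain \<gamma> where \<gamma>: "\<And>t. \<gamma> t \<in> s" "\<gamma> 0 = x0" "(\<gamma> has_vector_derivative \<xi>) (at 0)"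
    using tangent_spaceE by metis
  have fs: "?f x \<in> cimg e" "cinv e (?f x) = g \<otimes>\<^bsub>C\<^esub> cinv e x \<otimes>\<^bsub>C\<^esub> inv\<^bsub>C\<^esub> g" if "x \<in> s" for x
    using that cmap_in_cimg cinv_cmap[OF chart_e] by (auto simp: s_def)
  have fD': "(?f has_derivative Ad C e g) (at (\<gamma> 0) within s)" using fD at_eq \<gamma>(2) by simp
  have f\<gamma>: "((\<lambda>t. ?f (\<gamma> t)) has_vector_derivative Ad C e g \<xi>) (at 0)"
    by (rule has_vector_derivative_compose[OF \<gamma>(3) fD' \<gamma>(1)])
  show M: "Ad C e g \<xi> \<in> cmodel e"
    by (rule limit_in_subspace_derivative[OF f\<gamma> subspace_e _ zero_less_one])
       (use fs(1) \<gamma>(1) cimg_subset in blast)+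
  have "((\<lambda>x. R (cinv e x) v) has_derivative (\<lambda>\<xi>. dR \<xi> v)) (at (?f (\<gamma> 0)) within cimg e)"
    using dR_has_derivative fx0 \<gamma>(2) by simp
  from has_vector_derivative_compose[OF f\<gamma> this fs(1)[OF \<gamma>(1)]]
  have 1: "((\<lambda>t. R (cinv e (?f (\<gamma> t))) v) has_vector_derivative dR (Ad C e g \<xi>) v) (at 0)" .
  have s_sub: "s \<subseteq> cimg e" using V(2) by blast
  have "((\<lambda>x. R (cinv e x) (R (inv\<^bsub>C\<^esub> g) v)) has_derivative (\<lambda>\<xi>. dR \<xi> (R (inv\<^bsub>C\<^esub> g) v))) (at (\<gamma> 0) within s)"
    using dR_has_derivative \<gamma>(2) at_eq by simp
  from has_vector_derivative_compose[OF \<gamma>(3) this \<gamma>(1)]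
  have "((\<lambda>t. R (cinv e (\<gamma> t)) (R (inv\<^bsub>C\<^esub> g) v)) has_vector_derivative dR \<xi> (R (inv\<^bsub>C\<^esub> g) v)) (at 0)" .
  from bounded_linear.has_vector_derivative[OF R_linear[OF g, unfolded linear_conv_bounded_linear] this]
  have 2: "((\<lambda>t. R g (R (cinv e (\<gamma> t)) (R (inv\<^bsub>C\<^esub> g) v))) has_vector_derivative R g (dR \<xi> (R (inv\<^bsub>C\<^esub> g) v))) (at 0)" .
  have "(\<lambda>t. R (cinv e (?f (\<gamma> t))) v) = (\<lambda>t. R g (R (cinv e (\<gamma> t)) (R (inv\<^bsub>C\<^esub> g) v)))"
  proof
    fix t
    have "cinv e (\<gamma> t) \<in> carrier C" using \<gamma>(1) s_sub cc by blast
    then show "R (cinv e (?f (\<gamma> t))) v = R g (R (cinv e (\<gamma> t)) (R (inv\<^bsub>C\<^esub> g) v))"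
      using g by (simp add: fs(2)[OF \<gamma>(1)] R_mult)
  qed
  with 1 2 show "dR (Ad C e g \<xi>) v = R g (dR \<xi> (R (inv\<^bsub>C\<^esub> g) v))"
    using vector_derivative_unique_at by metis
qed

end

section \<open>The hyperkaehler moment map\<close>

lemma oadj_linear: "linear oadj"
  by (rule linearI; rule oadj_unique)
     (simp_all add: app.add_left app.scaleR_left app_oadj inner_add_left inner_add_right)

definition act :: "'v::euclidean_space opr \<Rightarrow> 'v \<times> 'v \<Rightarrow> 'v \<times> 'v" where
  "act A z = (app A (fst z), app A (snd z))"

lemma bounded_bilinear_act: "bounded_bilinear act"
  unfolding bilinear_conv_bounded_bilinear[symmetric] bilinear_def
  by (intro conjI allI linearI)
     (simp_all add: act_def app.add_left app.add_right app.scaleR_left app.scaleR_right)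

interpretation act: bounded_bilinear act
  by (rule bounded_bilinear_act)

lemma act_omul [simp]: "act (omul A B) z = act A (act B z)"
  by (simp add: act_def)

lemma act_oid [simp]: "act oid z = z"
  by (simp add: act_def)

definition bra :: "'v::euclidean_space opr \<Rightarrow> 'v opr \<Rightarrow> 'v opr" where
  "bra A B = omul A B - omul B A"

lemma act_bra: "act (bra A B) z = act A (act B z) - act B (act A z)"
  by (simp add: bra_def act.diff_left)

lemma bra_minus: "bra A B = - bra B A"
  by (simp add: bra_def)

text \<open>What remains of the group, its Lie algebra and \<theta> after passing to operators:
  \<open>K\<close> and \<open>\<g>\<close> are the images of the group and of the Lie algebra,
  \<open>g_conj\<close> is invariance under Ad, and \<open>v0_conj\<close> is the Ad-invariance of
  \<theta> expressed through \<open>v0\<close>.\<close>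

locale hk_rep =
  fixes K \<g> :: "'v::euclidean_space opr set" and I :: "'v \<Rightarrow> 'v" and v0 :: 'v
  assumes herm: "hermitian_structure I"
    and K_orth: "k \<in> K \<Longrightarrow> app k u \<bullet> app k v = u \<bullet> v"
    and K_I: "k \<in> K \<Longrightarrow> app k (I v) = I (app k v)"
    and K_mult: "k \<in> K \<Longrightarrow> h \<in> K \<Longrightarrow> omul k h \<in> K"
    and K_oid: "oid \<in> K"
    and K_oadj: "k \<in> K \<Longrightarrow> oadj k \<in> K"
    and K_compact: "compact K"
    and g_subspace: "subspace \<g>"
    and g_skew: "A \<in> \<g> \<Longrightarrow> app A u \<bullet> v = - (u \<bullet> app A v)"
    and g_I: "A \<in> \<g> \<Longrightarrow> app A (I v) = I (app A v)"
    and g_curve: "A \<in> \<g> \<Longrightarrow> \<exists>k. range k \<subseteq> K \<and> k 0 = oid \<and> (k has_vector_derivative A) (at (0::real))"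
    and g_conj: "k \<in> K \<Longrightarrow> A \<in> \<g> \<Longrightarrow> omul k (omul A (oadj k)) \<in> \<g>"
    and v0_conj: "k \<in> K \<Longrightarrow> A \<in> \<g> \<Longrightarrow> I (app (omul k (omul A (oadj k))) v0) \<bullet> v0 = I (app A v0) \<bullet> v0"
begin

abbreviation "cI \<equiv> cot_I I"
abbreviation "cK z \<equiv> cI (cot_J z)"

text \<open>\<open>v0\<close> is a point of \<open>\<mu>\<^sup>-\<^sup>1(0)\<close>, so that \<open>th\<close> is \<open>\<theta>\<close> carried over to operators.\<close>

definition th :: "'v opr \<Rightarrow> real" where "th A = - (1/2) * (I (app A v0) \<bullet> v0)"

text \<open>All three equations are written with the quadratic expression
  \<open>1/2 * (L (act A z) \<bullet> z)\<close> for \<open>L\<close> equal to I, J or K, so that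
  one argument can serve all three.\<close>

definition Z :: "('v \<times> 'v) set" where
  "Z = {z. \<forall>A\<in>\<g>. 1/2 * (cI (act A z) \<bullet> z) + th A = 0 \<and> 1/2 * (cot_J (act A z) \<bullet> z) = 0 \<and>
     1/2 * (cK (act A z) \<bullet> z) = 0}"

definition M :: "'v set" where "M = {v. \<forall>A\<in>\<g>. 1/2 * (I (app A v) \<bullet> v) + th A = 0}"

lemma I_linear: "linear I" and I_I: "I (I v) = - v" and I_orth: "I u \<bullet> I v = u \<bullet> v"
  using herm by (auto simp: hermitian_structure_def)

lemma I_skew: "I u \<bullet> v = - (u \<bullet> I v)"
  using I_orth[of u "I v"] by (simp add: I_I)

lemma I_add: "I (u + v) = I u + I v" and I_scale: "I (a *\<^sub>R u) = a *\<^sub>R I u" and I_minus: "I (- u) = - I u"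
  and I_diff: "I (u - v) = I u - I v" and I_0: "I 0 = 0"
  using I_linear by (simp_all add: linear_add linear_cmul linear_neg linear_diff linear_0)

lemma bounded_linear_I: "bounded_linear I"
  using I_linear by (simp add: linear_conv_bounded_linear)

lemma cI_linear: "linear cI" and cJ_linear: "linear cot_J"
  by (rule linearI; simp add: cot_I_def cot_J_def I_add I_scale)+

lemma cK_linear: "linear (\<lambda>z. cK z)"
  using linear_compose[OF cJ_linear cI_linear] by (simp add: o_def)

lemma cI_cI: "cI (cI z) = - z" and cJ_cJ: "cot_J (cot_J z) = - z"
  and cJ_cI: "cot_J (cI z) = - cI (cot_J z)"
  by (simp_all add: cot_I_def cot_J_def I_I I_minus prod_eq_iff)

lemma cI_orth: "cI u \<bullet> cI w = u \<bullet> w" and cJ_orth: "cot_J u \<bullet> cot_J w = u \<bullet> w"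
  by (simp_all add: cot_I_def cot_J_def I_orth inner_prod_def)

lemma cI_skew: "cI u \<bullet> w = - (u \<bullet> cI w)" and cJ_skew: "cot_J u \<bullet> w = - (u \<bullet> cot_J w)"
  using cI_orth[of u "cI w"] cJ_orth[of u "cot_J w"] by (simp_all add: cI_cI cJ_cJ)

lemma cK_skew: "cK u \<bullet> w = - (u \<bullet> cK w)"
proof -
  have "cK u \<bullet> w = u \<bullet> cot_J (cI w)" by (simp add: cI_skew cJ_skew)
  then show ?thesis by (simp add: cJ_cI)
qed

lemma act_cI: "A \<in> \<g> \<Longrightarrow> act A (cI z) = cI (act A z)"
  and act_cJ: "act A (cot_J z) = cot_J (act A z)"
  by (simp_all add: act_def cot_I_def cot_J_def g_I app.minus_right)

lemma act_skew: "A \<in> \<g> \<Longrightarrow> act A u \<bullet> w = - (u \<bullet> act A w)"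
  by (simp add: act_def inner_prod_def g_skew)

lemma K_oadj_inverse: "k \<in> K \<Longrightarrow> omul (oadj k) k = oid" "k \<in> K \<Longrightarrow> omul k (oadj k) = oid"
proof -
  have *: "omul (oadj k) k = oid" if "k \<in> K" for k
    by (rule opr_eqI, rule vector_eq_ldot[THEN iffD1]) (simp add: app_oadj' K_orth[OF that])
  show "k \<in> K \<Longrightarrow> omul (oadj k) k = oid" by (rule *)
  show "k \<in> K \<Longrightarrow> omul k (oadj k) = oid" using *[OF K_oadj] by simp
qed

lemma act_K_orth: "k \<in> K \<Longrightarrow> act k u \<bullet> act k w = u \<bullet> w"
  by (simp add: act_def inner_prod_def K_orth)

lemma act_K_cI: "k \<in> K \<Longrightarrow> act k (cI z) = cI (act k z)"
  by (simp add: act_def cot_I_def K_I app.minus_right)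

lemma act_K_inverse: "k \<in> K \<Longrightarrow> act (oadj k) (act k z) = z" "k \<in> K \<Longrightarrow> act k (act (oadj k) z) = z"
  using K_oadj_inverse by (metis act_oid act_omul)+

lemma oadj_g: "A \<in> \<g> \<Longrightarrow> oadj A = - A"
  by (rule oadj_unique) (simp add: app.minus_left g_skew)

lemma th_linear: "linear th"
  by (rule linearI) (simp_all add: th_def app.add_left app.scaleR_left I_add I_scale inner_add_left algebra_simps)

lemma th_conj: "k \<in> K \<Longrightarrow> A \<in> \<g> \<Longrightarrow> th (omul k (omul A (oadj k))) = th A"
  unfolding th_def using v0_conj by simp

text \<open>The derivative of the conjugates of \<open>B\<close> along a curve in \<open>K\<close>
  with velocity \<open>A\<close> is the bracket. Closure of \<open>\<g>\<close> under brackets and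
  vanishing of \<open>th\<close> on them are both read off this curve.\<close>

lemma conj_curve:
  assumes "A \<in> \<g>" "B \<in> \<g>"
  obtains \<beta> where "\<forall>t. \<beta> t \<in> \<g> \<and> th (\<beta> t) = th B" "(\<beta> has_vector_derivative bra A B) (at (0::real))"
proof -
  obtain k where k: "range k \<subseteq> K" "k 0 = oid" "(k has_vector_derivative A) (at (0::real))"
    using g_curve[OF assms(1)] by blast
  define \<beta> where "\<beta> t = omul (k t) (omul B (oadj (k t)))" for t
  have "((\<lambda>t. oadj (k t)) has_vector_derivative oadj A) (at 0)"
    by (rule bounded_linear.has_vector_derivative[OF oadj_linear[unfolded linear_conv_bounded_linear] k(3)])
  from omul.has_vector_derivative[OF k(3) omul.has_vector_derivative[OF has_vector_derivative_const this, of B]]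
  have "(\<beta> has_vector_derivative omul (k 0) (omul B (oadj A) + omul 0 (oadj (k 0))) + omul A (omul B (oadj (k 0)))) (at 0)"
    by (simp add: \<beta>_def[abs_def])
  moreover have oid: "oadj oid = oid" by (rule oadj_unique) simp
  ultimately have "(\<beta> has_vector_derivative bra A B) (at 0)"
    by (simp add: k(2) oid omul.zero_left oadj_g[OF assms(1)] omul.minus_right bra_def)
  moreover have "\<beta> t \<in> \<g> \<and> th (\<beta> t) = th B" for t
    using g_conj[OF _ assms(2), of "k t"] th_conj[OF _ assms(2), of "k t"] k(1) by (auto simp: \<beta>_def)
  ultimately show ?thesis by (intro that[of \<beta>]) auto
qed

lemma bra_in_g: assumes "A \<in> \<g>" "B \<in> \<g>" shows "bra A B \<in> \<g>"
proof -
  obtain \<beta> where b: "\<forall>t. \<beta> t \<in> \<g> \<and> th (\<beta> t) = th B" "(\<beta> has_vector_derivative bra A B) (at (0::real))"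
    by (rule conj_curve[OF assms])
  show ?thesis by (rule limit_in_subspace_derivative[OF b(2) g_subspace _ zero_less_one]) (use b(1) in auto)
qed

lemma th_bra: assumes "A \<in> \<g>" "B \<in> \<g>" shows "th (bra A B) = 0"
proof -
  obtain \<beta> where b: "\<forall>t. \<beta> t \<in> \<g> \<and> th (\<beta> t) = th B" "(\<beta> has_vector_derivative bra A B) (at (0::real))"
    by (rule conj_curve[OF assms])
  from bounded_linear.has_vector_derivative[OF th_linear[unfolded linear_conv_bounded_linear] b(2)]
  have "((\<lambda>t. th B) has_vector_derivative th (bra A B)) (at 0)" using b(1) by simp
  from vector_derivative_unique_at[OF this has_vector_derivative_const] show ?thesis .
qed

lemma Z_invariant: assumes "z \<in> Z" "k \<in> K" shows "act k z \<in> Z"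
proof -
  have "1/2 * (cI (act A (act k z)) \<bullet> act k z) + th A = 0 \<and> 1/2 * (cot_J (act A (act k z)) \<bullet> act k z) = 0 \<and>
     1/2 * (cK (act A (act k z)) \<bullet> act k z) = 0" if A: "A \<in> \<g>" for A
  proof -
    define B where "B = omul (oadj k) (omul A k)"
    have B: "B \<in> \<g>" "th B = th A"
      using g_conj[OF K_oadj[OF assms(2)] A] th_conj[OF K_oadj[OF assms(2)] A] by (simp_all add: B_def)
    have "act A (act k z) = act k (act B z)" by (simp add: B_def act_K_inverse assms(2))
    moreover have "1/2 * (cI (act B z) \<bullet> z) + th B = 0 \<and> 1/2 * (cot_J (act B z) \<bullet> z) = 0 \<and>
        1/2 * (cK (act B z) \<bullet> z) = 0"
      using assms(1) B(1) unfolding Z_def by blast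
    ultimately show ?thesis
      using B(2) act_K_orth[OF assms(2)]
      by (simp flip: act_K_cI[OF assms(2)] act_cJ[of k])
  qed
  then show ?thesis by (simp add: Z_def)
qed

text \<open>If \<open>k v0\<close> maximises \<open>x \<bullet> I (k v0)\<close> over \<open>k\<close> in \<open>K\<close>, then the whole line \<open>s x + k v0\<close> lies in \<open>M\<close>.\<close>

lemma M_unbounded:
  assumes x: "\<forall>A\<in>\<g>. I (app A x) \<bullet> x = 0" and M: "bounded M"
  shows "x = 0"
proof (rule ccontr)
  assume "x \<noteq> 0"
  define f where "f k = x \<bullet> I (app k v0)" for k
  have "continuous_on K f"
    unfolding f_def by (intro continuous_intros bounded_linear.continuous_on[OF bounded_linear_I] app.continuous_on)
  then obtain k where k: "k \<in> K" "\<And>k'. k' \<in> K \<Longrightarrow> f k' \<le> f k"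
    using continuous_attains_sup[OF K_compact] K_oid by blast
  define v where "v = app k v0"
  \<comment> \<open>First variation at the maximum, along a curve in \<open>K\<close> with velocity
    \<open>A\<close>.\<close>
  have crit: "x \<bullet> I (app A v) = 0" if A: "A \<in> \<g>" for A
  proof -
    obtain \<kappa> where \<kappa>: "range \<kappa> \<subseteq> K" "\<kappa> 0 = oid" "(\<kappa> has_vector_derivative A) (at (0::real))"
      using g_curve[OF A] by blast
    have bl: "bounded_linear (\<lambda>B. x \<bullet> I (app B v))"
      by (intro bounded_linear_compose[OF bounded_linear_inner_right] bounded_linear_compose[OF bounded_linear_I]
          app.bounded_linear_left)
    have "((\<lambda>t. x \<bullet> I (app (\<kappa> t) v)) has_real_derivative x \<bullet> I (app A v)) (at 0)"
      using bounded_linear.has_vector_derivative[OF bl \<kappa>(3)]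
      by (simp add: has_real_derivative_iff_has_vector_derivative)
    moreover have "x \<bullet> I (app (\<kappa> t) v) \<le> x \<bullet> I (app (\<kappa> 0) v)" for t
      using k(2)[OF K_mult[OF _ k(1), of "\<kappa> t"]] \<kappa>(1,2) by (auto simp: f_def v_def)
    ultimately show ?thesis using DERIV_local_max[of _ _ 0 1] by force
  qed
  have v: "I (app A v) \<bullet> v = I (app A v0) \<bullet> v0" if A: "A \<in> \<g>" for A
  proof -
    have "I (app A v) \<bullet> v = app (oadj k) (I (app A v)) \<bullet> v0" by (simp add: v_def app_oadj)
    also have "\<dots> = I (app (omul (oadj k) (omul A (oadj (oadj k)))) v0) \<bullet> v0"
      by (simp add: v_def K_I[OF K_oadj[OF k(1)]])
    finally show ?thesis using v0_conj[OF K_oadj[OF k(1)] A] by simp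
  qed
  have "s *\<^sub>R x + v \<in> M" for s
  proof -
    \<comment> \<open>The term of degree 2 in \<open>s\<close> vanishes by hypothesis, and the two
      mixed terms are equal and vanish by \<open>crit\<close>.\<close>
    have "I (app A (s *\<^sub>R x + v)) \<bullet> (s *\<^sub>R x + v) = I (app A v0) \<bullet> v0" if A: "A \<in> \<g>" for A
    proof -
      have "I (app A x) \<bullet> v = x \<bullet> I (app A v)"
        by (simp add: I_skew g_skew[OF A] g_I[OF A])
      then show ?thesis
        using x A crit[OF A] v[OF A]
        by (simp add: app.add_right app.scaleR_right I_add I_scale inner_add_left inner_add_right inner_commute)
    qed
    then show ?thesis by (simp add: M_def th_def)
  qed
  moreover obtain B where "\<And>w. w \<in> M \<Longrightarrow> norm w \<le> B" using M by (auto simp: bounded_iff)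
  ultimately have b: "norm (s *\<^sub>R x + v) \<le> B" for s by simp
  have "norm (((B + norm v + 1) / norm x) *\<^sub>R x) \<le> norm (((B + norm v + 1) / norm x) *\<^sub>R x + v) + norm v"
    using norm_triangle_ineq4[of "((B + norm v + 1) / norm x) *\<^sub>R x + v" v] by simp
  also have "\<dots> \<le> B + norm v" using b by simp
  finally have "\<bar>B + norm v + 1\<bar> \<le> B + norm v" using \<open>x \<noteq> 0\<close> by simp
  then show False by linarith
qed

lemma Z_components:
  assumes "z \<in> Z" "A \<in> \<g>"
  shows "I (app A (fst z)) \<bullet> fst z - I (app A (snd z)) \<bullet> snd z = I (app A v0) \<bullet> v0"
    "app A (fst z) \<bullet> snd z = 0" "I (app A (fst z)) \<bullet> snd z = 0"
proof -
  let ?x = "fst z" and ?y = "snd z"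
  have *: "1/2 * (cI (act A z) \<bullet> z) + th A = 0" "cot_J (act A z) \<bullet> z = 0" "cK (act A z) \<bullet> z = 0"
    using assms by (auto simp: Z_def)
  show "I (app A ?x) \<bullet> ?x - I (app A ?y) \<bullet> ?y = I (app A v0) \<bullet> v0"
    using *(1) by (simp add: th_def cot_I_def act_def inner_prod_def)
  have "app A ?y \<bullet> ?x = - (app A ?x \<bullet> ?y)" using g_skew[OF assms(2), of ?y ?x] by (simp add: inner_commute)
  then show "app A ?x \<bullet> ?y = 0" using *(2) by (simp add: cot_J_def act_def inner_prod_def)
  have "I (app A ?y) \<bullet> ?x = ?y \<bullet> I (app A ?x)"
    by (simp add: I_skew g_skew[OF assms(2)] g_I[OF assms(2)])
  then have "I (app A ?y) \<bullet> ?x = I (app A ?x) \<bullet> ?y" by (simp add: inner_commute)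
  then show "I (app A ?x) \<bullet> ?y = 0" using *(3) by (simp add: cot_I_def cot_J_def act_def inner_prod_def I_minus)
qed

text \<open>Otherwise the first components, rescaled to norm 1, subconverge to a unit vector
  \<open>x\<close>, while the second components become negligible. Dividing the first moment
  equation by the squared norm leaves \<open>I (app A x) \<bullet> x = 0\<close> for all
  \<open>A\<close>, which forces \<open>x = 0\<close> because \<open>M\<close> is bounded.\<close>

lemma Z_bound:
  assumes M: "bounded M"
  obtains c where "c > 0" "\<forall>z\<in>Z. norm (fst z) \<le> c * (1 + norm (snd z))"
proof -
  have "\<exists>n :: nat. \<forall>z\<in>Z. norm (fst z) \<le> Suc n * (1 + norm (snd z))"
  proof (rule ccontr)
    assume "\<not> ?thesis"
    then obtain z where z: "\<And>n. z n \<in> Z" "\<And>n. norm (fst (z n)) > Suc n * (1 + norm (snd (z n)))"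
      by (metis not_le)
    define a where "a n = norm (fst (z n))" for n
    have a1: "Suc n < a n" "Suc n * norm (snd (z n)) < a n" for n
    proof -
      have "real (Suc n) * 1 \<le> Suc n * (1 + norm (snd (z n)))" "real (Suc n) * norm (snd (z n)) \<le> Suc n * (1 + norm (snd (z n)))"
        by (intro mult_left_mono; simp)+
      then show "Suc n < a n" "Suc n * norm (snd (z n)) < a n"
        unfolding a_def by (auto intro: le_less_trans[OF _ z(2)[of n]])
    qed
    have ap: "a n > 0" for n using a1(1)[of n] by linarith
    define u where "u n = fst (z n) /\<^sub>R a n" for n
    have "u n \<in> sphere 0 1" for n using ap[of n] by (simp add: u_def a_def)
    then obtain x r where x: "x \<in> sphere 0 1" "strict_mono r" "(u \<circ> r) \<longlonglongrightarrow> x"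
      using compact_sphere[of "0 :: 'v" 1] unfolding compact_def by metis
    have inv0: "(\<lambda>n. inverse (real (Suc n))) \<longlonglongrightarrow> 0" by (rule LIMSEQ_inverse_real_of_nat)
    have y0: "(\<lambda>n. snd (z n) /\<^sub>R a n) \<longlonglongrightarrow> 0"
    proof (rule tendsto_norm_zero_cancel, rule tendsto_sandwich[OF _ _ tendsto_const inv0])
      show "\<forall>\<^sub>F n in sequentially. norm (snd (z n) /\<^sub>R a n) \<le> inverse (real (Suc n))"
        using a1(2) ap by (intro always_eventually allI) (simp add: field_simps less_imp_le)
    qed simp
    have i0: "(\<lambda>n. inverse (a n)) \<longlonglongrightarrow> 0"
    proof (rule tendsto_sandwich[OF _ _ tendsto_const inv0])
      show "\<forall>\<^sub>F n in sequentially. inverse (a n) \<le> inverse (real (Suc n))"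
        using a1(1) by (intro always_eventually allI le_imp_inverse_le) (auto simp: less_imp_le)
      show "\<forall>\<^sub>F n in sequentially. 0 \<le> inverse (a n)" using ap by (simp add: less_imp_le)
    qed
    have "I (app A x) \<bullet> x = 0" if A: "A \<in> \<g>" for A
    proof -
      define q where "q w = I (app A w) \<bullet> w" for w
      have qs: "q (w /\<^sub>R c) = q w * (inverse c * inverse c)" for w c
        by (simp add: q_def app.scaleR_right I_scale)
      have qc: "isCont q w" for w
        unfolding q_def by (intro continuous_intros bounded_linear.continuous[OF bounded_linear_I]
            bounded_linear.continuous[OF app.bounded_linear_right])
      have "q (fst (z n)) = q (snd (z n)) + q v0" for n
        using Z_components(1)[OF z(1) A, of n] by (simp add: q_def)
      then have "q (u n) = q (snd (z n) /\<^sub>R a n) + q v0 * (inverse (a n) * inverse (a n))" for n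
        unfolding u_def qs by (simp add: algebra_simps)
      moreover have "(\<lambda>n. q (snd (z n) /\<^sub>R a n) + q v0 * (inverse (a n) * inverse (a n))) \<longlonglongrightarrow> q 0 + q v0 * (0 * 0)"
        by (intro tendsto_intros i0 isCont_tendsto_compose[OF qc y0])
      ultimately have "(\<lambda>n. q (u n)) \<longlonglongrightarrow> 0" by (simp add: q_def)
      then have "(\<lambda>n. q ((u \<circ> r) n)) \<longlonglongrightarrow> 0" using LIMSEQ_subseq_LIMSEQ[OF _ x(2)] by (force simp: o_def)
      moreover have "(\<lambda>n. q ((u \<circ> r) n)) \<longlonglongrightarrow> q x" by (rule isCont_tendsto_compose[OF qc x(3)])
      ultimately show ?thesis using LIMSEQ_unique by (auto simp: q_def)
    qed
    then have "x = 0" by (intro M_unbounded[OF _ M]) blast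
    then show False using x(1) by simp
  qed
  then obtain n :: nat where "\<forall>z\<in>Z. norm (fst z) \<le> Suc n * (1 + norm (snd z))" by blast
  then show ?thesis by (intro that[of "Suc n"]) auto
qed

end

section \<open>Perturbation of kernels and commuting orthogonal projections\<close>

lemma perturbed_kernel:
  fixes a b :: "'a::euclidean_space \<Rightarrow> 'a"
  assumes "linear a" "linear b" and skew: "\<And>u v. a u \<bullet> v = - (u \<bullet> a v)" and comm: "\<And>u. a (b u) = b (a u)"
  obtains \<epsilon> where "\<epsilon> > 0" "\<And>u. a u + \<epsilon> *\<^sub>R b u = 0 \<Longrightarrow> a u = 0"
proof -
  have sub: "subspace (range a)" using assms(1) by (simp add: linear_subspace_image)
  \<comment> \<open>Kernel and range of a skew map are orthogonal, so \<open>a\<close> is bounded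
    below on its range by some \<open>c\<close>; a perturbation of size at most \<open>c / 2\<close>
    that commutes with \<open>a\<close> cannot cancel it there.\<close>
  have "\<forall>x\<in>range a. a x = 0 \<longrightarrow> x = 0"
  proof (intro ballI impI)
    fix x assume "x \<in> range a" "a x = 0"
    then obtain u where "x = a u" by blast
    then have "x \<bullet> x = - (u \<bullet> a x)" using skew[of u x] by simp
    then show "x = 0" using \<open>a x = 0\<close> by simp
  qed
  from injective_imp_isometric[OF closed_subspace[OF sub] sub assms(1)[unfolded linear_conv_bounded_linear] this]
  obtain c where c: "c > 0" "\<forall>x\<in>range a. c * norm x \<le> norm (a x)" by blast
  obtain B where B: "B > 0" "\<And>x. norm (b x) \<le> B * norm x"
    using linear_bounded_pos[OF assms(2)] by blast
  define \<epsilon> where "\<epsilon> = c / (2 * B)"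
  have \<epsilon>: "\<epsilon> > 0" using c(1) B(1) by (simp add: \<epsilon>_def)
  show ?thesis
  proof (rule that[OF \<epsilon>])
    fix u assume u: "a u + \<epsilon> *\<^sub>R b u = 0"
    define w where "w = a u"
    have "a w + \<epsilon> *\<^sub>R b w = a (a u + \<epsilon> *\<^sub>R b u)"
      by (simp add: w_def linear_add[OF assms(1)] linear_cmul[OF assms(1)] comm)
    then have "a w = - (\<epsilon> *\<^sub>R b w)" using u linear_0[OF assms(1)] by (simp add: add_eq_0_iff2)
    then have "c * norm w \<le> \<epsilon> * norm (b w)" using c(2)[rule_format, of w] \<epsilon> by (simp add: w_def)
    also have "\<dots> \<le> \<epsilon> * (B * norm w)" using B(2) \<epsilon> by simp
    also have "\<dots> = c / 2 * norm w" using B(1) by (simp add: \<epsilon>_def)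
    finally have "c * norm w \<le> 0" by simp
    then show "a u = 0" using c(1) by (simp add: w_def mult_le_0_iff)
  qed
qed

definition subproj :: "'a::euclidean_space set \<Rightarrow> 'a \<Rightarrow> 'a" where
  "subproj W v = (THE y. y \<in> W \<and> (\<forall>w\<in>W. (v - y) \<bullet> w = 0))"

lemma subproj_unique:
  assumes W: "subspace W" and y: "y \<in> W" "\<And>w. w \<in> W \<Longrightarrow> (v - y) \<bullet> w = 0"
  shows "subproj W v = y"
  unfolding subproj_def
proof (rule the_equality)
  show "y \<in> W \<and> (\<forall>w\<in>W. (v - y) \<bullet> w = 0)" using y by blast
  fix y' assume y': "y' \<in> W \<and> (\<forall>w\<in>W. (v - y') \<bullet> w = 0)"
  then have d: "y - y' \<in> W" using W y(1) by (simp add: subspace_diff)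
  have "(y - y') \<bullet> (y - y') = (v - y') \<bullet> (y - y') - (v - y) \<bullet> (y - y')" by (simp add: inner_diff_left)
  also have "\<dots> = 0" using y(2)[OF d] y' d by simp
  finally show "y' = y" by simp
qed

lemma subproj:
  assumes W: "subspace W"
  shows "subproj W v \<in> W" "w \<in> W \<Longrightarrow> (v - subproj W v) \<bullet> w = 0"
proof -
  obtain y z where "y \<in> span W" "\<And>w. w \<in> span W \<Longrightarrow> orthogonal z w" "v = y + z"
    using orthogonal_subspace_decomp_exists[of W v] by blast
  then have y: "y \<in> W" "\<And>w. w \<in> W \<Longrightarrow> (v - y) \<bullet> w = 0"
    by (auto simp: orthogonal_def span_eq_iff[THEN iffD2, OF W])
  from subproj_unique[OF W this] y
  show "subproj W v \<in> W" "w \<in> W \<Longrightarrow> (v - subproj W v) \<bullet> w = 0" by auto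
qed

lemma linear_subproj:
  assumes W: "subspace W" shows "linear (subproj W)"
proof (rule linearI)
  show "subproj W (u + v) = subproj W u + subproj W v" for u v
    using subproj(1)[OF W] subproj(2)[OF W, of _ u] subproj(2)[OF W, of _ v] W
    by (intro subproj_unique[OF W]) (auto simp: subspace_add inner_diff_left inner_add_left)
  show "subproj W (c *\<^sub>R u) = c *\<^sub>R subproj W u" for c u
    using subproj(1)[OF W] subproj(2)[OF W, of _ u] W
    by (intro subproj_unique[OF W]) (auto simp: subspace_scale inner_diff_left)
qed

lemma subproj_id: "subspace W \<Longrightarrow> w \<in> W \<Longrightarrow> subproj W w = w"
  by (rule subproj_unique) auto

lemma norm_subproj_le: assumes W: "subspace W" shows "norm (subproj W v) \<le> norm v"
proof -
  have "(norm v)\<^sup>2 = (norm (subproj W v))\<^sup>2 + (norm (v - subproj W v))\<^sup>2"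
    using subproj(2)[OF W subproj(1)[OF W, of v], of v]
    by (simp add: power2_norm_eq_inner inner_diff_left inner_diff_right inner_commute)
  then have "(norm (subproj W v))\<^sup>2 \<le> (norm v)\<^sup>2" by simp
  then show ?thesis by (rule power2_le_imp_le) simp
qed

abbreviation oproj :: "'v::euclidean_space set \<Rightarrow> 'v opr" where
  "oproj W \<equiv> opr_of (subproj W)"

lemma app_oproj: "subspace W \<Longrightarrow> app (oproj W) v = subproj W v"
  by (rule app_opr_of[OF linear_subproj])

lemma norm_oproj_le:
  assumes "subspace (W :: 'v::euclidean_space set)" shows "norm (oproj W) \<le> sqrt DIM('v)"
proof -
  have "(norm (oproj W))\<^sup>2 = (\<Sum>b\<in>Basis. (norm (subproj W b))\<^sup>2)"
    by (simp add: power2_norm_eq_inner inner_opr app_oproj[OF assms])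
  also have "\<dots> \<le> (\<Sum>b\<in>(Basis :: 'v set). 1)"
  proof (rule sum_mono)
    fix b :: 'v assume "b \<in> Basis"
    then have "norm (subproj W b) \<le> 1" using norm_subproj_le[OF assms, of b] by simp
    then show "(norm (subproj W b))\<^sup>2 \<le> 1" by (simp add: power_le_one)
  qed
  finally have "(norm (oproj W))\<^sup>2 \<le> DIM('v)" by simp
  then show ?thesis by (rule real_le_rsqrt)
qed

text \<open>Invariance of \<open>W\<close> under the adjoint is invariance of the orthogonal
  complement under \<open>S\<close>.\<close>

lemma oproj_commute:
  assumes W: "subspace W" and S: "\<And>w. w \<in> W \<Longrightarrow> app S w \<in> W" "\<And>w. w \<in> W \<Longrightarrow> app (oadj S) w \<in> W"
  shows "omul S (oproj W) = omul (oproj W) S"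
proof (rule opr_eqI)
  fix v
  have "subproj W (app S v) = app S (subproj W v)"
  proof (rule subproj_unique[OF W])
    show "app S (subproj W v) \<in> W" using S(1) subproj(1)[OF W] by blast
    fix w assume "w \<in> W"
    have "(app S v - app S (subproj W v)) \<bullet> w = (v - subproj W v) \<bullet> app (oadj S) w"
      by (simp add: app_oadj' app.diff_right)
    then show "(app S v - app S (subproj W v)) \<bullet> w = 0"
      using subproj(2)[OF W S(2)[OF \<open>w \<in> W\<close>]] by simp
  qed
  then show "app (omul S (oproj W)) v = app (omul (oproj W) S) v" by (simp add: app_oproj[OF W])
qed

text \<open>For \<open>w\<close> in \<open>W1\<close> the rest \<open>w - subproj W2 w\<close> is
  again in \<open>W1\<close>, by commutation, and is killed by the second projection. The difference
  of the projections thus fixes it, and norm less than 1 makes it 0.\<close>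

lemma commuting_projections_separated:
  assumes W: "subspace W1" "subspace W2"
    and comm: "omul (oproj W1) (oproj W2) = omul (oproj W2) (oproj W1)"
    and near: "norm (oproj W1 - oproj W2) < 1"
  shows "W1 \<subseteq> W2"
proof
  fix w assume w: "w \<in> W1"
  have c: "subproj W1 (subproj W2 v) = subproj W2 (subproj W1 v)" for v
    using arg_cong[OF comm, of "\<lambda>A. app A v"] by (simp add: app_oproj W)
  define w' where "w' = w - subproj W2 w"
  have "subproj W1 w' = w'"
    using w by (simp add: w'_def linear_diff[OF linear_subproj[OF W(1)]] c subproj_id W)
  moreover have "subproj W2 w' = 0"
    by (simp add: w'_def linear_diff[OF linear_subproj[OF W(2)]] subproj_id[OF W(2)] subproj(1)[OF W(2)])
  ultimately have "norm w' = norm (app (oproj W1 - oproj W2) w')"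
    by (simp add: app.diff_left app_oproj W)
  also have "\<dots> \<le> norm (oproj W1 - oproj W2) * norm w'" by (rule norm_app_le)
  finally have "norm w' * (1 - norm (oproj W1 - oproj W2)) \<le> 0" by (simp add: algebra_simps)
  then have "w' = 0" using near by (simp add: mult_le_0_iff)
  then show "w \<in> W2" using subproj(1)[OF W(2), of w] by (simp add: w'_def)
qed

text \<open>Projections onto distinct members have distance at least 1 and bounded norm, and a
  uniformly separated bounded set in finite dimension is finite.\<close>

lemma finite_commuting_subspaces:
  fixes \<W> :: "'v::euclidean_space set set"
  assumes W: "\<And>W. W \<in> \<W> \<Longrightarrow> subspace W"
    and comm: "\<And>W1 W2. W1 \<in> \<W> \<Longrightarrow> W2 \<in> \<W> \<Longrightarrow> omul (oproj W1) (oproj W2) = omul (oproj W2) (oproj W1)"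
  shows "finite \<W>"
proof (rule finite_imageD)
  have sep: "W1 = W2" if "W1 \<in> \<W>" "W2 \<in> \<W>" "norm (oproj W1 - oproj W2) < 1" for W1 W2
    using commuting_projections_separated[OF W W comm] that by (metis norm_minus_commute subset_antisym)
  show "inj_on oproj \<W>" using sep by (intro inj_onI) auto
  have "uniform_discrete (oproj ` \<W>)"
    unfolding uniform_discrete_def using sep by (intro exI[of _ 1]) (auto simp: dist_norm)
  moreover have "bounded (oproj ` \<W>)"
    unfolding bounded_iff using norm_oproj_le W by blast
  ultimately show "finite (oproj ` \<W>)" using uniform_discrete_finite_iff by blast
qed

section \<open>Finiteness of the critical values\<close>

context hk_rep
begin

definition commutant :: "'v opr \<Rightarrow> 'v opr set" where "commutant A = {S. bra A S = 0}"

lemma bra_linear: "linear (bra A)"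
  by (rule linearI) (simp_all add: bra_def omul.add_left omul.add_right omul.scaleR_left omul.scaleR_right algebra_simps)

lemma subspace_commutant: "subspace (commutant A)"
  unfolding commutant_def using bra_linear[of A] by (simp add: subspace_def linear_0 linear_add linear_cmul)

lemma bra_skew: "A \<in> \<g> \<Longrightarrow> bra A S \<bullet> S' = - (S \<bullet> bra A S')"
  unfolding bra_def inner_diff_left inner_diff_right inner_omul_left[of A S S'] inner_omul_right[of S A S']
  by (simp add: oadj_g omul.minus_left omul.minus_right)

lemma bra_commuting:
  assumes "bra A B = 0" shows "bra A (bra B S) = bra B (bra A S)"
proof -
  have "omul A B = omul B A" using assms by (simp add: bra_def)
  then have "omul A (omul B S) = omul B (omul A S)" "omul S (omul A B) = omul S (omul B A)"
    by (metis omul_assoc)+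
  then show ?thesis by (simp add: bra_def omul.diff_left omul.diff_right omul_assoc)
qed

text \<open>\<open>R\<close> has a commutant of least dimension. If \<open>A\<close> commutes with
  \<open>R\<close>, the commutant of \<open>R + \<epsilon> *\<^sub>R A\<close> for suitable small
  \<epsilon> lies in that of \<open>R\<close> and so equals it. Whatever commutes with
  \<open>R\<close> then commutes with \<open>A\<close>.\<close>

lemma regular_element:
  obtains R where "R \<in> \<g>" "\<forall>A\<in>\<g>. bra R A = 0 \<longrightarrow> commutant R \<subseteq> commutant A"
proof -
  have "\<exists>R\<in>\<g>. \<forall>A\<in>\<g>. dim (commutant R) \<le> dim (commutant A)"
    using ex_has_least_nat[of "\<lambda>A. A \<in> \<g>" 0 "\<lambda>A. dim (commutant A)"] subspace_0[OF g_subspace] by blast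
  then obtain R where R: "R \<in> \<g>" "\<And>A. A \<in> \<g> \<Longrightarrow> dim (commutant R) \<le> dim (commutant A)" by blast
  have "commutant R \<subseteq> commutant A" if A: "A \<in> \<g>" "bra R A = 0" for A
  proof -
    obtain \<epsilon> where \<epsilon>: "\<epsilon> > 0" "\<And>S. bra R S + \<epsilon> *\<^sub>R bra A S = 0 \<Longrightarrow> bra R S = 0"
      using perturbed_kernel[OF bra_linear bra_linear bra_skew[OF R(1)] bra_commuting[OF A(2)]] by blast
    define B where "B = R + \<epsilon> *\<^sub>R A"
    have B: "B \<in> \<g>" using R(1) A(1) g_subspace by (simp add: B_def subspace_add subspace_scale)
    have bB: "bra B S = bra R S + \<epsilon> *\<^sub>R bra A S" for S
      by (simp add: B_def bra_def omul.add_left omul.add_right omul.scaleR_left omul.scaleR_right algebra_simps)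
    have "commutant B \<subseteq> commutant R" using \<epsilon>(2) by (auto simp: commutant_def bB)
    then have eq: "commutant B = commutant R"
      by (intro subspace_dim_equal subspace_commutant R(2)[OF B])
    show ?thesis
    proof
      fix S assume "S \<in> commutant R"
      then have "bra R S = 0" "bra B S = 0" using eq by (auto simp: commutant_def)
      then show "S \<in> commutant A" using \<epsilon>(1) by (simp add: bB commutant_def)
    qed
  qed
  then show ?thesis using that R(1) by blast
qed

text \<open>The argument for conjugacy of maximal tori: at a conjugate \<open>A'\<close> of
  \<open>A\<close> with maximal inner product with \<open>R\<close>, all \<open>bra B A'\<close> are
  orthogonal to \<open>R\<close>. Taking \<open>bra R A'\<close> for \<open>B\<close> makes the
  squared norm of \<open>bra R A'\<close> vanish.\<close>

lemma conjugate_into_commutant: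
  assumes "A \<in> \<g>" "R \<in> \<g>"
  obtains k where "k \<in> K" "bra R (omul k (omul A (oadj k))) = 0"
proof -
  define f where "f k = omul k (omul A (oadj k)) \<bullet> R" for k
  have bl: "bounded_linear oadj" using oadj_linear by (simp add: linear_conv_bounded_linear)
  have "continuous_on K f"
    unfolding f_def by (intro continuous_intros omul.continuous_on bounded_linear.continuous_on[OF bl])
  then obtain k where k: "k \<in> K" "\<And>k'. k' \<in> K \<Longrightarrow> f k' \<le> f k"
    using continuous_attains_sup[OF K_compact] K_oid by blast
  define A' where "A' = omul k (omul A (oadj k))"
  have A': "A' \<in> \<g>" unfolding A'_def by (rule g_conj[OF k(1) assms(1)])
  have crit: "bra B A' \<bullet> R = 0" if B: "B \<in> \<g>" for B
  proof -
    obtain \<kappa> where \<kappa>: "range \<kappa> \<subseteq> K" "\<kappa> 0 = oid" "(\<kappa> has_vector_derivative B) (at (0::real))"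
      using g_curve[OF B] by blast
    define \<beta> where "\<beta> t = omul (\<kappa> t) (omul A' (oadj (\<kappa> t)))" for t
    have oid: "oadj oid = oid" by (rule oadj_unique) simp
    have "((\<lambda>t. oadj (\<kappa> t)) has_vector_derivative oadj B) (at 0)"
      by (rule bounded_linear.has_vector_derivative[OF bl \<kappa>(3)])
    from omul.has_vector_derivative[OF \<kappa>(3) omul.has_vector_derivative[OF has_vector_derivative_const this, of A']]
    have "(\<beta> has_vector_derivative bra B A') (at 0)"
      by (simp add: \<beta>_def[abs_def] \<kappa>(2) oid omul.zero_left oadj_g[OF B] omul.minus_right bra_def)
    from bounded_linear.has_vector_derivative[OF bounded_linear_inner_left[of R] this]
    have "((\<lambda>t. \<beta> t \<bullet> R) has_real_derivative bra B A' \<bullet> R) (at 0)"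
      by (simp add: has_real_derivative_iff_has_vector_derivative)
    moreover have "\<beta> t \<bullet> R \<le> \<beta> 0 \<bullet> R" for t
      using k(2)[OF K_mult[OF _ k(1), of "\<kappa> t"]] \<kappa>(1,2)
      by (auto simp: f_def \<beta>_def A'_def oid omul_assoc oadj_omul)
    ultimately show ?thesis using DERIV_local_max[of _ _ 0 1] by force
  qed
  have "bra R A' \<bullet> bra R A' = - (A' \<bullet> bra R (bra R A'))" by (rule bra_skew[OF assms(2)])
  also have "\<dots> = 0"
  proof -
    have "bra (bra R A') A' \<bullet> R = 0" by (rule crit[OF bra_in_g[OF assms(2) A']])
    moreover have "bra (bra R A') A' \<bullet> R = bra A' R \<bullet> bra R A'"
      using bra_skew[OF A', of "bra R A'" R] by (simp add: bra_minus[of "bra R A'" A'] inner_commute)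
    moreover have "A' \<bullet> bra R (bra R A') = bra A' R \<bullet> bra R A'"
      using bra_skew[OF assms(2), of A' "bra R A'"] by (simp add: bra_minus[of A' R])
    ultimately show ?thesis by simp
  qed
  finally have "bra R A' = 0" by simp
  then show ?thesis using that k(1) by (simp add: A'_def)
qed

text \<open>The pair \<open>(0, - I (snd z))\<close> is the velocity of the circle action at
  \<open>z\<close>; the condition says that it is tangent to the orbit of \<open>K\<close>, so that
  the point below is fixed infinitesimally.\<close>

definition critical_values :: "real set" where
  "critical_values = {(norm (snd z))\<^sup>2 | z. z \<in> Z \<and> (\<exists>A\<in>\<g>. app A (fst z) = 0 \<and> app A (snd z) = - I (snd z))}"

text \<open>In the first moment equation, tested against \<open>A\<close> itself, only the term with
  \<open>snd z\<close> survives. The value depends on \<open>A\<close> alone.\<close>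

lemma critical_value_eq:
  assumes "z \<in> Z" "A \<in> \<g>" "app A (fst z) = 0" "app A (snd z) = - I (snd z)"
  shows "(norm (snd z))\<^sup>2 = - (I (app A v0) \<bullet> v0)"
  using Z_components(1)[OF assms(1,2)] assms(3,4) by (simp add: I_0 I_minus I_I power2_norm_eq_inner)

text \<open>After conjugation \<open>A\<close> commutes with the regular element \<open>R\<close>.
  The spaces \<open>W1 A\<close> and \<open>W2 A\<close> where \<open>A\<close> is 0 and
  \<open>- I\<close> are then invariant under the self-adjoint algebra \<open>\<S>\<close> of
  operators commuting with \<open>R\<close> and \<open>J\<close>. Their projections belong to the
  same algebra, hence commute with each other, and only finitely many such pairs occur. The pair
  determines the critical value.\<close>

lemma finite_critical_values: "finite critical_values"
proof -
  obtain R where R: "R \<in> \<g>" "\<forall>A\<in>\<g>. bra R A = 0 \<longrightarrow> commutant R \<subseteq> commutant A"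
    by (rule regular_element)
  define \<A> where "\<A> = {A \<in> \<g>. bra R A = 0}"
  define W1 where "W1 A = {v. app A v = 0}" for A :: "'v opr"
  define W2 where "W2 A = {v. app A v = - I v}" for A
  have sub: "subspace (W1 A)" "subspace (W2 A)" for A :: "'v opr"
    unfolding W1_def W2_def subspace_def
    by (simp_all add: app.add_right app.scaleR_right app.zero_right I_add I_scale I_0)
  define J where "J = opr_of I"
  have J: "app J v = I v" for v by (simp add: J_def app_opr_of I_linear)
  have J_adj: "oadj J = - J" by (rule oadj_unique) (simp add: app.minus_left J I_skew)
  have JA: "J \<in> commutant A" "A \<in> commutant J" if "A \<in> \<g>" for A
    unfolding commutant_def bra_def using g_I[OF that] by (auto intro!: opr_eqI simp: J)
  have comm_eq: "app A (app S v) = app S (app A v)" if "S \<in> commutant A" for A S :: "'v opr" and v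
  proof -
    have "omul A S = omul S A" using that by (simp add: commutant_def bra_def)
    from arg_cong[OF this, of "\<lambda>B. app B v"] show ?thesis by simp
  qed
  have adj: "oadj S \<in> commutant B" if "S \<in> commutant B" "oadj B = - B" for S B
  proof -
    have "oadj (bra B S) = oadj 0" using that by (simp add: commutant_def)
    then have "oadj (omul B S) = oadj (omul S B)"
      by (simp add: bra_def linear_diff[OF oadj_linear] linear_0[OF oadj_linear])
    then show ?thesis
      by (simp add: oadj_omul that(2) omul.minus_left omul.minus_right commutant_def bra_def)
  qed
  \<comment> \<open>Commutation with \<open>J\<close> is included because \<open>W2\<close> is
    defined through \<open>I\<close>.\<close>
  define \<S> where "\<S> = commutant R \<inter> commutant J"
  have \<S>_adj: "oadj S \<in> \<S>" if "S \<in> \<S>" for S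
    using that adj oadj_g[OF R(1)] J_adj by (simp add: \<S>_def)
  have RJ: "R \<in> \<S>" "J \<in> \<S>" using JA[OF R(1)] by (auto simp: \<S>_def commutant_def bra_def)
  have fin: "finite (W ` \<A>)" if W: "\<And>A. subspace (W A)"
      "\<And>A S w. A \<in> \<A> \<Longrightarrow> S \<in> \<S> \<Longrightarrow> w \<in> W A \<Longrightarrow> app S w \<in> W A" for W :: "'v opr \<Rightarrow> 'v set"
  proof (rule finite_commuting_subspaces)
    show "subspace V" if "V \<in> W ` \<A>" for V using that W(1) by auto
    have c: "omul S (oproj (W A)) = omul (oproj (W A)) S" if "S \<in> \<S>" "A \<in> \<A>" for S A
      by (rule oproj_commute[OF W(1)]) (use W(2) that \<S>_adj in auto)
    \<comment> \<open>Since \<open>R\<close> and \<open>J\<close> are themselves in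
      \<open>\<S>\<close>, the projection commutes with both.\<close>
    have "oproj (W A) \<in> \<S>" if "A \<in> \<A>" for A
      using c[OF RJ(1) that] c[OF RJ(2) that] by (simp add: \<S>_def commutant_def bra_def)
    then show "omul (oproj V1) (oproj V2) = omul (oproj V2) (oproj V1)"
      if "V1 \<in> W ` \<A>" "V2 \<in> W ` \<A>" for V1 V2
      using that c by blast
  qed
  have \<S>_comm: "app A (app S w) = app S (app A w)" "I (app S w) = app S (I w)" if "A \<in> \<A>" "S \<in> \<S>" for A S w
    using that R(2) comm_eq[of S A w] comm_eq[of S J w] by (auto simp: \<S>_def \<A>_def J)
  have "app S w \<in> W1 A" if "A \<in> \<A>" "S \<in> \<S>" "w \<in> W1 A" for A S w
    using \<S>_comm(1)[OF that(1,2), of w] that(3) by (simp add: W1_def app.zero_right)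
  then have f1: "finite (W1 ` \<A>)" by (rule fin[OF sub(1)])
  have "app S w \<in> W2 A" if "A \<in> \<A>" "S \<in> \<S>" "w \<in> W2 A" for A S w
    using \<S>_comm[OF that(1,2), of w] that(3) by (simp add: W2_def app.minus_right)
  then have f2: "finite (W2 ` \<A>)" by (rule fin[OF sub(2)])
  have finW: "finite ((\<lambda>A. (W1 A, W2 A)) ` \<A>)"
    by (rule finite_subset[OF _ finite_cartesian_product[OF f1 f2]]) auto
  have "\<exists>z A. c = (norm (snd z))\<^sup>2 \<and> z \<in> Z \<and> A \<in> \<A> \<and> app A (fst z) = 0 \<and> app A (snd z) = - I (snd z)"
    if c: "c \<in> critical_values" for c
  proof -
    obtain z A where z: "c = (norm (snd z))\<^sup>2" "z \<in> Z" "A \<in> \<g>" "app A (fst z) = 0" "app A (snd z) = - I (snd z)"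
      using c unfolding critical_values_def by blast
    obtain k where k: "k \<in> K" "bra R (omul k (omul A (oadj k))) = 0"
      by (rule conjugate_into_commutant[OF z(3) R(1)])
    have n: "norm (app k v) = norm v" for v by (simp add: norm_eq_sqrt_inner K_orth[OF k(1)])
    have i: "app (oadj k) (app k v) = v" for v
      using arg_cong[OF K_oadj_inverse(1)[OF k(1)], of "\<lambda>B. app B v"] by simp
    show ?thesis
      by (rule exI[of _ "act k z"], rule exI[of _ "omul k (omul A (oadj k))"])
         (use z k g_conj[OF k(1) z(3)] Z_invariant[OF z(2) k(1)] n i in
           \<open>auto simp: \<A>_def act_def app.zero_right app.minus_right K_I\<close>)
  qed
  then obtain zz AA where ch: "\<And>c. c \<in> critical_values \<Longrightarrow> c = (norm (snd (zz c)))\<^sup>2 \<and> zz c \<in> Z \<and> AA c \<in> \<A> \<and>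
      app (AA c) (fst (zz c)) = 0 \<and> app (AA c) (snd (zz c)) = - I (snd (zz c))"
    by metis
  have "inj_on (\<lambda>c. (W1 (AA c), W2 (AA c))) critical_values"
  proof (rule inj_onI)
    fix c d assume cd: "c \<in> critical_values" "d \<in> critical_values" "(W1 (AA c), W2 (AA c)) = (W1 (AA d), W2 (AA d))"
    \<comment> \<open>A point that is critical for one operator is critical for every operator with
      the same pair of spaces, so its value may be computed from \<open>AA d\<close>.\<close>
    have "fst (zz c) \<in> W1 (AA d)" "snd (zz c) \<in> W2 (AA d)" using ch[OF cd(1)] cd(3) by (auto simp: W1_def W2_def)
    then have "(norm (snd (zz c)))\<^sup>2 = - (I (app (AA d) v0) \<bullet> v0)"
      using ch[OF cd(1)] ch[OF cd(2)] by (intro critical_value_eq) (auto simp: W1_def W2_def \<A>_def)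
    moreover have "(norm (snd (zz d)))\<^sup>2 = - (I (app (AA d) v0) \<bullet> v0)"
      using ch[OF cd(2)] by (intro critical_value_eq) (auto simp: \<A>_def)
    ultimately show "c = d" using ch[OF cd(1)] ch[OF cd(2)] by metis
  qed
  moreover have "(\<lambda>c. (W1 (AA c), W2 (AA c))) ` critical_values \<subseteq> (\<lambda>A. (W1 A, W2 A)) ` \<A>"
    using ch by blast
  ultimately show ?thesis using finW inj_on_finite by blast
qed

end

section \<open>Tangent vectors of the zero set\<close>

lemma quadratic_has_vector_derivative_zero:
  fixes E :: "real \<Rightarrow> 'a::real_normed_vector"
  assumes "d > 0" "\<And>t. \<bar>t\<bar> < d \<Longrightarrow> norm (E t) \<le> C * t\<^sup>2"
  shows "(E has_vector_derivative 0) (at 0)"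
proof -
  have E0: "E 0 = 0" using assms(2)[of 0] assms(1) by simp
  show ?thesis
    unfolding has_vector_derivative_def has_derivative_within_alt
  proof (intro conjI allI impI)
    show "bounded_linear (\<lambda>x :: real. x *\<^sub>R (0 :: 'a))" by simp
    fix e :: real assume e: "e > 0"
    define d' where "d' = min d (e / (\<bar>C\<bar> + 1))"
    have "norm (E y) \<le> e * \<bar>y\<bar>" if y: "\<bar>y\<bar> < d'" for y
    proof -
      have "norm (E y) \<le> C * y\<^sup>2" using assms(2) y by (simp add: d'_def)
      also have "\<dots> \<le> (\<bar>C\<bar> + 1) * y\<^sup>2" by (intro mult_right_mono) auto
      also have "\<dots> = ((\<bar>C\<bar> + 1) * \<bar>y\<bar>) * \<bar>y\<bar>" by (simp add: power2_eq_square mult.assoc flip: abs_mult)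
      also have "\<dots> \<le> e * \<bar>y\<bar>"
        using y by (intro mult_right_mono) (auto simp: d'_def pos_less_divide_eq mult.commute less_imp_le)
      finally show ?thesis .
    qed
    moreover have "d' > 0" using assms(1) e by (simp add: d'_def)
    ultimately show "\<exists>d>0. \<forall>y\<in>UNIV. norm (y - 0) < d \<longrightarrow> norm (E y - E 0 - (y - 0) *\<^sub>R 0) \<le> e * norm (y - 0)"
      by (intro exI[of _ d']) (simp add: E0)
  qed
qed

context hk_rep
begin

definition stab :: "'v \<times> 'v \<Rightarrow> 'v opr set" where "stab z = {A \<in> \<g>. act A z = 0}"

text \<open>Centraliser of the stabiliser algebra. For its elements the orbit vectors
  \<open>act A z\<close> are again annihilated by \<open>stab z\<close>.\<close>

definition cent :: "'v \<times> 'v \<Rightarrow> 'v opr set" where "cent z = {A \<in> \<g>. \<forall>B\<in>stab z. bra A B = 0}"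

text \<open>The part of the centraliser orthogonal to the elements that annihilate \<open>z\<close>;
  the map from \<open>A\<close> to \<open>act A z\<close> is injective on it.\<close>

definition slice :: "'v \<times> 'v \<Rightarrow> 'v opr set" where
  "slice z = {A \<in> cent z. \<forall>B\<in>cent z. act B z = 0 \<longrightarrow> A \<bullet> B = 0}"

lemma bra_add_left: "bra (A + A') B = bra A B + bra A' B" and bra_scale_left: "bra (c *\<^sub>R A) B = c *\<^sub>R bra A B"
  and bra_zero_left: "bra 0 B = 0"
  by (simp_all add: bra_def omul.add_left omul.add_right omul.scaleR_left omul.scaleR_right
      omul.diff_left omul.diff_right omul.zero_left omul.zero_right algebra_simps)

lemma subspace_cent: "subspace (cent z)"
  using g_subspace unfolding cent_def subspace_def by (simp add: bra_add_left bra_scale_left bra_zero_left)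

lemma subspace_slice: "subspace (slice z)"
  using subspace_cent[of z] unfolding slice_def subspace_def by (simp add: inner_add_left)

lemma cent_in_g: "A \<in> cent z \<Longrightarrow> A \<in> \<g>" and slice_in_cent: "A \<in> slice z \<Longrightarrow> A \<in> cent z"
  by (auto simp: cent_def slice_def)

lemma slice_injective: "A \<in> slice z \<Longrightarrow> act A z = 0 \<Longrightarrow> A = 0"
  unfolding slice_def by auto

text \<open>\<open>\<g>\<close> is spanned by the brackets of \<open>stab z\<close> with
  \<open>\<g>\<close>, by the annihilators of \<open>z\<close> in \<open>cent z\<close>, and by
  \<open>slice z\<close>. If \<open>w\<close> is annihilated by \<open>stab z\<close>, the equations
  for the first two kinds hold at \<open>w\<close> because they hold at \<open>z\<close>. Only those
  for \<open>slice z\<close> have to be solved.\<close>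

lemma reduced_moment_equations:
  fixes L :: "'v \<times> 'v \<Rightarrow> 'v \<times> 'v"
  assumes L: "linear L" "\<And>A w. A \<in> \<g> \<Longrightarrow> act A (L w) = L (act A w)" and \<theta>: "linear \<theta>"
    and z: "\<And>A. A \<in> \<g> \<Longrightarrow> 1/2 * (L (act A z) \<bullet> z) + \<theta> A = 0"
    and w: "\<And>B. B \<in> stab z \<Longrightarrow> act B w = 0"
    and red: "\<And>A. A \<in> slice z \<Longrightarrow> 1/2 * (L (act A w) \<bullet> w) + \<theta> A = 0"
    and A: "A \<in> \<g>"
  shows "1/2 * (L (act A w) \<bullet> w) + \<theta> A = 0"
proof -
  define f where "f A = 1/2 * (L (act A w) \<bullet> w) + \<theta> A" for A
  have f: "linear f"
    unfolding f_def[abs_def]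
    by (rule linearI)
       (simp_all add: act.add_left act.scaleR_left linear_add[OF L(1)] linear_cmul[OF L(1)] linear_add[OF \<theta>]
         linear_cmul[OF \<theta>] inner_add_left algebra_simps)
  have f_stab: "f B = 0" if "B \<in> stab z" for B
    using w[OF that] z[of B] that by (simp add: f_def stab_def linear_0[OF L(1)])
  have f_cent: "f A = 0" if A: "A \<in> cent z" for A
  proof -
    define n where "n = {B \<in> cent z. act B z = 0}"
    have n: "subspace n"
      using subspace_cent[of z] unfolding n_def subspace_def by (simp add: act.add_left act.scaleR_left act.zero_left)
    obtain y a where ya: "y \<in> span n" "\<And>w. w \<in> span n \<Longrightarrow> orthogonal a w" "A = y + a"
      using orthogonal_subspace_decomp_exists[of n A] by blast
    have y: "y \<in> n" using ya(1) span_eq_iff[THEN iffD2, OF n] by simp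
    have "A - y \<in> cent z" using A y subspace_cent by (simp add: n_def subspace_diff)
    then have "a \<in> cent z" using ya(3) by simp
    moreover have "a \<bullet> B = 0" if "B \<in> cent z" "act B z = 0" for B
      using ya(2)[of B] that by (simp add: orthogonal_def n_def span_base)
    ultimately have "a \<in> slice z" by (simp add: slice_def)
    then have "f a = 0" using red by (simp add: f_def)
    moreover have "f y = 0" using f_stab[of y] y cent_in_g[of y z] by (simp add: n_def stab_def)
    ultimately show ?thesis using ya(3) by (simp add: linear_add[OF f])
  qed
  define S where "S = {bra B C | B C. B \<in> stab z \<and> C \<in> \<g>}"
  have Sg: "S \<subseteq> \<g>" using bra_in_g by (auto simp: S_def stab_def)
  have sw: "L (act (bra B C) v) \<bullet> v = 0" if "B \<in> \<g>" "act B v = 0" "C \<in> \<g>" for B C v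
  proof -
    have "L (act (bra B C) v) \<bullet> v = act B (L (act C v)) \<bullet> v"
      using that by (simp add: act_bra L(2) act.zero_right)
    also have "\<dots> = 0" using that(2) by (simp add: act_skew[OF that(1)])
    finally show ?thesis .
  qed
  have "f x = 0" if "x \<in> S" for x
  proof -
    obtain B C where BC: "x = bra B C" "B \<in> stab z" "C \<in> \<g>" using \<open>x \<in> S\<close> by (auto simp: S_def)
    have B: "B \<in> \<g>" "act B z = 0" using BC(2) by (auto simp: stab_def)
    have "\<theta> x = 0" using z[OF bra_in_g[OF B(1) BC(3)]] sw[OF B BC(3)] BC(1) by simp
    moreover have "L (act x w) \<bullet> w = 0" using sw[OF B(1) w[OF BC(2)] BC(3)] BC(1) by simp
    ultimately show ?thesis by (simp add: f_def)
  qed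
  then have f_span: "f x = 0" if "x \<in> span S" for x using linear_eq_0_on_span[OF f _ that] by blast
  obtain y a where ya: "y \<in> span S" "\<And>w. w \<in> span S \<Longrightarrow> orthogonal a w" "A = y + a"
    using orthogonal_subspace_decomp_exists[of S A] by blast
  have "y \<in> \<g>" using ya(1) span_minimal[OF Sg g_subspace] by blast
  then have "A - y \<in> \<g>" using A g_subspace by (simp add: subspace_diff)
  then have ag: "a \<in> \<g>" using ya(3) by simp
  \<comment> \<open>For \<open>C = bra a B\<close> the inner product of \<open>a\<close> with
    \<open>bra B C\<close> is the squared norm of \<open>C\<close>, and it vanishes because
    \<open>a\<close> is orthogonal to all such brackets.\<close>
  have "bra a B = 0" if B: "B \<in> stab z" for B
  proof -
    have Bg: "B \<in> \<g>" using B by (simp add: stab_def)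
    define C where "C = bra a B"
    have C: "C \<in> \<g>" unfolding C_def by (rule bra_in_g[OF ag Bg])
    have "bra B C \<in> span S" using B C by (intro span_base) (auto simp: S_def)
    then have "a \<bullet> bra B C = 0" using ya(2) by (simp add: orthogonal_def)
    moreover have "a \<bullet> bra B C = C \<bullet> C"
      using bra_skew[OF Bg, of a C] by (simp add: bra_minus[of B a] C_def)
    ultimately show ?thesis by (simp add: C_def)
  qed
  then have "a \<in> cent z" using ag by (simp add: cent_def)
  then have "f A = 0" using f_cent f_span[OF ya(1)] by (simp add: ya(3) linear_add[OF f])
  then show ?thesis by (simp add: f_def)
qed

text \<open>Equivariance of the moment map: the form paired with two orbit vectors is, up to a
  factor, the moment map at the bracket. The orbits in \<open>Z\<close> are thus isotropic for all
  three forms.\<close>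

lemma moment_bracket:
  assumes P: "linear P" "\<And>A w. A \<in> \<g> \<Longrightarrow> act A (P w) = P (act A w)" "\<And>u w. P u \<bullet> w = - (u \<bullet> P w)"
    and z: "\<And>A B. A \<in> \<g> \<Longrightarrow> B \<in> \<g> \<Longrightarrow> P (act (bra A B) z) \<bullet> z = 0"
    and AB: "A \<in> \<g>" "B \<in> \<g>"
  shows "act A z \<bullet> P (act B z) = 0"
proof -
  have "act A z \<bullet> P (act B z) = - (z \<bullet> P (act A (act B z)))"
    by (simp add: act_skew[OF AB(1)] P(2)[OF AB(1)])
  moreover have "act A z \<bullet> P (act B z) = P (act B (act A z)) \<bullet> z"
    using P(3)[of "act A z" "act B z"] act_skew[OF AB(2), of "P (act A z)" z] P(2)[OF AB(2)]
    by simp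
  ultimately have "2 * (act A z \<bullet> P (act B z)) = - (P (act (bra A B) z) \<bullet> z)"
    by (simp add: act_bra linear_diff[OF P(1)] inner_diff_left inner_diff_right inner_commute)
  then show ?thesis using z[OF AB] by simp
qed

lemma Z_cross:
  assumes z: "z \<in> Z" and AB: "A \<in> \<g>" "B \<in> \<g>"
  shows "act A z \<bullet> cI (act B z) = 0" "act A z \<bullet> cot_J (act B z) = 0" "act A z \<bullet> cK (act B z) = 0"
proof -
  have z': "cI (act (bra A B) z) \<bullet> z = 0" "cot_J (act (bra A B) z) \<bullet> z = 0" "cK (act (bra A B) z) \<bullet> z = 0"
    if "A \<in> \<g>" "B \<in> \<g>" for A B
  proof -
    have "1/2 * (cI (act (bra A B) z) \<bullet> z) + th (bra A B) = 0 \<and> 1/2 * (cot_J (act (bra A B) z) \<bullet> z) = 0 \<and>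
        1/2 * (cK (act (bra A B) z) \<bullet> z) = 0"
      using z bra_in_g[OF that] unfolding Z_def by blast
    then show "cI (act (bra A B) z) \<bullet> z = 0" "cot_J (act (bra A B) z) \<bullet> z = 0" "cK (act (bra A B) z) \<bullet> z = 0"
      using th_bra[OF that] by simp_all
  qed
  show "act A z \<bullet> cI (act B z) = 0"
    by (rule moment_bracket[OF cI_linear act_cI cI_skew z'(1) AB])
  show "act A z \<bullet> cot_J (act B z) = 0"
    by (rule moment_bracket[OF cJ_linear act_cJ cJ_skew z'(2) AB])
  show "act A z \<bullet> cK (act B z) = 0"
    by (rule moment_bracket[OF cK_linear _ cK_skew z'(3) AB]) (simp add: act_cI act_cJ)
qed

text \<open>Moving one structure across the inner product leaves, up to sign, the remaining
  one.\<close>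

lemma quaternion_orthogonal:
  assumes "u \<bullet> cI w = 0" "u \<bullet> cot_J w = 0" "u \<bullet> cK w = 0"
  shows "cI u \<bullet> cot_J w = 0" "cI u \<bullet> cK w = 0" "cot_J u \<bullet> cI w = 0" "cot_J u \<bullet> cK w = 0"
    "cK u \<bullet> cI w = 0" "cK u \<bullet> cot_J w = 0"
  using assms by (simp_all add: cI_orth cI_skew cJ_skew cJ_cI cJ_cJ cI_cI linear_neg[OF cI_linear])

lemma Z_tangent:
  assumes z: "z \<in> Z" and fix_h: "\<And>B. B \<in> stab z \<Longrightarrow> act B h = 0"
    and orth: "\<And>A. A \<in> \<g> \<Longrightarrow> cI (act A z) \<bullet> h = 0 \<and> cot_J (act A z) \<bullet> h = 0 \<and> cK (act A z) \<bullet> h = 0"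
  shows "h \<in> tangent_space Z z"
proof -
  define Y where "Y = (\<lambda>A. act A z) ` slice z"
  have "linear (\<lambda>A. act A z)" by (rule bounded_linear.linear[OF act.bounded_linear_left])
  then have Y: "subspace Y" unfolding Y_def using subspace_slice by (rule linear_subspace_image)
  obtain OB where OB: "OB \<subseteq> Y" "pairwise orthogonal OB" "\<And>x. x \<in> OB \<Longrightarrow> norm x = 1" "independent OB" "span OB = Y"
    using orthonormal_basis_subspace[OF Y] by metis
  have finOB: "finite OB" using OB(4) by (rule independent_imp_finite)
  have "\<forall>b\<in>OB. \<exists>A. A \<in> slice z \<and> act A z = b" using OB(1) unfolding Y_def by blast
  then obtain \<alpha> where \<alpha>: "\<And>b. b \<in> OB \<Longrightarrow> \<alpha> b \<in> slice z" "\<And>b. b \<in> OB \<Longrightarrow> act (\<alpha> b) z = b" by metis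
  have \<alpha>g: "\<alpha> b \<in> \<g>" if "b \<in> OB" for b using \<alpha>(1)[OF that] slice_in_cent cent_in_g by blast
  have Yg: "\<exists>A\<in>\<g>. y = act A z" if "y \<in> Y" for y
    using that slice_in_cent cent_in_g unfolding Y_def by blast
  have Yfix: "act B y = 0" if yB: "y \<in> Y" "B \<in> stab z" for y B
  proof -
    obtain A where A: "A \<in> slice z" "y = act A z" using yB(1) unfolding Y_def by blast
    have "bra A B = 0" using slice_in_cent[OF A(1)] yB(2) by (simp add: cent_def)
    then have "act A (act B z) = act B (act A z)" using act_bra[of A B z] by (simp add: act.zero_left)
    then show ?thesis using A(2) yB(2) by (simp add: stab_def act.zero_right)
  qed
  define U where "U t p = t *\<^sub>R h + (cI (fst p) + (cot_J (fst (snd p)) + cK (snd (snd p))))"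
    for t and p :: "('v \<times> 'v) \<times> ('v \<times> 'v) \<times> ('v \<times> 'v)"
  \<comment> \<open>The vector of \<open>Y\<close> whose coordinates in the orthonormal basis
    \<open>OB\<close> are the values that the correction must have to cancel the quadratic part of
    the equation for \<open>L\<close>.\<close>
  define \<phi> where "\<phi> L u = - (1/2) *\<^sub>R (\<Sum>b\<in>OB. (L (act (\<alpha> b) u) \<bullet> u) *\<^sub>R b)" for L :: "('v \<times> 'v) \<Rightarrow> ('v \<times> 'v)" and u
  define \<Phi> where "\<Phi> t p = (\<phi> cI (U t p), \<phi> cot_J (U t p), \<phi> (\<lambda>z. cK z) (U t p))" for t p
  obtain k where k: "k > 0" "\<forall>A u. norm (act (A :: 'v opr) u) \<le> norm A * norm u * k"
    using act.pos_bounded by blast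
  define C0 where "C0 = (\<Sum>b\<in>OB. norm (\<alpha> b) * k)"
  have C0: "C0 \<ge> 0" unfolding C0_def using k(1) by (intro sum_nonneg) auto
  have nI: "norm (cI u) = norm u" and nJ: "norm (cot_J u) = norm u" for u :: "'v \<times> 'v"
    by (simp_all add: norm_eq_sqrt_inner cI_orth cJ_orth)
  have nK: "norm (cK u) = norm u" for u by (simp add: nI nJ)
  have \<phi>_bound: "norm (\<phi> L u) \<le> C0 * (norm u)\<^sup>2" if L: "\<And>u. norm (L u) = norm u" for L u
  proof -
    have "norm (\<Sum>b\<in>OB. (L (act (\<alpha> b) u) \<bullet> u) *\<^sub>R b) \<le> (\<Sum>b\<in>OB. norm (\<alpha> b) * k * (norm u)\<^sup>2)"
    proof (rule sum_norm_le)
      fix b assume b: "b \<in> OB"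
      have "\<bar>L (act (\<alpha> b) u) \<bullet> u\<bar> \<le> norm (act (\<alpha> b) u) * norm u"
        using Cauchy_Schwarz_ineq2[of "L (act (\<alpha> b) u)" u] L by simp
      also have "\<dots> \<le> (norm (\<alpha> b) * norm u * k) * norm u" by (intro mult_right_mono k(2)[rule_format] norm_ge_zero)
      finally show "norm ((L (act (\<alpha> b) u) \<bullet> u) *\<^sub>R b) \<le> norm (\<alpha> b) * k * (norm u)\<^sup>2"
        using OB(3)[OF b] by (simp add: power2_eq_square algebra_simps)
    qed
    also have "\<dots> = C0 * (norm u)\<^sup>2" by (simp add: C0_def sum_distrib_right)
    finally have "norm (\<phi> L u) \<le> 1/2 * (C0 * (norm u)\<^sup>2)" by (simp add: \<phi>_def)
    moreover have "0 \<le> C0 * (norm u)\<^sup>2" using C0 by simp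
    ultimately show ?thesis by linarith
  qed
  define H where "H = norm h + 3"
  have H: "H > 0" by (simp add: H_def add_nonneg_pos)
  have U_bound: "norm (U t p) \<le> \<bar>t\<bar> * norm h + 3 * norm p" for t p
  proof -
    have 1: "norm (fst p) \<le> norm p" "norm (fst (snd p)) \<le> norm p" "norm (snd (snd p)) \<le> norm p"
      using norm_fst_le[of "fst p" "snd p"] norm_snd_le[of "snd p" "fst p"]
        norm_fst_le[of "fst (snd p)" "snd (snd p)"] norm_snd_le[of "snd (snd p)" "fst (snd p)"]
      by simp_all
    have "norm (U t p) \<le> norm (t *\<^sub>R h) + (norm (cI (fst p)) + (norm (cot_J (fst (snd p))) + norm (cK (snd (snd p)))))"
      unfolding U_def by (intro norm_triangle_mono order_refl)
    then show ?thesis using 1 by (simp add: nI nJ)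
  qed
  \<comment> \<open>Three components, each at most \<open>C0 * H\<^sup>2 * t\<^sup>2\<close>; the
    added 1 keeps \<open>Q\<close> positive, and \<open>t0 = 1 / Q\<close> makes
    \<open>Q * t\<^sup>2\<close> at most \<open>\<bar>t\<bar>\<close>.\<close>
  define Q where "Q = 3 * C0 * H\<^sup>2 + 1"
  have Q: "Q > 0" using C0 by (simp add: Q_def add_nonneg_pos)
  have \<Phi>_bound: "norm (\<Phi> t p) \<le> Q * t\<^sup>2" if "norm p \<le> \<bar>t\<bar>" for t p
  proof -
    have "norm (U t p) \<le> \<bar>t\<bar> * H" using U_bound[of t p] that by (simp add: H_def algebra_simps)
    then have "(norm (U t p))\<^sup>2 \<le> (\<bar>t\<bar> * H)\<^sup>2" by (simp add: power_mono)
    then have u2: "C0 * (norm (U t p))\<^sup>2 \<le> C0 * (H\<^sup>2 * t\<^sup>2)" using C0 by (intro mult_left_mono) (simp_all add: power_mult_distrib mult.commute)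
    have "norm (\<Phi> t p) \<le> norm (\<phi> cI (U t p)) + (norm (\<phi> cot_J (U t p)) + norm (\<phi> (\<lambda>z. cK z) (U t p)))"
      unfolding \<Phi>_def by (intro order_trans[OF norm_Pair_le] add_mono order_refl norm_Pair_le)
    also have "\<dots> \<le> C0 * (H\<^sup>2 * t\<^sup>2) + (C0 * (H\<^sup>2 * t\<^sup>2) + C0 * (H\<^sup>2 * t\<^sup>2))"
      by (intro add_mono order_trans[OF \<phi>_bound u2] nI nJ nK)
    also have "\<dots> = 3 * C0 * H\<^sup>2 * t\<^sup>2" by simp
    also have "\<dots> \<le> Q * t\<^sup>2" by (intro mult_right_mono) (simp_all add: Q_def)
    finally show ?thesis .
  qed
  have blL: "bounded_linear cI" "bounded_linear cot_J" "bounded_linear (\<lambda>z. cK z)"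
    using cI_linear cJ_linear cK_linear by (simp_all add: linear_conv_bounded_linear)
  have contU: "continuous_on UNIV (U t)" for t
    unfolding U_def[abs_def]
    by (intro continuous_intros bounded_linear.continuous_on[OF blL(1)] bounded_linear.continuous_on[OF blL(2)]
        bounded_linear.continuous_on[OF blL(3)])
  have cont\<phi>: "continuous_on UNIV (\<lambda>p. \<phi> L (U t p))" if L: "bounded_linear L" for L t
    unfolding \<phi>_def
    by (intro continuous_intros bounded_linear.continuous_on[OF L] act.continuous_on contU)
  have cont\<Phi>: "continuous_on UNIV (\<Phi> t)" for t
    unfolding \<Phi>_def[abs_def] by (intro continuous_on_Pair cont\<phi> blL)
  define t0 where "t0 = 1 / Q"
  have t0: "t0 > 0" using Q by (simp add: t0_def)
  have "\<exists>p. \<Phi> t p = p \<and> norm p \<le> \<bar>t\<bar>" if t: "\<bar>t\<bar> < t0" for t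
  proof (cases "t = 0")
    case True
    have "norm (\<Phi> t 0) \<le> 0" using \<Phi>_bound[of 0 t] True by simp
    then show ?thesis by (intro exI[of _ 0]) simp
  next
    case False
    have "\<Phi> t p \<in> cball 0 \<bar>t\<bar>" if "p \<in> cball 0 \<bar>t\<bar>" for p
    proof -
      have "norm (\<Phi> t p) \<le> Q * t\<^sup>2" using that by (intro \<Phi>_bound) simp
      also have "\<dots> = (Q * \<bar>t\<bar>) * \<bar>t\<bar>" by (simp add: power2_eq_square mult.assoc flip: abs_mult)
      also have "\<dots> \<le> 1 * \<bar>t\<bar>"
        using t Q by (intro mult_right_mono) (auto simp: t0_def pos_less_divide_eq mult.commute less_imp_le)
      finally show ?thesis by simp
    qed
    then have maps: "\<Phi> t \<in> cball 0 \<bar>t\<bar> \<rightarrow> cball 0 \<bar>t\<bar>" by blast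
    have "\<bar>t\<bar> > 0" using False by simp
    from brouwer_ball[OF this continuous_on_subset[OF cont\<Phi> subset_UNIV] maps]
    obtain p where "p \<in> cball 0 \<bar>t\<bar>" "\<Phi> t p = p" .
    then show ?thesis by (intro exI[of _ p]) simp
  qed
  then obtain p where p: "\<And>t. \<bar>t\<bar> < t0 \<Longrightarrow> \<Phi> t (p t) = p t" "\<And>t. \<bar>t\<bar> < t0 \<Longrightarrow> norm (p t) \<le> \<bar>t\<bar>" by metis
  have p2: "norm (p t) \<le> Q * t\<^sup>2" if "\<bar>t\<bar> < t0" for t using \<Phi>_bound[OF p(2)[OF that]] p(1)[OF that] by simp
  have \<phi>Y: "\<phi> L u \<in> Y" for L u
    unfolding \<phi>_def using OB(1) by (intro subspace_scale[OF Y] subspace_sum[OF Y]) auto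
  have \<phi>_inner: "b \<bullet> \<phi> L u = - (1/2) * (L (act (\<alpha> b) u) \<bullet> u)" if b: "b \<in> OB" for b L u
  proof -
    have "b \<bullet> (\<Sum>c\<in>OB. (L (act (\<alpha> c) u) \<bullet> u) *\<^sub>R c) = (\<Sum>c\<in>OB. if c = b then L (act (\<alpha> b) u) \<bullet> u else 0)"
      unfolding inner_sum_right
    proof (rule sum.cong[OF refl])
      fix c assume c: "c \<in> OB"
      have "b \<bullet> b = 1" using OB(3)[OF b] by (simp add: norm_eq_sqrt_inner)
      then show "b \<bullet> (L (act (\<alpha> c) u) \<bullet> u) *\<^sub>R c = (if c = b then L (act (\<alpha> b) u) \<bullet> u else 0)"
        using OB(2) b c by (auto simp: pairwise_def orthogonal_def)
    qed
    then show ?thesis using finOB b by (simp add: \<phi>_def)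
  qed
  have inZ: "z + U t (p t) \<in> Z" if t: "\<bar>t\<bar> < t0" for t
  proof -
    define u where "u = U t (p t)"
    obtain y1 y2 y3 where y: "p t = (y1, y2, y3)" by (metis prod_cases3)
    have ys: "y1 = \<phi> cI u" "y2 = \<phi> cot_J u" "y3 = \<phi> (\<lambda>z. cK z) u"
      using p(1)[OF t] y by (auto simp: \<Phi>_def u_def)
    have yY: "y1 \<in> Y" "y2 \<in> Y" "y3 \<in> Y" by (simp_all add: ys \<phi>Y)
    have u: "u = t *\<^sub>R h + (cI y1 + (cot_J y2 + cK y3))" by (simp add: u_def U_def y)
    have ufix: "act B (z + u) = 0" if B: "B \<in> stab z" for B
      using B fix_h[OF B] Yfix[OF yY(1) B] Yfix[OF yY(2) B] Yfix[OF yY(3) B]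
      by (simp add: u act.add_right act.scaleR_right stab_def act_cI act_cJ linear_0[OF cI_linear] linear_0[OF cJ_linear])
    \<comment> \<open>One computation for I, J and K: linear and quadratic terms cancel on the basis
      \<open>OB\<close>, and injectivity on the slice carries this over to every \<open>A\<close> of
      the slice.\<close>
    have red: "1/2 * (L (act A (z + u)) \<bullet> (z + u)) + \<theta> A = 0"
      if L: "linear L" "\<And>A w. A \<in> \<g> \<Longrightarrow> act A (L w) = L (act A w)" "\<And>u w. L u \<bullet> w = - (u \<bullet> L w)"
        and zz: "1/2 * (L (act A z) \<bullet> z) + \<theta> A = 0"
        and \<theta>: "linear \<theta>"
        and A: "A \<in> slice z"
        and b: "\<And>b. b \<in> OB \<Longrightarrow> L b \<bullet> u = b \<bullet> \<phi> L u"
      for A L \<theta>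
    proof -
      have Ag: "A \<in> \<g>" using A slice_in_cent cent_in_g by blast
      define f where "f A = L (act A z) \<bullet> u + 1/2 * (L (act A u) \<bullet> u)" for A
      have linf: "linear f"
        unfolding f_def[abs_def]
        by (rule linearI)
           (simp_all add: act.add_left act.scaleR_left linear_add[OF L(1)] linear_cmul[OF L(1)] inner_add_left algebra_simps)
      have f\<alpha>: "f (\<alpha> c) = 0" if c: "c \<in> OB" for c
        using b[OF c] \<phi>_inner[OF c, of L u] \<alpha>(2)[OF c] by (simp add: f_def)
      have "act A z \<in> span OB" using A OB(5) unfolding Y_def by blast
      then obtain cc where cc: "act A z = (\<Sum>c\<in>OB. cc c *\<^sub>R c)" using span_finite[OF finOB] by auto
      define A' where "A' = A - (\<Sum>c\<in>OB. cc c *\<^sub>R \<alpha> c)"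
      have "A' \<in> slice z"
        unfolding A'_def using A \<alpha>(1)
        by (intro subspace_diff[OF subspace_slice] subspace_sum[OF subspace_slice] subspace_scale[OF subspace_slice])
      moreover have "act A' z = 0"
        using \<alpha>(2) by (simp add: A'_def act.diff_left act.sum_left act.scaleR_left cc)
      ultimately have "A' = 0" by (rule slice_injective)
      then have "f A = f (\<Sum>c\<in>OB. cc c *\<^sub>R \<alpha> c)" by (simp add: A'_def)
      also have "\<dots> = 0" using f\<alpha> by (simp add: linear_sum[OF linf] linear_cmul[OF linf])
      finally have "f A = 0" .
      moreover have "L (act A u) \<bullet> z = L (act A z) \<bullet> u"
      proof -
        have "L (act A u) \<bullet> z = u \<bullet> act A (L z)" by (simp add: L(3) act_skew[OF Ag])
        then show ?thesis by (simp add: L(2)[OF Ag] inner_commute)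
      qed
      ultimately have "L (act A (z + u)) \<bullet> (z + u) = L (act A z) \<bullet> z"
        by (simp add: f_def act.add_right linear_add[OF L(1)] inner_add_left inner_add_right)
      then show ?thesis using zz by simp
    qed
    \<comment> \<open>The equations decouple: the part along \<open>h\<close> vanishes by
      hypothesis, and corrections belonging to different structures are orthogonal because the orbit
      is isotropic.\<close>
    have basis: "cI b \<bullet> u = b \<bullet> y1" "cot_J b \<bullet> u = b \<bullet> y2" "cK b \<bullet> u = b \<bullet> y3" if b: "b \<in> OB" for b
    proof -
      have o: "cI b \<bullet> h = 0 \<and> cot_J b \<bullet> h = 0 \<and> cK b \<bullet> h = 0"
        using orth[OF \<alpha>g[OF b]] \<alpha>(2)[OF b] by simp
      have cr: "b \<bullet> cI y = 0" "b \<bullet> cot_J y = 0" "b \<bullet> cK y = 0" if y: "y \<in> Y" for y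
      proof -
        obtain A where "A \<in> \<g>" "y = act A z" using Yg[OF y] by blast
        then show "b \<bullet> cI y = 0" "b \<bullet> cot_J y = 0" "b \<bullet> cK y = 0"
          using Z_cross[OF z \<alpha>g[OF b], of A] \<alpha>(2)[OF b] by simp_all
      qed
      show "cI b \<bullet> u = b \<bullet> y1" "cot_J b \<bullet> u = b \<bullet> y2" "cK b \<bullet> u = b \<bullet> y3"
        using o quaternion_orthogonal[OF cr[OF yY(1)]] quaternion_orthogonal[OF cr[OF yY(2)]] quaternion_orthogonal[OF cr[OF yY(3)]]
        by (simp_all add: u inner_add_right cI_orth cJ_orth)
    qed
    have zA: "1/2 * (cI (act A z) \<bullet> z) + th A = 0" "1/2 * (cot_J (act A z) \<bullet> z) + 0 = 0"
      "1/2 * (cK (act A z) \<bullet> z) + 0 = 0" if "A \<in> \<g>" for A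
      using z that by (auto simp: Z_def)
    have sg: "A \<in> \<g>" if "A \<in> slice z" for A using that slice_in_cent cent_in_g by blast
    have actK: "act A (cK w) = cK (act A w)" if "A \<in> \<g>" for A w using that by (simp add: act_cI act_cJ)
    have redI: "1/2 * (cI (act A (z + u)) \<bullet> (z + u)) + th A = 0" if A: "A \<in> slice z" for A
      by (rule red[OF cI_linear act_cI cI_skew zA(1)[OF sg[OF A]] th_linear A]) (assumption | rule basis(1)[unfolded ys(1)])+
    have redJ: "1/2 * (cot_J (act A (z + u)) \<bullet> (z + u)) + 0 = 0" if A: "A \<in> slice z" for A
      by (rule red[OF cJ_linear act_cJ cJ_skew zA(2)[OF sg[OF A]] linear_zero A]) (assumption | rule basis(2)[unfolded ys(2)])+
    have redK: "1/2 * (cK (act A (z + u)) \<bullet> (z + u)) + 0 = 0" if A: "A \<in> slice z" for A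
      by (rule red[OF cK_linear actK cK_skew zA(3)[OF sg[OF A]] linear_zero A]) (assumption | rule basis(3)[unfolded ys(3)])+
    have "1/2 * (cI (act A (z + u)) \<bullet> (z + u)) + th A = 0" if "A \<in> \<g>" for A
      by (rule reduced_moment_equations[OF cI_linear act_cI th_linear zA(1) ufix redI that])
    moreover have "1/2 * (cot_J (act A (z + u)) \<bullet> (z + u)) + 0 = 0" if "A \<in> \<g>" for A
      by (rule reduced_moment_equations[OF cJ_linear act_cJ linear_zero zA(2) ufix redJ that])
    moreover have "1/2 * (cK (act A (z + u)) \<bullet> (z + u)) + 0 = 0" if "A \<in> \<g>" for A
      by (rule reduced_moment_equations[OF cK_linear actK linear_zero zA(3) ufix redK that])
    ultimately show ?thesis by (simp add: Z_def u_def)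
  qed
  define E where "E t = U t (p t) - t *\<^sub>R h" for t
  have "norm (E t) \<le> 3 * Q * t\<^sup>2" if "\<bar>t\<bar> < t0" for t
  proof -
    have "E t = U 0 (p t)" by (simp add: E_def U_def)
    then show ?thesis using U_bound[of 0 "p t"] p2[OF that] by simp
  qed
  from quadratic_has_vector_derivative_zero[OF t0 this]
  have Ed: "(E has_vector_derivative 0) (at 0)" .
  have "((\<lambda>t. z + (t *\<^sub>R h + E t)) has_vector_derivative h) (at 0)"
    by (auto intro!: derivative_eq_intros Ed)
  then have der: "((\<lambda>t. z + U t (p t)) has_vector_derivative h) (at 0)" by (simp add: E_def)
  have "U 0 (p 0) = 0"
    using p2[of 0] t0 by (simp add: U_def linear_0[OF cI_linear] linear_0[OF cJ_linear])
  then show ?thesis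
    using inZ der by (intro tangent_spaceI[OF t0, of "\<lambda>t. z + U t (p t)"]) auto
qed

end

section \<open>The quotient structure\<close>

locale hk_quotient = hk_rep K \<g> I v0
  for K \<g> :: "'v::euclidean_space opr set" and I :: "'v \<Rightarrow> 'v" and v0 :: 'v +
  fixes \<pi> :: "'v \<times> 'v \<Rightarrow> ('v \<times> 'v) set" and \<A> :: "(('v \<times> 'v) set, 'e::euclidean_space) chart set"
    and \<psi> :: "('v \<times> 'v) set \<Rightarrow> real"
  assumes \<pi>_def: "\<pi> z = (\<lambda>k. act k z) ` K"
    and sq: "smooth_quotient Z \<pi> \<A>"
    and orbit_tangent: "u \<in> tangent_space (\<pi> z) z \<Longrightarrow> \<exists>A\<in>\<g>. u = act A z"
    and \<psi>: "rot_moment_map I Z \<pi> \<A> \<psi>"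
    and M_bounded: "bounded M"
begin

abbreviation "TZ \<equiv> tangent_space Z"
abbreviation "dq \<equiv> dquot Z \<pi>"

lemma subspace_TZ: "z \<in> Z \<Longrightarrow> subspace (TZ z)"
  using subspace_tangent_space sq by (auto simp: smooth_quotient_def)

lemma \<pi>_self: "z \<in> \<pi> z"
  unfolding \<pi>_def using K_oid by (metis act_oid image_eqI)

lemma \<pi>_act: assumes "k \<in> K" shows "\<pi> (act k z) = \<pi> z"
proof -
  have "act h z \<in> \<pi> (act k z)" if "h \<in> K" for h
    unfolding \<pi>_def
    by (rule image_eqI[of _ _ "omul h (oadj k)"]) (simp_all add: act_K_inverse assms K_mult K_oadj that)
  moreover have "act h (act k z) \<in> \<pi> z" if "h \<in> K" for h
    unfolding \<pi>_def by (rule image_eqI[of _ _ "omul h k"]) (simp_all add: K_mult assms that)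
  ultimately show ?thesis unfolding \<pi>_def by blast
qed

lemma \<pi>_eq: "\<pi> z' = \<pi> z \<longleftrightarrow> (\<exists>k\<in>K. z' = act k z)"
proof
  assume "\<pi> z' = \<pi> z"
  then have "z' \<in> \<pi> z" using \<pi>_self[of z'] by simp
  then show "\<exists>k\<in>K. z' = act k z" unfolding \<pi>_def by blast
qed (use \<pi>_act in blast)

lemma fibre_eq:
  assumes "z \<in> Z" shows "{z' \<in> Z. \<pi> z' = \<pi> z} = \<pi> z"
proof (rule Set.set_eqI)
  fix x
  have "x \<in> Z" if "\<exists>k\<in>K. x = act k z" using that Z_invariant[OF assms] by force
  then show "x \<in> {z' \<in> Z. \<pi> z' = \<pi> z} \<longleftrightarrow> x \<in> \<pi> z"
    unfolding mem_Collect_eq \<pi>_eq by (simp add: \<pi>_def image_iff) blast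
qed

lemma chart_at_point:
  assumes "z \<in> Z" obtains c where "c \<in> \<A>" "\<pi> z \<in> cdom c"
proof -
  have "(\<Union>c\<in>\<A>. cdom c) = topspace (quotient_top Z \<pi>)"
    using sq by (simp add: smooth_quotient_def smooth_manifold_def)
  then have "\<pi> z \<in> (\<Union>c\<in>\<A>. cdom c)" using assms by (simp add: topspace_quotient_top)
  then show ?thesis using that by blast
qed

lemma g_curve_act:
  assumes "A \<in> \<g>"
  obtains \<gamma> where "\<And>t. \<gamma> t \<in> \<pi> z" "\<gamma> 0 = z" "(\<gamma> has_vector_derivative act A z) (at (0::real))"
proof -
  obtain k where k: "range k \<subseteq> K" "k 0 = oid" "(k has_vector_derivative A) (at (0::real))"
    using g_curve[OF assms] by blast
  show ?thesis
  proof (rule that[of "\<lambda>t. act (k t) z"])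
    show "((\<lambda>t. act (k t) z) has_vector_derivative act A z) (at 0)"
      by (rule bounded_linear.has_vector_derivative[OF act.bounded_linear_left k(3)])
  qed (use k in \<open>auto simp: \<pi>_def\<close>)
qed

lemma orbit_TZ: assumes "z \<in> Z" "A \<in> \<g>" shows "act A z \<in> TZ z"
proof -
  obtain \<gamma> where g: "\<And>t. \<gamma> t \<in> \<pi> z" "\<gamma> 0 = z" "(\<gamma> has_vector_derivative act A z) (at (0::real))"
    using g_curve_act[OF assms(2)] by blast
  show ?thesis
    by (rule tangent_spaceI[OF zero_less_one _ g(2,3)]) (use g(1) fibre_eq[OF assms(1)] in blast)
qed

lemma dq_orbit:
  assumes "z \<in> Z" "A \<in> \<g>" "c \<in> \<A>" "\<pi> z \<in> cdom c" shows "dq c z (act A z) = 0"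
proof -
  obtain \<gamma> where g: "\<And>t. \<gamma> t \<in> \<pi> z" "\<gamma> 0 = z" "(\<gamma> has_vector_derivative act A z) (at (0::real))"
    using g_curve_act[OF assms(2)] by blast
  have *: "\<gamma> t \<in> Z" "\<pi> (\<gamma> t) = \<pi> z" for t using g(1)[of t] fibre_eq[OF assms(1)] by blast+
  have "((\<lambda>t. cmap c (\<pi> (\<gamma> t))) has_vector_derivative dq c z (act A z)) (at 0)"
    using has_vector_derivative_compose[OF g(3) _ *(1), of "\<lambda>z. cmap c (\<pi> z)"]
      dquot_has_derivative[OF sq assms(3,1,4)] g(2) by simp
  then have "((\<lambda>t. cmap c (\<pi> z)) has_vector_derivative dq c z (act A z)) (at 0)" by (simp only: *(2))
  from vector_derivative_unique_at[OF this has_vector_derivative_const] show ?thesis .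
qed

lemma dq_kernel:
  assumes "z \<in> Z" "c \<in> \<A>" "\<pi> z \<in> cdom c" "u \<in> TZ z" "dq c z u = 0"
  shows "\<exists>A\<in>\<g>. u = act A z"
  using dquot_kernel[OF sq assms(2,1,3,4,5)] fibre_eq[OF assms(1)] orbit_tangent by simp

lemma linear_dq: "z \<in> Z \<Longrightarrow> c \<in> \<A> \<Longrightarrow> \<pi> z \<in> cdom c \<Longrightarrow> linear (dq c z)"
  using dquot_has_derivative[OF sq] has_derivative_linear by blast

text \<open>The quadratic moment equations are constant along curves in \<open>Z\<close>;
  differentiate them. This is the inclusion of the tangent space in the kernel of the differential
  of the moment map.\<close>

lemma TZ_orthogonal:
  assumes z: "z \<in> Z" and u: "u \<in> TZ z" and A: "A \<in> \<g>"
  shows "cI (act A z) \<bullet> u = 0" "cot_J (act A z) \<bullet> u = 0" "cK (act A z) \<bullet> u = 0"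
proof -
  obtain \<gamma> where g: "\<And>t. \<gamma> t \<in> Z" "\<gamma> 0 = z" "(\<gamma> has_vector_derivative u) (at 0)"
    using u by (rule tangent_spaceE) blast
  have *: "L (act A z) \<bullet> u = 0"
    if L: "linear L" "\<And>w. act A (L w) = L (act A w)" "\<And>u w. L u \<bullet> w = - (u \<bullet> L w)"
      and const: "\<And>z'. z' \<in> Z \<Longrightarrow> L (act A z') \<bullet> z' = c" for L c
  proof -
    have bl: "bounded_linear (\<lambda>w. L (act A w))"
      by (rule bounded_linear_compose[OF L(1)[unfolded linear_conv_bounded_linear] act.bounded_linear_right])
    have "((\<lambda>t. L (act A (\<gamma> t)) \<bullet> \<gamma> t) has_vector_derivative L (act A (\<gamma> 0)) \<bullet> u + L (act A u) \<bullet> \<gamma> 0) (at 0)"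
      by (rule bounded_bilinear.has_vector_derivative[OF bounded_bilinear_inner
            bounded_linear.has_vector_derivative[OF bl g(3)] g(3)])
    then have "((\<lambda>t. c) has_vector_derivative L (act A z) \<bullet> u + L (act A u) \<bullet> z) (at 0)"
      by (simp add: const[OF g(1)] g(2))
    from vector_derivative_unique_at[OF this has_vector_derivative_const]
    have "L (act A z) \<bullet> u + L (act A u) \<bullet> z = 0" .
    moreover have "L (act A u) \<bullet> z = u \<bullet> L (act A z)" by (simp add: L(2,3) act_skew[OF A])
    ultimately show ?thesis by (simp add: inner_commute)
  qed
  have ZA: "1/2 * (cI (act A z') \<bullet> z') + th A = 0" "cot_J (act A z') \<bullet> z' = 0" "cK (act A z') \<bullet> z' = 0"
    if "z' \<in> Z" for z' using that A by (auto simp: Z_def)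
  show "cI (act A z) \<bullet> u = 0"
    by (rule *[OF cI_linear act_cI[OF A] cI_skew, of "- 2 * th A"]) (use ZA(1) in force)
  show "cot_J (act A z) \<bullet> u = 0" by (rule *[OF cJ_linear act_cJ cJ_skew ZA(2)])
  show "cK (act A z) \<bullet> u = 0" by (rule *[OF cK_linear _ cK_skew ZA(3)]) (simp add: act_cI[OF A] act_cJ)
qed

definition Hz :: "'v \<times> 'v \<Rightarrow> ('v \<times> 'v) set" where
  "Hz z = {h \<in> TZ z. \<forall>A\<in>\<g>. h \<bullet> act A z = 0}"

lemma horizontal_eq: assumes "z \<in> Z" shows "horizontal Z \<pi> z = Hz z"
proof -
  have "(\<forall>u\<in>tangent_space (\<pi> z) z. h \<bullet> u = 0) \<longleftrightarrow> (\<forall>A\<in>\<g>. h \<bullet> act A z = 0)" for h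
  proof
    assume h: "\<forall>u\<in>tangent_space (\<pi> z) z. h \<bullet> u = 0"
    show "\<forall>A\<in>\<g>. h \<bullet> act A z = 0"
    proof
      fix A assume "A \<in> \<g>"
      then obtain \<gamma> where g: "\<And>t. \<gamma> t \<in> \<pi> z" "\<gamma> 0 = z" "(\<gamma> has_vector_derivative act A z) (at (0::real))"
        using g_curve_act by blast
      have "act A z \<in> tangent_space (\<pi> z) z"
        by (rule tangent_spaceI[OF zero_less_one _ g(2,3)]) (use g(1) in auto)
      then show "h \<bullet> act A z = 0" using h by blast
    qed
  qed (use orbit_tangent in blast)
  then show ?thesis unfolding horizontal_def Hz_def fibre_eq[OF assms] by blast
qed

text \<open>Along a curve \<gamma> in \<open>Z\<close> with velocity \<open>h\<close>, the vectors
  \<open>act B (\<gamma> t)\<close> divided by \<open>t\<close> are vertical and converge to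
  \<open>act B h\<close>. By continuity of the differential of the projection the limit is vertical
  too, so \<open>act B h = act A z\<close> for some \<open>A\<close>. Its squared norm is then, up
  to sign, \<open>h \<bullet> act (bra B A) z\<close>, which is 0 for horizontal
  \<open>h\<close>.\<close>

lemma horizontal_fixed:
  assumes z: "z \<in> Z" and h: "h \<in> Hz z" and B: "B \<in> stab z"
  shows "act B h = 0"
proof -
  have Bg: "B \<in> \<g>" "act B z = 0" using B by (auto simp: stab_def)
  have hT: "h \<in> TZ z" and ho: "\<And>A. A \<in> \<g> \<Longrightarrow> h \<bullet> act A z = 0" using h by (auto simp: Hz_def)
  obtain \<gamma> where g: "\<And>t. \<gamma> t \<in> Z" "\<gamma> 0 = z" "(\<gamma> has_vector_derivative h) (at 0)"
    using hT by (rule tangent_spaceE) blast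
  obtain c where c: "c \<in> \<A>" "\<pi> z \<in> cdom c" by (rule chart_at_point[OF z])
  obtain N G where N: "open N" "z \<in> N" "\<forall>k. Ck k G N" "\<forall>y\<in>Z \<inter> N. \<pi> y \<in> cdom c \<and> G y = cmap c (\<pi> y)"
    by (rule smooth_quotient_extension[OF sq c(1) z c(2)])
  define t :: "nat \<Rightarrow> real" where "t n = inverse (Suc n)" for n
  have t: "t \<longlonglongrightarrow> 0" "t n > 0" for n
    unfolding t_def[abs_def] using LIMSEQ_inverse_real_of_nat by simp_all
  \<comment> \<open>A sequence is used because the limit lemmas for tangent vectors and for
    \<open>dq\<close> are stated for sequences.\<close>
  have filt: "filterlim t (at 0) sequentially"
    unfolding filterlim_at using t by (auto intro!: always_eventually simp: less_imp_neq[symmetric])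
  define zs where "zs n = \<gamma> (t n)" for n
  define us where "us n = act ((1 / t n) *\<^sub>R B) (zs n)" for n
  have zsZ: "zs n \<in> Z" for n by (simp add: zs_def g(1))
  have "isCont \<gamma> 0" using g(3) has_vector_derivative_continuous by blast
  from isCont_tendsto_compose[OF this t(1)] have zsl: "zs \<longlonglongrightarrow> z" by (simp add: zs_def[abs_def] g(2))
  have tBg: "(1 / t n) *\<^sub>R B \<in> \<g>" for n using Bg(1) g_subspace by (simp add: subspace_scale)
  have usT: "us n \<in> TZ (zs n)" for n unfolding us_def by (rule orbit_TZ[OF zsZ tBg])
  have "((\<lambda>t. act B (\<gamma> t)) has_vector_derivative act B h) (at 0)"
    by (rule bounded_linear.has_vector_derivative[OF act.bounded_linear_right g(3)])
  from filterlim_compose[OF has_vector_derivative_quotient[OF this] filt]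
  have usl: "us \<longlonglongrightarrow> act B h"
    by (simp add: us_def[abs_def] zs_def[abs_def] g(2) Bg(2) act.scaleR_left inverse_eq_divide)
  have T: "act B h \<in> TZ z"
    using tangent_space_limit[OF _ z zsZ zsl usT usl] sq by (simp add: smooth_quotient_def)
  have lim: "(\<lambda>n. dq c (zs n) (us n)) \<longlonglongrightarrow> dq c z (act B h)"
    by (rule dquot_limit[OF sq c(1) z c(2) zsZ zsl usT usl])
  have "\<forall>\<^sub>F n in sequentially. dq c (zs n) (us n) = 0"
    using topological_tendstoD[OF zsl N(1,2)]
  proof eventually_elim
    case (elim n)
    then have "\<pi> (zs n) \<in> cdom c" using N(4) zsZ by blast
    then show ?case unfolding us_def by (rule dq_orbit[OF zsZ tBg c(1)])
  qed
  then have "(\<lambda>n. dq c (zs n) (us n)) \<longlonglongrightarrow> 0" by (rule tendsto_eventually)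
  with lim have "dq c z (act B h) = 0" using LIMSEQ_unique by blast
  then obtain A where A: "A \<in> \<g>" "act B h = act A z" using dq_kernel[OF z c T] by blast
  have "act B h \<bullet> act B h = - (h \<bullet> act B (act A z))" using A(2) act_skew[OF Bg(1), of h "act A z"] by simp
  also have "act B (act A z) = act (bra B A) z" using Bg(2) by (simp add: act_bra act.zero_right)
  also have "h \<bullet> act (bra B A) z = 0" by (rule ho[OF bra_in_g[OF Bg(1) A(1)]])
  finally show ?thesis by simp
qed

text \<open>A horizontal \<open>h\<close> is annihilated by \<open>stab z\<close> and orthogonal to
  the orbit vectors and to their images under the three structures. These conditions persist under
  \<open>cI\<close> and \<open>cot_J\<close>, and they imply tangency to \<open>Z\<close>.\<close>

lemma Hz_quaternionic:
  assumes z: "z \<in> Z" and h: "h \<in> Hz z"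
  shows "cI h \<in> Hz z" "cot_J h \<in> Hz z"
proof -
  have hT: "h \<in> TZ z" and ho: "act A z \<bullet> h = 0" if "A \<in> \<g>" for A
    using h that by (auto simp: Hz_def inner_commute)
  have o: "cI (act A z) \<bullet> h = 0" "cot_J (act A z) \<bullet> h = 0" "cK (act A z) \<bullet> h = 0" "act A z \<bullet> h = 0" if "A \<in> \<g>" for A
    using TZ_orthogonal[OF z _ that] h ho[OF that] by (auto simp: Hz_def)
  have s: "act B (cI h) = 0" "act B (cot_J h) = 0" if "B \<in> stab z" for B
    using horizontal_fixed[OF z h that] that
    by (auto simp: stab_def act_cI act_cJ linear_0[OF cI_linear] linear_0[OF cJ_linear])
  have I: "cI (act A z) \<bullet> cI h = 0 \<and> cot_J (act A z) \<bullet> cI h = 0 \<and> cK (act A z) \<bullet> cI h = 0" if "A \<in> \<g>" for A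
    using o[OF that] by (simp add: cI_orth cI_skew[of h] inner_commute[of _ "cI h"]) (simp add: inner_commute)
  have J: "cI (act A z) \<bullet> cot_J h = 0 \<and> cot_J (act A z) \<bullet> cot_J h = 0 \<and> cK (act A z) \<bullet> cot_J h = 0" if "A \<in> \<g>" for A
  proof -
    have "cI (act A z) \<bullet> cot_J h = - (cot_J (cI (act A z)) \<bullet> h)" by (simp add: cJ_skew)
    then have 1: "cI (act A z) \<bullet> cot_J h = 0" using o(3)[OF that] by (simp add: cJ_cI)
    have "cK (act A z) \<bullet> cot_J h = - (cot_J (cK (act A z)) \<bullet> h)" by (simp add: cJ_skew)
    also have "\<dots> = - (cI (act A z) \<bullet> h)" by (simp add: cJ_cI cJ_cJ linear_neg[OF cI_linear])
    finally show ?thesis using 1 o[OF that] by (simp add: cJ_orth)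
  qed
  have "cI h \<bullet> act A z = 0" "cot_J h \<bullet> act A z = 0" if "A \<in> \<g>" for A
    using o[OF that] cI_skew[of h "act A z"] cJ_skew[of h "act A z"] by (simp_all add: inner_commute)
  then show "cI h \<in> Hz z" "cot_J h \<in> Hz z"
    using Z_tangent[OF z s(1) I] Z_tangent[OF z s(2) J] by (auto simp: Hz_def)
qed

lemma horizontal_decomposition:
  assumes z: "z \<in> Z" and u: "u \<in> TZ z"
  obtains A h where "A \<in> \<g>" "h \<in> Hz z" "u = act A z + h"
proof -
  let ?O = "(\<lambda>A. act A z) ` \<g>"
  have O: "subspace ?O"
    using bounded_linear.linear[OF act.bounded_linear_left] g_subspace by (rule linear_subspace_image)
  obtain y h where y: "y \<in> span ?O" "\<And>w. w \<in> span ?O \<Longrightarrow> orthogonal h w" "u = y + h"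
    using orthogonal_subspace_decomp_exists[of ?O u] by blast
  then obtain A where A: "A \<in> \<g>" "y = act A z" using span_eq_iff[THEN iffD2, OF O] by auto
  have "u - y \<in> TZ z" unfolding A(2) by (rule subspace_diff[OF subspace_TZ[OF z] u orbit_TZ[OF z A(1)]])
  then have "h \<in> Hz z" using y(2,3) by (auto simp: Hz_def orthogonal_def span_base)
  then show ?thesis using that[OF A(1), of h] A(2) y(3) by simp
qed

lemma hlift_iff: "z \<in> Z \<Longrightarrow> hlift Z \<pi> c z w h \<longleftrightarrow> h \<in> Hz z \<and> dq c z h = w"
  by (simp add: hlift_def horizontal_eq)

lemma subspace_Hz: "z \<in> Z \<Longrightarrow> subspace (Hz z)"
  using subspace_TZ unfolding Hz_def subspace_def by (simp add: inner_add_left)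

lemma hlift_unique:
  assumes "z \<in> Z" "c \<in> \<A>" "\<pi> z \<in> cdom c" "h \<in> Hz z" "h' \<in> Hz z" "dq c z h = dq c z h'"
  shows "h = h'"
proof -
  have d: "h - h' \<in> Hz z" using subspace_Hz assms by (simp add: subspace_diff)
  have "dq c z (h - h') = 0" using assms(6) by (simp add: linear_diff[OF linear_dq[OF assms(1-3)]])
  moreover have "h - h' \<in> TZ z" using d by (simp add: Hz_def)
  ultimately obtain A where "A \<in> \<g>" "h - h' = act A z" using dq_kernel[OF assms(1-3)] by blast
  then have "(h - h') \<bullet> (h - h') = 0" using d by (auto simp: Hz_def)
  then show ?thesis by simp
qed

lemma hlift_exists:
  assumes "z \<in> Z" "c \<in> \<A>" "\<pi> z \<in> cdom c" "w \<in> cmodel c"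
  obtains h where "h \<in> Hz z" "dq c z h = w"
proof -
  obtain u where u: "u \<in> TZ z" "dq c z u = w" using assms(4) unfolding dquot_image[OF sq assms(2,1,3), symmetric] by auto
  obtain A h where A: "A \<in> \<g>" "h \<in> Hz z" "u = act A z + h" by (rule horizontal_decomposition[OF assms(1) u(1)])
  have "dq c z h = w"
    using u(2) dq_orbit[OF assms(1) A(1) assms(2,3)] by (simp add: A(3) linear_add[OF linear_dq[OF assms(1-3)]])
  then show ?thesis using that A(2) by blast
qed

lemma TZ_act:
  assumes "z \<in> Z" "k \<in> K" "u \<in> TZ z"
  shows "act k u \<in> TZ (act k z)" "c \<in> \<A> \<Longrightarrow> \<pi> z \<in> cdom c \<Longrightarrow> dq c (act k z) (act k u) = dq c z u"
proof -
  obtain \<gamma> where g: "\<And>t. \<gamma> t \<in> Z" "\<gamma> 0 = z" "(\<gamma> has_vector_derivative u) (at 0)"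
    using assms(3) by (rule tangent_spaceE) blast
  have kg: "((\<lambda>t. act k (\<gamma> t)) has_vector_derivative act k u) (at 0)"
    by (rule bounded_linear.has_vector_derivative[OF act.bounded_linear_right g(3)])
  have kZ: "act k (\<gamma> t) \<in> Z" for t using Z_invariant[OF g(1) assms(2)] .
  show "act k u \<in> TZ (act k z)"
    by (rule tangent_spaceI[OF zero_less_one _ _ kg]) (simp_all add: kZ g(2))
  assume c: "c \<in> \<A>" "\<pi> z \<in> cdom c"
  have "((\<lambda>t. cmap c (\<pi> (act k (\<gamma> t)))) has_vector_derivative dq c (act k z) (act k u)) (at 0)"
    using has_vector_derivative_compose[OF kg _ kZ, of "\<lambda>z. cmap c (\<pi> z)"] g(2) c
      dquot_has_derivative[OF sq c(1) Z_invariant[OF assms(1,2)]] \<pi>_act[OF assms(2)] by simp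
  moreover have "((\<lambda>t. cmap c (\<pi> (\<gamma> t))) has_vector_derivative dq c z u) (at 0)"
    using has_vector_derivative_compose[OF g(3) _ g(1), of "\<lambda>z. cmap c (\<pi> z)"] g(2)
      dquot_has_derivative[OF sq c(1) assms(1) c(2)] by simp
  ultimately show "dq c (act k z) (act k u) = dq c z u"
    using vector_derivative_unique_at by (simp add: \<pi>_act[OF assms(2)])
qed

lemma Hz_act:
  assumes "z \<in> Z" "k \<in> K" "h \<in> Hz z" shows "act k h \<in> Hz (act k z)"
proof -
  have "act k h \<bullet> act A (act k z) = 0" if A: "A \<in> \<g>" for A
  proof -
    define B where "B = omul (oadj k) (omul A k)"
    have B: "B \<in> \<g>" using g_conj[OF K_oadj[OF assms(2)] A] by (simp add: B_def)
    have "act A (act k z) = act k (act B z)" by (simp add: B_def act_K_inverse assms(2))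
    then show ?thesis using assms(3) B by (simp add: act_K_orth[OF assms(2)] Hz_def)
  qed
  then show ?thesis using TZ_act(1)[OF assms(1,2)] assms(3) by (auto simp: Hz_def)
qed

text \<open>\<open>K\<close> permutes the points of a fibre and carries horizontal lifts to
  horizontal lifts; this makes the descriptions in \<open>quotient_endo\<close> and
  \<open>quotient_metric\<close> independent of the chosen point.\<close>

lemma hlift_transport:
  assumes z: "z \<in> Z" "c \<in> \<A>" "\<pi> z \<in> cdom c" "h \<in> Hz z"
    and z': "z' \<in> Z" "\<pi> z' = \<pi> z" "h' \<in> Hz z'" "dq c z' h' = dq c z h"
  obtains k where "k \<in> K" "z' = act k z" "h' = act k h"
proof -
  obtain k where k: "k \<in> K" "z' = act k z" using z'(2) \<pi>_eq by blast
  have "act k h \<in> Hz z'" using Hz_act[OF z(1) k(1) z(4)] k(2) by simp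
  moreover have "dq c z' (act k h) = dq c z h" using TZ_act(2)[OF z(1) k(1) _ z(2,3)] z(4) k(2) by (simp add: Hz_def)
  ultimately have "h' = act k h" using hlift_unique[OF z'(1) z(2) _ z'(3)] z(3) z'(2,4) by simp
  with k that show ?thesis by blast
qed

lemma quotient_endo_eq:
  assumes z: "z \<in> Z" "c \<in> \<A>" "\<pi> z \<in> cdom c" "\<pi> z = cinv c q" and h: "h \<in> Hz z" "dq c z h = u"
    and L: "\<And>k w. k \<in> K \<Longrightarrow> act k (L w) = L (act k w)" "\<And>z h. z \<in> Z \<Longrightarrow> h \<in> Hz z \<Longrightarrow> L h \<in> Hz z"
  shows "quotient_endo Z \<pi> L c q u = dq c z (L h)"
  unfolding quotient_endo_def
proof (rule the_equality)
  show "\<exists>z'\<in>Z. \<exists>h'. \<pi> z' = cinv c q \<and> hlift Z \<pi> c z' u h' \<and> dq c z (L h) = dq c z' (L h')"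
    using z h hlift_iff[OF z(1)] by blast
  fix w assume "\<exists>z\<in>Z. \<exists>h. \<pi> z = cinv c q \<and> hlift Z \<pi> c z u h \<and> w = dq c z (L h)"
  then obtain z' h' where *: "z' \<in> Z" "\<pi> z' = \<pi> z" "h' \<in> Hz z'" "dq c z' h' = dq c z h" "w = dq c z' (L h')"
    using z(4) h(2) hlift_iff by metis
  obtain k where k: "k \<in> K" "z' = act k z" "h' = act k h" by (rule hlift_transport[OF z(1-3) h(1) *(1-4)])
  have "L h \<in> TZ z" using L(2)[OF z(1) h(1)] by (simp add: Hz_def)
  then show "w = dq c z (L h)"
    using TZ_act(2)[OF z(1) k(1) _ z(2,3)] by (simp add: *(5) k(2,3) flip: L(1)[OF k(1)])
qed

lemma quotient_metric_eq:
  assumes z: "z \<in> Z" "c \<in> \<A>" "\<pi> z \<in> cdom c" "\<pi> z = cinv c q"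
    and h: "h \<in> Hz z" "dq c z h = u" "h' \<in> Hz z" "dq c z h' = w"
  shows "quotient_metric Z \<pi> c q u w = h \<bullet> h'"
  unfolding quotient_metric_def
proof (rule the_equality)
  show "\<exists>z1\<in>Z. \<exists>h1 k. \<pi> z1 = cinv c q \<and> hlift Z \<pi> c z1 u h1 \<and> hlift Z \<pi> c z1 w k \<and> h \<bullet> h' = h1 \<bullet> k"
    using z h hlift_iff[OF z(1)] by blast
  fix a assume "\<exists>z\<in>Z. \<exists>h k. \<pi> z = cinv c q \<and> hlift Z \<pi> c z u h \<and> hlift Z \<pi> c z w k \<and> a = h \<bullet> k"
  then obtain z' h1 h2 where *: "z' \<in> Z" "\<pi> z' = \<pi> z" "h1 \<in> Hz z'" "dq c z' h1 = dq c z h"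
      "h2 \<in> Hz z'" "dq c z' h2 = dq c z h'" "a = h1 \<bullet> h2"
    using z(4) h hlift_iff by metis
  obtain k where k: "k \<in> K" "z' = act k z" "h1 = act k h" by (rule hlift_transport[OF z(1-3) h(1) *(1-4)])
  obtain k' where k': "k' \<in> K" "z' = act k' z" "h2 = act k' h'" by (rule hlift_transport[OF z(1-3) h(3) *(1,2,5,6)])
  have "act k h' \<in> Hz z'" using Hz_act[OF z(1) k(1) h(3)] k(2) by simp
  moreover have "dq c z' (act k h') = dq c z' h2"
    using TZ_act(2)[OF z(1) k(1) _ z(2,3)] h(3) k(2) *(6) by (simp add: Hz_def)
  ultimately have "h2 = act k h'" using hlift_unique[OF *(1) z(2) _ *(5)] z(3) *(2) by simp
  then show "a = h \<bullet> h'" using *(7) k(3) act_K_orth[OF k(1)] by simp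
qed

end

section \<open>Strict plurisubharmonicity\<close>

lemma tangent_space_openin_subspace:
  assumes "subspace M" "openin (top_of_set M) U" "x \<in> U" "v \<in> M"
  shows "v \<in> tangent_space U x"
proof -
  obtain W where W: "open W" "U = M \<inter> W" using assms(2) unfolding openin_open by blast
  have "isCont (\<lambda>t. x + t *\<^sub>R v) 0" by (intro continuous_intros)
  then have "\<forall>\<^sub>F t in at 0. x + t *\<^sub>R v \<in> W"
    using W assms(3) unfolding isCont_def tendsto_def by auto
  then obtain d where d: "d > 0" "\<And>t. t \<noteq> 0 \<Longrightarrow> dist t 0 < d \<Longrightarrow> x + t *\<^sub>R v \<in> W"
    unfolding eventually_at by blast
  show ?thesis
  proof (rule tangent_spaceI[OF d(1), of "\<lambda>t. x + t *\<^sub>R v"])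
    fix t :: real assume "\<bar>t\<bar> < d"
    then have "x + t *\<^sub>R v \<in> W" using d(2)[of t] W assms(3) by (cases "t = 0") auto
    moreover have "x \<in> M" using assms(3) W(2) by blast
    ultimately show "x + t *\<^sub>R v \<in> U"
      using W(2) assms(1,4) by (simp add: subspace_add subspace_scale)
  qed (auto intro!: derivative_eq_intros)
qed

lemma chart_tangent:
  assumes "is_chart T c" "x \<in> cimg c" "v \<in> cmodel c" shows "v \<in> tangent_space (cimg c) x"
  using tangent_space_openin_subspace[OF _ _ assms(2,3)] assms(1) by (simp add: is_chart_def)

text \<open>Within a subset of a subspace only the values of \<open>D\<close> on the subspace
  matter, so \<open>D\<close> may be replaced by 0 everywhere.\<close>

lemma has_derivative_zero_on_subspace:
  assumes "(f has_derivative D) (at x within S)" "subspace M" "S \<subseteq> M" "x \<in> S" "\<And>v. v \<in> M \<Longrightarrow> D v = 0"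
  shows "(f has_derivative (\<lambda>v. 0)) (at x within S)"
proof -
  have "D (y - x) = 0" if "y \<in> S" for y
    using assms(2-5) that by (meson subsetD subspace_diff)
  then show ?thesis
    using assms(1) unfolding has_derivative_within_alt by auto
qed

context hk_quotient
begin

lemma norm_snd_act: "k \<in> K \<Longrightarrow> norm (snd (act k z)) = norm (snd z)"
  by (simp add: act_def norm_eq_sqrt_inner K_orth)

text \<open>Rotating the second component preserves the value of the Hermitian expression in the
  first equation and mixes the other two equations with each other, both being 0.\<close>

lemma rot_Z: assumes "z \<in> Z" shows "rot I t z \<in> Z"
proof -
  define x y where "x = fst z" and "y = snd z"
  define y' where "y' = cos t *\<^sub>R y - sin t *\<^sub>R I y"
  have r: "rot I t z = (x, y')" by (simp add: rot_def x_def y_def y'_def)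
  have "1/2 * (cI (act A (x, y')) \<bullet> (x, y')) + th A = 0 \<and> 1/2 * (cot_J (act A (x, y')) \<bullet> (x, y')) = 0 \<and>
     1/2 * (cK (act A (x, y')) \<bullet> (x, y')) = 0" if A: "A \<in> \<g>" for A
  proof -
    have *: "I (app A x) \<bullet> x - I (app A y) \<bullet> y = I (app A v0) \<bullet> v0" "app A x \<bullet> y = 0" "I (app A x) \<bullet> y = 0"
      using Z_components[OF assms A] by (simp_all add: x_def y_def)
    have Ay: "app A y' = cos t *\<^sub>R app A y - sin t *\<^sub>R I (app A y)"
      by (simp add: y'_def app.diff_right app.scaleR_right g_I[OF A])
    have IAy: "I (app A y') = cos t *\<^sub>R I (app A y) + sin t *\<^sub>R app A y"
      unfolding Ay by (simp add: I_diff I_scale I_I)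
    have AyI: "app A y \<bullet> I y = - (I (app A y) \<bullet> y)" by (simp add: I_skew)
    have "I (app A y') \<bullet> y' = cos t * cos t * (I (app A y) \<bullet> y) + sin t * sin t * (I (app A y) \<bullet> y)"
      unfolding IAy unfolding y'_def
      by (simp add: inner_add_left inner_diff_right AyI I_orth algebra_simps)
    also have "\<dots> = I (app A y) \<bullet> y"
      unfolding distrib_right[symmetric] sin_cos_squared_add3 by simp
    finally have 1: "I (app A y') \<bullet> y' = I (app A y) \<bullet> y" .
    have AxI: "app A x \<bullet> I y = 0" using *(3) I_skew[of "app A x" y] by simp
    have 2: "app A x \<bullet> y' = 0" by (simp add: y'_def inner_diff_right *(2) AxI)
    have 3: "I (app A x) \<bullet> y' = 0" by (simp add: y'_def inner_diff_right *(2,3) I_orth)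
    have 4: "app A y' \<bullet> x = 0" using g_skew[OF A, of y' x] 2 by (simp add: inner_commute)
    have "I (app A y') \<bullet> x = y' \<bullet> I (app A x)"
      by (simp add: I_skew[of "app A y'" x] g_skew[OF A] g_I[OF A])
    then have 5: "I (app A y') \<bullet> x = 0" using 3 by (simp add: inner_commute)
    show ?thesis
      using *(1) 1 2 3 4 5 by (simp add: th_def cot_I_def cot_J_def act_def inner_prod_def I_minus)
  qed
  then show ?thesis unfolding r by (simp add: Z_def)
qed

lemma rot_\<pi>: "rot I t ` \<pi> z = \<pi> (rot I t z)"
proof -
  have "rot I t (act k z) = act k (rot I t z)" if "k \<in> K" for k
    by (simp add: rot_def act_def app.diff_right app.scaleR_right K_I[OF that])
  then show ?thesis unfolding \<pi>_def image_image by (rule image_cong[OF refl])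
qed

lemma rot_derivative: "((\<lambda>t. rot I t z) has_vector_derivative (0, - I (snd z))) (at 0)"
  unfolding has_vector_derivative_def rot_def
  by (auto intro!: derivative_eq_intros)

lemma rot_TZ: assumes "z \<in> Z" shows "(0, - I (snd z)) \<in> TZ z"
  by (rule tangent_spaceI[OF zero_less_one rot_Z[OF assms] _ rot_derivative]) (simp add: rot_def)

lemma rot_field_eq:
  assumes "z \<in> Z" "c \<in> \<A>" "\<pi> z \<in> cdom c" "\<pi> z = cinv c q"
  shows "rot_field I c q = dq c z (0, - I (snd z))"
proof -
  have "((\<lambda>t. cmap c (\<pi> (rot I t z))) has_vector_derivative dq c z (0, - I (snd z))) (at 0)"
  proof (rule has_vector_derivative_compose[OF rot_derivative _ rot_Z[OF assms(1)]])
    show "((\<lambda>z. cmap c (\<pi> z)) has_derivative dq c z) (at (rot I 0 z) within Z)"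
      using dquot_has_derivative[OF sq assms(2,1,3)] by (simp add: rot_def)
  qed
  then show ?thesis unfolding rot_field_def assms(4)[symmetric] rot_\<pi> by (rule vector_derivative_at)
qed

text \<open>The derivative of \<psi> on \<open>h\<close> is the inner product of \<open>cI\<close>
  of the rotation field with \<open>h\<close>. The vertical part of the field contributes nothing,
  as \<open>cI (act A z)\<close> is orthogonal to tangent vectors, and \<open>cI\<close> sends
  \<open>(0, - I y)\<close> to \<open>(0, - y)\<close>.\<close>

lemma psi_derivative:
  assumes c: "c \<in> \<A>" "q \<in> cimg c" and z: "z \<in> Z" "\<pi> z = cinv c q"
  obtains D where "((\<lambda>x. \<psi> (cinv c x)) has_derivative D) (at q within cimg c)"
    "\<And>h. h \<in> Hz z \<Longrightarrow> D (dq c z h) = - (snd z \<bullet> snd h)"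
proof -
  have chart: "is_chart (quotient_top Z \<pi>) c" by (rule smooth_quotient_chart[OF sq c(1)])
  have dom: "\<pi> z \<in> cdom c" using cinv_in_cdom[OF chart c(2)] z(2) by simp
  obtain D where D: "((\<lambda>x. \<psi> (cinv c x)) has_derivative D) (at q within cimg c)"
    "\<forall>w\<in>cmodel c. D w = quotient_form Z \<pi> cI c q (rot_field I c q) w"
    using \<psi> c unfolding rot_moment_map_def by blast
  show ?thesis
  proof (rule that[OF D(1)])
    fix h assume h: "h \<in> Hz z"
    define \<phi> where "\<phi> = (0 :: 'v, - I (snd z))"
    obtain A f where A: "A \<in> \<g>" "f \<in> Hz z" "\<phi> = act A z + f"
      unfolding \<phi>_def by (rule horizontal_decomposition[OF z(1) rot_TZ[OF z(1)]])
    have hT: "h \<in> TZ z" using h by (simp add: Hz_def)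
    have "dq c z h \<in> cmodel c" using dquot_image[OF sq c(1) z(1) dom] hT by blast
    then have "D (dq c z h) = quotient_metric Z \<pi> c q (quotient_endo Z \<pi> cI c q (rot_field I c q)) (dq c z h)"
      using D(2) by (simp add: quotient_form_def)
    also have "rot_field I c q = dq c z f"
      unfolding rot_field_eq[OF z(1) c(1) dom z(2)] \<phi>_def[symmetric] A(3)
      by (simp add: linear_add[OF linear_dq[OF z(1) c(1) dom]] dq_orbit[OF z(1) A(1) c(1) dom])
    also have "quotient_endo Z \<pi> cI c q (dq c z f) = dq c z (cI f)"
      by (rule quotient_endo_eq[OF z(1) c(1) dom z(2) A(2) refl act_K_cI Hz_quaternionic(1)])
    also have "quotient_metric Z \<pi> c q (dq c z (cI f)) (dq c z h) = cI f \<bullet> h"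
      by (rule quotient_metric_eq[OF z(1) c(1) dom z(2) Hz_quaternionic(1)[OF z(1) A(2)] refl h refl])
    also have "\<dots> = cI \<phi> \<bullet> h"
      using TZ_orthogonal(1)[OF z(1) hT A(1)] by (simp add: A(3) linear_add[OF cI_linear] inner_add_left)
    also have "\<dots> = - (snd z \<bullet> snd h)" by (simp add: \<phi>_def cot_I_def I_0 I_minus I_I inner_prod_def)
    finally show "D (dq c z h) = - (snd z \<bullet> snd h)" .
  qed
qed

text \<open>Sections replace the abstract quotient by a twice differentiable map on an open set;
  their derivatives are lifts, though in general not horizontal ones.\<close>

lemma quotient_section:
  assumes c: "c \<in> \<A>" "q \<in> cimg c" and z: "z \<in> Z" "\<pi> z = cinv c q"
  obtains N s where "open N" "q \<in> N" "Ck 2 s N" "s q = z"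
    "\<forall>x\<in>N \<inter> cmodel c. s x \<in> Z \<and> \<pi> (s x) = cinv c x \<and> \<pi> (s x) \<in> cdom c \<and> x \<in> cimg c"
    "\<forall>x\<in>N \<inter> cmodel c. \<forall>w\<in>cmodel c. frechet_derivative s (at x) w \<in> TZ (s x) \<and>
      dq c (s x) (frechet_derivative s (at x) w) = w"
proof -
  have chart: "is_chart (quotient_top Z \<pi>) c" by (rule smooth_quotient_chart[OF sq c(1)])
  have M: "subspace (cmodel c)" using chart by (simp add: is_chart_def)
  have dom: "\<pi> z \<in> cdom c" using cinv_in_cdom[OF chart c(2)] z(2) by simp
  have q: "cmap c (\<pi> z) = q" using cmap_cinv[OF chart c(2)] z(2) by simp
  obtain N s where s: "open N" "q \<in> N" "Ck 2 s N" "s q = z"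
    "\<forall>q\<in>N \<inter> cmodel c. s q \<in> Z \<and> \<pi> (s q) \<in> cdom c \<and> cmap c (\<pi> (s q)) = q"
    by (rule local_section[OF sq c(1) z(1) dom, unfolded q])
  have 1: "s x \<in> Z \<and> \<pi> (s x) = cinv c x \<and> \<pi> (s x) \<in> cdom c \<and> x \<in> cimg c" if x: "x \<in> N \<inter> cmodel c" for x
    using s(5) x cinv_cmap[OF chart, of "\<pi> (s x)"] cmap_in_cimg[of "\<pi> (s x)" c] by auto
  have 2: "frechet_derivative s (at x) w \<in> TZ (s x) \<and> dq c (s x) (frechet_derivative s (at x) w) = w"
    if x: "x \<in> N \<inter> cmodel c" and w: "w \<in> cmodel c" for x w
  proof -
    have sD: "(s has_derivative frechet_derivative s (at x)) (at x)"
      using Ck_has_derivative[OF Ck2_imp_Ck1[OF s(3)]] x by blast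
    have op: "openin (top_of_set (cmodel c)) (cmodel c \<inter> N)" using s(1) by (rule openin_open_Int)
    have "w \<in> tangent_space (cmodel c \<inter> N) x"
      by (rule tangent_space_openin_subspace[OF M op _ w]) (use x in blast)
    then obtain \<gamma> where g: "\<And>t. \<gamma> t \<in> cmodel c \<inter> N" "\<gamma> 0 = x" "(\<gamma> has_vector_derivative w) (at 0)"
      by (rule tangent_spaceE) blast
    have g': "\<gamma> t \<in> N \<inter> cmodel c" for t using g(1) by blast
    have sg: "((\<lambda>t. s (\<gamma> t)) has_vector_derivative frechet_derivative s (at x) w) (at 0)"
      using has_vector_derivative_compose[OF g(3), of s "frechet_derivative s (at x)" UNIV] sD g(2) by simp
    have sZ: "s (\<gamma> t) \<in> Z" for t using 1[OF g'] by blast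
    have T: "frechet_derivative s (at x) w \<in> TZ (s x)"
      by (rule tangent_spaceI[OF zero_less_one _ _ sg]) (simp_all add: sZ g(2))
    have "((\<lambda>t. cmap c (\<pi> (s (\<gamma> t)))) has_vector_derivative dq c (s x) (frechet_derivative s (at x) w)) (at 0)"
    proof (rule has_vector_derivative_compose[OF sg _ sZ])
      have "s x \<in> Z" "\<pi> (s x) \<in> cdom c" using 1[OF x] by blast+
      then show "((\<lambda>z. cmap c (\<pi> z)) has_derivative dq c (s x)) (at (s (\<gamma> 0)) within Z)"
        unfolding g(2) by (rule dquot_has_derivative[OF sq c(1)])
    qed
    moreover have "cmap c (\<pi> (s (\<gamma> t))) = \<gamma> t" for t using s(5) g' by blast
    ultimately have "(\<gamma> has_vector_derivative dq c (s x) (frechet_derivative s (at x) w)) (at 0)" by simp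
    from vector_derivative_unique_at[OF this g(3)] T show ?thesis by simp
  qed
  show ?thesis by (rule that[OF s(1-4)]) (use 1 2 in blast)+
qed

lemma snd_act_orth: "A \<in> \<g> \<Longrightarrow> snd z \<bullet> snd (act A z) = 0"
  using g_skew[of A "snd z" "snd z"] by (simp add: act_def inner_commute)

text \<open>The sum of \<psi> and |y|^2/2, taken along a section, has derivative 0: vertical vectors
  do not change |y| because the operators are skew, and on horizontal ones the two derivatives
  cancel. A ball in the model space is convex, so the sum is constant there.\<close>

lemma psi_in_chart:
  assumes c: "c \<in> \<A>" "q \<in> cimg c"
    and s: "open N" "q \<in> N" "Ck 2 s N"
      "\<forall>x\<in>N \<inter> cmodel c. s x \<in> Z \<and> \<pi> (s x) = cinv c x \<and> \<pi> (s x) \<in> cdom c \<and> x \<in> cimg c"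
      "\<forall>x\<in>N \<inter> cmodel c. \<forall>w\<in>cmodel c. frechet_derivative s (at x) w \<in> TZ (s x) \<and>
        dq c (s x) (frechet_derivative s (at x) w) = w"
  obtains r C where "r > 0" "ball q r \<subseteq> N"
    "\<forall>x\<in>ball q r \<inter> cmodel c. \<psi> (cinv c x) = C - 1/2 * (norm (snd (s x)))\<^sup>2"
proof -
  have chart: "is_chart (quotient_top Z \<pi>) c" by (rule smooth_quotient_chart[OF sq c(1)])
  have M: "subspace (cmodel c)" using chart by (simp add: is_chart_def)
  obtain r where r: "r > 0" "ball q r \<subseteq> N" using s(1,2) openE by blast
  define S where "S = ball q r \<inter> cmodel c"
  have S: "S \<subseteq> N \<inter> cmodel c" using r(2) by (auto simp: S_def)
  have "((\<lambda>x. \<psi> (cinv c x) + 1/2 * (norm (snd (s x)))\<^sup>2) has_derivative (\<lambda>v. 0)) (at x within S)" if x: "x \<in> S" for x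
  proof -
    have xN: "x \<in> N \<inter> cmodel c" using x S by blast
    have sx: "s x \<in> Z" "\<pi> (s x) = cinv c x" "\<pi> (s x) \<in> cdom c" "x \<in> cimg c"
      using s(4)[rule_format, OF xN] by blast+
    obtain D where D: "((\<lambda>x. \<psi> (cinv c x)) has_derivative D) (at x within cimg c)"
      "\<And>h. h \<in> Hz (s x) \<Longrightarrow> D (dq c (s x) h) = - (snd (s x) \<bullet> snd h)"
      using psi_derivative[OF c(1) sx(4) sx(1,2)] by blast
    have "S \<subseteq> cimg c" using S s(4) by blast
    from has_derivative_subset[OF D(1) this]
    have D1: "((\<lambda>x. \<psi> (cinv c x)) has_derivative D) (at x within S)" .
    have "(s has_derivative frechet_derivative s (at x)) (at x within S)"
      using Ck_has_derivative[OF Ck2_imp_Ck1[OF s(3)]] xN has_derivative_at_withinI by blast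
    then have sd: "((\<lambda>x. snd (s x)) has_derivative (\<lambda>v. snd (frechet_derivative s (at x) v))) (at x within S)"
      by (rule has_derivative_snd)
    have "((\<lambda>x. 1/2 * (snd (s x) \<bullet> snd (s x))) has_derivative
        (\<lambda>v. snd (s x) \<bullet> snd (frechet_derivative s (at x) v))) (at x within S)"
      by (rule has_derivative_eq_rhs[OF has_derivative_mult_right[OF has_derivative_inner[OF sd sd]]])
         (auto simp: inner_commute)
    then have D2: "((\<lambda>x. 1/2 * (norm (snd (s x)))\<^sup>2) has_derivative
        (\<lambda>v. snd (s x) \<bullet> snd (frechet_derivative s (at x) v))) (at x within S)"
      by (simp add: power2_norm_eq_inner)
    show ?thesis
    proof (rule has_derivative_zero_on_subspace[OF has_derivative_add[OF D1 D2] M])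
      fix w assume w: "w \<in> cmodel c"
      have Dw: "frechet_derivative s (at x) w \<in> TZ (s x)" "dq c (s x) (frechet_derivative s (at x) w) = w"
        using s(5) xN w by auto
      obtain A h where A: "A \<in> \<g>" "h \<in> Hz (s x)" "frechet_derivative s (at x) w = act A (s x) + h"
        by (rule horizontal_decomposition[OF sx(1) Dw(1)])
      have "dq c (s x) h = w"
        using Dw(2) unfolding A(3)
        by (simp add: linear_add[OF linear_dq[OF sx(1) c(1) sx(3)]] dq_orbit[OF sx(1) A(1) c(1) sx(3)])
      then have "D w = - (snd (s x) \<bullet> snd h)" using D(2)[OF A(2)] by simp
      then show "D w + snd (s x) \<bullet> snd (frechet_derivative s (at x) w) = 0"
        by (simp add: A(3) inner_add_right snd_act_orth[OF A(1)])
    qed (use x in \<open>auto simp: S_def\<close>)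
  qed
  moreover have "convex S" unfolding S_def using subspace_imp_convex[OF M] by (simp add: convex_Int)
  ultimately obtain C where C: "\<And>x. x \<in> S \<Longrightarrow> \<psi> (cinv c x) + 1/2 * (norm (snd (s x)))\<^sup>2 = C"
    using has_derivative_zero_constant[of S "\<lambda>x. \<psi> (cinv c x) + 1/2 * (norm (snd (s x)))\<^sup>2"] by auto
  have "\<psi> (cinv c x) = C - 1/2 * (norm (snd (s x)))\<^sup>2" if "x \<in> ball q r \<inter> cmodel c" for x
    using C[of x] that unfolding S_def by linarith
  then show ?thesis by (intro that[OF r, of C]) blast
qed

lemma dc_psi:
  assumes c: "c \<in> \<A>" "x \<in> cimg c" and z: "z \<in> Z" "\<pi> z = cinv c x" and v: "v \<in> TZ z"
  shows "dc (quotient_endo Z \<pi> cot_J) (\<lambda>p. - \<psi> p) c x (dq c z v) = - (snd z \<bullet> fst v)"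
proof -
  have chart: "is_chart (quotient_top Z \<pi>) c" by (rule smooth_quotient_chart[OF sq c(1)])
  have dom: "\<pi> z \<in> cdom c" using cinv_in_cdom[OF chart c(2)] z(2) by simp
  obtain A h where A: "A \<in> \<g>" "h \<in> Hz z" "v = act A z + h" by (rule horizontal_decomposition[OF z(1) v])
  have dqv: "dq c z v = dq c z h"
    by (simp add: A(3) linear_add[OF linear_dq[OF z(1) c(1) dom]] dq_orbit[OF z(1) A(1) c(1) dom])
  have Jh: "cot_J h \<in> Hz z" by (rule Hz_quaternionic(2)[OF z(1) A(2)])
  have J: "quotient_endo Z \<pi> cot_J c x (dq c z v) = dq c z (cot_J h)"
    unfolding dqv by (rule quotient_endo_eq[OF z(1) c(1) dom z(2) A(2) refl act_cJ[symmetric, THEN sym] Hz_quaternionic(2)])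
  obtain D where D: "((\<lambda>x. \<psi> (cinv c x)) has_derivative D) (at x within cimg c)"
      "\<And>h. h \<in> Hz z \<Longrightarrow> D (dq c z h) = - (snd z \<bullet> snd h)"
    using psi_derivative[OF c z] by blast
  have D': "((\<lambda>x. - \<psi> (cinv c x)) has_derivative (\<lambda>v. - D v)) (at x within cimg c)"
    using D(1) by (rule has_derivative_minus)
  then have D'': "((\<lambda>x. - \<psi> (cinv c x)) has_derivative frechet_derivative (\<lambda>x. - \<psi> (cinv c x)) (at x within cimg c)) (at x within cimg c)"
    using frechet_derivative_works differentiable_def by blast
  have "dq c z (cot_J h) \<in> cmodel c"
    using dquot_image[OF sq c(1) z(1) dom] Jh by (auto simp: Hz_def)
  from tangent_space_derivative_unique[OF chart_tangent[OF chart c(2) this] D'' D']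
  have "dc (quotient_endo Z \<pi> cot_J) (\<lambda>p. - \<psi> p) c x (dq c z v) = D (dq c z (cot_J h))"
    by (simp add: dc_def J)
  also have "\<dots> = - (snd z \<bullet> snd (cot_J h))" by (rule D(2)[OF Jh])
  also have "\<dots> = - (snd z \<bullet> fst h)" by (simp add: cot_J_def)
  \<comment> \<open>The vertical part drops out by the second moment equation, so the formula holds
    for any lift and not only for the horizontal one.\<close>
  also have "snd z \<bullet> fst h = snd z \<bullet> fst v"
  proof -
    have "snd z \<bullet> fst (act A z) = 0"
      using Z_components(2)[OF z(1) A(1)] by (simp add: act_def inner_commute)
    then show ?thesis by (simp add: A(3) inner_add_right)
  qed
  finally show ?thesis .
qed

text \<open>\<open>dd\<^sup>c(-\<psi>)\<close> is the form \<open>\<omega>\<^sub>J\<close> of the quotient: along a local section \<open>s = (x, y)\<close> the form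
  \<open>d\<^sup>c(-\<psi>)\<close> is \<open>- y \<cdot> dx\<close>.\<close>

lemma ddc_psi:
  assumes c: "c \<in> \<A>" "q \<in> cimg c" and z: "z \<in> Z" "\<pi> z = cinv c q" and h: "h \<in> Hz z" "k \<in> Hz z"
  shows "ddc (quotient_endo Z \<pi> cot_J) (\<lambda>p. - \<psi> p) c q (dq c z h) (dq c z k) = cot_J h \<bullet> k"
proof -
  let ?J = "quotient_endo Z \<pi> cot_J" and ?D = "\<lambda>f x. frechet_derivative f (at x)"
  have chart: "is_chart (quotient_top Z \<pi>) c" by (rule smooth_quotient_chart[OF sq c(1)])
  have dom: "\<pi> z \<in> cdom c" using cinv_in_cdom[OF chart c(2)] z(2) by simp
  obtain N s where s: "open N" "q \<in> N" "Ck 2 s N" "s q = z"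
    "\<forall>x\<in>N \<inter> cmodel c. s x \<in> Z \<and> \<pi> (s x) = cinv c x \<and> \<pi> (s x) \<in> cdom c \<and> x \<in> cimg c"
    "\<forall>x\<in>N \<inter> cmodel c. \<forall>w\<in>cmodel c. ?D s x w \<in> TZ (s x) \<and> dq c (s x) (?D s x w) = w"
    by (rule quotient_section[OF c z])
  have cM: "cimg c \<subseteq> cmodel c" by (rule is_chart_cimg_subset[OF chart])
  have sS: "Ck (Suc (Suc 0)) s N" using s(3) by (simp add: numeral_2_eq_2)
  have sD: "(s has_derivative ?D s q) (at q)" using Ck_has_derivative[OF sS s(2)] .
  have dcs: "dc ?J (\<lambda>p. - \<psi> p) c x w = - (snd (s x) \<bullet> fst (?D s x w))"
    if "x \<in> N \<inter> cimg c" "w \<in> cmodel c" for x w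
  proof -
    have x: "x \<in> N \<inter> cmodel c" using that(1) cM by blast
    have "dc ?J (\<lambda>p. - \<psi> p) c x (dq c (s x) (?D s x w)) = - (snd (s x) \<bullet> fst (?D s x w))"
      by (rule dc_psi) (use c(1) s(5,6) x that(2) in auto)
    then show ?thesis using s(6) x that(2) by simp
  qed
  have der: "frechet_derivative (\<lambda>x. dc ?J (\<lambda>p. - \<psi> p) c x w) (at q within cimg c) u =
      - (snd z \<bullet> fst (?D (\<lambda>x. ?D s x w) q u) + snd (?D s q u) \<bullet> fst (?D s q w))"
    if u: "u \<in> cmodel c" and w: "w \<in> cmodel c" for u w
  proof -
    have "Ck (Suc 0) (\<lambda>x. ?D s x w) N" using sS by simp
    from Ck_has_derivative[OF this s(2)]
    have wD: "((\<lambda>x. ?D s x w) has_derivative ?D (\<lambda>x. ?D s x w) q) (at q)" .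
    have B: "((\<lambda>x. - (snd (s x) \<bullet> fst (?D s x w))) has_derivative
        (\<lambda>u. - (snd z \<bullet> fst (?D (\<lambda>x. ?D s x w) q u) + snd (?D s q u) \<bullet> fst (?D s q w)))) (at q)"
      using has_derivative_minus[OF has_derivative_inner[OF has_derivative_snd[OF sD] has_derivative_fst[OF wD]]] s(4)
      by simp
    obtain d where d: "d > 0" "ball q d \<subseteq> N" using s(1,2) openE by blast
    have 1: "((\<lambda>x. dc ?J (\<lambda>p. - \<psi> p) c x w) has_derivative
        (\<lambda>u. - (snd z \<bullet> fst (?D (\<lambda>x. ?D s x w) q u) + snd (?D s q u) \<bullet> fst (?D s q w)))) (at q within cimg c)"
      by (rule has_derivative_transform_within[OF has_derivative_at_withinI[OF B] d(1) c(2)])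
         (use d(2) dcs w in \<open>auto simp: dist_commute subset_iff\<close>)
    then have 2: "((\<lambda>x. dc ?J (\<lambda>p. - \<psi> p) c x w) has_derivative
        frechet_derivative (\<lambda>x. dc ?J (\<lambda>p. - \<psi> p) c x w) (at q within cimg c)) (at q within cimg c)"
      using frechet_derivative_works differentiable_def by blast
    show ?thesis by (rule tangent_space_derivative_unique[OF chart_tangent[OF chart c(2) u] 2 1])
  qed
  define u where "u = dq c z h"
  define w where "w = dq c z k"
  have hT: "h \<in> TZ z" "k \<in> TZ z" using h by (auto simp: Hz_def)
  have u: "u \<in> cmodel c" and w: "w \<in> cmodel c"
    using dquot_image[OF sq c(1) z(1) dom] hT by (auto simp: u_def w_def)
  \<comment> \<open>With symmetry of second derivatives the second-order terms of the two halves of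
    the exterior derivative cancel.\<close>
  have sym: "?D (\<lambda>x. ?D s x w) q u = ?D (\<lambda>x. ?D s x u) q w"
    by (rule second_derivative_symmetric[OF s(1,3,2)])
  have ddc: "ddc ?J (\<lambda>p. - \<psi> p) c q u w = cot_J (?D s q u) \<bullet> ?D s q w"
    unfolding ddc_def ext_deriv_def der[OF u w] der[OF w u] sym
    by (simp add: cot_J_def inner_prod_def inner_commute)
  \<comment> \<open>The section differs from the horizontal lift by a vertical vector, which does
    not affect the pairing with \<open>cot_J\<close>.\<close>
  have lift: "\<exists>A\<in>\<g>. ?D s q (dq c z l) = act A z + l" if l: "l \<in> Hz z" for l
  proof -
    have lT: "l \<in> TZ z" using l by (simp add: Hz_def)
    have lM: "dq c z l \<in> cmodel c" using dquot_image[OF sq c(1) z(1) dom] lT by blast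
    have qN: "q \<in> N \<inter> cmodel c" using s(2) c(2) cM by blast
    have *: "?D s q (dq c z l) \<in> TZ z" "dq c z (?D s q (dq c z l)) = dq c z l"
      using s(4,6) qN lM by auto
    have "?D s q (dq c z l) - l \<in> TZ z" using subspace_TZ[OF z(1)] *(1) lT by (simp add: subspace_diff)
    moreover have "dq c z (?D s q (dq c z l) - l) = 0"
      using *(2) by (simp add: linear_diff[OF linear_dq[OF z(1) c(1) dom]])
    ultimately obtain A where "A \<in> \<g>" "?D s q (dq c z l) - l = act A z"
      using dq_kernel[OF z(1) c(1) dom] by blast
    then show ?thesis by (intro bexI[of _ A]) (simp add: algebra_simps)
  qed
  obtain A B where AB: "A \<in> \<g>" "?D s q u = act A z + h" "B \<in> \<g>" "?D s q w = act B z + k"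
    using lift[OF h(1)] lift[OF h(2)] by (auto simp: u_def w_def)
  have Jh: "cot_J h \<in> Hz z" by (rule Hz_quaternionic(2)[OF z(1) h(1)])
  have "act B z + k \<in> TZ z"
    using subspace_TZ[OF z(1)] orbit_TZ[OF z(1) AB(3)] hT(2) by (simp add: subspace_add)
  from TZ_orthogonal(2)[OF z(1) this AB(1)]
  have "cot_J (act A z) \<bullet> (act B z + k) = 0" .
  moreover have "cot_J h \<bullet> act B z = 0" using Jh AB(3) by (simp add: Hz_def)
  ultimately have "cot_J (act A z + h) \<bullet> (act B z + k) = cot_J h \<bullet> k"
    by (simp add: linear_add[OF cJ_linear] inner_add_left inner_add_right)
  then show ?thesis using ddc unfolding AB by (simp only: u_def w_def)
qed

text \<open>In terms of horizontal lifts the form is \<open>cot_J h \<bullet> k\<close>. Its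
  invariance is orthogonality of \<open>cot_J\<close>, and its value on a vector and the image of
  this vector under the complex structure is the squared norm of the lift.\<close>

lemma psi_strictly_plurisubharmonic:
  "strictly_plurisubharmonic \<A> (quotient_endo Z \<pi> cot_J) (\<lambda>p. - \<psi> p)"
  unfolding strictly_plurisubharmonic_def
proof (intro ballI conjI impI)
  fix c assume c: "c \<in> \<A>"
  have chart: "is_chart (quotient_top Z \<pi>) c" by (rule smooth_quotient_chart[OF sq c])
  have cM: "cimg c \<subseteq> cmodel c" by (rule is_chart_cimg_subset[OF chart])
  have pt: "\<exists>z\<in>Z. \<pi> z = cinv c q \<and> \<pi> z \<in> cdom c" if "q \<in> cimg c" for q
  proof -
    have "openin (quotient_top Z \<pi>) (cdom c)" using chart by (simp add: is_chart_def)
    then have "cdom c \<subseteq> \<pi> ` Z" using openin_subset topspace_quotient_top by metis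
    then have "cinv c q \<in> \<pi> ` Z" using cinv_in_cdom[OF chart that] by blast
    then obtain z where "z \<in> Z" "\<pi> z = cinv c q" by (metis imageE)
    then show ?thesis using cinv_in_cdom[OF chart that] by auto
  qed
  show "Ck_on 2 (\<lambda>x. - \<psi> (cinv c x)) (cimg c)"
    unfolding Ck_on_def
  proof
    fix q assume q: "q \<in> cimg c"
    obtain z where z: "z \<in> Z" "\<pi> z = cinv c q" using pt[OF q] by blast
    obtain N s where s: "open N" "q \<in> N" "Ck 2 s N" "s q = z"
      "\<forall>x\<in>N \<inter> cmodel c. s x \<in> Z \<and> \<pi> (s x) = cinv c x \<and> \<pi> (s x) \<in> cdom c \<and> x \<in> cimg c"
      "\<forall>x\<in>N \<inter> cmodel c. \<forall>w\<in>cmodel c. frechet_derivative s (at x) w \<in> TZ (s x) \<and>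
        dq c (s x) (frechet_derivative s (at x) w) = w"
      by (rule quotient_section[OF c q z])
    obtain r C where r: "r > 0" "ball q r \<subseteq> N"
      "\<forall>x\<in>ball q r \<inter> cmodel c. \<psi> (cinv c x) = C - 1/2 * (norm (snd (s x)))\<^sup>2"
      by (rule psi_in_chart[OF c q s(1,2,3,5,6)])
    define F where "F x = 1/2 * (snd (s x) \<bullet> snd (s x)) + - C" for x
    have o: "open (ball q r)" by simp
    have sC: "Ck 2 (\<lambda>x. snd (s x)) (ball q r)"
      by (rule Ck_linear_compose[OF o bounded_linear_snd Ck_subset[OF s(3) r(2)]])
    have "Ck 2 F (ball q r)"
      unfolding F_def[abs_def]
      by (intro Ck_add[OF o] Ck_const Ck_linear_compose[OF o bounded_linear_mult_right]
          Ck_bilinear[OF o bounded_bilinear_inner sC sC])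
    moreover have "\<forall>y\<in>cimg c \<inter> ball q r. F y = - \<psi> (cinv c y)"
      using r(3) cM by (auto simp: F_def power2_norm_eq_inner)
    ultimately show "\<exists>W F. open W \<and> q \<in> W \<and> Ck 2 F W \<and> (\<forall>y\<in>cimg c \<inter> W. F y = - \<psi> (cinv c y))"
      using o r(1) by (intro exI[of _ "ball q r"] exI[of _ F]) simp
  qed
  fix q assume q: "q \<in> cimg c"
  obtain z where z: "z \<in> Z" "\<pi> z = cinv c q" "\<pi> z \<in> cdom c" using pt[OF q] by blast
  let ?J = "quotient_endo Z \<pi> cot_J"
  have Jl: "?J c q (dq c z h) = dq c z (cot_J h)" if "h \<in> Hz z" for h
    by (rule quotient_endo_eq[OF z(1) c z(3,2) that refl act_cJ Hz_quaternionic(2)])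
  show "ddc ?J (\<lambda>p. - \<psi> p) c q (?J c q u) (?J c q w) = ddc ?J (\<lambda>p. - \<psi> p) c q u w"
    if uw: "u \<in> cmodel c" "w \<in> cmodel c" for u w
  proof -
    obtain h where h: "h \<in> Hz z" "dq c z h = u" by (rule hlift_exists[OF z(1) c z(3) uw(1)])
    obtain k where k: "k \<in> Hz z" "dq c z k = w" by (rule hlift_exists[OF z(1) c z(3) uw(2)])
    show ?thesis
      unfolding h(2)[symmetric] k(2)[symmetric] Jl[OF h(1)] Jl[OF k(1)]
      using ddc_psi[OF c q z(1,2) h(1) k(1)] ddc_psi[OF c q z(1,2) Hz_quaternionic(2)[OF z(1) h(1)] Hz_quaternionic(2)[OF z(1) k(1)]]
      by (simp add: cJ_orth)
  qed
  show "0 < ddc ?J (\<lambda>p. - \<psi> p) c q u (?J c q u)" if u: "u \<in> cmodel c" "u \<noteq> 0" for u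
  proof -
    obtain h where h: "h \<in> Hz z" "dq c z h = u" by (rule hlift_exists[OF z(1) c z(3) u(1)])
    have "h \<noteq> 0" using h(2) u(2) linear_0[OF linear_dq[OF z(1) c z(3)]] by auto
    then show ?thesis
      unfolding h(2)[symmetric] Jl[OF h(1)]
      using ddc_psi[OF c q z(1,2) h(1) Hz_quaternionic(2)[OF z(1) h(1)]] by (simp add: cJ_orth)
  qed
qed

end

section \<open>Properness\<close>

context hk_quotient
begin

text \<open>The locally constant discrepancy between \<open>- \<psi>\<close> and |y|^2/2, pulled
  back to \<open>Z\<close>.\<close>

definition hh :: "'v \<times> 'v \<Rightarrow> real" where "hh z = \<psi> (\<pi> z) + 1/2 * (norm (snd z))\<^sup>2"

lemma hh_locally_constant:
  assumes z: "z \<in> Z" obtains N where "open N" "z \<in> N" "\<And>z'. z' \<in> Z \<inter> N \<Longrightarrow> hh z' = hh z"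
proof -
  obtain c where c: "c \<in> \<A>" "\<pi> z \<in> cdom c" by (rule chart_at_point[OF z])
  have chart: "is_chart (quotient_top Z \<pi>) c" by (rule smooth_quotient_chart[OF sq c(1)])
  have cM: "cimg c \<subseteq> cmodel c" by (rule is_chart_cimg_subset[OF chart])
  define q where "q = cmap c (\<pi> z)"
  have q: "q \<in> cimg c" "\<pi> z = cinv c q"
    using cmap_in_cimg[OF c(2)] cinv_cmap[OF chart c(2)] by (auto simp: q_def)
  obtain N s where s: "open N" "q \<in> N" "Ck 2 s N" "s q = z"
      "\<forall>x\<in>N \<inter> cmodel c. s x \<in> Z \<and> \<pi> (s x) = cinv c x \<and> \<pi> (s x) \<in> cdom c \<and> x \<in> cimg c"
      "\<forall>x\<in>N \<inter> cmodel c. \<forall>w\<in>cmodel c. frechet_derivative s (at x) w \<in> TZ (s x) \<and>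
        dq c (s x) (frechet_derivative s (at x) w) = w"
    by (rule quotient_section[OF c(1) q(1) z q(2)])
  obtain r C where r: "r > 0" "ball q r \<subseteq> N"
      "\<forall>x\<in>ball q r \<inter> cmodel c. \<psi> (cinv c x) = C - 1/2 * (norm (snd (s x)))\<^sup>2"
    by (rule psi_in_chart[OF c(1) q(1) s(1,2,3,5,6)])
  obtain N0 G where N0: "open N0" "z \<in> N0" "\<forall>k. Ck k G N0" "\<forall>y\<in>Z \<inter> N0. \<pi> y \<in> cdom c \<and> G y = cmap c (\<pi> y)"
    by (rule smooth_quotient_extension[OF sq c(1) z c(2)])
  define N' where "N' = N0 \<inter> G -` ball q r"
  have "open N'"
    unfolding N'_def by (rule continuous_open_preimage[OF Ck_continuous[OF N0(3)[rule_format]] N0(1)]) simp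
  moreover have zN': "z \<in> N'" using N0(2,4) z r(1) by (auto simp: N'_def q_def)
  moreover have "hh z' = C" if z': "z' \<in> Z \<inter> N'" for z'
  proof -
    define x where "x = cmap c (\<pi> z')"
    have d: "\<pi> z' \<in> cdom c" "x \<in> ball q r" using z' N0(4) by (auto simp: N'_def x_def)
    have "x \<in> cmodel c" using cmap_in_cimg[OF d(1)] cM by (auto simp: x_def)
    then have xB: "x \<in> ball q r \<inter> cmodel c" "x \<in> N \<inter> cmodel c" using d(2) r(2) by auto
    have cx: "cinv c x = \<pi> z'" unfolding x_def by (rule cinv_cmap[OF chart d(1)])
    then have "\<pi> (s x) = \<pi> z'" using s(5) xB(2) by metis
    then obtain k where "k \<in> K" "s x = act k z'" using \<pi>_eq by blast
    then have "norm (snd (s x)) = norm (snd z')" by (simp add: norm_snd_act)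
    then show ?thesis using r(3)[rule_format, OF xB(1)] cx by (simp add: hh_def)
  qed
  ultimately show ?thesis using that z by (metis IntI)
qed

lemma continuous_hh: "continuous_on Z hh"
  unfolding continuous_on_eq_continuous_within
proof
  fix z assume z: "z \<in> Z"
  obtain N where N: "open N" "z \<in> N" "\<And>z'. z' \<in> Z \<inter> N \<Longrightarrow> hh z' = hh z"
    using hh_locally_constant[OF z] by blast
  have "\<forall>\<^sub>F z' in at z within Z. hh z' = hh z"
    unfolding eventually_at_topological using N by blast
  then show "continuous (at z within Z) hh" unfolding continuous_within by (rule tendsto_eventually)
qed

lemma continuous_psi: "continuous_on Z (\<lambda>z. \<psi> (\<pi> z))"
proof -
  have "continuous_on Z (\<lambda>z. hh z - 1/2 * (norm (snd z))\<^sup>2)"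
    by (intro continuous_intros continuous_hh)
  then show ?thesis by (simp add: hh_def)
qed

lemma closed_Z: "closed Z"
proof -
  have bl: "bounded_linear cI" "bounded_linear cot_J" "bounded_linear (\<lambda>z. cK z)"
    using cI_linear cJ_linear cK_linear by (simp_all add: linear_conv_bounded_linear)
  have c: "continuous_on UNIV (\<lambda>z. L (act A z) \<bullet> z)" if "bounded_linear L" for L A
    by (intro continuous_intros bounded_linear.continuous_on[OF that] bounded_linear.continuous_on[OF act.bounded_linear_right])
  have "Z = (\<Inter>A\<in>\<g>. {z. 1/2 * (cI (act A z) \<bullet> z) + th A = 0} \<inter> {z. 1/2 * (cot_J (act A z) \<bullet> z) = 0} \<inter>
      {z. 1/2 * (cK (act A z) \<bullet> z) = 0})"
    by (auto simp: Z_def)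
  also have "closed \<dots>"
    by (intro closed_INT ballI closed_Int closed_Collect_eq continuous_intros c bl)
  finally show ?thesis .
qed

lemma bounded_Z_sublevel: "bounded {z \<in> Z. norm (snd z) \<le> b}"
proof -
  obtain c where c: "c > 0" "\<forall>z\<in>Z. norm (fst z) \<le> c * (1 + norm (snd z))" by (rule Z_bound[OF M_bounded])
  have "norm z \<le> c * (1 + b) + b" if z: "z \<in> Z" "norm (snd z) \<le> b" for z
  proof -
    have "norm z \<le> norm (fst z) + norm (snd z)" using norm_Pair_le[of "fst z" "snd z"] by simp
    moreover have "norm (fst z) \<le> c * (1 + norm (snd z))" using c(2) z(1) by blast
    moreover have "c * (1 + norm (snd z)) \<le> c * (1 + b)" using z(2) c(1) by (intro mult_left_mono) auto
    ultimately show ?thesis using z(2) by linarith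
  qed
  then show ?thesis unfolding bounded_iff by blast
qed

text \<open>The minimum of \<open>|y|\<^sup>2\<close> on a level set of the locally constant function \<open>hh\<close> is attained at a fixed
  point of the circle action on the quotient.\<close>

lemma hh_critical:
  assumes z: "z \<in> Z" obtains z' where "z' \<in> Z" "hh z' = hh z" "(norm (snd z'))\<^sup>2 \<in> critical_values"
proof -
  define S where "S = {z' \<in> Z. hh z' = hh z} \<inter> {z'. norm (snd z') \<le> norm (snd z)}"
  have "closedin (top_of_set Z) {z' \<in> Z. hh z' = hh z}"
    by (rule continuous_closedin_preimage_constant[OF continuous_hh])
  then have "closed {z' \<in> Z. hh z' = hh z}" using closed_Z closedin_closed_trans by blast
  then have "closed S"
    unfolding S_def by (intro closed_Int closed_Collect_le continuous_intros)
  moreover have "bounded S" by (rule bounded_subset[OF bounded_Z_sublevel[of "norm (snd z)"]]) (auto simp: S_def)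
  ultimately have "compact S" by (simp add: compact_eq_bounded_closed)
  moreover have "z \<in> S" using z by (simp add: S_def)
  moreover have "continuous_on S (\<lambda>z. norm (snd z))" by (intro continuous_intros)
  ultimately obtain w where w: "w \<in> S" "\<forall>z'\<in>S. norm (snd w) \<le> norm (snd z')"
    using continuous_attains_inf[of S "\<lambda>z. norm (snd z)"] by blast
  have wZ: "w \<in> Z" "hh w = hh z" using w(1) by (auto simp: S_def)
  have min: "norm (snd w) \<le> norm (snd z')" if "z' \<in> Z" "hh z' = hh z" for z'
  proof (cases "norm (snd z') \<le> norm (snd z)")
    case True then show ?thesis using w(2) that by (simp add: S_def)
  next
    case False then show ?thesis using w(1) by (simp add: S_def)
  qed
  obtain N where N: "open N" "w \<in> N" "\<And>z'. z' \<in> Z \<inter> N \<Longrightarrow> hh z' = hh w"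
    using hh_locally_constant[OF wZ(1)] by blast
  have crit: "snd w \<bullet> snd u = 0" if u: "u \<in> TZ w" for u
  proof -
    obtain \<gamma> where g: "\<And>t. \<gamma> t \<in> Z" "\<gamma> 0 = w" "(\<gamma> has_vector_derivative u) (at 0)"
      using u by (rule tangent_spaceE) blast
    have "(\<gamma> \<longlongrightarrow> w) (at 0)" using has_vector_derivative_continuous[OF g(3)] g(2) by (simp add: isCont_def)
    then have "\<forall>\<^sub>F t in at 0. \<gamma> t \<in> N" using N(1,2) by (rule topological_tendstoD)
    then obtain d where d: "d > 0" "\<And>t. t \<noteq> 0 \<Longrightarrow> dist t 0 < d \<Longrightarrow> \<gamma> t \<in> N"
      unfolding eventually_at by blast
    have sg: "((\<lambda>t. snd (\<gamma> t)) has_vector_derivative snd u) (at 0)"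
      by (rule bounded_linear.has_vector_derivative[OF bounded_linear_snd g(3)])
    have "((\<lambda>t. snd (\<gamma> t) \<bullet> snd (\<gamma> t)) has_real_derivative snd w \<bullet> snd u + snd u \<bullet> snd w) (at 0)"
      using bounded_bilinear.has_vector_derivative[OF bounded_bilinear_inner sg sg] g(2)
      by (simp add: has_real_derivative_iff_has_vector_derivative)
    moreover have "snd (\<gamma> 0) \<bullet> snd (\<gamma> 0) \<le> snd (\<gamma> t) \<bullet> snd (\<gamma> t)" if "\<bar>0 - t\<bar> < d" for t
    proof -
      have "\<gamma> t \<in> N" using d(2)[of t] that N(2) g(2) by (cases "t = 0") auto
      then have "hh (\<gamma> t) = hh z" using N(3)[of "\<gamma> t"] g(1) wZ(2) by simp
      then have "norm (snd w) \<le> norm (snd (\<gamma> t))" using min g(1) by blast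
      then have "(norm (snd w))\<^sup>2 \<le> (norm (snd (\<gamma> t)))\<^sup>2" by (simp add: power_mono)
      then show ?thesis by (simp add: power2_norm_eq_inner g(2))
    qed
    ultimately have "snd w \<bullet> snd u + snd u \<bullet> snd w = 0"
      using DERIV_local_min[OF _ d(1)] by blast
    then show ?thesis by (simp add: inner_commute)
  qed
  define \<phi> where "\<phi> = (0 :: 'v, - I (snd w))"
  obtain A f where A: "A \<in> \<g>" "f \<in> Hz w" "\<phi> = act A w + f"
    unfolding \<phi>_def by (rule horizontal_decomposition[OF wZ(1) rot_TZ[OF wZ(1)]])
  \<comment> \<open>The horizontal part \<open>f\<close> of the rotation field is itself tested:
    \<open>\<phi> \<bullet> f\<close> equals \<open>cI \<phi> \<bullet> cI f\<close>, which is the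
    derivative of |y|^2/2 in the tangent direction \<open>cI f\<close> up to sign, hence 0 at the
    minimum. So \<open>f\<close> vanishes and the field is vertical.\<close>
  have "cI f \<in> TZ w" using Hz_quaternionic(1)[OF wZ(1) A(2)] by (simp add: Hz_def)
  then have "snd w \<bullet> snd (cI f) = 0" by (rule crit)
  moreover have "cI \<phi> \<bullet> cI f = - (snd w \<bullet> snd (cI f))" by (simp add: \<phi>_def cot_I_def I_0 I_minus I_I inner_prod_def)
  ultimately have "\<phi> \<bullet> f = 0" by (simp add: cI_orth)
  moreover have "act A w \<bullet> f = 0" using A(1,2) by (simp add: Hz_def inner_commute)
  ultimately have "f \<bullet> f = 0" by (simp add: A(3) inner_add_left)
  then have "act A w = (0, - I (snd w))" using A(3) by (simp add: \<phi>_def)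
  then have "app A (fst w) = 0" "app A (snd w) = - I (snd w)" by (simp_all add: act_def)
  then have "(norm (snd w))\<^sup>2 \<in> critical_values"
    unfolding critical_values_def using wZ(1) A(1) by blast
  then show ?thesis using that wZ by blast
qed

text \<open>Every value of \<open>hh\<close> is attained at a point with |y|^2 a critical value, so
  on one compact set \<open>S\<close>, where the continuous function \<open>hh\<close> is
  bounded.\<close>

lemma hh_bounded: obtains B where "\<And>z. z \<in> Z \<Longrightarrow> \<bar>hh z\<bar> \<le> B"
proof -
  have "bounded critical_values" using finite_critical_values by (rule finite_imp_bounded)
  then obtain b where b: "\<forall>c\<in>critical_values. norm c \<le> b" unfolding bounded_iff by blast
  define S where "S = {z \<in> Z. norm (snd z) \<le> sqrt b}"
  have "closed S"
  proof -
    have "S = Z \<inter> {z. norm (snd z) \<le> sqrt b}" by (auto simp: S_def)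
    then show ?thesis using closed_Z by (simp add: closed_Int closed_Collect_le continuous_on_norm continuous_on_snd)
  qed
  then have "compact S" using bounded_Z_sublevel by (simp add: S_def compact_eq_bounded_closed)
  moreover have "continuous_on S hh" by (rule continuous_on_subset[OF continuous_hh]) (auto simp: S_def)
  ultimately have "bounded (hh ` S)" using compact_continuous_image compact_imp_bounded by blast
  then obtain B where B: "\<forall>x\<in>hh ` S. norm x \<le> B" unfolding bounded_iff by blast
  have "\<bar>hh z\<bar> \<le> B" if z: "z \<in> Z" for z
  proof -
    obtain w where w: "w \<in> Z" "hh w = hh z" "(norm (snd w))\<^sup>2 \<in> critical_values" by (rule hh_critical[OF z])
    have "(norm (snd w))\<^sup>2 \<le> b" using b[rule_format, OF w(3)] by simp
    then have "w \<in> S" using w(1) by (simp add: S_def real_le_rsqrt)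
    then show ?thesis using B w(2) by auto
  qed
  then show ?thesis using that by blast
qed

text \<open>Since \<open>hh\<close> is bounded, a bound on \<psi> bounds |y|, and |y| bounds all of
  \<open>z\<close> on \<open>Z\<close>. Preimages of compact sets are images of compact subsets of
  \<open>Z\<close>.\<close>

lemma psi_proper: "proper_map (quotient_top Z \<pi>) euclideanreal (\<lambda>p. - \<psi> p)"
proof (rule compact_imp_proper_map)
  show "k_space euclideanreal" by (rule metrizable_imp_k_space) (rule metrizable_space_euclidean)
  show "kc_space euclideanreal" by (rule Hausdorff_imp_kc_space) simp
  show "(\<lambda>p. - \<psi> p) \<in> topspace (quotient_top Z \<pi>) \<rightarrow> topspace euclideanreal" by simp
  have "openin (quotient_top Z \<pi>) {p \<in> \<pi> ` Z. - \<psi> p \<in> U}" if "open U" for U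
  proof -
    have "openin (top_of_set Z) {z \<in> Z. - \<psi> (\<pi> z) \<in> U}"
      using continuous_openin_preimage_gen[OF continuous_on_minus[OF continuous_psi] that]
      by (simp add: vimage_def Int_def)
    moreover have "{z \<in> Z. \<pi> z \<in> {p \<in> \<pi> ` Z. - \<psi> p \<in> U}} = {z \<in> Z. - \<psi> (\<pi> z) \<in> U}" by auto
    ultimately show ?thesis by (auto simp: openin_quotient_top)
  qed
  then show "continuous_map (quotient_top Z \<pi>) euclideanreal (\<lambda>p. - \<psi> p) \<or> kc_space (quotient_top Z \<pi>)"
    by (simp add: continuous_map topspace_quotient_top)
next
  fix C assume "compactin euclideanreal C"
  then have C: "compact C" by simp
  obtain B where B: "\<And>z. z \<in> Z \<Longrightarrow> \<bar>hh z\<bar> \<le> B" using hh_bounded by blast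
  obtain R where R: "\<forall>x\<in>C. norm x \<le> R" using compact_imp_bounded[OF C] unfolding bounded_iff by blast
  define S where "S = {z \<in> Z. - \<psi> (\<pi> z) \<in> C}"
  have "closedin (top_of_set Z) S"
    using continuous_closedin_preimage[OF continuous_on_minus[OF continuous_psi] compact_imp_closed[OF C]]
    by (simp add: S_def vimage_def Int_def)
  then have "closed S" using closed_Z closedin_closed_trans by blast
  moreover have "bounded S"
  proof (rule bounded_subset[OF bounded_Z_sublevel[of "sqrt (2 * (R + B))"]], safe)
    fix z assume z: "z \<in> S"
    then show "z \<in> Z" by (simp add: S_def)
    then have "\<bar>hh z\<bar> \<le> B" by (rule B)
    moreover have "\<bar>- \<psi> (\<pi> z)\<bar> \<le> R" using z R unfolding S_def real_norm_def by blast
    ultimately have "(norm (snd z))\<^sup>2 \<le> 2 * (R + B)" unfolding hh_def abs_le_iff by argo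
    then show "norm (snd z) \<le> sqrt (2 * (R + B))" by (rule real_le_rsqrt)
  qed
  ultimately have "compact S" by (simp add: compact_eq_bounded_closed)
  then have "compactin (top_of_set Z) S" by (auto simp: compactin_subtopology S_def)
  then have "compactin (quotient_top Z \<pi>) (\<pi> ` S)"
    by (rule image_compactin[OF _ continuous_map_quotient_top])
  moreover have "{p \<in> topspace (quotient_top Z \<pi>). - \<psi> p \<in> C} = \<pi> ` S"
    by (auto simp: topspace_quotient_top S_def)
  ultimately show "compactin (quotient_top Z \<pi>) {p \<in> topspace (quotient_top Z \<pi>). - \<psi> p \<in> C}" by simp
qed

end

section \<open>The representation of the group and of its Lie algebra\<close>

lemma smooth_on_pair:
  assumes "smooth_on f S" "smooth_on g S" shows "smooth_on (\<lambda>x. (f x, g x)) S"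
  unfolding smooth_on_def
proof
  fix x assume x: "x \<in> S"
  obtain W F where W: "open W" "x \<in> W" "\<forall>k. Ck k F W" "\<forall>y\<in>S \<inter> W. F y = f y"
    using assms(1) x unfolding smooth_on_def by auto
  obtain V G where V: "open V" "x \<in> V" "\<forall>k. Ck k G V" "\<forall>y\<in>S \<inter> V. G y = g y"
    using assms(2) x unfolding smooth_on_def by auto
  have o: "open (W \<inter> V)" using W(1) V(1) by (rule open_Int)
  have "Ck k (\<lambda>x. (F x, G x)) (W \<inter> V)" for k
    by (rule Ck_pair[OF o Ck_subset[OF W(3)[rule_format]] Ck_subset[OF V(3)[rule_format]]]) auto
  then show "\<exists>W F. open W \<and> x \<in> W \<and> (\<forall>k. Ck k F W) \<and> (\<forall>y\<in>S \<inter> W. F y = (f y, g y))"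
    using o W(2,4) V(2,4) by (intro exI[of _ "W \<inter> V"] exI[of _ "\<lambda>x. (F x, G x)"]) simp
qed

lemma opr_of_sum: "opr_of f = (\<Sum>i\<in>UNIV. axis i (f (Rep_bidx i)))"
  by (simp add: vec_eq_iff opr_of_def axis_def)

lemma bounded_linear_axis: "bounded_linear (axis i :: 'v::euclidean_space \<Rightarrow> 'v ^ 'n::finite)"
  unfolding linear_conv_bounded_linear[symmetric]
  by (rule linearI) (simp_all add: axis_def vec_eq_iff)

text \<open>An operator is a finite sum of terms depending on its values on basis vectors, so
  differentiation vector by vector is enough.\<close>

lemma has_vector_derivative_opr_of:
  assumes "\<And>v. ((\<lambda>t. f t v) has_vector_derivative f' v) (at t)"
  shows "((\<lambda>t. opr_of (f t)) has_vector_derivative opr_of f') (at t)"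
  unfolding opr_of_sum
  by (intro has_vector_derivative_sum bounded_linear.has_vector_derivative[OF bounded_linear_axis] assms)

lemma continuous_map_opr_of:
  assumes "\<And>v. continuous_map T euclidean (\<lambda>g. f g v)"
  shows "continuous_map T euclidean (\<lambda>g. opr_of (f g))"
proof -
  have "continuous_map T euclidean (\<lambda>g. axis i (f g v) :: 'a opr)" for i v
  proof -
    have "continuous_map euclidean euclidean (axis i :: 'a \<Rightarrow> 'a opr)"
      using linear_continuous_on[OF bounded_linear_axis] by simp
    from continuous_map_compose[OF assms this] show ?thesis by (simp add: o_def)
  qed
  then show ?thesis unfolding opr_of_sum by (intro continuous_map_sum) auto
qed

context lie_rep
begin

lemma R_inner: "g \<in> carrier C \<Longrightarrow> R g u \<bullet> R g v = u \<bullet> v"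
  using R_norm[of g "u + v"] R_norm[of g u] R_norm[of g v]
  by (simp add: linear_add[OF R_linear] dot_norm)

lemma dR_skew:
  assumes "\<xi> \<in> cmodel e" shows "dR \<xi> u \<bullet> v = - (u \<bullet> dR \<xi> v)"
proof -
  obtain k where k: "\<And>t. k t \<in> carrier C" "k 0 = \<one>\<^bsub>C\<^esub>" "\<forall>v. ((\<lambda>t. R (k t) v) has_vector_derivative dR \<xi> v) (at 0)"
    using chart_curve[OF assms] by blast
  have "((\<lambda>t. R (k t) u \<bullet> R (k t) v) has_vector_derivative R (k 0) u \<bullet> dR \<xi> v + dR \<xi> u \<bullet> R (k 0) v) (at 0)"
    using k(3) by (intro bounded_bilinear.has_vector_derivative[OF bounded_bilinear_inner]) auto
  then have "((\<lambda>t. u \<bullet> v) has_vector_derivative u \<bullet> dR \<xi> v + dR \<xi> u \<bullet> v) (at 0)"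
    by (simp add: R_inner[OF k(1)] k(2) R_one)
  from vector_derivative_unique_at[OF this has_vector_derivative_const] show ?thesis by simp
qed

lemma dR_commute:
  assumes \<xi>: "\<xi> \<in> cmodel e" and L: "linear L" "\<And>g v. g \<in> carrier C \<Longrightarrow> R g (L v) = L (R g v)"
  shows "dR \<xi> (L v) = L (dR \<xi> v)"
proof -
  have "((\<lambda>x. L (R (cinv e x) v)) has_derivative (\<lambda>\<xi>. L (dR \<xi> v))) (at x0 within cimg e)"
    by (rule bounded_linear.has_derivative[OF L(1)[unfolded linear_conv_bounded_linear] dR_has_derivative])
  then have "((\<lambda>x. R (cinv e x) (L v)) has_derivative (\<lambda>\<xi>. L (dR \<xi> v))) (at x0 within cimg e)"
    by (rule has_derivative_transform[OF x0_in(1), rotated]) (simp add: L(2) cinv_carrier[OF e_in])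
  from dR_eqI[OF \<xi> this] show ?thesis .
qed

abbreviation opK :: "'x opr set" where "opK \<equiv> (\<lambda>g. opr_of (R g)) ` carrier C"
abbreviation opg :: "'x opr set" where "opg \<equiv> (\<lambda>\<xi>. opr_of (dR \<xi>)) ` cmodel e"

lemma app_R [simp]: "g \<in> carrier C \<Longrightarrow> app (opr_of (R g)) v = R g v"
  by (rule app_opr_of[OF R_linear])

lemma app_dR [simp]: "\<xi> \<in> cmodel e \<Longrightarrow> app (opr_of (dR \<xi>)) v = dR \<xi> v"
  by (rule app_opr_of[OF linear_dR_right])

lemma oadj_R: "g \<in> carrier C \<Longrightarrow> oadj (opr_of (R g)) = opr_of (R (inv\<^bsub>C\<^esub> g))"
proof -
  interpret group C by (rule group_C)
  assume g: "g \<in> carrier C"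
  show ?thesis
  proof (rule oadj_unique)
    fix v w
    show "app (opr_of (R (inv\<^bsub>C\<^esub> g))) v \<bullet> w = v \<bullet> app (opr_of (R g)) w"
      using g R_inner[OF g, of "R (inv\<^bsub>C\<^esub> g) v" w] R_inv(2)[OF g, of v] by simp
  qed
qed

lemma compact_opK: "compact opK"
proof -
  have "compactin T (carrier C)" using compact_T topspace_T by (simp add: compact_space_def)
  then have "compactin euclidean opK" by (rule image_compactin[OF _ continuous_map_opr_of[OF continuous_R]])
  then show ?thesis by simp
qed

lemma conj_dR:
  assumes "g \<in> carrier C" "\<xi> \<in> cmodel e"
  shows "omul (opr_of (R g)) (omul (opr_of (dR \<xi>)) (oadj (opr_of (R g)))) = opr_of (dR (Ad C e g \<xi>))"
proof (rule opr_eqI)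
  interpret group C by (rule group_C)
  fix v
  show "app (omul (opr_of (R g)) (omul (opr_of (dR \<xi>)) (oadj (opr_of (R g))))) v = app (opr_of (dR (Ad C e g \<xi>))) v"
    using assms Ad_dR[OF assms] by (simp add: oadj_R)
qed

text \<open>Hypothesis \<open>v0\<close> is invariance of \<theta> under Ad, with \<theta> rewritten
  through a point of the zero set.\<close>

lemma hk_repI:
  assumes herm: "hermitian_structure I" and comm: "\<And>g v. g \<in> carrier C \<Longrightarrow> R g (I v) = I (R g v)"
    and v0: "\<And>g \<xi>. g \<in> carrier C \<Longrightarrow> \<xi> \<in> cmodel e \<Longrightarrow> I (dR (Ad C e g \<xi>) v0) \<bullet> v0 = I (dR \<xi> v0) \<bullet> v0"
  shows "hk_rep opK opg I v0"
proof -
  interpret group C by (rule group_C)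
  have linI: "linear I" using herm by (simp add: hermitian_structure_def)
  have lin: "linear (\<lambda>\<xi>. opr_of (dR \<xi>))"
    by (rule linearI) (simp_all add: opr_of_def vec_eq_iff linear_add[OF linear_dR] linear_cmul[OF linear_dR])
  show ?thesis
  proof
    show "hermitian_structure I" by (rule herm)
    show "compact opK" by (rule compact_opK)
    show "subspace opg" using lin subspace_e by (rule linear_subspace_image)
    show "oid \<in> opK"
      by (rule image_eqI[of _ _ "\<one>\<^bsub>C\<^esub>"]) (auto intro!: opr_eqI simp: R_one)
    fix k assume k: "k \<in> opK"
    then obtain g where g: "g \<in> carrier C" "k = opr_of (R g)" by blast
    show "app k u \<bullet> app k v = u \<bullet> v" for u v using g by (simp add: R_inner)
    show "app k (I v) = I (app k v)" for v using g by (simp add: comm)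
    show "oadj k \<in> opK" using g by (auto simp: oadj_R)
    show "omul k h \<in> opK" if h: "h \<in> opK" for h
    proof -
      obtain g' where g': "g' \<in> carrier C" "h = opr_of (R g')" using h by blast
      have "omul k h = opr_of (R (g \<otimes>\<^bsub>C\<^esub> g'))" using g g' by (intro opr_eqI) (simp add: R_mult)
      then show ?thesis using g(1) g'(1) by (intro image_eqI[of _ _ "g \<otimes>\<^bsub>C\<^esub> g'"]) simp_all
    qed
    fix A assume A: "A \<in> opg"
    then obtain \<xi> where \<xi>: "\<xi> \<in> cmodel e" "A = opr_of (dR \<xi>)" by blast
    show "omul k (omul A (oadj k)) \<in> opg"
      unfolding g(2) \<xi>(2) conj_dR[OF g(1) \<xi>(1)] using Ad_dR(1)[OF g(1) \<xi>(1)] by blast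
    show "I (app (omul k (omul A (oadj k))) v0) \<bullet> v0 = I (app A v0) \<bullet> v0"
      unfolding g(2) \<xi>(2) conj_dR[OF g(1) \<xi>(1)] using v0[OF g(1) \<xi>(1)] Ad_dR(1)[OF g(1) \<xi>(1)] \<xi>(1) by simp
  next
    fix A assume A: "A \<in> opg"
    then obtain \<xi> where \<xi>: "\<xi> \<in> cmodel e" "A = opr_of (dR \<xi>)" by blast
    show "app A u \<bullet> v = - (u \<bullet> app A v)" for u v using \<xi> by (simp add: dR_skew)
    show "app A (I v) = I (app A v)" for v using \<xi> by (simp add: dR_commute[OF \<xi>(1) linI comm])
    obtain k where k: "\<And>t. k t \<in> carrier C" "k 0 = \<one>\<^bsub>C\<^esub>" "\<forall>v. ((\<lambda>t. R (k t) v) has_vector_derivative dR \<xi> v) (at 0)"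
      using chart_curve[OF \<xi>(1)] by blast
    have "((\<lambda>t. opr_of (R (k t))) has_vector_derivative A) (at 0)"
      unfolding \<xi>(2) using k(3) by (intro has_vector_derivative_opr_of) blast
    moreover have "opr_of (R (k 0)) = oid" by (rule opr_eqI) (simp add: k(2) R_one)
    moreover have "range (\<lambda>t. opr_of (R (k t))) \<subseteq> opK" using k(1) by blast
    ultimately show "\<exists>k. range k \<subseteq> opK \<and> k 0 = oid \<and> (k has_vector_derivative A) (at (0::real))"
      by (intro exI[of _ "\<lambda>t. opr_of (R (k t))"]) simp
  qed
qed

end

text \<open>The norm is constant on fibres and descends to a continuous function on the compact
  quotient.\<close>

lemma orbit_quotient_bounded:
  fixes M :: "'v::euclidean_space set"
  assumes "compact_space (quotient_top M \<pi>)" "\<And>v w. v \<in> M \<Longrightarrow> w \<in> M \<Longrightarrow> \<pi> v = \<pi> w \<Longrightarrow> norm v = norm w"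
  shows "bounded M"
proof -
  define f where "f p = norm (SOME v. v \<in> M \<and> \<pi> v = p)" for p
  have f: "f (\<pi> v) = norm v" if "v \<in> M" for v
  proof -
    have "(SOME w. w \<in> M \<and> \<pi> w = \<pi> v) \<in> M \<and> \<pi> (SOME w. w \<in> M \<and> \<pi> w = \<pi> v) = \<pi> v"
      by (rule someI[of _ v]) (use that in simp)
    then show ?thesis unfolding f_def using assms(2) that by blast
  qed
  have "openin (quotient_top M \<pi>) {p \<in> \<pi> ` M. f p \<in> U}" if U: "open U" for U
  proof -
    have "{v \<in> M. \<pi> v \<in> {p \<in> \<pi> ` M. f p \<in> U}} = {v \<in> M. f (\<pi> v) \<in> U}" by blast
    also have "\<dots> = M \<inter> norm -` U" using f by auto
    finally have "{v \<in> M. \<pi> v \<in> {p \<in> \<pi> ` M. f p \<in> U}} = M \<inter> norm -` U" .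
    moreover have "openin (top_of_set M) (M \<inter> norm -` U)"
      using continuous_openin_preimage_gen[OF continuous_on_norm_id U] .
    ultimately show ?thesis by (auto simp: openin_quotient_top)
  qed
  then have "continuous_map (quotient_top M \<pi>) euclidean f"
    by (simp add: continuous_map topspace_quotient_top)
  moreover have "compactin (quotient_top M \<pi>) (\<pi> ` M)"
    using assms(1) by (simp add: compact_space_def topspace_quotient_top)
  ultimately have "compactin euclidean (f ` \<pi> ` M)" using image_compactin by blast
  then have "bounded (f ` \<pi> ` M)" by (simp add: compact_imp_bounded)
  then obtain B where "\<forall>x\<in>f ` \<pi> ` M. norm x \<le> B" unfolding bounded_iff by blast
  then have "\<forall>v\<in>M. norm v \<le> B" using f by auto
  then show ?thesis unfolding bounded_iff by blast
qed

theorem proposition4p8: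
  fixes C :: "'c monoid" and T :: "'c topology" and AC :: "('c, 'l::euclidean_space) chart set"
    and e :: "('c, 'l) chart"
    and I :: "'v::euclidean_space \<Rightarrow> 'v" and r :: "'c \<Rightarrow> 'v \<Rightarrow> 'v" and \<theta> :: "'l \<Rightarrow> real"
    and M :: "'v set" and Z :: "('v \<times> 'v) set"
    and orbV :: "'v \<Rightarrow> 'v set" and orb :: "'v \<times> 'v \<Rightarrow> ('v \<times> 'v) set"
    and AN :: "('v set, 'n::euclidean_space) chart set"
    and AY :: "(('v \<times> 'v) set, 'e::euclidean_space) chart set"
    and \<psi> :: "('v \<times> 'v) set \<Rightarrow> real"
  assumes "compact_lie_group C T AC"
    and "e \<in> AC" and "\<one>\<^bsub>C\<^esub> \<in> cdom e"
    and "hermitian_structure I" and "unitary_rep C AC I r"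
    and "Ad_invariant C e \<theta>"
    and "M = mu_zero C e I r \<theta>" and "orbV = orbit C r"
    and "Z = mu_hk_zero C e I r \<theta>" and "orb = orbit C (cot_rep r)"
    and Y_smooth: "smooth_quotient Z orb AY"
    and N_smooth: "smooth_quotient M orbV AN"
    and N_compact: "compact_space (quotient_top M orbV)" and N_nonempty: "M \<noteq> {}"
    and "rot_moment_map I Z orb AY \<psi>"
  shows "proper_map (quotient_top Z orb) euclideanreal (\<lambda>p. - \<psi> p) \<and>
    strictly_plurisubharmonic AY (quotient_endo Z orb cot_J) (\<lambda>p. - \<psi> p)"
proof -
  interpret compact_lie_chart C T AC e by unfold_locales (rule assms)+
  interpret group C by (rule group_C)
  have rep: "\<And>g. g \<in> carrier C \<Longrightarrow> linear (r g)" "\<And>g v. g \<in> carrier C \<Longrightarrow> r g (I v) = I (r g v)"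
    "\<And>g u v. g \<in> carrier C \<Longrightarrow> r g u \<bullet> r g v = u \<bullet> v"
    "\<And>g h v. g \<in> carrier C \<Longrightarrow> h \<in> carrier C \<Longrightarrow> r (g \<otimes>\<^bsub>C\<^esub> h) v = r g (r h v)"
    "\<And>v. r \<one>\<^bsub>C\<^esub> v = v" "\<And>c v. c \<in> AC \<Longrightarrow> smooth_on (\<lambda>x. r (cinv c x) v) (cimg c)"
    using assms(5) by (auto simp: unitary_rep_def)
  interpret r: lie_rep C T AC e r
    by unfold_locales (simp_all add: rep linear_add[OF rep(1)] linear_cmul[OF rep(1)] norm_eq_sqrt_inner)
  have cot_smooth: "smooth_on (\<lambda>x. cot_rep r (cinv c x) v) (cimg c)" if "c \<in> AC" for c v
    unfolding cot_rep_def by (intro smooth_on_pair rep(6) that)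
  note cot_smooth = cot_smooth[unfolded cot_rep_def]
  interpret R: lie_rep C T AC e "cot_rep r"
    by unfold_locales
      (simp_all add: cot_smooth cot_rep_def rep linear_add[OF rep(1)] linear_cmul[OF rep(1)]
        norm_eq_sqrt_inner inner_prod_def)
  obtain v0 where v0: "v0 \<in> M" using N_nonempty by blast
  \<comment> \<open>The moment equation at \<open>v0\<close> expresses \<theta> through the operator
    of \<open>\<xi>\<close>. In particular \<theta> vanishes on the kernel of the representation and
    descends to operators; this is where nonemptiness of \<open>M\<close> enters.\<close>
  have \<theta>: "\<theta> \<xi> = - (1/2) * (I (r.dR \<xi> v0) \<bullet> v0)" if "\<xi> \<in> cmodel e" for \<xi>
  proof -
    have "1/2 * (I (r.dR \<xi> v0) \<bullet> v0) + \<theta> \<xi> = 0"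
      using v0 that unfolding assms(7) mu_zero_def mu_def by blast
    then show ?thesis by simp
  qed
  have hk: "hk_rep r.opK r.opg I v0"
  proof (rule r.hk_repI[OF assms(4) rep(2)])
    fix g \<xi> assume "g \<in> carrier C" "\<xi> \<in> cmodel e"
    moreover from this have "\<theta> (Ad C e g \<xi>) = \<theta> \<xi>" using assms(6) by (simp add: Ad_invariant_def)
    ultimately show "I (r.dR (Ad C e g \<xi>) v0) \<bullet> v0 = I (r.dR \<xi> v0) \<bullet> v0"
      using \<theta> r.Ad_dR(1) by simp
  qed
  then interpret hk: hk_rep r.opK r.opg I v0 .
  have th: "hk.th (opr_of (r.dR \<xi>)) = \<theta> \<xi>" if "\<xi> \<in> cmodel e" for \<xi>
    using \<theta>[OF that] that by (simp add: hk.th_def)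
  have M: "hk.M = M"
    by (auto simp: hk.M_def assms(7) mu_zero_def mu_def th)
  have Z: "hk.Z = Z"
  proof -
    have "1/2 * (cot_I I (act (opr_of (r.dR \<xi>)) z) \<bullet> z) + hk.th (opr_of (r.dR \<xi>)) = mu_I C e I r \<theta> z \<xi> \<and>
      1/2 * (cot_J (act (opr_of (r.dR \<xi>)) z) \<bullet> z) = mu_J C e r z \<xi> \<and>
      1/2 * (cot_I I (cot_J (act (opr_of (r.dR \<xi>)) z)) \<bullet> z) = mu_K C e I r z \<xi>" if \<xi>: "\<xi> \<in> cmodel e" for z \<xi>
    proof -
      let ?x = "fst z" and ?y = "snd z"
      have 1: "r.dR \<xi> ?y \<bullet> ?x = - (r.dR \<xi> ?x \<bullet> ?y)" using r.dR_skew[OF \<xi>, of ?y ?x] by (simp add: inner_commute)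
      have "I (r.dR \<xi> ?y) \<bullet> ?x = ?y \<bullet> I (r.dR \<xi> ?x)"
        using r.dR_commute[OF \<xi> hk.I_linear rep(2)] by (simp add: hk.I_skew r.dR_skew[OF \<xi>])
      then have 2: "I (r.dR \<xi> ?y) \<bullet> ?x = I (r.dR \<xi> ?x) \<bullet> ?y" by (simp add: inner_commute)
      show ?thesis
        using \<xi> 1 2 by (simp add: act_def cot_I_def cot_J_def inner_prod_def th mu_I_def mu_J_def mu_K_def hk.I_minus algebra_simps)
    qed
    then show ?thesis by (simp add: hk.Z_def assms(9) mu_hk_zero_def)
  qed
  \<comment> \<open>The infinitesimal action on the cotangent bundle is the diagonal one, which
    translates the result on orbit tangents into \<open>orbit_tangent\<close>.\<close>
  have dR_cot: "R.dR \<xi> z = act (opr_of (r.dR \<xi>)) z" if \<xi>: "\<xi> \<in> cmodel e" for \<xi> z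
  proof -
    have "((\<lambda>x. cot_rep r (cinv e x) z) has_derivative (\<lambda>\<xi>. (r.dR \<xi> (fst z), r.dR \<xi> (snd z)))) (at x0 within cimg e)"
      unfolding cot_rep_def by (intro has_derivative_Pair r.dR_has_derivative)
    from R.dR_eqI[OF \<xi> this] show ?thesis using \<xi> by (simp add: act_def)
  qed
  have orb: "orb z = (\<lambda>k. act k z) ` r.opK" for z
    by (auto simp: assms(10) orbit_def cot_rep_def act_def image_iff)
  interpret hk_quotient r.opK r.opg I v0 orb AY \<psi>
  proof unfold_locales
    show "orb z = (\<lambda>k. act k z) ` r.opK" for z by (rule orb)
    show "smooth_quotient hk.Z orb AY" unfolding Z by (rule Y_smooth)
    show "rot_moment_map I hk.Z orb AY \<psi>" unfolding Z by (rule assms(15))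
    show "\<exists>A\<in>r.opg. u = act A z" if "u \<in> tangent_space (orb z) z" for u z
      using R.tangent_space_orbit[of u z] that dR_cot unfolding assms(10) by blast
    have "norm v = norm w" if eq: "orbV v = orbV w" for v w
    proof -
      have "v = r \<one>\<^bsub>C\<^esub> v" by (simp add: rep(5))
      then have "v \<in> orbV v" unfolding assms(8) orbit_def by blast
      then have "v \<in> orbV w" using eq by simp
      then obtain g where "g \<in> carrier C" "v = r g w" unfolding assms(8) orbit_def by blast
      then show ?thesis using r.R_norm by simp
    qed
    then show "bounded hk.M" unfolding M by (intro orbit_quotient_bounded[OF N_compact])
  qed
  show ?thesis using psi_proper psi_strictly_plurisubharmonic unfolding Z by blast
qed

end
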